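(* Let $\nu>0$ and $u_0\in H^s(\mathbb T^2)$, $s\ge4$, with mean zero. Let $u(t)$ be the solution of the Cahn–Hilliard equation $\partial_t u=\Delta(-\nu\Delta u+f(u))$ on $\mathbb T^2$ with $u(0)=u_0$, where $f(u)=u^3-u$. Let $u^n$ be defined by the scheme $u^0=\Pi_Nu_0$, $\frac{u^{n+1}-u^n}{\tau}=-\nu\Delta^2u^{n+1}+A\Delta(u^{n+1}-u^n)+\Delta\Pi_N(f(u^n))$, where $A$ satisfies $A\ge\beta(\|u_0\|_\infty^2+\nu^{-1}|\log\nu|^2+1)$ with $\beta\ge\beta_c$, $\beta_c=\beta_c(E(u_0))$ being the constant of the unconditional energy stability theorem for this scheme. Let $t_m=m\tau$, $m\ge1$. Then $$\|u(t_m)-u^m\|_{L^2}\le A\cdot e^{C_1t_m}\cdot C_2\cdot(N^{-s}+\tau),$$ where $C_1>0$ depends only on $(u_0,\nu)$ and $C_2>0$ depends only on $(u_0,\nu,s)$.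
   Context: $\mathbb T^2=\mathbb R^2/2\pi\mathbb Z^2$; $\Pi_N$ is the $L^2$-orthogonal projection onto $X_N=\operatorname{span}\{\cos(k\cdot x),\sin(k\cdot x):k\in\mathbb Z^2,|k|\le N\}$, $N\ge2$. $E(u)=\int(\frac\nu2|\nabla u|^2+\frac14(u^2-1)^2)dx$. The constant $\beta_c$ is the one (depending only on $E(u_0)$) for which $A\ge\beta(\|u_0\|_\infty^2+\nu^{-1}|\log\nu|^2+1)$, $\beta\ge\beta_c$, guarantees $E(u^{n+1})\le E(u^n)$ for all $n$ and all $\tau>0$. $H^s$ norm: $\|f\|_{H^s}^2=\sum_k(1+|k|^{2s})|\hat f(k)|^2$, $\hat f(k)=\int_{\mathbb T^2}f(x)e^{-ik\cdot x}dx$. *)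

theory Defs
  imports "HOL-Analysis.Analysis"
begin

text \<open>Functions on the torus T^2 = R^2/2pi Z^2 are represented as 2pi-periodic
  functions on real \<times> real.  Integrals over T^2 are Lebesgue integrals over the
  fundamental cell [0,2pi]^2.\<close>

definition cell :: "(real \<times> real) set" where
  "cell = cbox (0,0) (2*pi, 2*pi)"

definition periodic2 :: "(real \<times> real \<Rightarrow> real) \<Rightarrow> bool" where
  "periodic2 g \<longleftrightarrow> (\<forall>x y. g (x + 2*pi, y) = g (x, y) \<and> g (x, y + 2*pi) = g (x, y))"

definition dx :: "(real \<times> real \<Rightarrow> real) \<Rightarrow> real \<times> real \<Rightarrow> real" where
  "dx g = (\<lambda>p. deriv (\<lambda>r. g (r, snd p)) (fst p))"

definition dy :: "(real \<times> real \<Rightarrow> real) \<Rightarrow> real \<times> real \<Rightarrow> real" where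
  "dy g = (\<lambda>p. deriv (\<lambda>r. g (fst p, r)) (snd p))"

definition lap :: "(real \<times> real \<Rightarrow> real) \<Rightarrow> real \<times> real \<Rightarrow> real" where
  "lap g = (\<lambda>p. dx (dx g) p + dy (dy g) p)"

fun Ck :: "nat \<Rightarrow> (real \<times> real \<Rightarrow> real) \<Rightarrow> bool" where
  "Ck 0 g = continuous_on UNIV g"
| "Ck (Suc k) g = ((\<forall>p. g differentiable (at p)) \<and> Ck k (dx g) \<and> Ck k (dy g))"

definition L2inner :: "(real \<times> real \<Rightarrow> real) \<Rightarrow> (real \<times> real \<Rightarrow> real) \<Rightarrow> real" where
  "L2inner g h = (LINT p:cell|lborel. g p * h p)"

definition L2norm :: "(real \<times> real \<Rightarrow> real) \<Rightarrow> real" where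
  "L2norm g = sqrt (LINT p:cell|lborel. (g p)\<^sup>2)"

definition supnorm :: "(real \<times> real \<Rightarrow> real) \<Rightarrow> real" where
  "supnorm g = (SUP p. \<bar>g p\<bar>)"

definition kdot :: "int \<times> int \<Rightarrow> real \<times> real \<Rightarrow> real" where
  "kdot k p = real_of_int (fst k) * fst p + real_of_int (snd k) * snd p"

definition ksq :: "int \<times> int \<Rightarrow> real" where
  "ksq k = (real_of_int (fst k))\<^sup>2 + (real_of_int (snd k))\<^sup>2"

definition fourier :: "(real \<times> real \<Rightarrow> real) \<Rightarrow> int \<times> int \<Rightarrow> complex" where
  "fourier g k = (LINT p:cell|lborel. complex_of_real (g p) * cis (- kdot k p))"

definition in_Hs :: "real \<Rightarrow> (real \<times> real \<Rightarrow> real) \<Rightarrow> bool" where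
  "in_Hs s g \<longleftrightarrow> set_integrable lborel cell (\<lambda>p. (g p)\<^sup>2)
      \<and> g \<in> borel_measurable lborel
      \<and> (\<lambda>k. (1 + ksq k powr s) * (cmod (fourier g k))\<^sup>2) summable_on UNIV"

definition XN :: "nat \<Rightarrow> (real \<times> real \<Rightarrow> real) set" where
  "XN N = {g. \<exists>a b. g = (\<lambda>p. \<Sum>k\<in>{k. ksq k \<le> (real N)\<^sup>2}.
                      a k * cos (kdot k p) + b k * sin (kdot k p))}"

definition PiN :: "nat \<Rightarrow> (real \<times> real \<Rightarrow> real) \<Rightarrow> (real \<times> real \<Rightarrow> real)" where
  "PiN N g = (THE h. h \<in> XN N \<and> (\<forall>v\<in>XN N. L2inner (\<lambda>p. g p - h p) v = 0))"

definition fCH :: "real \<Rightarrow> real" where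
  "fCH v = v ^ 3 - v"

definition energy :: "real \<Rightarrow> (real \<times> real \<Rightarrow> real) \<Rightarrow> real" where
  "energy \<nu> g = (LINT p:cell|lborel.
      \<nu> / 2 * ((dx g p)\<^sup>2 + (dy g p)\<^sup>2) + 1/4 * ((g p)\<^sup>2 - 1)\<^sup>2)"

definition admissible_data :: "real \<Rightarrow> (real \<times> real \<Rightarrow> real) \<Rightarrow> bool" where
  "admissible_data s u0 \<longleftrightarrow> 4 \<le> s \<and> continuous_on UNIV u0 \<and> periodic2 u0
      \<and> in_Hs s u0 \<and> (LINT p:cell|lborel. u0 p) = 0"

definition is_scheme ::
  "real \<Rightarrow> nat \<Rightarrow> real \<Rightarrow> real \<Rightarrow> (real \<times> real \<Rightarrow> real) \<Rightarrow> (nat \<Rightarrow> real \<times> real \<Rightarrow> real) \<Rightarrow> bool" where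
  "is_scheme \<nu> N \<tau> A u0 U \<longleftrightarrow>
     (\<forall>n. U n \<in> XN N) \<and> U 0 = PiN N u0 \<and>
     (\<forall>n p. (U (Suc n) p - U n p) / \<tau> =
         - \<nu> * lap (lap (U (Suc n))) p
         + A * lap (\<lambda>q. U (Suc n) q - U n q) p
         + lap (PiN N (\<lambda>q. fCH (U n q))) p)"

definition is_CH_solution ::
  "real \<Rightarrow> (real \<times> real \<Rightarrow> real) \<Rightarrow> (real \<Rightarrow> real \<times> real \<Rightarrow> real) \<Rightarrow> bool" where
  "is_CH_solution \<nu> u0 u \<longleftrightarrow>
     u 0 = u0 \<and> (\<forall>t\<ge>0. periodic2 (u t)) \<and>
     continuous_on ({0..} \<times> UNIV) (\<lambda>(t, p). u t p) \<and>
     (\<forall>t>0. Ck 4 (u t)) \<and>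
     continuous_on ({0<..} \<times> UNIV)
        (\<lambda>(t, p). lap (\<lambda>q. - \<nu> * lap (u t) q + fCH (u t q)) p) \<and>
     (\<forall>t>0. \<forall>p. ((\<lambda>r. u r p) has_real_derivative
                     lap (\<lambda>q. - \<nu> * lap (u t) q + fCH (u t q)) p) (at t))"

end

theory Submission
  imports Defs
begin

text \<open>
  Everything is done on the Fourier side.

  \<^emph>\<open>Energy stability.\<close> Testing the scheme with the inverse Laplacian of the increment reduces the claim to
  bounding the quartic increment terms by the stabilisation \<open>A\<close> and the \<open>\<nu>\<close>-dissipation.  The stabilisation
  hypothesis forces \<open>A \<nu> \<ge> \<beta> / 4\<close>, whatever \<open>\<nu>\<close> is, so the Ladyzhenskaya inequality (or Bernstein's inequality,
  if \<open>N \<nu>\<close> is small) suffices, with constants depending only on the initial energy.  The disc projection is not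
  bounded on \<open>L\<^sup>4\<close> uniformly in \<open>N\<close>; the energy of the projected data is nevertheless at most a constant depending on that of \<open>u0\<close> times
  \<open>(max 1 (1 / (N \<nu>)))\<^sup>2\<close>.

  \<^emph>\<open>Regularity.\<close> For the exact solution, Duhamel's formula for each mode turns an \<open>H\<^sup>1\<close> bound into pointwise decay
  of the Fourier coefficients, and convolution estimates for the cubic term bootstrap this decay.  The \<open>H\<^sup>1\<close> bound,
  hence every constant, is uniform in time because the energy decreases.

  \<^emph>\<open>Convergence.\<close> The difference of the cubic terms is estimated by the sup norm of the error times the uniform
  \<open>L\<^sup>4\<close> bound on the numerical solution coming from energy stability.  By an Agmon-type inequality the sup norm is at
  most a small multiple of the \<open>L\<^sup>2\<close> norm of the Laplacian of the error, absorbed by the dissipation, plus a constant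
  times its \<open>L\<^sup>2\<close> norm, so the discrete Gronwall inequality applies for every \<open>\<tau>\<close>.
\<close>

text \<open>The solution is classical only for positive times and merely continuous at time 0, so
  the energy law cannot simply be integrated from the start. A crude bound depending on the length
  of the time interval comes first; it yields enough decay to justify the energy inequality mode by
  mode, which then replaces the crude constants by uniform ones. The bound on \<open>A \<nu>\<close>
  rests on \<open>(ln \<nu>)^2 + \<nu> \<ge> 1/4\<close>. It matters because, by Young's inequality,
  the dissipation \<open>A ||d||^2 + \<nu> ||grad d||^2\<close> dominates
  \<open>sqrt (A \<nu>)\<close> times the product of norms in Ladyzhenskaya's inequality. No
  restriction on \<open>\<tau>\<close> arises because the implicit dissipation is kept in the
  propagated quantity: the share \<open>\<tau> \<nu> |k|^4\<close> gained in one step pays for the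
  nonlinear error of the next. The factor \<open>A\<close> in the final estimate reflects the
  consistency error of the stabilisation, of size \<open>A \<tau>\<close>. The constant in the
  exponent can precede \<open>s\<close>, since it uses only a sup bound on the solution and the
  quartic bound on the scheme, neither of which involves \<open>s\<close>.\<close>

definition tvol :: real where
  "tvol = 4 * pi\<^sup>2"

lemma tvol_pos [simp]: "tvol > 0"
  by (simp add: tvol_def)

lemma tvol_nonneg [simp]: "tvol \<ge> 0" and tvol_nonzero [simp]: "tvol \<noteq> 0"
  using tvol_pos by linarith+

definition ep :: "int \<times> int \<Rightarrow> real \<times> real \<Rightarrow> complex" where
  "ep k p = cis (kdot k p)"

text \<open>Working class of functions. Continuity makes the Lebesgue integrals of the definitions
  agree with Henstock-Kurzweil integrals over the compact cell, where Fubini and the fundamental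
  theorem are applied; periodicity removes boundary terms.\<close>

definition CP :: "(real \<times> real \<Rightarrow> real) \<Rightarrow> bool" where
  "CP g \<longleftrightarrow> continuous_on UNIV g \<and> periodic2 g"

lemma compact_cell [simp]: "compact cell"
  by (simp add: cell_def)

lemma kdot_add: "kdot (j + k) p = kdot j p + kdot k p"
  by (simp add: kdot_def algebra_simps)

lemma kdot_minus: "kdot (- k) p = - kdot k p"
  by (simp add: kdot_def algebra_simps)

lemma ksq_nonneg [simp]: "ksq k \<ge> 0"
  by (simp add: ksq_def)

lemma ksq_minus [simp]: "ksq (- k) = ksq k"
  by (simp add: ksq_def)

lemma ksq_zero [simp]: "ksq 0 = 0"
  by (simp add: ksq_def)

lemma ksq_ge_1: "k \<noteq> 0 \<Longrightarrow> ksq k \<ge> 1"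
proof -
  assume "k \<noteq> 0"
  have "(fst k)\<^sup>2 + (snd k)\<^sup>2 \<noteq> 0"
    using \<open>k \<noteq> 0\<close> by (auto simp: prod_eq_iff sum_power2_eq_zero_iff)
  moreover have "(fst k)\<^sup>2 + (snd k)\<^sup>2 \<ge> 0" by simp
  ultimately have "(fst k)\<^sup>2 + (snd k)\<^sup>2 \<ge> 1" by linarith
  then have "real_of_int ((fst k)\<^sup>2 + (snd k)\<^sup>2) \<ge> real_of_int 1"
    by (subst of_int_le_iff)
  then show ?thesis by (simp add: ksq_def)
qed

lemma ep_add: "ep (j + k) p = ep j p * ep k p"
  by (simp add: ep_def kdot_add cis_mult)

lemma ep_0 [simp]: "ep 0 p = 1"
  by (simp add: ep_def kdot_def)

lemma cnj_ep: "cnj (ep k p) = ep (- k) p"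
  by (simp add: ep_def kdot_minus cis_cnj)

lemma norm_ep [simp]: "cmod (ep k p) = 1"
  by (simp add: ep_def)

lemma continuous_on_ep [continuous_intros]:
  "continuous_on S f \<Longrightarrow> continuous_on S (\<lambda>x. ep k (f x))"
  unfolding ep_def kdot_def cis_conv_exp by (intro continuous_intros)

lemma periodic2_ep:
  "ep k (x + 2*pi, y) = ep k (x, y)" "ep k (x, y + 2*pi) = ep k (x, y)"
proof -
  have "kdot k (x + 2*pi, y) = kdot k (x, y) + 2 * pi * real_of_int (fst k)"
    "kdot k (x, y + 2*pi) = kdot k (x, y) + 2 * pi * real_of_int (snd k)"
    by (simp_all add: kdot_def algebra_simps)
  then show "ep k (x + 2*pi, y) = ep k (x, y)" "ep k (x, y + 2*pi) = ep k (x, y)"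
    by (simp_all add: ep_def flip: cis_mult)
qed

section \<open>Integrals over the cell and orthogonality of the characters\<close>

lemma LINT_cell:
  fixes g :: "real \<times> real \<Rightarrow> 'a::euclidean_space"
  assumes "continuous_on cell g"
  shows "(LINT p:cell|lborel. g p) = integral cell g"
proof -
  have "set_integrable lborel cell g"
    unfolding set_integrable_def using assms by (intro borel_integrable_compact) auto
  then show ?thesis
    by (rule set_borel_integral_eq_integral(2))
qed

lemma cell_integrable [intro]:
  fixes g :: "real \<times> real \<Rightarrow> 'a::banach"
  shows "continuous_on cell g \<Longrightarrow> g integrable_on cell"
  unfolding cell_def by (rule integrable_continuous)

lemma integral_cell_const [simp]: "integral cell (\<lambda>p. c :: 'a::euclidean_space) = tvol *\<^sub>R c"
proof -
  have "Henstock_Kurzweil_Integration.content cell = tvol"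
    unfolding cell_def content_Pair by (simp add: tvol_def power2_eq_square)
  then show ?thesis
    unfolding cell_def by simp
qed

lemma integral_cell_fubini:
  fixes g :: "real \<times> real \<Rightarrow> 'a::banach"
  assumes "continuous_on cell g"
  shows "integral cell g = integral {0..2*pi} (\<lambda>x. integral {0..2*pi} (\<lambda>y. g (x, y)))"
  using integral_prod_continuous[of 0 0 "2*pi" "2*pi" g] assms by (simp add: cell_def)

lemma integral_cell_fubini':
  fixes g :: "real \<times> real \<Rightarrow> 'a::banach"
  assumes "continuous_on cell g"
  shows "integral cell g = integral {0..2*pi} (\<lambda>y. integral {0..2*pi} (\<lambda>x. g (x, y)))"
proof -
  have "continuous_on (cbox (0,0) (2*pi,2*pi)) (\<lambda>(x,y). g (x,y))"
    using assms by (simp add: cell_def)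
  from integral_swap_continuous[OF this] show ?thesis
    using integral_cell_fubini[OF assms] by simp
qed

lemma integral_cis:
  "integral {0..2*pi} (\<lambda>y. cis (real_of_int m * y)) = (if m = 0 then of_real (2*pi) else 0)"
proof (cases "m = 0")
  case True
  then show ?thesis by (simp add: scaleR_conv_of_real)
next
  case False
  let ?F = "\<lambda>y. cis (real_of_int m * y) / (\<i> * of_int m)"
  have "(?F has_vector_derivative cis (real_of_int m * y)) (at y within {0..2*pi})" for y
  proof -
    have "((\<lambda>z. exp (\<i> * (of_int m * z)) / (\<i> * of_int m)) has_field_derivative exp (\<i> * (of_int m * of_real y))) (at (of_real y))"
      using False by (auto intro!: derivative_eq_intros simp: field_simps)
    then show ?thesis
      using has_vector_derivative_real_field by (fastforce simp: cis_conv_exp)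
  qed
  then have "((\<lambda>y. cis (real_of_int m * y)) has_integral (?F (2*pi) - ?F 0)) {0..2*pi}"
    by (intro fundamental_theorem_of_calculus) auto
  moreover have "?F (2*pi) - ?F 0 = 0"
    using cis_multiple_2pi[of "real_of_int m"] by (simp add: mult.commute mult.left_commute)
  ultimately show ?thesis
    using False by (simp add: integral_unique)
qed

lemma integral_ep: "integral cell (ep k) = (if k = 0 then of_real tvol else 0)"
proof -
  have c: "continuous_on cell (ep k)"
    using continuous_on_ep[of cell "\<lambda>p. p" k] by simp
  have "integral cell (ep k)
      = integral {0..2*pi} (\<lambda>x. integral {0..2*pi} (\<lambda>y. cis (real_of_int (fst k) * x) * cis (real_of_int (snd k) * y)))"
    unfolding integral_cell_fubini[OF c] by (simp add: ep_def kdot_def cis_mult)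
  also have "\<dots> = (if fst k = 0 then of_real (2*pi) else 0) * (if snd k = 0 then of_real (2*pi) else 0)"
    by (simp add: integral_cis)
  also have "\<dots> = (if k = 0 then of_real tvol else 0)"
    by (auto simp: prod_eq_iff tvol_def power2_eq_square)
  finally show ?thesis .
qed

section \<open>Continuous periodic functions and their Fourier coefficients\<close>

lemma CP_cont [intro]: "CP g \<Longrightarrow> continuous_on S g"
  unfolding CP_def using continuous_on_subset by blast

lemma CP_const [simp]: "CP (\<lambda>p. c)"
  by (simp add: CP_def periodic2_def)

lemma CP_add: "CP g \<Longrightarrow> CP h \<Longrightarrow> CP (\<lambda>p. g p + h p)"
  and CP_diff: "CP g \<Longrightarrow> CP h \<Longrightarrow> CP (\<lambda>p. g p - h p)"
  and CP_mult: "CP g \<Longrightarrow> CP h \<Longrightarrow> CP (\<lambda>p. g p * h p)"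
  and CP_power: "CP g \<Longrightarrow> CP (\<lambda>p. g p ^ n)"
  and CP_cmult: "CP g \<Longrightarrow> CP (\<lambda>p. c * g p)"
  unfolding CP_def periodic2_def by (auto intro!: continuous_intros)

lemma CP_fCH: "CP g \<Longrightarrow> CP (\<lambda>p. fCH (g p))"
  unfolding fCH_def by (intro CP_diff CP_power)

lemma fourier_eq:
  assumes "CP g"
  shows "fourier g k = integral cell (\<lambda>p. of_real (g p) * ep (- k) p)"
  unfolding fourier_def ep_def[symmetric] kdot_minus[symmetric]
  by (intro LINT_cell continuous_intros) (use assms in auto)

lemma fourier_add: "CP g \<Longrightarrow> CP h \<Longrightarrow> fourier (\<lambda>p. g p + h p) k = fourier g k + fourier h k"
  and fourier_diff: "CP g \<Longrightarrow> CP h \<Longrightarrow> fourier (\<lambda>p. g p - h p) k = fourier g k - fourier h k"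
  by (simp_all add: fourier_eq CP_add CP_diff ring_distribs)
     (subst integral_add integral_diff, auto intro!: cell_integrable continuous_intros)+

lemma fourier_cmult: "CP g \<Longrightarrow> fourier (\<lambda>p. c * g p) k = of_real c * fourier g k"
  by (simp add: fourier_eq CP_cmult mult.assoc)

lemma cnj_integral_cell:
  "continuous_on cell H \<Longrightarrow> cnj (integral cell H) = integral cell (\<lambda>p. cnj (H p))"
  using integral_linear[OF cell_integrable bounded_linear_cnj, of H] by (simp add: o_def)

lemma fourier_uminus: "CP g \<Longrightarrow> fourier g (- k) = cnj (fourier g k)"
  by (subst (1 2) fourier_eq, simp, simp, subst cnj_integral_cell)
     (auto intro!: continuous_intros simp: cnj_ep)

lemma Re_integral_cell:
  "continuous_on cell H \<Longrightarrow> Re (integral cell H) = integral cell (\<lambda>p. Re (H p))"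
  using integral_linear[OF cell_integrable bounded_linear_Re, of H] by (simp add: o_def)

lemma norm_fourier_le:
  assumes "CP g" "CP h" "\<And>p. \<bar>g p\<bar> \<le> h p"
  shows "cmod (fourier g k) \<le> integral cell h"
  unfolding fourier_eq[OF assms(1)]
  using assms by (intro integral_norm_bound_integral cell_integrable continuous_intros)
     (auto simp: norm_mult)

subsection \<open>Completeness of the trigonometric system\<close>

text \<open>Expanding the square leaves a quadratic in the coefficients \<open>c\<close>, without
  cross terms by orthogonality of the characters. Bessel's inequality and the best approximation
  property are both read off from it.\<close>

lemma integral_sq_diff:
  assumes g: "CP g" and F: "finite F"
  shows "integral cell (\<lambda>p. (cmod (of_real (g p) - (\<Sum>k\<in>F. c k * ep k p)))\<^sup>2)
     = integral cell (\<lambda>p. (g p)\<^sup>2) - 2 * (\<Sum>k\<in>F. Re (cnj (c k) * fourier g k)) + tvol * (\<Sum>k\<in>F. (cmod (c k))\<^sup>2)"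
proof -
  let ?P = "\<lambda>p. \<Sum>k\<in>F. c k * ep k p"
  have cP: "continuous_on cell ?P" by (intro continuous_intros)
  have cg: "continuous_on cell g" using g by auto
  have sq: "(cmod (of_real a - z))\<^sup>2 = (a\<^sup>2 - 2 * (a * Re z)) + Re (z * cnj z)" for a z
    by (simp only: cmod_power2) (simp add: power2_eq_square algebra_simps)
  have 1: "(cmod (of_real (g p) - ?P p))\<^sup>2
      = ((g p)\<^sup>2 - 2 * (g p * Re (?P p))) + Re (?P p * cnj (?P p))" for p
    by (rule sq)
  have "integral cell (\<lambda>p. (cmod (of_real (g p) - ?P p))\<^sup>2) =
     (integral cell (\<lambda>p. (g p)\<^sup>2) - integral cell (\<lambda>p. 2 * (g p * Re (?P p)))) + integral cell (\<lambda>p. Re (?P p * cnj (?P p)))"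
    unfolding 1
    by (subst integral_add, (intro cell_integrable continuous_intros cg cP)+,
        subst integral_diff, (intro cell_integrable continuous_intros cg cP)+) simp
  moreover have "integral cell (\<lambda>p. g p * Re (?P p)) = (\<Sum>k\<in>F. Re (cnj (c k) * fourier g k))"
  proof -
    have "integral cell (\<lambda>p. g p * Re (?P p)) = Re (integral cell (\<lambda>p. of_real (g p) * cnj (?P p)))"
      by (subst Re_integral_cell) (auto intro!: continuous_intros cg)
    also have "integral cell (\<lambda>p. of_real (g p) * cnj (?P p))
        = integral cell (\<lambda>p. \<Sum>k\<in>F. cnj (c k) * (of_real (g p) * ep (- k) p))"
      by (simp add: sum_distrib_left cnj_ep mult.left_commute)
    also have "\<dots> = (\<Sum>k\<in>F. cnj (c k) * fourier g k)"
      by (subst integral_sum[OF F], intro cell_integrable continuous_intros cg)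
         (simp add: fourier_eq[OF g])
    finally show ?thesis by simp
  qed
  moreover have "integral cell (\<lambda>p. Re (?P p * cnj (?P p))) = tvol * (\<Sum>k\<in>F. (cmod (c k))\<^sup>2)"
  proof -
    have "integral cell (\<lambda>p. Re (?P p * cnj (?P p))) = Re (integral cell (\<lambda>p. ?P p * cnj (?P p)))"
      by (subst Re_integral_cell) (auto intro!: continuous_intros cP)
    also have "integral cell (\<lambda>p. ?P p * cnj (?P p))
       = integral cell (\<lambda>p. \<Sum>j\<in>F. \<Sum>k\<in>F. (c j * cnj (c k)) * ep (j - k) p)"
      by (simp add: sum_product cnj_ep ep_add[of _ "- _", simplified] mult_ac)
    also have "\<dots> = (\<Sum>j\<in>F. \<Sum>k\<in>F. (c j * cnj (c k)) * integral cell (ep (j - k)))"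
      by (subst integral_sum[OF F], intro cell_integrable continuous_intros,
          subst integral_sum[OF F], intro cell_integrable continuous_intros) simp
    also have "\<dots> = (\<Sum>j\<in>F. \<Sum>k\<in>F. if j = k then of_real ((cmod (c k))\<^sup>2 * tvol) else 0)"
      by (intro sum.cong) (auto simp: integral_ep complex_norm_square[symmetric])
    also have "\<dots> = of_real (tvol * (\<Sum>k\<in>F. (cmod (c k))\<^sup>2))"
      by (simp add: F sum_distrib_left mult.commute)
    finally show ?thesis by simp
  qed
  ultimately show ?thesis by simp
qed

lemma bessel:
  assumes g: "CP g" and F: "finite F"
  shows "(\<Sum>k\<in>F. (cmod (fourier g k))\<^sup>2) \<le> tvol * integral cell (\<lambda>p. (g p)\<^sup>2)"
proof -
  let ?c = "\<lambda>k. fourier g k / of_real tvol"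
  have "0 \<le> integral cell (\<lambda>p. (cmod (of_real (g p) - (\<Sum>k\<in>F. ?c k * ep k p)))\<^sup>2)"
    by (rule integral_nonneg) (use g in \<open>auto intro!: cell_integrable continuous_intros\<close>)
  also have "\<dots> = integral cell (\<lambda>p. (g p)\<^sup>2) - (\<Sum>k\<in>F. (cmod (fourier g k))\<^sup>2) / tvol"
  proof -
    have "Re (cnj (?c k) * fourier g k) = (cmod (fourier g k))\<^sup>2 / tvol" for k
      unfolding cmod_power2 by (simp add: power2_eq_square add_divide_distrib)
    moreover have "(cmod (?c k))\<^sup>2 = (cmod (fourier g k))\<^sup>2 / tvol\<^sup>2" for k
      by (simp add: norm_divide power_divide)
    ultimately show ?thesis
      unfolding integral_sq_diff[OF g F]
      by (simp add: sum_divide_distrib[symmetric]) (simp add: power2_eq_square)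
  qed
  finally show ?thesis by (simp add: field_simps)
qed

text \<open>Completing the square coefficient by coefficient: the left side is the minimum of the
  quadratic, attained at \<open>fourier g k / tvol\<close>.\<close>

lemma fourier_best_approx:
  assumes g: "CP g" and F: "finite F"
  shows "integral cell (\<lambda>p. (g p)\<^sup>2) - (\<Sum>k\<in>F. (cmod (fourier g k))\<^sup>2) / tvol
      \<le> integral cell (\<lambda>p. (cmod (of_real (g p) - (\<Sum>k\<in>F. c k * ep k p)))\<^sup>2)"
proof -
  have "0 \<le> tvol * (cmod (c k))\<^sup>2 - 2 * Re (cnj (c k) * fourier g k) + (cmod (fourier g k))\<^sup>2 / tvol" for k
  proof -
    have "0 \<le> (cmod (of_real tvol * c k - fourier g k))\<^sup>2" by simp
    also have "\<dots> = tvol * (tvol * (cmod (c k))\<^sup>2 - 2 * Re (cnj (c k) * fourier g k) + (cmod (fourier g k))\<^sup>2 / tvol)"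
      by (simp only: cmod_power2) (simp add: power2_eq_square field_simps)
    finally show ?thesis by (simp only: zero_le_mult_iff) (use tvol_pos in auto)
  qed
  then have "0 \<le> (\<Sum>k\<in>F. tvol * (cmod (c k))\<^sup>2 - 2 * Re (cnj (c k) * fourier g k) + (cmod (fourier g k))\<^sup>2 / tvol)"
    by (intro sum_nonneg)
  then show ?thesis
    unfolding integral_sq_diff[OF g F]
    by (simp add: sum.distrib sum_subtractf sum_distrib_left sum_divide_distrib)
qed

text \<open>Closure under sums is built in, so that closure under products reduces to multiplying
  two characters. These are the operations met when a polynomial in \<open>cis x\<close> and
  \<open>cis y\<close> is expanded.\<close>

inductive_set trig_polys :: "(real \<times> real \<Rightarrow> complex) set" where
  single: "(\<lambda>p. c * ep k p) \<in> trig_polys"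
| add: "H \<in> trig_polys \<Longrightarrow> K \<in> trig_polys \<Longrightarrow> (\<lambda>p. H p + K p) \<in> trig_polys"

lemma trig_polys_repr:
  "H \<in> trig_polys \<Longrightarrow> \<exists>F c. finite F \<and> H = (\<lambda>p. \<Sum>k\<in>F. c k * ep k p)"
proof (induction rule: trig_polys.induct)
  case (single c k)
  then show ?case by (intro exI[of _ "{k}"] exI[of _ "\<lambda>_. c"]) auto
next
  case (add H K)
  then obtain F c F' c' where *: "finite F" "H = (\<lambda>p. \<Sum>k\<in>F. c k * ep k p)"
    "finite F'" "K = (\<lambda>p. \<Sum>k\<in>F'. c' k * ep k p)" by blast
  have 1: "(\<Sum>k\<in>F. c k * ep k p) = (\<Sum>k\<in>F \<union> F'. (if k \<in> F then c k else 0) * ep k p)" for p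
    using * by (intro sum.mono_neutral_cong_left) auto
  have 2: "(\<Sum>k\<in>F'. c' k * ep k p) = (\<Sum>k\<in>F \<union> F'. (if k \<in> F' then c' k else 0) * ep k p)" for p
    using * by (intro sum.mono_neutral_cong_left) auto
  have "(\<lambda>p. H p + K p) = (\<lambda>p. \<Sum>k\<in>F \<union> F'. ((if k \<in> F then c k else 0) + (if k \<in> F' then c' k else 0)) * ep k p)"
    unfolding *(2,4) 1 2 by (simp only: distrib_right sum.distrib)
  with * show ?case by (intro exI[of _ "F \<union> F'"] exI conjI) auto
qed

lemma trig_polys_mult:
  assumes "H \<in> trig_polys" "K \<in> trig_polys"
  shows "(\<lambda>p. H p * K p) \<in> trig_polys"
  using assms(1)
proof induction
  case (single c k)
  show ?case using assms(2)
  proof induction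
    case (single d j)
    have "(\<lambda>p. c * ep k p * (d * ep j p)) = (\<lambda>p. (c * d) * ep (k + j) p)"
      by (simp add: ep_add mult_ac)
    then show ?case by (simp only: trig_polys.single)
  next
    case (add H K)
    then show ?case using trig_polys.add by (auto simp: distrib_left)
  qed
next
  case (add H1 H2)
  then show ?case using trig_polys.add by (auto simp: distrib_right)
qed

lemma trig_polys_cmult: "H \<in> trig_polys \<Longrightarrow> (\<lambda>p. c * H p) \<in> trig_polys"
  using trig_polys_mult[OF trig_polys.single[of c 0], of H] by simp

lemma cos_trig_polys:
  "(\<lambda>p. of_real (cos (fst p))) \<in> trig_polys" "(\<lambda>p. of_real (sin (fst p))) \<in> trig_polys"
  "(\<lambda>p. of_real (cos (snd p))) \<in> trig_polys" "(\<lambda>p. of_real (sin (snd p))) \<in> trig_polys"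
proof -
  have "(\<lambda>p. (1/2) * ep (1,0) p + (1/2) * ep (-1,0) p) \<in> trig_polys"
    "(\<lambda>p. (1/(2*\<i>)) * ep (1,0) p + (-1/(2*\<i>)) * ep (-1,0) p) \<in> trig_polys"
    "(\<lambda>p. (1/2) * ep (0,1) p + (1/2) * ep (0,-1) p) \<in> trig_polys"
    "(\<lambda>p. (1/(2*\<i>)) * ep (0,1) p + (-1/(2*\<i>)) * ep (0,-1) p) \<in> trig_polys"
    by (intro trig_polys.add trig_polys.single)+
  moreover have "(\<lambda>p. (1/2) * ep (1,0) p + (1/2) * ep (-1,0) p) = (\<lambda>p. of_real (cos (fst p)))"
    "(\<lambda>p. (1/(2*\<i>)) * ep (1,0) p + (-1/(2*\<i>)) * ep (-1,0) p) = (\<lambda>p. of_real (sin (fst p)))"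
    "(\<lambda>p. (1/2) * ep (0,1) p + (1/2) * ep (0,-1) p) = (\<lambda>p. of_real (cos (snd p)))"
    "(\<lambda>p. (1/(2*\<i>)) * ep (0,1) p + (-1/(2*\<i>)) * ep (0,-1) p) = (\<lambda>p. of_real (sin (snd p)))"
    by (auto simp: fun_eq_iff ep_def kdot_def complex_eq_iff)
  ultimately show "(\<lambda>p. of_real (cos (fst p))) \<in> trig_polys" "(\<lambda>p. of_real (sin (fst p))) \<in> trig_polys"
    "(\<lambda>p. of_real (cos (snd p))) \<in> trig_polys" "(\<lambda>p. of_real (sin (snd p))) \<in> trig_polys"
    by simp_all
qed

text \<open>A real linear functional of \<open>(cis x, cis y)\<close> is a combination of
  \<open>cos x\<close>, \<open>sin x\<close>, \<open>cos y\<close> and \<open>sin y\<close>; sums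
  and products are covered by the closure properties.\<close>

lemma real_polynomial_cis_trig_polys:
  fixes q :: "complex \<times> complex \<Rightarrow> real"
  assumes "real_polynomial_function q"
  shows "(\<lambda>p. of_real (q (cis (fst p), cis (snd p)))) \<in> trig_polys"
  using assms
proof induction
  case (linear f)
  interpret f: bounded_linear f by fact
  have "f (cis x, cis y) = f (1,0) * cos x + f (\<i>,0) * sin x + f (0,1) * cos y + f (0,\<i>) * sin y" for x y
  proof -
    have "(cis x, cis y) = cos x *\<^sub>R (1,0) + sin x *\<^sub>R (\<i>,0) + cos y *\<^sub>R (0,1) + sin y *\<^sub>R (0,\<i>)"
      by (auto simp: complex_eq_iff)
    then have "f (cis x, cis y) = f (cos x *\<^sub>R (1,0) + sin x *\<^sub>R (\<i>,0) + cos y *\<^sub>R (0,1) + sin y *\<^sub>R (0,\<i>))"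
      by (rule arg_cong)
    then show ?thesis by (simp only: f.add f.scaleR real_scaleR_def mult.commute)
  qed
  then have "(\<lambda>p. of_real (f (cis (fst p), cis (snd p))))
      = (\<lambda>p. of_real (f (1,0)) * of_real (cos (fst p)) + of_real (f (\<i>,0)) * of_real (sin (fst p))
          + of_real (f (0,1)) * of_real (cos (snd p)) + of_real (f (0,\<i>)) * (of_real (sin (snd p)) :: complex))"
    by (simp add: fun_eq_iff)
  also have "\<dots> \<in> trig_polys"
    by (intro trig_polys.add trig_polys_cmult cos_trig_polys)
  finally show ?case .
next
  case (const c)
  show ?case using trig_polys.single[of "of_real c" 0] by simp
next
  case (add f g)
  then show ?case using trig_polys.add by simp
next
  case (mult f g)
  then show ?case using trig_polys_mult by simp
qed

lemma periodic2_int: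
  assumes "periodic2 g"
  shows "g (x + 2 * pi * of_int m, y + 2 * pi * of_int n) = g (x, y)"
proof -
  have X: "g (x + 2 * pi * of_int m, y) = g (x, y)" for x y m
  proof (induction m rule: int_induct[where k = 0])
    case (step1 i)
    have "x + 2 * pi * of_int (i + 1) = (x + 2 * pi * of_int i) + 2 * pi" by (simp add: algebra_simps)
    then show ?case using assms step1 unfolding periodic2_def by metis
  next
    case (step2 i)
    have "x + 2 * pi * of_int i = (x + 2 * pi * of_int (i - 1)) + 2 * pi" by (simp add: algebra_simps)
    then show ?case using assms step2 unfolding periodic2_def by metis
  qed simp
  have Y: "g (x, y + 2 * pi * of_int m) = g (x, y)" for x y m
  proof (induction m rule: int_induct[where k = 0])
    case (step1 i)
    have "y + 2 * pi * of_int (i + 1) = (y + 2 * pi * of_int i) + 2 * pi" by (simp add: algebra_simps)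
    then show ?case using assms step1 unfolding periodic2_def by metis
  next
    case (step2 i)
    have "y + 2 * pi * of_int i = (y + 2 * pi * of_int (i - 1)) + 2 * pi" by (simp add: algebra_simps)
    then show ?case using assms step2 unfolding periodic2_def by metis
  qed simp
  show ?thesis by (simp add: X Y)
qed

lemma periodic2_reduce:
  obtains q where "q \<in> cell" "\<And>g. periodic2 g \<Longrightarrow> g q = g p"
proof -
  define red where "red x = x + 2 * pi * of_int (- \<lfloor>x / (2*pi)\<rfloor>)" for x :: real
  have r: "0 \<le> red x \<and> red x \<le> 2 * pi" for x
  proof -
    have "of_int \<lfloor>x / (2*pi)\<rfloor> \<le> x / (2*pi)" "x / (2*pi) \<le> of_int \<lfloor>x / (2*pi)\<rfloor> + 1"
      by linarith+
    then have "of_int \<lfloor>x / (2*pi)\<rfloor> * (2*pi) \<le> x" "x \<le> (of_int \<lfloor>x / (2*pi)\<rfloor> + 1) * (2*pi)"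
      by (simp_all only: pos_le_divide_eq pos_divide_le_eq pi_gt_zero zero_less_mult_iff zero_less_numeral simp_thms)
    then show ?thesis by (simp add: red_def algebra_simps)
  qed
  have "(red (fst p), red (snd p)) \<in> cell"
    using r by (simp add: cell_def cbox_Pair_eq)
  moreover have "g (red (fst p), red (snd p)) = g p" if "periodic2 g" for g
    unfolding red_def by (subst periodic2_int[OF that]) simp
  ultimately show ?thesis using that by blast
qed

text \<open>The torus is embedded in \<open>complex \<times> complex\<close> by
  \<open>\<phi>\<close>, where Stone-Weierstrass applies to real polynomials; these pull back to
  trigonometric polynomials. This density is what turns Bessel's inequality into Parseval's
  identity.\<close>

lemma trig_poly_dense:
  assumes g: "CP g" and e: "e > 0"
  shows "\<exists>F c. finite F \<and> (\<forall>p\<in>cell. cmod (of_real (g p) - (\<Sum>k\<in>F. c k * ep k p)) < e)"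
proof -
  define \<phi> where "\<phi> = (\<lambda>p :: real \<times> real. (cis (fst p), cis (snd p)))"
  define K where "K = \<phi> ` cell"
  \<comment> \<open>\<open>G\<close> is \<open>g\<close> transported to the image \<open>K\<close>;
    by periodicity the choice of the preimage does not affect the value.\<close>
  define G where "G = (\<lambda>q. g (SOME p. p \<in> cell \<and> \<phi> p = q))"
  have c\<phi>: "continuous_on cell \<phi>"
    unfolding \<phi>_def cis_conv_exp by (intro continuous_intros)
  have inv: "g p = g p'" if "\<phi> p = \<phi> p'" for p p'
  proof -
    have "sin (fst p) = sin (fst p') \<and> cos (fst p) = cos (fst p')" "sin (snd p) = sin (snd p') \<and> cos (snd p) = cos (snd p')"
      using that unfolding \<phi>_def by (simp_all add: complex_eq_iff)
    then obtain m n :: int where "fst p = fst p' + 2 * pi * m" "snd p = snd p' + 2 * pi * n"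
      unfolding sin_cos_eq_iff by blast
    then have "p = (fst p' + 2 * pi * m, snd p' + 2 * pi * n)" by (simp add: prod_eq_iff)
    then show ?thesis using periodic2_int[of g "fst p'" m "snd p'" n] g by (simp add: CP_def)
  qed
  have G: "G (\<phi> p) = g p" if "p \<in> cell" for p
  proof -
    have "(SOME q. q \<in> cell \<and> \<phi> q = \<phi> p) \<in> cell \<and> \<phi> (SOME q. q \<in> cell \<and> \<phi> q = \<phi> p) = \<phi> p"
      by (rule someI[of _ p]) (use that in auto)
    then show ?thesis unfolding G_def using inv by blast
  qed
  have K: "compact K" unfolding K_def using c\<phi> by (simp add: compact_continuous_image)
  \<comment> \<open>\<open>\<phi>\<close> is continuous on the compact cell, hence a quotient map
    onto \<open>K\<close>; so relative openness in \<open>K\<close> may be tested on preimages in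
    the cell.\<close>
  have G': "continuous_on K G"
    unfolding continuous_openin_preimage_eq
  proof (intro allI impI)
    fix T :: "real set" assume "open T"
    have eq: "cell \<inter> \<phi> -` (K \<inter> G -` T) = cell \<inter> g -` T"
    proof -
      have "\<phi> p \<in> K \<and> G (\<phi> p) = g p" if "p \<in> cell" for p
        using that G[OF that] unfolding K_def by blast
      then have "p \<in> cell \<inter> \<phi> -` (K \<inter> G -` T) \<longleftrightarrow> p \<in> cell \<inter> g -` T" for p
        by (cases "p \<in> cell") simp_all
      then show ?thesis by (rule set_eqI)
    qed
    have "openin (top_of_set cell) (cell \<inter> g -` T)"
      by (rule continuous_openin_preimage_gen[OF CP_cont[OF g] \<open>open T\<close>])
    moreover have "openin (top_of_set cell) (cell \<inter> \<phi> -` (K \<inter> G -` T)) \<longleftrightarrow> openin (top_of_set K) (K \<inter> G -` T)"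
      by (rule Abstract_Topology_2.continuous_imp_quotient_map[OF c\<phi> K_def[symmetric] compact_cell]) simp
    ultimately show "openin (top_of_set K) (K \<inter> G -` T)"
      unfolding eq by simp
  qed
  obtain q where q: "real_polynomial_function q" "\<And>x. x \<in> K \<Longrightarrow> \<bar>G x - q x\<bar> < e"
    by (rule Stone_Weierstrass_real_polynomial_function[OF K G' e]) blast
  obtain F c where F: "finite F" "(\<lambda>p. of_real (q (cis (fst p), cis (snd p)))) = (\<lambda>p. \<Sum>k\<in>F. c k * ep k p)"
    using trig_polys_repr[OF real_polynomial_cis_trig_polys[OF q(1)]] by blast
  have "cmod (of_real (g p) - (\<Sum>k\<in>F. c k * ep k p)) < e" if "p \<in> cell" for p
  proof -
    have "(\<Sum>k\<in>F. c k * ep k p) = of_real (q (\<phi> p))"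
      using fun_cong[OF F(2), of p] by (simp only: \<phi>_def)
    then have "of_real (g p) - (\<Sum>k\<in>F. c k * ep k p) = (of_real (G (\<phi> p) - q (\<phi> p)) :: complex)"
      by (simp only: G[OF that] of_real_diff)
    then show ?thesis using q(2)[of "\<phi> p"] that by (simp add: K_def del: of_real_diff)
  qed
  then show ?thesis using F(1) by blast
qed

text \<open>Bessel gives one inequality. For the other, the Fourier partial sum over the frequencies
  of a uniform approximation is at least as close to \<open>g\<close> in the mean as that
  approximation.\<close>

theorem parseval:
  assumes g: "CP g"
  shows "((\<lambda>k. (cmod (fourier g k))\<^sup>2) has_sum (tvol * integral cell (\<lambda>p. (g p)\<^sup>2))) UNIV"
proof -
  let ?f = "\<lambda>k. (cmod (fourier g k))\<^sup>2" and ?I = "integral cell (\<lambda>p. (g p)\<^sup>2)"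
  have bdd: "sum ?f F \<le> tvol * ?I" if "finite F" for F
    using bessel[OF g that] .
  have sm: "?f summable_on UNIV"
    by (rule nonneg_bdd_above_summable_on) (use bdd in \<open>auto intro!: bdd_aboveI2\<close>)
  have "infsum ?f UNIV \<le> tvol * ?I"
    by (rule infsum_le_finite_sums[OF sm bdd])
  moreover have "tvol * ?I \<le> infsum ?f UNIV + d" if "d > 0" for d
  proof -
    \<comment> \<open>One factor \<open>tvol\<close> is the area of the cell, the other the
      normalisation of the coefficients; with this \<open>e\<close> both together leave exactly
      \<open>d\<close>.\<close>
    define e where "e = sqrt d / tvol"
    have e: "e > 0" "tvol * (tvol * e\<^sup>2) = d" using that by (auto simp: e_def power_divide power2_eq_square)
    obtain F c where F: "finite F" "\<forall>p\<in>cell. cmod (of_real (g p) - (\<Sum>k\<in>F. c k * ep k p)) < e"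
      using trig_poly_dense[OF g e(1)] by blast
    have "?I - sum ?f F / tvol \<le> integral cell (\<lambda>p. (cmod (of_real (g p) - (\<Sum>k\<in>F. c k * ep k p)))\<^sup>2)"
      using fourier_best_approx[OF g F(1)] .
    also have "\<dots> \<le> integral cell (\<lambda>p. e\<^sup>2)"
    proof (rule integral_le)
      fix p assume "p \<in> cell"
      then have "cmod (of_real (g p) - (\<Sum>k\<in>F. c k * ep k p)) \<le> e" using F by (simp add: less_imp_le)
      then show "(cmod (of_real (g p) - (\<Sum>k\<in>F. c k * ep k p)))\<^sup>2 \<le> e\<^sup>2" by (rule power_mono) simp
    qed (use g in \<open>auto intro!: cell_integrable continuous_intros\<close>)
    finally have "tvol * (?I - sum ?f F / tvol) \<le> tvol * (tvol * e\<^sup>2)"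
      by (intro mult_left_mono) auto
    then have "tvol * ?I \<le> sum ?f F + d" using e(2) by (simp add: right_diff_distrib)
    also have "sum ?f F \<le> infsum ?f UNIV"
      by (rule finite_sum_le_infsum[OF sm F(1)]) auto
    finally show ?thesis by simp
  qed
  then have "tvol * ?I \<le> infsum ?f UNIV" by (rule field_le_epsilon)
  ultimately show ?thesis using sm by (simp add: has_sum_iff)
qed

text \<open>Polarization of Parseval's identity through
  \<open>2ab = (a+b)^2 - a^2 - b^2\<close>.\<close>

theorem parseval_inner:
  assumes g: "CP g" and h: "CP h"
  shows "((\<lambda>k. Re (fourier g k * cnj (fourier h k))) has_sum (tvol * integral cell (\<lambda>p. g p * h p))) UNIV"
proof -
  have 1: "((\<lambda>k. 1/2 * ((cmod (fourier (\<lambda>p. g p + h p) k))\<^sup>2 + ((-1) * (cmod (fourier g k))\<^sup>2 + (-1) * (cmod (fourier h k))\<^sup>2))) has_sum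
      (1/2 * (tvol * integral cell (\<lambda>p. (g p + h p)\<^sup>2) + ((-1) * (tvol * integral cell (\<lambda>p. (g p)\<^sup>2)) + (-1) * (tvol * integral cell (\<lambda>p. (h p)\<^sup>2)))))) UNIV"
    by (intro has_sum_cmult_right has_sum_add parseval g h CP_add)
  have 2: "1/2 * ((cmod (fourier (\<lambda>p. g p + h p) k))\<^sup>2 + ((-1) * (cmod (fourier g k))\<^sup>2 + (-1) * (cmod (fourier h k))\<^sup>2))
     = Re (fourier g k * cnj (fourier h k))" for k
    unfolding fourier_add[OF g h] cmod_power2 by (simp add: power2_eq_square algebra_simps)
  have "integral cell (\<lambda>p. (g p + h p)\<^sup>2) = integral cell (\<lambda>p. (g p)\<^sup>2) + integral cell (\<lambda>p. (h p)\<^sup>2) + integral cell (\<lambda>p. 2 * (g p * h p))"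
    unfolding power2_sum mult.assoc
    by (subst integral_add, (intro cell_integrable continuous_intros; use g h in auto)+,
        subst integral_add, (intro cell_integrable continuous_intros; use g h in auto)+) (rule refl)
  then have 3: "1/2 * (tvol * integral cell (\<lambda>p. (g p + h p)\<^sup>2) + ((-1) * (tvol * integral cell (\<lambda>p. (g p)\<^sup>2)) + (-1) * (tvol * integral cell (\<lambda>p. (h p)\<^sup>2))))
     = tvol * integral cell (\<lambda>p. g p * h p)"
    by (simp add: algebra_simps flip: integral_mult_right)
  show ?thesis using 1 unfolding 2 3 .
qed

lemma integral_cell_eq_0_imp:
  assumes g: "CP g" and nn: "\<And>p. g p \<ge> 0" and z: "integral cell g = 0"
  shows "g p = 0"
proof -
  obtain q where q: "q \<in> cell" "g q = g p"
    using periodic2_reduce[of p] g unfolding CP_def by metis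
  have "(g has_integral 0) cell"
    using integrable_integral[OF cell_integrable[OF CP_cont[OF g]]] z by simp
  moreover have "box (0,0) (2*pi,2*pi) \<noteq> ({} :: (real \<times> real) set)"
    by (simp add: box_ne_empty Basis_prod_def)
  ultimately have "g q = 0"
    using q(1) nn unfolding cell_def by (intro has_integral_0_cbox_imp_0[OF CP_cont[OF g]]) auto
  then show ?thesis using q by simp
qed

text \<open>Cauchy criterion for nonnegative families, phrased with finite sets that avoid
  \<open>H\<close>. It recurs wherever all but finitely many modes must be made small: uniform
  convergence, truncation of the energy law, and the Agmon-type inequality.\<close>

lemma abs_le_summable_tail:
  fixes f :: "'a \<Rightarrow> real"
  assumes "f summable_on UNIV" "\<And>x. f x \<ge> 0" "e > 0"
  shows "\<exists>H. finite H \<and> (\<forall>F. finite F \<longrightarrow> F \<inter> H = {} \<longrightarrow> sum f F < e)"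
proof -
  obtain H where H: "finite H" "dist (sum f H) (infsum f UNIV) \<le> e/2"
    using has_sum_finite_approximation[OF has_sum_infsum[OF assms(1)], of "e/2"] assms(3) by auto
  have "sum f F < e" if "finite F" "F \<inter> H = {}" for F
  proof -
    have "sum f F + sum f H = sum f (F \<union> H)" using that H(1) by (simp add: sum.union_disjoint)
    also have "\<dots> \<le> infsum f UNIV" using that H assms by (intro finite_sum_le_infsum) auto
    finally show ?thesis using H(2) assms(3) unfolding dist_real_def by linarith
  qed
  then show ?thesis using H(1) by blast
qed

text \<open>The absolutely convergent series has a continuous sum \<open>S\<close>. By Parseval its
  partial sums converge to \<open>g\<close> in the mean, so \<open>g\<close> and \<open>S\<close>
  agree in the mean, hence everywhere by continuity.\<close>

lemma fourier_series_approx: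
  assumes g: "CP g" and s: "(\<lambda>k. cmod (fourier g k)) summable_on UNIV" and e: "e > 0"
  shows "\<exists>H. finite H \<and> (\<forall>F p. finite F \<longrightarrow> H \<subseteq> F \<longrightarrow>
      cmod (of_real (g p) - (\<Sum>k\<in>F. fourier g k / of_real tvol * ep k p)) \<le> e)"
proof -
  let ?a = "\<lambda>k p. fourier g k / of_real tvol * ep k p"
  define S where "S = (\<lambda>p. \<Sum>\<^sub>\<infinity>k. ?a k p)"
  have sm': "(\<lambda>k. cmod (fourier g k) / tvol) summable_on UNIV"
    using summable_on_cmult_left[OF s, of "inverse tvol"] by (simp add: field_simps)
  have sm: "(\<lambda>k. ?a k p) summable_on UNIV" for p
    by (rule abs_summable_summable) (use sm' in \<open>simp add: norm_mult norm_divide\<close>)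
  have tail: "cmod (S p - (\<Sum>k\<in>F. ?a k p)) \<le> d"
    if H: "finite F" "\<And>F'. finite F' \<Longrightarrow> F' \<inter> F = {} \<Longrightarrow> (\<Sum>k\<in>F'. cmod (fourier g k) / tvol) < d" for F p d
  proof -
    have s2: "(\<lambda>k. ?a k p) summable_on (- F)" by (rule summable_on_subset_banach[OF sm]) simp
    have a2: "(\<lambda>k. cmod (fourier g k) / tvol) summable_on (- F)" by (rule summable_on_subset_banach[OF sm']) simp
    have "S p = (\<Sum>k\<in>F. ?a k p) + (\<Sum>\<^sub>\<infinity>k\<in>-F. ?a k p)"
      unfolding S_def using infsum_Un_disjoint[of "\<lambda>k. ?a k p" F "-F"] H(1) s2 by (simp add: Compl_partition)
    moreover have "cmod (\<Sum>\<^sub>\<infinity>k\<in>-F. ?a k p) \<le> (\<Sum>\<^sub>\<infinity>k\<in>-F. cmod (fourier g k) / tvol)"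
      using norm_infsum_bound[of "\<lambda>k. ?a k p" "-F"] a2 by (simp add: norm_mult norm_divide)
    moreover have "(\<Sum>\<^sub>\<infinity>k\<in>-F. cmod (fourier g k) / tvol) \<le> d"
      by (rule infsum_le_finite_sums[OF a2], rule less_imp_le, rule H(2)) auto
    ultimately show ?thesis by simp
  qed
  have ex: "\<exists>H. finite H \<and> (\<forall>F p. finite F \<longrightarrow> H \<subseteq> F \<longrightarrow> cmod (S p - (\<Sum>k\<in>F. ?a k p)) \<le> d)" if "d > 0" for d
  proof -
    have "\<exists>H. finite H \<and> (\<forall>F. finite F \<longrightarrow> F \<inter> H = {} \<longrightarrow> (\<Sum>k\<in>F. cmod (fourier g k) / tvol) < d)"
      by (rule abs_le_summable_tail[OF sm' _ \<open>d > 0\<close>]) simp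
    then obtain H where H: "finite H" "\<And>F. finite F \<Longrightarrow> F \<inter> H = {} \<Longrightarrow> (\<Sum>k\<in>F. cmod (fourier g k) / tvol) < d"
      by blast
    have "cmod (S p - (\<Sum>k\<in>F. ?a k p)) \<le> d" if "finite F" "H \<subseteq> F" for F p
    proof (rule tail[OF that(1)])
      fix F' assume "finite F'" "F' \<inter> F = {}"
      then show "(\<Sum>k\<in>F'. cmod (fourier g k) / tvol) < d" using that(2) by (intro H(2)) auto
    qed
    with H show ?thesis by blast
  qed
  have cont: "continuous_on UNIV S"
  proof (rule uniform_limit_theorem)
    show "uniform_limit UNIV (\<lambda>F p. \<Sum>k\<in>F. ?a k p) S (finite_subsets_at_top UNIV)"
      unfolding uniform_limit_iff
    proof (intro allI impI)
      fix d :: real assume "d > 0"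
      then have "d/2 > 0" by simp
      from ex[OF this] obtain H where H: "finite H" "\<forall>F p. finite F \<longrightarrow> H \<subseteq> F \<longrightarrow> cmod (S p - (\<Sum>k\<in>F. ?a k p)) \<le> d/2"
        by blast
      show "\<forall>\<^sub>F F in finite_subsets_at_top UNIV. \<forall>p\<in>UNIV. dist (\<Sum>k\<in>F. ?a k p) (S p) < d"
        unfolding eventually_finite_subsets_at_top
      proof (rule exI[of _ H], intro conjI allI impI ballI)
        show "finite H" by (rule H(1))
        show "H \<subseteq> UNIV" by simp
        fix F p assume F: "finite F \<and> H \<subseteq> F \<and> F \<subseteq> UNIV"
        have "cmod (S p - (\<Sum>k\<in>F. ?a k p)) \<le> d/2"
          using H(2)[rule_format, of F p] F by blast
        then show "dist (\<Sum>k\<in>F. ?a k p) (S p) < d"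
          using \<open>d > 0\<close> by (subst dist_commute) (simp add: dist_norm)
      qed
    qed
  qed (auto intro!: always_eventually continuous_intros)
  let ?h = "\<lambda>p. (cmod (of_real (g p) - S p))\<^sup>2"
  have h: "CP ?h"
    unfolding CP_def
  proof
    show "continuous_on UNIV ?h" by (intro continuous_intros cont) (use g in auto)
    show "periodic2 ?h" using g periodic2_ep unfolding CP_def periodic2_def S_def by simp
  qed
  have "integral cell ?h \<le> d" if "d > 0" for d
  proof -
    \<comment> \<open>Chosen so that the mean square error of the partial sum and its uniform
      distance to \<open>S\<close>, each doubled by \<open>(a+b)^2 \<le> 2a^2 + 2b^2\<close>, add up
      to \<open>d\<close>.\<close>
    define d' where "d' = d / (2 + 2 * tvol)"
    have "2 + 2 * tvol > 0" using tvol_pos by linarith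
    then have d': "d' > 0" "d' * (2 + 2 * tvol) = d"
      using that by (simp_all add: d'_def)
    then have d'3: "2 * d' + 2 * (tvol * d') = d" by (simp add: algebra_simps)
    have "sqrt d' > 0" using d' by simp
    from ex[OF this] obtain H where H: "finite H" "\<forall>F p. finite F \<longrightarrow> H \<subseteq> F \<longrightarrow> cmod (S p - (\<Sum>k\<in>F. ?a k p)) \<le> sqrt d'"
      by blast
    obtain H' where H': "finite H'" "dist (\<Sum>k\<in>H'. (cmod (fourier g k))\<^sup>2) (tvol * integral cell (\<lambda>p. (g p)\<^sup>2)) \<le> tvol * d'"
      using has_sum_finite_approximation[OF parseval[OF g], of "tvol * d'"] d'(1) by auto
    define F where "F = H \<union> H'"
    have F: "finite F" "H \<subseteq> F" using H(1) H'(1) by (auto simp: F_def)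
    let ?P = "\<lambda>p. \<Sum>k\<in>F. ?a k p"
    have "integral cell (\<lambda>p. (cmod (of_real (g p) - ?P p))\<^sup>2) \<le> d'"
    proof -
      have "(\<Sum>k\<in>F. Re (cnj (fourier g k / of_real tvol) * fourier g k)) = (\<Sum>k\<in>F. (cmod (fourier g k))\<^sup>2) / tvol"
        unfolding sum_divide_distrib cmod_power2 by (intro sum.cong) (auto simp: power2_eq_square add_divide_distrib)
      moreover have "(\<Sum>k\<in>F. (cmod (fourier g k / of_real tvol))\<^sup>2) = (\<Sum>k\<in>F. (cmod (fourier g k))\<^sup>2) / tvol\<^sup>2"
        by (simp add: norm_divide power_divide sum_divide_distrib)
      ultimately have "integral cell (\<lambda>p. (cmod (of_real (g p) - ?P p))\<^sup>2)
         = integral cell (\<lambda>p. (g p)\<^sup>2) - (\<Sum>k\<in>F. (cmod (fourier g k))\<^sup>2) / tvol"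
        unfolding integral_sq_diff[OF g F(1)] by (simp add: power2_eq_square)
      moreover have "(\<Sum>k\<in>H'. (cmod (fourier g k))\<^sup>2) \<le> (\<Sum>k\<in>F. (cmod (fourier g k))\<^sup>2)"
        using H'(1) F(1) by (intro sum_mono2) (auto simp: F_def)
      moreover have "tvol * integral cell (\<lambda>p. (g p)\<^sup>2) - (\<Sum>k\<in>H'. (cmod (fourier g k))\<^sup>2) \<le> d' * tvol"
        using H'(2) unfolding dist_real_def by (simp add: mult.commute abs_le_iff)
      ultimately have "tvol * integral cell (\<lambda>p. (g p)\<^sup>2) - (\<Sum>k\<in>F. (cmod (fourier g k))\<^sup>2) \<le> d' * tvol"
        "integral cell (\<lambda>p. (cmod (of_real (g p) - ?P p))\<^sup>2)
         = (tvol * integral cell (\<lambda>p. (g p)\<^sup>2) - (\<Sum>k\<in>F. (cmod (fourier g k))\<^sup>2)) / tvol"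
        by (linarith, simp only: diff_divide_distrib) simp
      then show ?thesis by (simp only: pos_divide_le_eq tvol_pos)
    qed
    have "integral cell ?h \<le> integral cell (\<lambda>p. 2 * (cmod (of_real (g p) - ?P p))\<^sup>2 + 2 * d')"
    proof (rule integral_le)
      fix p assume "p \<in> cell"
      have "cmod (of_real (g p) - S p) \<le> cmod (of_real (g p) - ?P p) + cmod (S p - ?P p)"
        using norm_triangle_ineq4[of "of_real (g p) - ?P p" "S p - ?P p"] by simp
      then have "?h p \<le> (cmod (of_real (g p) - ?P p) + cmod (S p - ?P p))\<^sup>2"
        by (intro power_mono) auto
      also have "\<dots> \<le> 2 * (cmod (of_real (g p) - ?P p))\<^sup>2 + 2 * (cmod (S p - ?P p))\<^sup>2"
        using sum_squares_bound[of "cmod (of_real (g p) - ?P p)" "cmod (S p - ?P p)"] by (simp add: power2_sum)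
      also have "(cmod (S p - ?P p))\<^sup>2 \<le> d'"
      proof -
        have "cmod (S p - ?P p) \<le> sqrt d'" using H(2)[rule_format, OF F] .
        then have "(cmod (S p - ?P p))\<^sup>2 \<le> (sqrt d')\<^sup>2" by (rule power_mono) simp
        then show ?thesis using d'(1) by simp
      qed
      finally show "?h p \<le> 2 * (cmod (of_real (g p) - ?P p))\<^sup>2 + 2 * d'" by simp
    next
      show "?h integrable_on cell" by (rule cell_integrable[OF CP_cont[OF h]])
      show "(\<lambda>p. 2 * (cmod (of_real (g p) - ?P p))\<^sup>2 + 2 * d') integrable_on cell"
        by (intro cell_integrable continuous_intros CP_cont g)
    qed
    also have "\<dots> = 2 * integral cell (\<lambda>p. (cmod (of_real (g p) - ?P p))\<^sup>2) + 2 * (tvol * d')"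
      by (subst integral_add) (intro cell_integrable continuous_intros CP_cont g, intro cell_integrable continuous_intros, simp)
    finally show ?thesis using \<open>integral cell (\<lambda>p. (cmod (of_real (g p) - ?P p))\<^sup>2) \<le> d'\<close> d'3 by linarith
  qed
  then have "integral cell ?h \<le> 0" by (intro field_le_epsilon[of _ 0]) simp
  moreover have "integral cell ?h \<ge> 0" by (intro integral_nonneg cell_integrable CP_cont h) simp
  ultimately have "integral cell ?h = 0" by simp
  then have "?h p = 0" for p by (rule integral_cell_eq_0_imp[OF h, rotated]) simp
  then have gS: "of_real (g p) = S p" for p
  proof -
    have "cmod (of_real (g p) - S p) = 0" using \<open>\<And>p. ?h p = 0\<close>[of p] by (rule zero_eq_power2[THEN iffD1])
    then show ?thesis by simp
  qed
  show ?thesis using ex[OF e] unfolding gS .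
qed

lemma fourier_bound_sup:
  assumes g: "CP g" and s: "(\<lambda>k. cmod (fourier g k)) summable_on UNIV"
    and B: "\<And>F. finite F \<Longrightarrow> (\<Sum>k\<in>F. cmod (fourier g k)) \<le> B"
  shows "\<bar>g p\<bar> \<le> B / tvol"
proof (rule field_le_epsilon)
  fix e :: real assume "e > 0"
  obtain H where H1: "finite H" "\<And>F p. finite F \<Longrightarrow> H \<subseteq> F \<Longrightarrow> cmod (of_real (g p) - (\<Sum>k\<in>F. fourier g k / of_real tvol * ep k p)) \<le> e"
    using fourier_series_approx[OF g s \<open>e > 0\<close>] by blast
  then have H: "finite H" "cmod (of_real (g p) - (\<Sum>k\<in>H. fourier g k / of_real tvol * ep k p)) \<le> e"
    by simp_all
  have "\<bar>g p\<bar> = cmod (of_real (g p))" by simp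
  also have "\<dots> \<le> cmod (of_real (g p) - (\<Sum>k\<in>H. fourier g k / of_real tvol * ep k p)) + cmod (\<Sum>k\<in>H. fourier g k / of_real tvol * ep k p)"
    by (subst add.commute) (rule norm_triangle_sub)
  also have "cmod (\<Sum>k\<in>H. fourier g k / of_real tvol * ep k p) \<le> (\<Sum>k\<in>H. cmod (fourier g k) / tvol)"
    by (rule sum_norm_le) (simp add: norm_mult norm_divide)
  also have "\<dots> \<le> B / tvol" using B[OF H(1)] by (simp add: sum_divide_distrib[symmetric] divide_right_mono)
  finally show "\<bar>g p\<bar> \<le> B / tvol + e" using H(2) by simp
qed

subsection \<open>Decay of Fourier coefficients of products\<close>

text \<open>\<open>kw q\<close> expresses decay like \<open>|k|^(-2q)\<close>. It is summed over the
  lattice only for \<open>q \<ge> 3/2\<close>, a threshold that allows comparison with products of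
  one-dimensional sums and is reached by the first regularity estimate.\<close>

definition kw :: "real \<Rightarrow> int \<times> int \<Rightarrow> real" where
  "kw q k = (1 + ksq k) powr (- q)"

lemma one_plus_ksq_pos [simp]: "1 + ksq k > 0"
  by (simp add: add_pos_nonneg)

lemma kw_pos [simp]: "kw q k > 0"
  using one_plus_ksq_pos[of k] unfolding kw_def powr_gt_zero by linarith

lemma kw_nonneg [simp]: "kw q k \<ge> 0"
  by (rule less_imp_le) simp

lemma kw_mono: "q \<le> q' \<Longrightarrow> kw q' k \<le> kw q k"
  unfolding kw_def by (intro powr_mono) auto

lemma kw_add: "kw (p + q) k = kw p k * kw q k"
  unfolding kw_def by (simp flip: powr_add)

lemma summable_on_int_weight:
  "(\<lambda>m::int. (1 + (real_of_int m)\<^sup>2) powr (- (3/4))) summable_on UNIV"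
proof -
  let ?w = "\<lambda>m::int. (1 + (real_of_int m)\<^sup>2) powr (- (3/4))"
  have le: "(1 + (real (Suc n))\<^sup>2) powr (- (3/4)) \<le> real (Suc n) powr (- (3/2))" for n
  proof -
    have "(1 + (real (Suc n))\<^sup>2) powr (- (3/4)) \<le> ((real (Suc n))\<^sup>2) powr (- (3/4))"
      by (intro powr_mono2') auto
    also have "\<dots> = (real (Suc n) powr 2) powr (- (3/4))" by (simp add: powr_numeral)
    also have "\<dots> = real (Suc n) powr (- (3/2))" by (subst powr_powr) simp
    finally show ?thesis .
  qed
  have "summable (\<lambda>n. real (Suc n) powr (- (3/2)))"
    by (subst summable_Suc_iff) (simp add: summable_real_powr_iff)
  then have s: "summable (\<lambda>n. (1 + (real (Suc n))\<^sup>2) powr (- (3/4)))"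
    by (rule summable_comparison_test'[where N = 0]) (use le in auto)
  then have s0: "summable (\<lambda>n. (1 + (real n)\<^sup>2) powr (- (3/4)))"
    by (subst (asm) summable_Suc_iff)
  have A: "?w summable_on range int"
    by (subst summable_on_reindex) (use s0 in \<open>auto simp: o_def summable_on_UNIV_nonneg_real_iff\<close>)
  have "inj (\<lambda>n. - int (Suc n))" by (auto simp: inj_on_def)
  then have B: "?w summable_on range (\<lambda>n. - int (Suc n))"
  proof (subst summable_on_reindex)
    have "?w \<circ> (\<lambda>n. - int (Suc n)) = (\<lambda>n. (1 + (real (Suc n))\<^sup>2) powr (- (3/4)))"
      by (simp only: o_def of_int_minus of_int_of_nat_eq power2_minus)
    then show "(?w \<circ> (\<lambda>n. - int (Suc n))) summable_on UNIV"
      using s by (simp only: summable_on_UNIV_nonneg_real_iff powr_ge_zero)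
  qed
  have "m \<in> range int \<union> range (\<lambda>n. - int (Suc n))" for m
  proof (cases "m \<ge> 0")
    case True
    then have "m = int (nat m)" by simp
    then show ?thesis by blast
  next
    case False
    then have "m = - int (Suc (nat (- m - 1)))" by simp
    then show ?thesis by blast
  qed
  then have "UNIV = range int \<union> range (\<lambda>n. - int (Suc n))" by blast
  moreover have "range int \<inter> range (\<lambda>n. - int (Suc n)) = {}" by auto
  ultimately show ?thesis using summable_on_Un_disjoint[OF A B] by simp
qed

text \<open>From \<open>(1 + a^2)(1 + b^2) \<le> (1 + a^2 + b^2)^2\<close>, the exponent
  \<open>3/2\<close> on the plane splits into \<open>3/4\<close> in each variable, and
  \<open>n^(-3/2)\<close> is summable.\<close>

lemma kw_summable:
  assumes "q \<ge> 3/2"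
  shows "kw q summable_on UNIV"
proof -
  let ?w = "\<lambda>m::int. (1 + (real_of_int m)\<^sup>2) powr (- (3/4))"
  have hs: "(?w has_sum infsum ?w UNIV) UNIV" using summable_on_int_weight by simp
  have "(\<lambda>k. ?w (fst k) * ?w (snd k)) summable_on (SIGMA x:UNIV. UNIV)"
    by (rule summable_on_SigmaI[where g = "\<lambda>x. ?w x * infsum ?w UNIV"])
       (auto intro!: has_sum_cmult_right[OF hs] summable_on_cmult_left summable_on_int_weight)
  then have 1: "(\<lambda>k. ?w (fst k) * ?w (snd k)) summable_on UNIV" by simp
  show ?thesis
  proof (rule summable_on_comparison_test[OF 1])
    fix k :: "int \<times> int"
    let ?a = "real_of_int (fst k)" and ?b = "real_of_int (snd k)"
    have "kw q k \<le> kw (3/2) k" using assms by (rule kw_mono)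
    also have "\<dots> = ((1 + ksq k) powr 2) powr (- (3/4))" unfolding kw_def by (subst powr_powr) simp
    also have "\<dots> \<le> ((1 + ?a\<^sup>2) * (1 + ?b\<^sup>2)) powr (- (3/4))"
    proof (rule powr_mono2')
      have "(1 + ?a\<^sup>2) * (1 + ?b\<^sup>2) \<le> (1 + ksq k)\<^sup>2"
      proof -
        have "(1 + ksq k)\<^sup>2 - (1 + ?a\<^sup>2) * (1 + ?b\<^sup>2) = ?a\<^sup>2 + ?b\<^sup>2 + (?a\<^sup>2)\<^sup>2 + (?b\<^sup>2)\<^sup>2 + ?a\<^sup>2 * ?b\<^sup>2"
          unfolding ksq_def by (simp add: power2_eq_square algebra_simps)
        moreover have "\<dots> \<ge> 0" by (intro add_nonneg_nonneg mult_nonneg_nonneg zero_le_power2)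
        ultimately show ?thesis by linarith
      qed
      then show "(1 + ?a\<^sup>2) * (1 + ?b\<^sup>2) \<le> (1 + ksq k) powr 2" by (simp add: powr_numeral add_pos_nonneg)
    qed (auto intro!: mult_pos_pos add_pos_nonneg)
    also have "\<dots> = ?w (fst k) * ?w (snd k)" by (simp add: powr_mult)
    finally show "kw q k \<le> ?w (fst k) * ?w (snd k)" .
  qed simp
qed

lemma kw_sum_le:
  assumes "q \<ge> 3/2" "finite F"
  shows "sum (kw q) F \<le> infsum (kw q) UNIV"
  by (rule finite_sum_le_infsum[OF kw_summable[OF assms(1)] assms(2)]) auto

lemma infsum_kw_nonneg: "infsum (kw q) UNIV \<ge> 0"
  by (rule infsum_nonneg) simp

lemma ksq_triangle: "1 + ksq k \<le> 4 * max (1 + ksq j) (1 + ksq (k - j))"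
proof -
  have "ksq k \<le> 2 * ksq j + 2 * ksq (k - j)"
  proof -
    have *: "x\<^sup>2 \<le> 2 * y\<^sup>2 + 2 * (x - y)\<^sup>2" for x y :: real
      using zero_le_power2[of "x - 2 * y"] by (simp add: power2_eq_square algebra_simps)
    show ?thesis unfolding ksq_def
      using *[of "real_of_int (fst k)" "real_of_int (fst j)"] *[of "real_of_int (snd k)" "real_of_int (snd j)"]
      by simp
  qed
  then show ?thesis by (auto simp: max_def)
qed

text \<open>By \<open>ksq_triangle\<close> the larger of \<open>1 + |j|^2\<close> and
  \<open>1 + |k-j|^2\<close> is at least a quarter of \<open>1 + |k|^2\<close>, so its weight is at
  most \<open>4 powr q * kw q k\<close>; the other weight stays summable in \<open>j\<close>. Adding
  both weights on the right removes the case distinction.\<close>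

lemma kw_conv_le:
  assumes "q \<ge> 0"
  shows "kw q j * kw q (k - j) \<le> 4 powr q * kw q k * (kw q j + kw q (k - j))"
proof -
  let ?m = "max (1 + ksq j) (1 + ksq (k - j))"
  have m: "?m > 0" by (simp add: add_pos_nonneg less_max_iff_disj)
  have "(4 * ?m) powr (- q) \<le> (1 + ksq k) powr (- q)"
    using assms ksq_triangle by (intro powr_mono2') (auto simp: add_pos_nonneg)
  then have "4 powr q * (4 * ?m) powr (- q) \<le> 4 powr q * kw q k"
    unfolding kw_def by (intro mult_left_mono) auto
  moreover have "4 powr q * (4 * ?m) powr (- q) = ?m powr (- q)"
    using m by (subst powr_mult) (auto simp: powr_minus field_simps)
  ultimately have *: "?m powr (- q) \<le> 4 powr q * kw q k" by simp
  show ?thesis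
  proof (cases "ksq j \<le> ksq (k - j)")
    case True
    then have "kw q (k - j) \<le> 4 powr q * kw q k" using * by (simp add: kw_def max_def)
    then have "kw q j * kw q (k - j) \<le> kw q j * (4 powr q * kw q k)" by (rule mult_left_mono) simp
    also have "\<dots> \<le> (kw q j + kw q (k - j)) * (4 powr q * kw q k)" by (intro mult_right_mono) auto
    finally show ?thesis by (simp add: mult_ac)
  next
    case False
    then have "kw q j \<le> 4 powr q * kw q k" using * by (simp add: kw_def max_def)
    then have "kw q (k - j) * kw q j \<le> kw q (k - j) * (4 powr q * kw q k)" by (rule mult_left_mono) simp
    also have "\<dots> \<le> (kw q j + kw q (k - j)) * (4 powr q * kw q k)" by (intro mult_right_mono) auto
    finally show ?thesis by (simp add: mult_ac)
  qed
qed

text \<open>Algebra constant for coefficients decaying like \<open>kw q\<close>: the factor 2 counts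
  the two weights of \<open>kw_conv_le\<close>, and \<open>1 / tvol\<close> belongs to the
  convolution of unnormalised coefficients.\<close>

definition convK :: "real \<Rightarrow> real" where
  "convK q = 2 * 4 powr q * infsum (kw q) UNIV / tvol"

lemma fourier_summable_of_decay:
  assumes "q \<ge> 3/2" "\<And>k. cmod (fourier g k) \<le> C * kw q k"
  shows "(\<lambda>k. cmod (fourier g k)) summable_on UNIV"
  by (rule summable_on_comparison_test[OF summable_on_cmult_right[OF kw_summable[OF assms(1)], of C]])
     (use assms(2) in auto)

text \<open>Instead of forming an infinite convolution, \<open>g\<close> is replaced by a finite
  partial sum within \<open>e\<close> uniformly. The finite convolution obeys the bound for every
  partial sum, and the remainder costs \<open>e\<close> times the \<open>L^1\<close> norm of
  \<open>h\<close>.\<close>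

lemma fourier_mult_bound:
  assumes q: "q \<ge> 3/2" and g: "CP g" and h: "CP h"
    and C: "\<And>k. cmod (fourier g k) \<le> C * kw q k" and D: "\<And>k. cmod (fourier h k) \<le> D * kw q k"
  shows "cmod (fourier (\<lambda>p. g p * h p) k) \<le> convK q * (C * D) * kw q k"
proof -
  have C0: "C \<ge> 0" using order_trans[OF norm_ge_zero C[of 0]] kw_pos[of q 0] by (simp add: zero_le_mult_iff not_less)
  have D0: "D \<ge> 0" using order_trans[OF norm_ge_zero D[of 0]] kw_pos[of q 0] by (simp add: zero_le_mult_iff not_less)
  have ch: "continuous_on cell h" and cg: "continuous_on cell g" using g h by auto
  let ?J = "integral cell (\<lambda>p. \<bar>h p\<bar>)"
  have J: "?J \<ge> 0" by (rule integral_nonneg) (auto intro!: cell_integrable continuous_intros ch)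
  have main: "cmod (fourier (\<lambda>p. g p * h p) k) \<le> convK q * (C * D) * kw q k + e * ?J" if "e > 0" for e
  proof -
    obtain H where H: "finite H" "\<And>p. cmod (of_real (g p) - (\<Sum>j\<in>H. fourier g j / of_real tvol * ep j p)) \<le> e"
      using fourier_series_approx[OF g fourier_summable_of_decay[OF q C] \<open>e > 0\<close>] by blast
    let ?P = "\<lambda>p. \<Sum>j\<in>H. fourier g j / of_real tvol * ep j p"
    have cP: "continuous_on cell ?P" by (intro continuous_intros)
    have "fourier (\<lambda>p. g p * h p) k = integral cell (\<lambda>p. (of_real (g p) - ?P p) * (of_real (h p) * ep (- k) p) + ?P p * (of_real (h p) * ep (- k) p))"
      unfolding fourier_eq[OF CP_mult[OF g h]] by (intro arg_cong[of _ _ "integral cell"] ext) (simp add: left_diff_distrib mult.assoc)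
    also have "\<dots> = integral cell (\<lambda>p. (of_real (g p) - ?P p) * (of_real (h p) * ep (- k) p)) + integral cell (\<lambda>p. ?P p * (of_real (h p) * ep (- k) p))"
      by (rule integral_add) (intro cell_integrable continuous_intros cg ch cP)+
    also have "integral cell (\<lambda>p. ?P p * (of_real (h p) * ep (- k) p)) = (\<Sum>j\<in>H. fourier g j / of_real tvol * fourier h (k - j))"
    proof -
      have "integral cell (\<lambda>p. ?P p * (of_real (h p) * ep (- k) p))
          = integral cell (\<lambda>p. \<Sum>j\<in>H. fourier g j / of_real tvol * (of_real (h p) * ep (- (k - j)) p))"
        by (intro arg_cong[of _ _ "integral cell"] ext, unfold sum_distrib_right)
           (intro sum.cong refl, simp add: ep_add[of _ "- k", simplified])
      also have "\<dots> = (\<Sum>j\<in>H. fourier g j / of_real tvol * fourier h (k - j))"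
        unfolding fourier_eq[OF h] by (subst integral_sum[OF H(1)]) (intro cell_integrable continuous_intros ch, simp)
      finally show ?thesis .
    qed
    finally have "cmod (fourier (\<lambda>p. g p * h p) k)
        \<le> cmod (integral cell (\<lambda>p. (of_real (g p) - ?P p) * (of_real (h p) * ep (- k) p))) + cmod (\<Sum>j\<in>H. fourier g j / of_real tvol * fourier h (k - j))"
      using norm_triangle_ineq by simp
    also have "cmod (integral cell (\<lambda>p. (of_real (g p) - ?P p) * (of_real (h p) * ep (- k) p))) \<le> integral cell (\<lambda>p. e * \<bar>h p\<bar>)"
    proof (rule integral_norm_bound_integral)
      fix p
      show "cmod ((of_real (g p) - ?P p) * (of_real (h p) * ep (- k) p)) \<le> e * \<bar>h p\<bar>"
        using mult_right_mono[OF H(2)[of p], of "\<bar>h p\<bar>"] by (simp add: norm_mult)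
    qed (intro cell_integrable continuous_intros cg ch cP)+
    also have "cmod (\<Sum>j\<in>H. fourier g j / of_real tvol * fourier h (k - j))
        \<le> (\<Sum>j\<in>H. C * D / tvol * (4 powr q * kw q k * (kw q j + kw q (k - j))))"
    proof (rule sum_norm_le)
      fix j
      have "cmod (fourier g j / of_real tvol * fourier h (k - j)) \<le> (C * kw q j) * (D * kw q (k - j)) / tvol"
        using mult_mono[OF C[of j] D[of "k - j"]] C0 by (simp add: norm_mult norm_divide divide_right_mono)
      also have "\<dots> = C * D / tvol * (kw q j * kw q (k - j))" by simp
      also have "\<dots> \<le> C * D / tvol * (4 powr q * kw q k * (kw q j + kw q (k - j)))"
        using q C0 D0 by (intro mult_left_mono kw_conv_le) auto
      finally show "cmod (fourier g j / of_real tvol * fourier h (k - j)) \<le> C * D / tvol * (4 powr q * kw q k * (kw q j + kw q (k - j)))" .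
    qed
    also have "\<dots> = C * D / tvol * (4 powr q * kw q k * (sum (kw q) H + (\<Sum>j\<in>H. kw q (k - j))))"
      by (simp only: sum_distrib_left[symmetric] sum.distrib)
    also have "\<dots> \<le> C * D / tvol * (4 powr q * kw q k * (infsum (kw q) UNIV + infsum (kw q) UNIV))"
    proof -
      have "(\<Sum>j\<in>H. kw q (k - j)) = sum (kw q) ((\<lambda>j. k - j) ` H)"
        by (subst sum.reindex) (auto simp: inj_on_def)
      then have "(\<Sum>j\<in>H. kw q (k - j)) \<le> infsum (kw q) UNIV" using kw_sum_le[OF q] H(1) by simp
      then show ?thesis using kw_sum_le[OF q H(1)] C0 D0
        by (intro mult_left_mono add_mono) (auto intro!: mult_nonneg_nonneg)
    qed
    also have "\<dots> = convK q * (C * D) * kw q k" by (simp add: convK_def)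
    finally show ?thesis by simp
  qed
  show ?thesis
  proof (rule field_le_epsilon)
    fix d :: real assume "d > 0"
    have "d / (?J + 1) * ?J \<le> d" using J \<open>d > 0\<close> by (simp add: field_simps)
    then show "cmod (fourier (\<lambda>p. g p * h p) k) \<le> convK q * (C * D) * kw q k + d"
      using main[of "d / (?J + 1)"] \<open>d > 0\<close> J by simp
  qed
qed

lemma fourier_fCH_bound:
  assumes q: "q \<ge> 3/2" and g: "CP g" and C: "\<And>k. cmod (fourier g k) \<le> C * kw q k"
  shows "cmod (fourier (\<lambda>p. fCH (g p)) k) \<le> ((convK q)\<^sup>2 * C ^ 3 + C) * kw q k"
proof -
  have 2: "cmod (fourier (\<lambda>p. g p * g p) k) \<le> convK q * (C * C) * kw q k" for k
    by (rule fourier_mult_bound[OF q g g C C])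
  have "cmod (fourier (\<lambda>p. g p * (g p * g p)) k) \<le> convK q * (C * (convK q * (C * C))) * kw q k"
    by (rule fourier_mult_bound[OF q g CP_mult[OF g g] C 2])
  moreover have "fourier (\<lambda>p. fCH (g p)) k = fourier (\<lambda>p. g p * (g p * g p)) k - fourier g k"
    by (subst fourier_diff[symmetric]) (intro CP_mult g, rule g, simp add: fCH_def power3_eq_cube mult.assoc)
  ultimately have "cmod (fourier (\<lambda>p. fCH (g p)) k) \<le> convK q * (C * (convK q * (C * C))) * kw q k + C * kw q k"
    using norm_triangle_ineq4[of "fourier (\<lambda>p. g p * (g p * g p)) k" "fourier g k"] C[of k]
    by simp
  then show ?thesis by (simp add: algebra_simps power2_eq_square power3_eq_cube)
qed

subsection \<open>Trigonometric polynomials\<close>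

text \<open>Taking the real part gives a real function for arbitrary coefficients, so no symmetry
  has to be carried along. With the factor \<open>1 / tvol\<close>, \<open>tp F (fourier g)\<close>
  is the Fourier partial sum of \<open>g\<close> whenever \<open>F\<close> is symmetric.\<close>

definition tp :: "(int \<times> int) set \<Rightarrow> (int \<times> int \<Rightarrow> complex) \<Rightarrow> real \<times> real \<Rightarrow> real" where
  "tp F c p = Re (\<Sum>k\<in>F. c k * ep k p) / tvol"

lemma CP_tp [simp]: "CP (tp F c)"
  unfolding CP_def tp_def[abs_def] periodic2_def by (auto intro!: continuous_intros simp: periodic2_ep)

lemma norm_tp_le: "\<bar>tp F c p\<bar> \<le> (\<Sum>k\<in>F. cmod (c k)) / tvol"
proof -
  have "\<bar>Re (\<Sum>k\<in>F. c k * ep k p)\<bar> \<le> cmod (\<Sum>k\<in>F. c k * ep k p)" by (rule abs_Re_le_cmod)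
  also have "\<dots> \<le> (\<Sum>k\<in>F. cmod (c k))" by (rule sum_norm_le) (simp add: norm_mult)
  finally show ?thesis by (simp add: tp_def divide_right_mono)
qed

text \<open>Taking the real part averages the coefficient at \<open>j\<close> with the conjugate of
  the one at \<open>-j\<close>; for coefficients of a real function this changes nothing.\<close>

lemma fourier_tp:
  assumes F: "finite F" "uminus ` F = F"
  shows "fourier (tp F c) j = (if j \<in> F then (c j + cnj (c (- j))) / 2 else 0)"
proof -
  have mem: "- k \<in> F" if "k \<in> F" for k using F(2) that by blast
  have "of_real (tp F c p) = (\<Sum>k\<in>F. (c k + cnj (c (- k))) / (2 * of_real tvol) * ep k p)" for p
  proof -
    have "(\<Sum>k\<in>F. cnj (c (- k)) * ep k p) = (\<Sum>k\<in>uminus ` F. cnj (c (- k)) * ep k p)" using F(2) by simp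
    also have "\<dots> = (\<Sum>k\<in>F. cnj (c k) * ep (- k) p)" by (subst sum.reindex) (auto simp: inj_on_def)
    also have "\<dots> = cnj (\<Sum>k\<in>F. c k * ep k p)" by (simp add: cnj_ep)
    finally have "(\<Sum>k\<in>F. c k * ep k p) + cnj (\<Sum>k\<in>F. c k * ep k p) = (\<Sum>k\<in>F. (c k + cnj (c (- k))) * ep k p)"
      by (simp add: sum.distrib distrib_right)
    then have "2 * of_real (Re (\<Sum>k\<in>F. c k * ep k p)) = (\<Sum>k\<in>F. (c k + cnj (c (- k))) * ep k p)"
      by (simp only: complex_add_cnj) simp
    then have "of_real (Re (\<Sum>k\<in>F. c k * ep k p)) = (\<Sum>k\<in>F. (c k + cnj (c (- k))) * ep k p) / 2"
      by (rule eq_divide_imp[rotated, OF trans[OF mult.commute]]) simp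
    then have "of_real (tp F c p) = (\<Sum>k\<in>F. (c k + cnj (c (- k))) * ep k p) / 2 / of_real tvol"
      by (simp only: tp_def of_real_divide)
    then show ?thesis by (simp add: sum_divide_distrib)
  qed
  then have "fourier (tp F c) j = integral cell (\<lambda>p. \<Sum>k\<in>F. (c k + cnj (c (- k))) / (2 * of_real tvol) * ep (k - j) p)"
    unfolding fourier_eq[OF CP_tp] by (simp add: sum_distrib_right ep_add[of _ "- j", simplified] mult.assoc)
  also have "\<dots> = (\<Sum>k\<in>F. (c k + cnj (c (- k))) / (2 * of_real tvol) * integral cell (ep (k - j)))"
    by (subst integral_sum[OF F(1)]) (intro cell_integrable continuous_intros, simp)
  also have "\<dots> = (\<Sum>k\<in>F. if k = j then (c j + cnj (c (- j))) / 2 else 0)"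
    by (intro sum.cong) (auto simp: integral_ep)
  finally show ?thesis using F(1) by simp
qed

lemma fourier_inj:
  assumes "CP g" "CP h" "\<And>k. fourier g k = fourier h k"
  shows "g = h"
proof
  fix p
  let ?d = "\<lambda>p. (g p - h p)\<^sup>2"
  have cd: "CP (\<lambda>p. g p - h p)" by (rule CP_diff[OF assms(1,2)])
  have "((\<lambda>k :: int \<times> int. 0) has_sum (tvol * integral cell ?d)) UNIV"
    using parseval[OF cd] unfolding fourier_diff[OF assms(1,2)] assms(3) by simp
  then have "tvol * integral cell ?d = 0" by (rule has_sum_unique[OF _ has_sum_0]) simp
  then have z: "integral cell ?d = 0" by simp
  have "?d p = 0" by (rule integral_cell_eq_0_imp[OF CP_power[OF cd] _ z]) simp
  then show "g p = h p" by simp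
qed

definition DN :: "nat \<Rightarrow> (int \<times> int) set" where
  "DN N = {k. ksq k \<le> (real N)\<^sup>2}"

lemma finite_DN [simp]: "finite (DN N)"
proof (rule finite_subset)
  show "DN N \<subseteq> {- int N..int N} \<times> {- int N..int N}"
  proof
    fix k assume "k \<in> DN N"
    then have "(real_of_int (fst k))\<^sup>2 + (real_of_int (snd k))\<^sup>2 \<le> (real N)\<^sup>2"
      by (simp add: DN_def ksq_def)
    then have "(real_of_int (fst k))\<^sup>2 \<le> (real N)\<^sup>2" "(real_of_int (snd k))\<^sup>2 \<le> (real N)\<^sup>2"
      using zero_le_power2[of "real_of_int (fst k)"] zero_le_power2[of "real_of_int (snd k)"] by linarith+
    then have "\<bar>real_of_int (fst k)\<bar> \<le> real N" "\<bar>real_of_int (snd k)\<bar> \<le> real N"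
      using abs_le_square_iff[of "real_of_int (fst k)" "real N"] abs_le_square_iff[of "real_of_int (snd k)" "real N"] by simp_all
    then have "\<bar>fst k\<bar> \<le> int N" "\<bar>snd k\<bar> \<le> int N" by linarith+
    then show "k \<in> {- int N..int N} \<times> {- int N..int N}" by (cases k) auto
  qed
qed simp

lemma uminus_DN [simp]: "uminus ` DN N = DN N"
proof -
  have "- k \<in> DN N" if "k \<in> DN N" for k using that by (simp add: DN_def)
  then have "k \<in> uminus ` DN N" if "k \<in> DN N" for k
    using that by (intro image_eqI[of _ _ "- k"]) simp_all
  with \<open>\<And>k. k \<in> DN N \<Longrightarrow> - k \<in> DN N\<close> show ?thesis by blast
qed

text \<open>The real pair \<open>a\<close>, \<open>b\<close> corresponds to the complex coefficient
  \<open>a - i b\<close>. Both \<open>k\<close> and \<open>-k\<close> occur in the sums, so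
  representations are not unique; equality in \<open>XN N\<close> is therefore always decided by
  Fourier coefficients.\<close>

lemma XN_iff: "g \<in> XN N \<longleftrightarrow> (\<exists>c. g = tp (DN N) c)"
proof
  assume "g \<in> XN N"
  then obtain a b where g: "g = (\<lambda>p. \<Sum>k\<in>DN N. a k * cos (kdot k p) + b k * sin (kdot k p))"
    unfolding XN_def DN_def by blast
  have "g = tp (DN N) (\<lambda>k. of_real tvol * Complex (a k) (- b k))"
    unfolding g tp_def[abs_def] by (simp add: fun_eq_iff ep_def sum_divide_distrib) (simp add: algebra_simps add_divide_distrib)
  then show "\<exists>c. g = tp (DN N) c" by blast
next
  assume "\<exists>c. g = tp (DN N) c"
  then obtain c where g: "g = tp (DN N) c" by blast
  have "g = (\<lambda>p. \<Sum>k\<in>DN N. (Re (c k) / tvol) * cos (kdot k p) + (- Im (c k) / tvol) * sin (kdot k p))"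
    unfolding g tp_def[abs_def] by (simp add: fun_eq_iff ep_def sum_divide_distrib diff_divide_distrib)
  then show "g \<in> XN N" unfolding XN_def DN_def[symmetric] mem_Collect_eq
    by (intro exI[of _ "\<lambda>k. Re (c k) / tvol"] exI[of _ "\<lambda>k. - Im (c k) / tvol"])
qed

lemma tp_in_XN [simp]: "tp (DN N) c \<in> XN N"
  using XN_iff by blast

lemma CP_XN: "g \<in> XN N \<Longrightarrow> CP g"
  unfolding XN_iff by auto

lemma fourier_XN_outside: "g \<in> XN N \<Longrightarrow> k \<notin> DN N \<Longrightarrow> fourier g k = 0"
  unfolding XN_iff by (auto simp: fourier_tp)

lemma fourier_tp_DN:
  assumes "CP g"
  shows "fourier (tp (DN N) (fourier g)) k = (if k \<in> DN N then fourier g k else 0)"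
  by (simp add: fourier_tp fourier_uminus[OF assms])

lemma XN_repr: "g \<in> XN N \<Longrightarrow> g = tp (DN N) (fourier g)"
proof (rule fourier_inj)
  fix k assume g: "g \<in> XN N"
  show "fourier g k = fourier (tp (DN N) (fourier g)) k"
    by (simp add: fourier_tp_DN[OF CP_XN[OF g]] fourier_XN_outside[OF g])
qed (simp_all add: CP_XN)

lemma XN_eqI:
  "g \<in> XN N \<Longrightarrow> h \<in> XN N \<Longrightarrow> (\<And>k. k \<in> DN N \<Longrightarrow> fourier g k = fourier h k) \<Longrightarrow> g = h"
proof (rule fourier_inj)
  fix k assume *: "g \<in> XN N" "h \<in> XN N" "\<And>k. k \<in> DN N \<Longrightarrow> fourier g k = fourier h k"
  show "fourier g k = fourier h k"
    by (cases "k \<in> DN N") (simp_all add: * fourier_XN_outside[OF *(1)] fourier_XN_outside[OF *(2)])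
qed (simp_all add: CP_XN)

lemma XN_diff: 
  assumes "g \<in> XN N" "h \<in> XN N" shows "(\<lambda>p. g p - h p) \<in> XN N"
proof -
  obtain c d where "g = tp (DN N) c" "h = tp (DN N) d" using assms XN_iff by blast
  then have "(\<lambda>p. g p - h p) = tp (DN N) (\<lambda>k. c k - d k)"
    by (simp add: fun_eq_iff tp_def left_diff_distrib sum_subtractf diff_divide_distrib)
  then show ?thesis by simp
qed

lemma parseval_XN:
  assumes h: "h \<in> XN N" and g: "CP g"
  shows "(\<Sum>k\<in>DN N. Re (fourier g k * cnj (fourier h k))) = tvol * integral cell (\<lambda>p. g p * h p)"
proof -
  have "((\<lambda>k. Re (fourier g k * cnj (fourier h k))) has_sum (\<Sum>k\<in>DN N. Re (fourier g k * cnj (fourier h k)))) UNIV"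
    by (rule has_sum_finite_neutralI[of "DN N"]) (auto simp: fourier_XN_outside[OF h])
  then show ?thesis by (rule has_sum_unique[OF _ parseval_inner[OF g CP_XN[OF h]]])
qed

lemma parseval_XN_sq:
  assumes h: "h \<in> XN N"
  shows "(\<Sum>k\<in>DN N. (cmod (fourier h k))\<^sup>2) = tvol * integral cell (\<lambda>p. (h p)\<^sup>2)"
proof -
  have "Re (z * cnj z) = (cmod z)\<^sup>2" for z by (metis complex_norm_square Re_complex_of_real)
  then show ?thesis using parseval_XN[OF h CP_XN[OF h]] by (simp only: power2_eq_square)
qed

text \<open>Truncation leaves a residual without low modes, which is orthogonal to
  \<open>XN N\<close>. Conversely, a candidate is tested against the truncation of its own residual,
  which turns orthogonality into the vanishing of a sum of squares.\<close>

lemma PiN_eq: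
  assumes g: "CP g"
  shows "PiN N g = tp (DN N) (fourier g)"
proof -
  have inner: "L2inner (\<lambda>p. g p - h p) v = integral cell (\<lambda>p. (g p - h p) * v p)" if "h \<in> XN N" "v \<in> XN N" for h v
    unfolding L2inner_def using that g by (intro LINT_cell continuous_intros CP_cont) (auto intro: CP_XN)
  show ?thesis
    unfolding PiN_def
  proof (rule the_equality)
    have "L2inner (\<lambda>p. g p - tp (DN N) (fourier g) p) v = 0" if v: "v \<in> XN N" for v
    proof -
      have "tvol * L2inner (\<lambda>p. g p - tp (DN N) (fourier g) p) v
          = (\<Sum>k\<in>DN N. Re (fourier (\<lambda>p. g p - tp (DN N) (fourier g) p) k * cnj (fourier v k)))"
        unfolding inner[OF tp_in_XN v] by (subst parseval_XN[OF v CP_diff[OF g CP_tp]]) simp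
      also have "\<dots> = 0" by (intro sum.neutral ballI) (simp add: fourier_diff g fourier_tp_DN)
      finally show ?thesis by simp
    qed
    then show "tp (DN N) (fourier g) \<in> XN N \<and> (\<forall>v\<in>XN N. L2inner (\<lambda>p. g p - tp (DN N) (fourier g) p) v = 0)" by simp
  next
    fix h assume h: "h \<in> XN N \<and> (\<forall>v\<in>XN N. L2inner (\<lambda>p. g p - h p) v = 0)"
    show "h = tp (DN N) (fourier g)"
    proof (rule XN_eqI)
      fix k assume k: "k \<in> DN N"
      define v where "v = tp (DN N) (fourier (\<lambda>p. g p - h p))"
      have cd: "CP (\<lambda>p. g p - h p)" using h by (intro CP_diff[OF g] CP_XN[of h N]) simp
      have fv: "fourier v j = (if j \<in> DN N then fourier (\<lambda>p. g p - h p) j else 0)" for j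
        unfolding v_def by (rule fourier_tp_DN[OF cd])
      have v: "v \<in> XN N" by (simp add: v_def)
      have "(\<Sum>j\<in>DN N. (cmod (fourier (\<lambda>p. g p - h p) j))\<^sup>2) = (\<Sum>j\<in>DN N. Re (fourier (\<lambda>p. g p - h p) j * cnj (fourier v j)))"
        unfolding cmod_power2 by (intro sum.cong refl) (simp add: fv power2_eq_square)
      also have "\<dots> = 0" unfolding parseval_XN[OF v cd] using h v inner[of h v] by simp
      finally have "(cmod (fourier (\<lambda>p. g p - h p) k))\<^sup>2 = 0"
        using k by (subst (asm) sum_nonneg_eq_0_iff) auto
      then show "fourier h k = fourier (tp (DN N) (fourier g)) k"
        using k fourier_diff[OF g CP_XN[of h N], of k] h by (simp add: fourier_tp_DN g)
    qed (use h in auto)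
  qed
qed

subsection \<open>Partial derivatives and the Ladyzhenskaya inequality\<close>

lemma has_dx:
  assumes "g differentiable (at p)"
  shows "((\<lambda>r. g (r, snd p)) has_real_derivative dx g p) (at (fst p))"
proof -
  have "(\<lambda>r. g (r, snd p)) differentiable (at (fst p))"
    using assms by (intro differentiable_compose[of g "\<lambda>r. (r, snd p)"]) (auto intro!: derivative_intros)
  then obtain D where D: "((\<lambda>r. g (r, snd p)) has_real_derivative D) (at (fst p))"
    unfolding real_differentiable_def by blast
  then show ?thesis unfolding dx_def using DERIV_imp_deriv[OF D] by simp
qed

lemma has_dy:
  assumes "g differentiable (at p)"
  shows "((\<lambda>r. g (fst p, r)) has_real_derivative dy g p) (at (snd p))"
proof -
  have "(\<lambda>r. g (fst p, r)) differentiable (at (snd p))"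
    using assms by (intro differentiable_compose[of g "\<lambda>r. (fst p, r)"]) (auto intro!: derivative_intros)
  then obtain D where D: "((\<lambda>r. g (fst p, r)) has_real_derivative D) (at (snd p))"
    unfolding real_differentiable_def by blast
  then show ?thesis unfolding dy_def using DERIV_imp_deriv[OF D] by simp
qed

lemma dx_eqI: "((\<lambda>r. g (r, snd p)) has_real_derivative D) (at (fst p)) \<Longrightarrow> dx g p = D"
  unfolding dx_def by (rule DERIV_imp_deriv)

lemma dy_eqI: "((\<lambda>r. g (fst p, r)) has_real_derivative D) (at (snd p)) \<Longrightarrow> dy g p = D"
  unfolding dy_def by (rule DERIV_imp_deriv)

lemma periodic2_dx: assumes "periodic2 g" shows "periodic2 (dx g)"
proof -
  have "deriv (\<lambda>r. g (r, y)) (x + 2 * pi) = deriv (\<lambda>r. g (r, y)) x" for x y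
  proof -
    have "(\<lambda>r. g (r + 2 * pi, y)) = (\<lambda>r. g (r, y))" using assms by (simp add: periodic2_def)
    then show ?thesis unfolding deriv_def DERIV_shift[of "\<lambda>r. g (r, y)" _ x "2 * pi"] by simp
  qed
  moreover have "(\<lambda>r. g (r, y + 2 * pi)) = (\<lambda>r. g (r, y))" for y using assms by (simp add: periodic2_def)
  ultimately show ?thesis unfolding periodic2_def dx_def by simp
qed

lemma periodic2_dy: assumes "periodic2 g" shows "periodic2 (dy g)"
proof -
  have "deriv (\<lambda>r. g (x, r)) (y + 2 * pi) = deriv (\<lambda>r. g (x, r)) y" for x y
  proof -
    have "(\<lambda>r. g (x, r + 2 * pi)) = (\<lambda>r. g (x, r))" using assms by (simp add: periodic2_def)
    then show ?thesis unfolding deriv_def DERIV_shift[of "\<lambda>r. g (x, r)" _ y "2 * pi"] by simp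
  qed
  moreover have "(\<lambda>r. g (x + 2 * pi, r)) = (\<lambda>r. g (x, r))" for x using assms by (simp add: periodic2_def)
  ultimately show ?thesis unfolding periodic2_def dy_def by simp
qed

lemma Ck_Suc_imp: "Ck (Suc n) g \<Longrightarrow> Ck n g"
proof (induction n arbitrary: g)
  case 0
  then show ?case
    by (auto intro!: continuous_at_imp_continuous_on differentiable_imp_continuous_within)
next
  case (Suc n)
  then show ?case by (metis Ck.simps(2))
qed

lemma Ck_le: "m \<le> n \<Longrightarrow> Ck n g \<Longrightarrow> Ck m g"
  by (induction n rule: nat_induct) (auto simp: le_Suc_eq simp del: Ck.simps dest: Ck_Suc_imp)

lemma Ck_differentiable: "Ck (Suc n) g \<Longrightarrow> g differentiable (at p)"
  by (simp only: Ck.simps)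

lemma dx_add: "g differentiable (at p) \<Longrightarrow> h differentiable (at p) \<Longrightarrow> dx (\<lambda>p. g p + h p) p = dx g p + dx h p"
  by (rule dx_eqI) (intro DERIV_add has_dx)

lemma dy_add: "g differentiable (at p) \<Longrightarrow> h differentiable (at p) \<Longrightarrow> dy (\<lambda>p. g p + h p) p = dy g p + dy h p"
  by (rule dy_eqI) (intro DERIV_add has_dy)

lemma dx_mult: "g differentiable (at p) \<Longrightarrow> h differentiable (at p) \<Longrightarrow> dx (\<lambda>p. g p * h p) p = dx g p * h p + g p * dx h p"
  by (rule dx_eqI, rule DERIV_cong, rule DERIV_mult[OF has_dx has_dx]) (auto simp: algebra_simps)

lemma dy_mult: "g differentiable (at p) \<Longrightarrow> h differentiable (at p) \<Longrightarrow> dy (\<lambda>p. g p * h p) p = dy g p * h p + g p * dy h p"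
  by (rule dy_eqI, rule DERIV_cong, rule DERIV_mult[OF has_dy has_dy]) (auto simp: algebra_simps)

lemma Ck_add: "Ck n g \<Longrightarrow> Ck n h \<Longrightarrow> Ck n (\<lambda>p. g p + h p)"
proof (induction n arbitrary: g h)
  case 0
  then show ?case by (auto intro!: continuous_intros)
next
  case (Suc n)
  have d: "g differentiable (at p)" "h differentiable (at p)" for p using Suc.prems by (simp_all only: Ck.simps)
  have "dx (\<lambda>p. g p + h p) = (\<lambda>p. dx g p + dx h p)" "dy (\<lambda>p. g p + h p) = (\<lambda>p. dy g p + dy h p)"
    using d by (auto simp: fun_eq_iff dx_add dy_add)
  moreover have "Ck n (\<lambda>p. dx g p + dx h p)" "Ck n (\<lambda>p. dy g p + dy h p)" using Suc by auto
  moreover have "(\<lambda>p. g p + h p) differentiable (at p)" for p using d by (intro differentiable_add)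
  ultimately show ?case by simp
qed

lemma Ck_mult: "Ck n g \<Longrightarrow> Ck n h \<Longrightarrow> Ck n (\<lambda>p. g p * h p)"
proof (induction n arbitrary: g h)
  case 0
  then show ?case by (auto intro!: continuous_intros)
next
  case (Suc n)
  have d: "g differentiable (at p)" "h differentiable (at p)" for p using Suc.prems by (simp_all only: Ck.simps)
  have n: "Ck n g" "Ck n h" using Suc.prems Ck_Suc_imp by blast+
  have "dx (\<lambda>p. g p * h p) = (\<lambda>p. dx g p * h p + g p * dx h p)" "dy (\<lambda>p. g p * h p) = (\<lambda>p. dy g p * h p + g p * dy h p)"
    using d by (auto simp: fun_eq_iff dx_mult dy_mult)
  moreover have "Ck n (\<lambda>p. dx g p * h p + g p * dx h p)" "Ck n (\<lambda>p. dy g p * h p + g p * dy h p)"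
    using Suc.prems n by (auto intro!: Ck_add Suc.IH)
  moreover have "(\<lambda>p. g p * h p) differentiable (at p)" for p using d by (intro differentiable_mult)
  ultimately show ?case by simp
qed

lemma dx_const: "dx (\<lambda>p. c) = (\<lambda>p. 0)" and dy_const: "dy (\<lambda>p. c) = (\<lambda>p. 0)"
  by (auto simp: dx_def dy_def)

lemma Ck_const: "Ck n (\<lambda>p. c)"
  by (induction n arbitrary: c) (auto simp: dx_const dy_const)

lemma Ck_cmult: "Ck n g \<Longrightarrow> Ck n (\<lambda>p. c * g p)"
  by (intro Ck_mult Ck_const)

lemma Ck_fCH: "Ck n g \<Longrightarrow> Ck n (\<lambda>p. fCH (g p))"
proof -
  assume g: "Ck n g"
  have "(\<lambda>p. fCH (g p)) = (\<lambda>p. g p * (g p * g p) + (-1) * g p)"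
    by (simp add: fun_eq_iff fCH_def power3_eq_cube)
  then show ?thesis using g by (simp only:) (intro Ck_add Ck_mult Ck_const)
qed

lemma Ck_lap: "Ck (Suc (Suc n)) g \<Longrightarrow> Ck n (lap g)"
  unfolding lap_def by (intro Ck_add) (auto simp del: Ck.simps(1))

lemma CP_Ck: "periodic2 g \<Longrightarrow> Ck n g \<Longrightarrow> CP g"
  unfolding CP_def using Ck_le[of 0 n g] by simp

lemma CP_dx: "periodic2 g \<Longrightarrow> Ck 1 g \<Longrightarrow> CP (dx g)" and CP_dy: "periodic2 g \<Longrightarrow> Ck 1 g \<Longrightarrow> CP (dy g)"
  unfolding CP_def using periodic2_dx periodic2_dy by auto

lemma ep_deriv_x: "((\<lambda>r. ep k (r, y)) has_vector_derivative (\<i> * of_int (fst k) * ep k (x, y))) (at x within S)"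
proof -
  have "((\<lambda>z. exp (\<i> * (of_int (fst k) * z + of_int (snd k) * of_real y))) has_field_derivative
      (\<i> * of_int (fst k) * exp (\<i> * (of_int (fst k) * of_real x + of_int (snd k) * of_real y)))) (at (of_real x))"
    by (auto intro!: derivative_eq_intros)
  from has_vector_derivative_real_field[OF this] show ?thesis
    by (simp add: ep_def kdot_def cis_conv_exp has_vector_derivative_at_within)
qed

lemma ep_deriv_y: "((\<lambda>r. ep k (x, r)) has_vector_derivative (\<i> * of_int (snd k) * ep k (x, y))) (at y within S)"
proof -
  have "((\<lambda>z. exp (\<i> * (of_int (fst k) * of_real x + of_int (snd k) * z))) has_field_derivative
      (\<i> * of_int (snd k) * exp (\<i> * (of_int (fst k) * of_real x + of_int (snd k) * of_real y)))) (at (of_real y))"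
    by (auto intro!: derivative_eq_intros)
  from has_vector_derivative_real_field[OF this] show ?thesis
    by (simp add: ep_def kdot_def cis_conv_exp has_vector_derivative_at_within)
qed

text \<open>Integration by parts, in the form of the fundamental theorem for \<open>g\<close> times
  a character; the end values cancel by periodicity. Fubini is used with \<open>x\<close> innermost
  here and with \<open>y\<close> innermost in \<open>fourier_dy\<close>.\<close>

lemma fourier_dx:
  assumes per: "periodic2 g" and C1: "Ck 1 g"
  shows "fourier (dx g) k = \<i> * of_int (fst k) * fourier g k"
proof -
  have g: "CP g" by (rule CP_Ck[OF per C1])
  have gx: "CP (dx g)" by (rule CP_dx[OF per C1])
  let ?H = "\<lambda>p. of_real (dx g p) * ep (- k) p - \<i> * of_int (fst k) * (of_real (g p) * ep (- k) p)"
  have cH: "continuous_on cell ?H" by (intro continuous_intros CP_cont g gx)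
  have "integral {0..2*pi} (\<lambda>x. ?H (x, y)) = 0" for y
  proof -
    let ?F = "\<lambda>x. of_real (g (x, y)) * ep (- k) (x, y)"
    have "(?F has_vector_derivative ?H (x, y)) (at x within {0..2*pi})" for x
    proof -
      have "((\<lambda>r. g (r, y)) has_real_derivative dx g (x, y)) (at x)"
        using has_dx[of g "(x, y)"] C1 by simp
      then have "((\<lambda>r. g (r, y)) has_real_derivative dx g (x, y)) (at x within {0..2*pi})"
        by (rule has_field_derivative_at_within)
      then have "((\<lambda>r. of_real (g (r, y)) :: complex) has_vector_derivative of_real (dx g (x, y))) (at x within {0..2*pi})"
        by (intro has_vector_derivative_of_real) (simp add: has_real_derivative_iff_has_vector_derivative)
      from has_vector_derivative_mult[OF this ep_deriv_x[of "- k" y x]] show ?thesis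
        by (simp add: algebra_simps)
    qed
    then have "((\<lambda>x. ?H (x, y)) has_integral (?F (2*pi) - ?F 0)) {0..2*pi}"
      by (intro fundamental_theorem_of_calculus) auto
    moreover have "?F (2*pi) = ?F 0"
      using per periodic2_ep(1)[of "- k" 0 y] unfolding periodic2_def by (metis add_0)
    ultimately show ?thesis by (simp add: integral_unique)
  qed
  then have "integral cell ?H = 0" unfolding integral_cell_fubini'[OF cH] by simp
  moreover have "integral cell ?H = fourier (dx g) k - \<i> * of_int (fst k) * fourier g k"
    unfolding fourier_eq[OF g] fourier_eq[OF gx]
    by (subst integral_diff) (intro cell_integrable continuous_intros CP_cont g gx, intro cell_integrable continuous_intros CP_cont g gx, simp)
  ultimately show ?thesis by simp
qed

lemma fourier_dy:
  assumes per: "periodic2 g" and C1: "Ck 1 g"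
  shows "fourier (dy g) k = \<i> * of_int (snd k) * fourier g k"
proof -
  have g: "CP g" by (rule CP_Ck[OF per C1])
  have gx: "CP (dy g)" by (rule CP_dy[OF per C1])
  let ?H = "\<lambda>p. of_real (dy g p) * ep (- k) p - \<i> * of_int (snd k) * (of_real (g p) * ep (- k) p)"
  have cH: "continuous_on cell ?H" by (intro continuous_intros CP_cont g gx)
  have "integral {0..2*pi} (\<lambda>y. ?H (x, y)) = 0" for x
  proof -
    let ?F = "\<lambda>y. of_real (g (x, y)) * ep (- k) (x, y)"
    have "(?F has_vector_derivative ?H (x, y)) (at y within {0..2*pi})" for y
    proof -
      have "((\<lambda>r. g (x, r)) has_real_derivative dy g (x, y)) (at y)"
        using has_dy[of g "(x, y)"] C1 by simp
      then have "((\<lambda>r. g (x, r)) has_real_derivative dy g (x, y)) (at y within {0..2*pi})"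
        by (rule has_field_derivative_at_within)
      then have "((\<lambda>r. of_real (g (x, r)) :: complex) has_vector_derivative of_real (dy g (x, y))) (at y within {0..2*pi})"
        by (intro has_vector_derivative_of_real) (simp add: has_real_derivative_iff_has_vector_derivative)
      from has_vector_derivative_mult[OF this ep_deriv_y[of "- k" x y]] show ?thesis
        by (simp add: algebra_simps)
    qed
    then have "((\<lambda>y. ?H (x, y)) has_integral (?F (2*pi) - ?F 0)) {0..2*pi}"
      by (intro fundamental_theorem_of_calculus) auto
    moreover have "?F (2*pi) = ?F 0"
      using per periodic2_ep(2)[of "- k" x 0] unfolding periodic2_def by (metis add_0)
    ultimately show ?thesis by (simp add: integral_unique)
  qed
  then have "integral cell ?H = 0" unfolding integral_cell_fubini[OF cH] by simp
  moreover have "integral cell ?H = fourier (dy g) k - \<i> * of_int (snd k) * fourier g k"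
    unfolding fourier_eq[OF g] fourier_eq[OF gx]
    by (subst integral_diff) (intro cell_integrable continuous_intros CP_cont g gx, intro cell_integrable continuous_intros CP_cont g gx, simp)
  ultimately show ?thesis by simp
qed

lemma of_real_ksq: "of_real (ksq k) = (of_int (fst k))\<^sup>2 + (of_int (snd k) :: complex)\<^sup>2"
  by (simp add: ksq_def)

lemma fourier_lap:
  assumes per: "periodic2 g" and C2: "Ck 2 g"
  shows "CP (lap g)" "fourier (lap g) k = - of_real (ksq k) * fourier g k"
proof -
  have c: "Ck 1 g" "Ck 1 (dx g)" "Ck 1 (dy g)" using C2 Ck_le[of 1 2 g] by (auto simp: numeral_2_eq_2)
  have p: "periodic2 (dx g)" "periodic2 (dy g)" using per periodic2_dx periodic2_dy by auto
  have cp: "CP (dx (dx g))" "CP (dy (dy g))" using CP_dx[OF p(1) c(2)] CP_dy[OF p(2) c(3)] .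
  show "CP (lap g)" unfolding lap_def by (rule CP_add[OF cp])
  show "fourier (lap g) k = - of_real (ksq k) * fourier g k"
    unfolding lap_def fourier_add[OF cp] fourier_dx[OF p(1) c(2)] fourier_dy[OF p(2) c(3)] fourier_dx[OF per c(1)] fourier_dy[OF per c(1)]
      of_real_ksq
    by (simp add: power2_eq_square algebra_simps)
qed

definition gradsq :: "(real \<times> real \<Rightarrow> real) \<Rightarrow> real" where
  "gradsq g = integral cell (\<lambda>p. (dx g p)\<^sup>2 + (dy g p)\<^sup>2)"

lemma parseval_grad:
  assumes per: "periodic2 g" and C1: "Ck 1 g"
  shows "((\<lambda>k. ksq k * (cmod (fourier g k))\<^sup>2) has_sum (tvol * gradsq g)) UNIV"
proof -
  note c = CP_dx[OF assms] CP_dy[OF assms]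
  have "((\<lambda>k. (cmod (fourier (dx g) k))\<^sup>2 + (cmod (fourier (dy g) k))\<^sup>2) has_sum
      (tvol * integral cell (\<lambda>p. (dx g p)\<^sup>2) + tvol * integral cell (\<lambda>p. (dy g p)\<^sup>2))) UNIV"
    by (intro has_sum_add parseval c)
  moreover have "(cmod (fourier (dx g) k))\<^sup>2 + (cmod (fourier (dy g) k))\<^sup>2 = ksq k * (cmod (fourier g k))\<^sup>2" for k
    unfolding fourier_dx[OF assms] fourier_dy[OF assms]
    by (simp add: norm_mult power_mult_distrib ksq_def distrib_right)
  moreover have "gradsq g = integral cell (\<lambda>p. (dx g p)\<^sup>2) + integral cell (\<lambda>p. (dy g p)\<^sup>2)"
    unfolding gradsq_def by (rule integral_add) (intro cell_integrable continuous_intros CP_cont c)+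
  ultimately show ?thesis by (simp add: distrib_left)
qed

lemma gradsq_nonneg: "periodic2 g \<Longrightarrow> Ck 1 g \<Longrightarrow> gradsq g \<ge> 0"
  unfolding gradsq_def by (intro integral_nonneg cell_integrable continuous_intros CP_cont CP_dx CP_dy) auto

text \<open>Every nonzero frequency has \<open>ksq k \<ge> 1\<close>, which is why the constant is
  1.\<close>

lemma poincare:
  assumes per: "periodic2 g" and C1: "Ck 1 g" and m: "fourier g 0 = 0"
  shows "integral cell (\<lambda>p. (g p)\<^sup>2) \<le> gradsq g"
proof -
  have "tvol * integral cell (\<lambda>p. (g p)\<^sup>2) \<le> tvol * gradsq g"
  proof (rule has_sum_mono[OF parseval[OF CP_Ck[OF per C1]] parseval_grad[OF per C1]])
    fix k
    show "(cmod (fourier g k))\<^sup>2 \<le> ksq k * (cmod (fourier g k))\<^sup>2"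
      using ksq_ge_1[of k] m mult_right_mono[of 1 "ksq k" "(cmod (fourier g k))\<^sup>2"] by (cases "k = 0") auto
  qed
  then show ?thesis by simp
qed

lemma integral_cauchy_schwarz:
  fixes f h :: "real \<times> real \<Rightarrow> real"
  assumes f: "continuous_on cell f" and h: "continuous_on cell h"
  shows "(integral cell (\<lambda>p. f p * h p))\<^sup>2 \<le> integral cell (\<lambda>p. (f p)\<^sup>2) * integral cell (\<lambda>p. (h p)\<^sup>2)"
proof -
  let ?F = "integral cell (\<lambda>p. (f p)\<^sup>2)" and ?H = "integral cell (\<lambda>p. (h p)\<^sup>2)" and ?X = "integral cell (\<lambda>p. f p * h p)"
  have q: "0 \<le> a\<^sup>2 * ?F - 2 * a * b * ?X + b\<^sup>2 * ?H" for a b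
  proof -
    have "0 \<le> integral cell (\<lambda>p. (a * f p - b * h p)\<^sup>2)"
      by (intro integral_nonneg cell_integrable continuous_intros f h) auto
    also have "(\<lambda>p. (a * f p - b * h p)\<^sup>2) = (\<lambda>p. (a\<^sup>2 * (f p)\<^sup>2 - (2 * a * b) * (f p * h p)) + b\<^sup>2 * (h p)\<^sup>2)"
      by (simp add: fun_eq_iff power2_eq_square algebra_simps)
    also have "integral cell \<dots> = integral cell (\<lambda>p. a\<^sup>2 * (f p)\<^sup>2 - (2 * a * b) * (f p * h p)) + integral cell (\<lambda>p. b\<^sup>2 * (h p)\<^sup>2)"
      by (rule integral_add) (intro cell_integrable continuous_intros f h)+
    also have "integral cell (\<lambda>p. a\<^sup>2 * (f p)\<^sup>2 - (2 * a * b) * (f p * h p)) = integral cell (\<lambda>p. a\<^sup>2 * (f p)\<^sup>2) - integral cell (\<lambda>p. (2 * a * b) * (f p * h p))"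
      by (rule integral_diff) (intro cell_integrable continuous_intros f h)+
    finally show ?thesis by simp
  qed
  have F0: "?F \<ge> 0" and H0: "?H \<ge> 0" by (intro integral_nonneg cell_integrable continuous_intros f h; simp)+
  show ?thesis
  proof (cases "?H = 0")
    case True
    \<comment> \<open>With \<open>?H = 0\<close> the quadratic is affine in \<open>b\<close>, hence
      nonnegative only if its slope vanishes; the witness below makes its value
      \<open>-1\<close>.\<close>
    have "?X = 0"
    proof (rule ccontr)
      assume "?X \<noteq> 0"
      then have "2 * 1 * ((?F + 1) / (2 * ?X)) * ?X = ?F + 1" by simp
      then show False using q[of 1 "(?F + 1) / (2 * ?X)"] True by simp
    qed
    then show ?thesis using F0 H0 by simp
  next
    case False
    have "0 \<le> ?H * (?F * ?H - ?X\<^sup>2)" using q[of ?H ?X] by (simp add: power2_eq_square algebra_simps)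
    then show ?thesis using False H0 by (simp add: zero_le_mult_iff)
  qed
qed

lemma integral_cauchy_schwarz_sqrt:
  fixes f h :: "real \<times> real \<Rightarrow> real"
  assumes f: "continuous_on cell f" and h: "continuous_on cell h"
  shows "integral cell (\<lambda>p. f p * h p) \<le> sqrt (integral cell (\<lambda>p. (f p)\<^sup>2)) * sqrt (integral cell (\<lambda>p. (h p)\<^sup>2))"
  using real_le_rsqrt[OF integral_cauchy_schwarz[OF assms]] by (simp add: real_sqrt_mult)

text \<open>Any two values of \<open>f\<close> differ by at most the total variation; integrating
  \<open>f y - ?V \<le> f z\<close> over \<open>z\<close> brings in the mean.\<close>

lemma sup_le_mean_plus_variation:
  fixes f :: "real \<Rightarrow> real"
  assumes L: "L > 0" and d: "\<And>x. x \<in> {0..L} \<Longrightarrow> (f has_real_derivative f' x) (at x)"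
    and c: "continuous_on {0..L} f'" and y: "y \<in> {0..L}"
  shows "f y \<le> integral {0..L} f / L + integral {0..L} (\<lambda>x. \<bar>f' x\<bar>)"
proof -
  let ?V = "integral {0..L} (\<lambda>x. \<bar>f' x\<bar>)"
  have cf: "continuous_on {0..L} f"
    by (rule DERIV_continuous_on) (use d in \<open>auto intro: has_field_derivative_at_within\<close>)
  have ca: "(\<lambda>x. \<bar>f' x\<bar>) integrable_on {a..b}" if "0 \<le> a" "b \<le> L" for a b
    using that by (intro integrable_continuous_interval continuous_intros continuous_on_subset[OF c]) auto
  have var: "\<bar>f b - f a\<bar> \<le> ?V" if ab: "0 \<le> a" "a \<le> b" "b \<le> L" for a b
  proof -
    have "(f' has_integral (f b - f a)) {a..b}"
      using ab d by (intro fundamental_theorem_of_calculus)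
        (auto simp flip: has_real_derivative_iff_has_vector_derivative intro: has_field_derivative_at_within)
    then have "\<bar>f b - f a\<bar> = \<bar>integral {a..b} f'\<bar>" by (simp add: integral_unique)
    also have "\<dots> \<le> integral {a..b} (\<lambda>x. \<bar>f' x\<bar>)"
      using ab integral_norm_bound_integral[of f' "{a..b}" "\<lambda>x. \<bar>f' x\<bar>"] ca[of a b]
        integrable_continuous_interval[OF continuous_on_subset[OF c, of "{a..b}"]]
      by simp
    also have "\<dots> \<le> ?V" using ab by (intro integral_subset_le ca) auto
    finally show ?thesis .
  qed
  have "f y - ?V \<le> f z" if "z \<in> {0..L}" for z
    using var[of y z] var[of z y] that y by (cases "y \<le> z") auto
  then have "integral {0..L} (\<lambda>z. f y - ?V) \<le> integral {0..L} f"
    by (intro integral_le integrable_continuous_interval cf continuous_intros) auto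
  then have "L * (f y - ?V) \<le> integral {0..L} f" using L by simp
  then have "f y - ?V \<le> integral {0..L} f / L" using L by (simp add: field_simps)
  then show ?thesis by simp
qed

text \<open>On every vertical line \<open>g^2\<close> is at most \<open>P x\<close>, on every
  horizontal line at most \<open>Q y\<close>. Hence \<open>g^4 \<le> P x * Q y\<close>, whose
  integral factorises; each factor is at most three times the product of the norms of
  \<open>g\<close> and of its gradient, which gives the 9.\<close>

theorem ladyzhenskaya:
  assumes per: "periodic2 g" and C1: "Ck 1 g" and m: "fourier g 0 = 0"
  shows "integral cell (\<lambda>p. (g p) ^ 4) \<le> 9 * integral cell (\<lambda>p. (g p)\<^sup>2) * gradsq g"
proof -
  have g: "CP g" by (rule CP_Ck[OF per C1])
  have gx: "CP (dx g)" by (rule CP_dx[OF per C1])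
  have gy: "CP (dy g)" by (rule CP_dy[OF per C1])
  have cg: "continuous_on S g" "continuous_on S (dx g)" "continuous_on S (dy g)" for S using g gx gy by auto
  have comp: "continuous_on S (\<lambda>x. g (a x, b x))" "continuous_on S (\<lambda>x. dx g (a x, b x))" "continuous_on S (\<lambda>x. dy g (a x, b x))"
    if "continuous_on S a" "continuous_on S b" for S :: "'z::topological_space set" and a b
    by (intro continuous_on_compose2[OF cg(1)[of UNIV]] continuous_on_compose2[OF cg(2)[of UNIV]] continuous_on_compose2[OF cg(3)[of UNIV]] continuous_intros that; simp)+
  let ?L = "2 * pi" and ?n = "sqrt (integral cell (\<lambda>p. (g p)\<^sup>2))" and ?d = "sqrt (gradsq g)"
  define P where "P x = integral {0..?L} (\<lambda>y. (g (x, y))\<^sup>2) / ?L + integral {0..?L} (\<lambda>y. \<bar>2 * (g (x, y) * dy g (x, y))\<bar>)" for x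
  define Q where "Q y = integral {0..?L} (\<lambda>x. (g (x, y))\<^sup>2) / ?L + integral {0..?L} (\<lambda>x. \<bar>2 * (g (x, y) * dx g (x, y))\<bar>)" for y
  have le1: "(g (x, y))\<^sup>2 \<le> P x" if "y \<in> {0..?L}" for x y
    unfolding P_def
  proof (rule sup_le_mean_plus_variation[OF _ _ _ that])
    fix z
    show "((\<lambda>y. (g (x, y))\<^sup>2) has_real_derivative 2 * (g (x, z) * dy g (x, z))) (at z)"
      using has_dy[of g "(x, z)"] C1 by (auto intro!: derivative_eq_intros)
  qed (auto intro!: continuous_intros comp)
  have le2: "(g (x, y))\<^sup>2 \<le> Q y" if "x \<in> {0..?L}" for x y
    unfolding Q_def
  proof (rule sup_le_mean_plus_variation[OF _ _ _ that])
    fix z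
    show "((\<lambda>x. (g (x, y))\<^sup>2) has_real_derivative 2 * (g (z, y) * dx g (z, y))) (at z)"
      using has_dx[of g "(z, y)"] C1 by (auto intro!: derivative_eq_intros)
  qed (auto intro!: continuous_intros comp)
  have icp: "continuous_on {0..?L} (\<lambda>x. integral {0..?L} (f x))" if "continuous_on UNIV (\<lambda>(x, y). f x y)" for f :: "real \<Rightarrow> real \<Rightarrow> real"
    using integral_continuous_on_param[of "{0..?L}" 0 ?L f] continuous_on_subset[OF that] by simp
  have cP1: "continuous_on {0..?L} (\<lambda>x. integral {0..?L} (\<lambda>y. (g (x, y))\<^sup>2))"
    by (intro icp, unfold case_prod_beta', intro continuous_intros comp)
  have cP2: "continuous_on {0..?L} (\<lambda>x. integral {0..?L} (\<lambda>y. \<bar>2 * (g (x, y) * dy g (x, y))\<bar>))"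
    by (intro icp, unfold case_prod_beta', intro continuous_intros comp)
  have cQ1: "continuous_on {0..?L} (\<lambda>y. integral {0..?L} (\<lambda>x. (g (x, y))\<^sup>2))"
    by (intro icp, unfold case_prod_beta', intro continuous_intros comp)
  have cQ2: "continuous_on {0..?L} (\<lambda>y. integral {0..?L} (\<lambda>x. \<bar>2 * (g (x, y) * dx g (x, y))\<bar>))"
    by (intro icp, unfold case_prod_beta', intro continuous_intros comp)
  have cP: "continuous_on {0..?L} P" unfolding P_def[abs_def] by (intro continuous_intros cP1 cP2) auto
  have cQ: "continuous_on {0..?L} Q" unfolding Q_def[abs_def] by (intro continuous_intros cQ1 cQ2) auto
  have n0: "?n \<ge> 0" and d0: "?d \<ge> 0" using gradsq_nonneg[OF per C1]
    by (simp_all, intro integral_nonneg cell_integrable continuous_intros cg) auto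
  have nd: "?n \<le> ?d" using poincare[OF assms] by simp
  have nn: "?n * ?n = integral cell (\<lambda>p. (g p)\<^sup>2)"
    by (rule real_sqrt_mult_self[THEN trans], rule abs_of_nonneg, intro integral_nonneg cell_integrable continuous_intros cg) auto
  \<comment> \<open>The 2 comes from differentiating \<open>g^2\<close>. The mean contributes the
    remaining 1: zero mean allows Poincare's inequality, and the period exceeds 1.\<close>
  have bnd: "?n * ?n / ?L + 2 * (?n * ?d) \<le> 3 * (?n * ?d)"
  proof -
    have *: "x / L \<le> x" if "x \<ge> 0" "L \<ge> 1" for x L :: real
      using mult_left_mono[of 1 L x] that by (simp add: pos_divide_le_eq)
    have "?n * ?n / ?L \<le> ?n * ?n" using pi_gt3 n0 by (intro *) auto
    also have "\<dots> \<le> ?n * ?d" using nd n0 by (rule mult_left_mono)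
    finally show ?thesis by linarith
  qed
  have cs: "integral cell (\<lambda>p. \<bar>2 * (g p * h p)\<bar>) \<le> 2 * (?n * ?d)" if h: "CP h" "integral cell (\<lambda>p. (h p)\<^sup>2) \<le> gradsq g" for h
  proof -
    have "integral cell (\<lambda>p. \<bar>2 * (g p * h p)\<bar>) = 2 * integral cell (\<lambda>p. \<bar>g p\<bar> * \<bar>h p\<bar>)"
      by (simp add: abs_mult)
    also have "integral cell (\<lambda>p. \<bar>g p\<bar> * \<bar>h p\<bar>) \<le> sqrt (integral cell (\<lambda>p. \<bar>g p\<bar>\<^sup>2)) * sqrt (integral cell (\<lambda>p. \<bar>h p\<bar>\<^sup>2))"
      by (intro integral_cauchy_schwarz_sqrt continuous_intros CP_cont g h(1))
    also have "\<dots> \<le> ?n * ?d" using h(2) n0 by (simp add: mult_left_mono)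
    finally show ?thesis by simp
  qed
  have gs: "gradsq g = integral cell (\<lambda>p. (dx g p)\<^sup>2) + integral cell (\<lambda>p. (dy g p)\<^sup>2)"
    unfolding gradsq_def by (rule integral_add) (intro cell_integrable continuous_intros cg)+
  have nnx: "integral cell (\<lambda>p. (dx g p)\<^sup>2) \<ge> 0" and nny: "integral cell (\<lambda>p. (dy g p)\<^sup>2) \<ge> 0"
    by (intro integral_nonneg cell_integrable continuous_intros cg; simp)+
  have csx: "integral cell (\<lambda>p. \<bar>2 * (g p * dx g p)\<bar>) \<le> 2 * (?n * ?d)"
    by (rule cs[OF gx]) (use gs nny in simp)
  have csy: "integral cell (\<lambda>p. \<bar>2 * (g p * dy g p)\<bar>) \<le> 2 * (?n * ?d)"
    by (rule cs[OF gy]) (use gs nnx in simp)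
  have IP: "integral {0..?L} P \<le> 3 * (?n * ?d)"
  proof -
    have "integral {0..?L} P = integral {0..?L} (\<lambda>x. integral {0..?L} (\<lambda>y. (g (x, y))\<^sup>2) / ?L) + integral {0..?L} (\<lambda>x. integral {0..?L} (\<lambda>y. \<bar>2 * (g (x, y) * dy g (x, y))\<bar>))"
      unfolding P_def[abs_def] by (rule integral_add) (intro integrable_continuous_interval continuous_intros cP1 cP2; simp)+
    also have "\<dots> = integral cell (\<lambda>p. (g p)\<^sup>2) / ?L + integral cell (\<lambda>p. \<bar>2 * (g p * dy g p)\<bar>)"
      by (subst (1 2) integral_cell_fubini) (intro continuous_intros cg, intro continuous_intros cg, simp only: integral_divide)
    finally show ?thesis using bnd csy unfolding nn by linarith
  qed
  have IQ: "integral {0..?L} Q \<le> 3 * (?n * ?d)"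
  proof -
    have "integral {0..?L} Q = integral {0..?L} (\<lambda>y. integral {0..?L} (\<lambda>x. (g (x, y))\<^sup>2) / ?L) + integral {0..?L} (\<lambda>y. integral {0..?L} (\<lambda>x. \<bar>2 * (g (x, y) * dx g (x, y))\<bar>))"
      unfolding Q_def[abs_def] by (rule integral_add) (intro integrable_continuous_interval continuous_intros cQ1 cQ2; simp)+
    also have "\<dots> = integral cell (\<lambda>p. (g p)\<^sup>2) / ?L + integral cell (\<lambda>p. \<bar>2 * (g p * dx g p)\<bar>)"
      by (subst (1 2) integral_cell_fubini') (intro continuous_intros cg, intro continuous_intros cg, simp only: integral_divide)
    finally show ?thesis using bnd csx unfolding nn by linarith
  qed
  have P0: "P x \<ge> 0" if "x \<in> {0..?L}" for x using le1[of 0 x] zero_le_power2[of "g (x, 0)"] by (simp, linarith)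
  have Q0: "Q y \<ge> 0" if "y \<in> {0..?L}" for y using le2[of 0 y] zero_le_power2[of "g (0, y)"] by (simp, linarith)
  have cPQ: "continuous_on cell (\<lambda>p. P (fst p) * Q (snd p))"
    by (intro continuous_intros continuous_on_compose2[OF cP] continuous_on_compose2[OF cQ]) (auto simp: cell_def cbox_Pair_eq)
  have "integral cell (\<lambda>p. (g p) ^ 4) \<le> integral cell (\<lambda>p. P (fst p) * Q (snd p))"
  proof (rule integral_le)
    fix p assume "p \<in> cell"
    then have p: "fst p \<in> {0..?L}" "snd p \<in> {0..?L}" by (auto simp: cell_def cbox_Pair_eq)
    have "(g p) ^ 4 = (g p)\<^sup>2 * (g p)\<^sup>2" by (simp add: power2_eq_square eval_nat_numeral)
    also have "\<dots> \<le> P (fst p) * Q (snd p)"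
      using le1[OF p(2), of "fst p"] le2[OF p(1), of "snd p"] P0[OF p(1)] by (intro mult_mono) auto
    finally show "(g p) ^ 4 \<le> P (fst p) * Q (snd p)" .
  qed (intro cell_integrable continuous_intros cg cPQ)+
  also have "\<dots> = integral {0..?L} P * integral {0..?L} Q"
    unfolding integral_cell_fubini[OF cPQ] by simp
  also have "\<dots> \<le> (3 * (?n * ?d)) * (3 * (?n * ?d))"
    using IP IQ n0 d0 integral_nonneg[OF integrable_continuous_interval[OF cQ]] Q0 by (intro mult_mono) auto
  also have "\<dots> = 9 * (?n * ?n) * (?d * ?d)" by algebra
  also have "?d * ?d = gradsq g" using gradsq_nonneg[OF per C1] by simp
  finally show ?thesis unfolding nn .
qed

subsection \<open>Derivatives of trigonometric polynomials\<close>

lemma tp_real: "tp F c p = (\<Sum>k\<in>F. Re (c k) * cos (kdot k p) - Im (c k) * sin (kdot k p)) / tvol"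
  by (simp add: tp_def ep_def)

lemma differentiable_tp: "tp F c differentiable (at p)"
  unfolding tp_real[abs_def] kdot_def differentiable_def
  by (rule exI, (rule derivative_intros)+) simp

lemma dx_tp: "dx (tp F c) = tp F (\<lambda>k. \<i> * of_int (fst k) * c k)"
proof
  fix p
  have "((\<lambda>r. \<Sum>k\<in>F. c k * ep k (r, snd p)) has_vector_derivative (\<Sum>k\<in>F. c k * (\<i> * of_int (fst k) * ep k (fst p, snd p)))) (at (fst p))"
    by (intro has_vector_derivative_sum has_vector_derivative_mult_right ep_deriv_x)
  from bounded_linear.has_vector_derivative[OF bounded_linear_compose[OF bounded_linear_divide[of tvol] bounded_linear_Re] this]
  show "dx (tp F c) p = tp F (\<lambda>k. \<i> * of_int (fst k) * c k) p"
    by (intro dx_eqI) (simp only: has_real_derivative_iff_has_vector_derivative tp_def prod.collapse mult.assoc mult.left_commute)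
qed

lemma dy_tp: "dy (tp F c) = tp F (\<lambda>k. \<i> * of_int (snd k) * c k)"
proof
  fix p
  have "((\<lambda>r. \<Sum>k\<in>F. c k * ep k (fst p, r)) has_vector_derivative (\<Sum>k\<in>F. c k * (\<i> * of_int (snd k) * ep k (fst p, snd p)))) (at (snd p))"
    by (intro has_vector_derivative_sum has_vector_derivative_mult_right ep_deriv_y)
  from bounded_linear.has_vector_derivative[OF bounded_linear_compose[OF bounded_linear_divide[of tvol] bounded_linear_Re] this]
  show "dy (tp F c) p = tp F (\<lambda>k. \<i> * of_int (snd k) * c k) p"
    by (intro dy_eqI) (simp only: has_real_derivative_iff_has_vector_derivative tp_def prod.collapse mult.assoc mult.left_commute)
qed

lemma Ck_tp: "Ck n (tp F c)"
proof (induction n arbitrary: c)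
  case 0
  then show ?case using CP_tp[of F c] by (simp add: CP_def)
next
  case (Suc n)
  then show ?case by (simp add: differentiable_tp dx_tp dy_tp)
qed

lemma lap_tp: "lap (tp F c) = tp F (\<lambda>k. - of_real (ksq k) * c k)"
  unfolding lap_def dx_tp dy_tp of_real_ksq
  by (auto simp: fun_eq_iff tp_def add_divide_distrib[symmetric] plus_complex.sel(1)[symmetric] sum.distrib[symmetric] power2_eq_square algebra_simps
      simp del: plus_complex.sel intro!: arg_cong[where f = Re] sum.cong)

lemma Ck_XN: "g \<in> XN N \<Longrightarrow> Ck n g"
  unfolding XN_iff using Ck_tp by auto

lemma periodic2_XN: "g \<in> XN N \<Longrightarrow> periodic2 g"
  using CP_XN unfolding CP_def by blast

lemma lap_XN: "g \<in> XN N \<Longrightarrow> lap g \<in> XN N"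
  unfolding XN_iff using lap_tp by auto

lemma fourier_lap_XN: "g \<in> XN N \<Longrightarrow> fourier (lap g) k = - of_real (ksq k) * fourier g k"
  by (rule fourier_lap(2)[OF periodic2_XN Ck_XN])

lemma parseval_grad_XN:
  assumes "h \<in> XN N"
  shows "(\<Sum>k\<in>DN N. ksq k * (cmod (fourier h k))\<^sup>2) = tvol * gradsq h"
proof -
  have "((\<lambda>k. ksq k * (cmod (fourier h k))\<^sup>2) has_sum (\<Sum>k\<in>DN N. ksq k * (cmod (fourier h k))\<^sup>2)) UNIV"
    by (rule has_sum_finite_neutralI[of "DN N"]) (auto simp: fourier_XN_outside[OF assms])
  then show ?thesis by (rule has_sum_unique[OF _ parseval_grad[OF periodic2_XN[OF assms] Ck_XN[OF assms]]])
qed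

subsection \<open>Regularity of the data\<close>

lemma DN_mono: "m \<le> n \<Longrightarrow> DN m \<subseteq> DN n"
proof -
  assume "m \<le> n"
  then have "(real m)\<^sup>2 \<le> (real n)\<^sup>2" by simp
  then show ?thesis unfolding DN_def by (intro Collect_mono impI) (rule order_trans)
qed

lemma DN_covers:
  assumes "finite H"
  shows "\<exists>n0. \<forall>n\<ge>n0. H \<subseteq> DN n"
proof -
  obtain n0 where n0: "real n0 \<ge> (\<Sum>k\<in>H. ksq k) + 1" using real_arch_simple by blast
  have "H \<subseteq> DN n0"
  proof
    fix k assume "k \<in> H"
    then have "ksq k \<le> (\<Sum>k\<in>H. ksq k)" using assms by (intro member_le_sum) auto
    also have "\<dots> \<le> real n0 * 1" using n0 by simp
    also have "\<dots> \<le> real n0 * real n0"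
    proof -
      have "(\<Sum>k\<in>H. ksq k) \<ge> 0" by (intro sum_nonneg) simp
      then have "real n0 \<ge> 1" using n0 by linarith
      then show ?thesis by (intro mult_left_mono) auto
    qed
    finally show "k \<in> DN n0" by (simp add: DN_def power2_eq_square)
  qed
  then show ?thesis using DN_mono by (meson subset_trans)
qed

lemma tp_uniform_limit:
  assumes "(\<lambda>k. cmod (d k)) summable_on UNIV"
  shows "\<exists>G. continuous_on UNIV G \<and> uniform_limit UNIV (\<lambda>n. tp (DN n) d) G sequentially"
proof -
  have "uniformly_Cauchy_on UNIV (\<lambda>n. tp (DN n) d)"
  proof (rule uniformly_Cauchy_onI)
    fix e :: real assume "e > 0"
    then have "e * tvol > 0" by simp
    from abs_le_summable_tail[OF assms _ this] obtain H where H: "finite H"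
      "\<And>F. finite F \<Longrightarrow> F \<inter> H = {} \<Longrightarrow> (\<Sum>k\<in>F. cmod (d k)) < e * tvol" by auto
    obtain n0 where n0: "\<And>n. n \<ge> n0 \<Longrightarrow> H \<subseteq> DN n" using DN_covers[OF H(1)] by blast
    have le: "dist (tp (DN m) d p) (tp (DN n) d p) < e" if "n0 \<le> m" "m \<le> n" for m n p
    proof -
      have "(\<Sum>k\<in>DN n. d k * ep k p) = (\<Sum>k\<in>DN m. d k * ep k p) + (\<Sum>k\<in>DN n - DN m. d k * ep k p)"
        using sum.subset_diff[OF DN_mono[OF that(2)] finite_DN] by (simp add: add.commute)
      then have "tp (DN n) d p = tp (DN m) d p + tp (DN n - DN m) d p"
        by (simp only: tp_def plus_complex.sel add_divide_distrib)
      then have "dist (tp (DN m) d p) (tp (DN n) d p) = \<bar>tp (DN n - DN m) d p\<bar>" by (simp add: dist_real_def)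
      also have "\<dots> \<le> (\<Sum>k\<in>DN n - DN m. cmod (d k)) / tvol" by (rule norm_tp_le)
      also have "\<dots> < e"
        using H(2)[of "DN n - DN m"] n0[OF that(1)] by (subst pos_divide_less_eq) auto
      finally show ?thesis .
    qed
    show "\<exists>M. \<forall>x\<in>UNIV. \<forall>m\<ge>M. \<forall>n\<ge>M. dist (tp (DN m) d x) (tp (DN n) d x) < e"
    proof (intro exI ballI allI impI)
      fix x m n assume "n0 \<le> m" "n0 \<le> n"
      then show "dist (tp (DN m) d x) (tp (DN n) d x) < e"
        using le[of m n x] le[of n m x] by (cases "m \<le> n") (auto simp: dist_commute)
    qed
  qed
  then obtain G where G: "uniform_limit UNIV (\<lambda>n. tp (DN n) d) G sequentially"
    using Cauchy_uniformly_convergent uniformly_convergent_on_def by blast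
  moreover have "continuous_on UNIV G"
    by (rule uniform_limit_theorem[OF _ G]) (auto intro!: always_eventually CP_cont)
  ultimately show ?thesis by blast
qed

text \<open>Differentiating a sequence of functions of two variables yields total derivatives,
  whereas \<open>dx\<close> and \<open>dy\<close> are one-dimensional; this translates between
  them.\<close>

lemma has_derivative_dx_dy:
  assumes "g differentiable (at p)"
  shows "(g has_derivative (\<lambda>h. dx g p * fst h + dy g p * snd h)) (at p)"
proof -
  obtain D where D: "(g has_derivative D) (at p)" using assms unfolding differentiable_def by blast
  interpret D: bounded_linear D using D by (rule has_derivative_bounded_linear)
  have 1: "((\<lambda>r. (r, snd p)) has_derivative (\<lambda>h. (h, 0))) (at (fst p))"
    by (intro derivative_intros)
  have "((\<lambda>r. g (r, snd p)) has_derivative (\<lambda>h. D (h, 0))) (at (fst p))"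
    by (rule has_derivative_compose[OF 1]) (simp add: D)
  moreover have "(\<lambda>h. D (h, 0)) = (*) (D (1, 0))"
  proof
    fix h have "D (h *\<^sub>R (1, 0)) = h *\<^sub>R D (1, 0)" by (rule D.scaleR)
    then show "D (h, 0) = D (1, 0) * h" by simp
  qed
  ultimately have x: "dx g p = D (1, 0)"
    by (intro dx_eqI) (simp add: has_field_derivative_def)
  have 2: "((\<lambda>r. (fst p, r)) has_derivative (\<lambda>h. (0, h))) (at (snd p))"
    by (intro derivative_intros)
  have "((\<lambda>r. g (fst p, r)) has_derivative (\<lambda>h. D (0, h))) (at (snd p))"
    by (rule has_derivative_compose[OF 2]) (simp add: D)
  moreover have "(\<lambda>h. D (0, h)) = (*) (D (0, 1))"
  proof
    fix h have "D (h *\<^sub>R (0, 1)) = h *\<^sub>R D (0, 1)" by (rule D.scaleR)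
    then show "D (0, h) = D (0, 1) * h" by simp
  qed
  ultimately have y: "dy g p = D (0, 1)"
    by (intro dy_eqI) (simp add: has_field_derivative_def)
  have "D = (\<lambda>h. dx g p * fst h + dy g p * snd h)"
  proof
    fix h
    have "D h = D (fst h *\<^sub>R (1, 0) + snd h *\<^sub>R (0, 1))" by (cases h) simp
    also have "\<dots> = fst h *\<^sub>R D (1, 0) + snd h *\<^sub>R D (0, 1)" by (simp only: D.add D.scaleR)
    finally show "D h = dx g p * fst h + dy g p * snd h" by (simp add: x y)
  qed
  then show ?thesis using D by simp
qed

lemma fourier_tp_uniform_limit:
  assumes g: "CP g" and s: "(\<lambda>k. cmod (fourier g k)) summable_on UNIV"
  shows "(\<lambda>n. tp (DN n) (fourier g) p) \<longlonglongrightarrow> g p"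
proof (rule LIMSEQ_I)
  fix r :: real assume "r > 0"
  then have "r / 2 > 0" by simp
  from fourier_series_approx[OF g s this] obtain H where H: "finite H"
    "\<And>F p. finite F \<Longrightarrow> H \<subseteq> F \<Longrightarrow> cmod (of_real (g p) - (\<Sum>k\<in>F. fourier g k / of_real tvol * ep k p)) \<le> r / 2" by blast
  obtain n0 where n0: "\<And>n. n \<ge> n0 \<Longrightarrow> H \<subseteq> DN n" using DN_covers[OF H(1)] by blast
  have "norm (tp (DN n) (fourier g) p - g p) < r" if "n \<ge> n0" for n
  proof -
    let ?P = "\<Sum>k\<in>DN n. fourier g k / of_real tvol * ep k p"
    have "?P = (\<Sum>k\<in>DN n. fourier g k * ep k p) / of_real tvol" by (simp add: sum_divide_distrib)
    then have "tp (DN n) (fourier g) p = Re ?P" unfolding tp_def by (simp only: Re_divide_of_real)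
    then have "\<bar>tp (DN n) (fourier g) p - g p\<bar> = \<bar>Re (of_real (g p) - ?P)\<bar>"
      by (simp only: minus_complex.sel Re_complex_of_real abs_minus_commute)
    also have "\<dots> \<le> cmod (of_real (g p) - ?P)" by (rule abs_Re_le_cmod)
    also have "\<dots> \<le> r / 2" by (rule H(2)) (use n0[OF that] in auto)
    finally show ?thesis using \<open>r > 0\<close> by (simp only: real_norm_def)
  qed
  then show "\<exists>no. \<forall>n\<ge>no. norm (tp (DN n) (fourier g) p - g p) < r" by blast
qed

lemma ksq_fst_le: "\<bar>real_of_int (fst k)\<bar> \<le> (1 + ksq k) powr (1/2)"
  and ksq_snd_le: "\<bar>real_of_int (snd k)\<bar> \<le> (1 + ksq k) powr (1/2)"
proof -
  have "\<bar>real_of_int (fst k)\<bar> \<le> sqrt (1 + ksq k)" "\<bar>real_of_int (snd k)\<bar> \<le> sqrt (1 + ksq k)"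
    by (rule real_le_rsqrt, simp add: ksq_def)+
  then show "\<bar>real_of_int (fst k)\<bar> \<le> (1 + ksq k) powr (1/2)" "\<bar>real_of_int (snd k)\<bar> \<le> (1 + ksq k) powr (1/2)"
    using one_plus_ksq_pos[of k] by (simp_all add: powr_half_sqrt less_imp_le)
qed

text \<open>A derivative costs a factor \<open>(1 + |k|^2)^(1/2)\<close>, which lowers
  \<open>kw 2\<close> to the summable \<open>kw (3/2)\<close>, so the series may be differentiated
  termwise. The data are given only as continuous functions with finite Sobolev norm, while the
  energy contains classical derivatives.\<close>

lemma Ck_1_of_decay:
  assumes g: "CP g" and C: "\<And>k. cmod (fourier g k) \<le> C * kw 2 k"
  shows "Ck 1 g"
proof -
  have C0: "C \<ge> 0" using order_trans[OF norm_ge_zero C[of 0]] kw_pos[of 2 0] by (simp add: zero_le_mult_iff not_less)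
  have s0: "(\<lambda>k. cmod (fourier g k)) summable_on UNIV"
    by (rule fourier_summable_of_decay[OF _ C]) simp
  have w: "(1 + ksq k) powr (1/2) * kw 2 k = kw (3/2) k" for k
    unfolding kw_def by (simp flip: powr_add)
  have bd: "a * cmod (fourier g k) \<le> C * kw (3/2) k" if "a \<ge> 0" "a \<le> (1 + ksq k) powr (1/2)" for a k
  proof -
    have "a * cmod (fourier g k) \<le> (1 + ksq k) powr (1/2) * (C * kw 2 k)" using C that C0 by (intro mult_mono) auto
    also have "\<dots> = C * kw (3/2) k" unfolding w[symmetric] by simp
    finally show ?thesis .
  qed
  have sC: "(\<lambda>k. C * kw (3/2) k) summable_on UNIV" by (intro summable_on_cmult_right kw_summable) simp
  have s1: "(\<lambda>k. cmod (\<i> * of_int (fst k) * fourier g k)) summable_on UNIV"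
    by (rule summable_on_comparison_test[OF sC]) (use bd ksq_fst_le in \<open>auto simp: norm_mult\<close>)
  have s2: "(\<lambda>k. cmod (\<i> * of_int (snd k) * fourier g k)) summable_on UNIV"
    by (rule summable_on_comparison_test[OF sC]) (use bd ksq_snd_le in \<open>auto simp: norm_mult\<close>)
  obtain G1 where G1: "continuous_on UNIV G1" "uniform_limit UNIV (\<lambda>n. tp (DN n) (\<lambda>k. \<i> * of_int (fst k) * fourier g k)) G1 sequentially"
    using tp_uniform_limit[OF s1] by blast
  obtain G2 where G2: "continuous_on UNIV G2" "uniform_limit UNIV (\<lambda>n. tp (DN n) (\<lambda>k. \<i> * of_int (snd k) * fourier g k)) G2 sequentially"
    using tp_uniform_limit[OF s2] by blast
  let ?f = "\<lambda>n. tp (DN n) (fourier g)"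
  have "\<exists>h. \<forall>x\<in>UNIV. (\<lambda>n. ?f n x) \<longlonglongrightarrow> h x \<and> (h has_derivative (\<lambda>v. G1 x * fst v + G2 x * snd v)) (at x within UNIV)"
  proof (rule has_derivative_sequence)
    fix n x
    show "(?f n has_derivative (\<lambda>v. dx (?f n) x * fst v + dy (?f n) x * snd v)) (at x within UNIV)"
      using has_derivative_dx_dy[OF differentiable_tp] by simp
  next
    fix e :: real assume e: "e > 0"
    have "\<forall>\<^sub>F n in sequentially. \<forall>x\<in>UNIV. dist (dx (?f n) x) (G1 x) < e / 2"
      using G1(2) e unfolding dx_tp uniform_limit_iff by (meson half_gt_zero)
    moreover have "\<forall>\<^sub>F n in sequentially. \<forall>x\<in>UNIV. dist (dy (?f n) x) (G2 x) < e / 2"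
      using G2(2) e unfolding dy_tp uniform_limit_iff by (meson half_gt_zero)
    ultimately show "\<forall>\<^sub>F n in sequentially. \<forall>x\<in>UNIV. \<forall>v. norm ((dx (?f n) x * fst v + dy (?f n) x * snd v) - (G1 x * fst v + G2 x * snd v)) \<le> e * norm v"
    proof eventually_elim
      case (elim n)
      show ?case
      proof (intro ballI allI)
        fix x v :: "real \<times> real"
        have "\<bar>dx (?f n) x - G1 x\<bar> \<le> e / 2" "\<bar>dy (?f n) x - G2 x\<bar> \<le> e / 2"
          using bspec[OF elim(1) UNIV_I, of x] bspec[OF elim(2) UNIV_I, of x] unfolding dist_real_def by linarith+
        moreover have "\<bar>fst v\<bar> \<le> norm v" "\<bar>snd v\<bar> \<le> norm v"
          using norm_fst_le[of "fst v" "snd v"] norm_snd_le[of "snd v" "fst v"] by simp_all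
        ultimately have "\<bar>dx (?f n) x - G1 x\<bar> * \<bar>fst v\<bar> \<le> e / 2 * norm v" "\<bar>dy (?f n) x - G2 x\<bar> * \<bar>snd v\<bar> \<le> e / 2 * norm v"
          using e by (intro mult_mono; simp)+
        moreover have "(dx (?f n) x * fst v + dy (?f n) x * snd v) - (G1 x * fst v + G2 x * snd v)
            = (dx (?f n) x - G1 x) * fst v + (dy (?f n) x - G2 x) * snd v" by (simp add: algebra_simps)
        ultimately show "norm ((dx (?f n) x * fst v + dy (?f n) x * snd v) - (G1 x * fst v + G2 x * snd v)) \<le> e * norm v"
          using abs_triangle_ineq[of "(dx (?f n) x - G1 x) * fst v" "(dy (?f n) x - G2 x) * snd v"]
          by (simp only: real_norm_def abs_mult)
      qed
    qed
  next
    show "(\<lambda>n. ?f n (0, 0)) \<longlonglongrightarrow> g (0, 0)" by (rule fourier_tp_uniform_limit[OF g s0])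
  qed auto
  then obtain h where h: "\<And>x. (\<lambda>n. ?f n x) \<longlonglongrightarrow> h x" "\<And>x. (h has_derivative (\<lambda>v. G1 x * fst v + G2 x * snd v)) (at x)" by auto
  have "h = g"
    by (rule ext, rule LIMSEQ_unique[OF h(1) fourier_tp_uniform_limit[OF g s0]])
  then have gd: "(g has_derivative (\<lambda>v. G1 x * fst v + G2 x * snd v)) (at x)" for x using h(2) by simp
  then have diff: "g differentiable (at x)" for x unfolding differentiable_def by blast
  have eq: "(\<lambda>v. G1 x * fst v + G2 x * snd v) = (\<lambda>v. dx g x * fst v + dy g x * snd v)" for x
    by (rule has_derivative_unique[OF gd has_derivative_dx_dy[OF diff]])
  have "dx g = G1" using fun_cong[OF eq, of _ "(1, 0)"] by auto
  moreover have "dy g = G2" using fun_cong[OF eq, of _ "(0, 1)"] by auto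
  ultimately show ?thesis using diff G1(1) G2(1) by simp
qed

text \<open>A single term of the Sobolev sum is bounded by the whole sum, and comparing
  \<open>1 + |k|^(2s)\<close> with \<open>(1 + |k|^2)^s\<close> costs \<open>2 powr s\<close>.
  Pointwise decay loses square summability, hence the last conclusion keeps the weighted sum as
  well.\<close>

lemma admissible_decay:
  assumes "admissible_data s u0"
  shows "CP u0" "fourier u0 0 = 0" "\<exists>C>0. \<forall>k. cmod (fourier u0 k) \<le> C * kw (s/2) k"
    "(\<lambda>k. (ksq k powr s) * (cmod (fourier u0 k))\<^sup>2) summable_on UNIV"
proof -
  show cp: "CP u0" using assms by (simp add: admissible_data_def CP_def)
  have "fourier u0 0 = of_real (LINT p:cell|lborel. u0 p)"
    unfolding fourier_eq[OF cp] using integral_linear[OF cell_integrable[OF CP_cont[OF cp]] bounded_linear_of_real[where 'a = complex]]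
    by (subst LINT_cell[OF CP_cont[OF cp]]) (simp add: o_def)
  then show "fourier u0 0 = 0" using assms by (simp add: admissible_data_def)
  let ?f = "\<lambda>k. (1 + ksq k powr s) * (cmod (fourier u0 k))\<^sup>2"
  have s: "?f summable_on UNIV" "s \<ge> 4" using assms by (auto simp: admissible_data_def in_Hs_def)
  show "(\<lambda>k. (ksq k powr s) * (cmod (fourier u0 k))\<^sup>2) summable_on UNIV"
    by (rule summable_on_comparison_test[OF s(1)]) (auto intro!: mult_right_mono)
  have f0: "?f k \<ge> 0" for k by (intro mult_nonneg_nonneg add_nonneg_nonneg) auto
  let ?S = "infsum ?f UNIV"
  have S0: "?S \<ge> 0" by (rule infsum_nonneg) (rule f0)
  have le: "?f k \<le> ?S" for k using finite_sum_le_infsum[OF s(1), of "{k}"] f0 by auto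
  have "(cmod (fourier u0 k))\<^sup>2 \<le> 2 powr s * (?S + 1) * (kw (s/2) k)\<^sup>2" for k
  proof -
    have "(1 + ksq k) powr s \<le> 2 powr s * (1 + ksq k powr s)"
    proof (cases "ksq k \<le> 1")
      case True
      then have "(1 + ksq k) powr s \<le> 2 powr s" using s by (intro powr_mono2) auto
      also have "\<dots> \<le> 2 powr s * (1 + ksq k powr s)" by simp
      finally show ?thesis .
    next
      case False
      then have "(1 + ksq k) powr s \<le> (2 * ksq k) powr s" using s by (intro powr_mono2) auto
      also have "\<dots> = 2 powr s * ksq k powr s" by (simp add: powr_mult)
      also have "\<dots> \<le> 2 powr s * (1 + ksq k powr s)" by simp
      finally show ?thesis .
    qed
    then have "(1 + ksq k) powr s * (cmod (fourier u0 k))\<^sup>2 \<le> 2 powr s * (1 + ksq k powr s) * (cmod (fourier u0 k))\<^sup>2"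
      by (rule mult_right_mono) simp
    also have "\<dots> = 2 powr s * ?f k" by simp
    also have "\<dots> \<le> 2 powr s * (?S + 1)" using le[of k] by (intro mult_left_mono) auto
    finally have "(1 + ksq k) powr s * (cmod (fourier u0 k))\<^sup>2 * (kw (s/2) k)\<^sup>2 \<le> 2 powr s * (?S + 1) * (kw (s/2) k)\<^sup>2"
      by (rule mult_right_mono) simp
    moreover have "(1 + ksq k) powr s * x * (kw (s/2) k)\<^sup>2 = x" for x
      unfolding kw_def power2_eq_square using one_plus_ksq_pos[of k] by (simp add: powr_add[symmetric] less_imp_neq[symmetric])
    ultimately show ?thesis by simp
  qed
  then have "cmod (fourier u0 k) \<le> sqrt (2 powr s * (?S + 1)) * kw (s/2) k" for k
    using real_le_rsqrt[of "cmod (fourier u0 k)" "2 powr s * (?S + 1) * (kw (s/2) k)\<^sup>2"] by (simp add: real_sqrt_mult)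
  moreover have "sqrt (2 powr s * (?S + 1)) > 0" using S0 by (simp add: zero_less_mult_iff)
  ultimately show "\<exists>C>0. \<forall>k. cmod (fourier u0 k) \<le> C * kw (s/2) k" by blast
qed

lemma admissible_Ck_1:
  assumes "admissible_data s u0"
  shows "Ck 1 u0"
proof -
  obtain C where C: "C > 0" "\<And>k. cmod (fourier u0 k) \<le> C * kw (s/2) k" using admissible_decay(3)[OF assms] by blast
  have "s \<ge> 4" using assms by (simp add: admissible_data_def)
  then have "C * kw (s/2) k \<le> C * kw 2 k" for k using C by (intro mult_left_mono kw_mono) auto
  then show ?thesis using C(2) by (intro Ck_1_of_decay[OF admissible_decay(1)[OF assms], of C]) (rule order_trans)
qed

subsection \<open>Energy stability\<close>

lemma energy_eq:
  assumes "periodic2 g" "Ck 1 g"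
  shows "energy \<nu> g = \<nu> / 2 * gradsq g + 1/4 * integral cell (\<lambda>p. ((g p)\<^sup>2 - 1)\<^sup>2)"
proof -
  note c = CP_dx[OF assms] CP_dy[OF assms] CP_Ck[OF assms]
  have "energy \<nu> g = integral cell (\<lambda>p. \<nu> / 2 * ((dx g p)\<^sup>2 + (dy g p)\<^sup>2) + 1/4 * ((g p)\<^sup>2 - 1)\<^sup>2)"
    unfolding energy_def by (intro LINT_cell continuous_intros CP_cont c)
  also have "\<dots> = integral cell (\<lambda>p. \<nu> / 2 * ((dx g p)\<^sup>2 + (dy g p)\<^sup>2)) + integral cell (\<lambda>p. 1/4 * ((g p)\<^sup>2 - 1)\<^sup>2)"
    by (rule integral_add) (intro cell_integrable continuous_intros CP_cont c)+
  finally show ?thesis by (simp only: integral_mult_right gradsq_def)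
qed

lemma potential_nonneg: "CP g \<Longrightarrow> integral cell (\<lambda>p. ((g p)\<^sup>2 - 1)\<^sup>2) \<ge> 0"
  by (intro integral_nonneg cell_integrable continuous_intros CP_cont) auto

lemma integral_pow4_nonneg: "CP g \<Longrightarrow> integral cell (\<lambda>p. (g p) ^ 4) \<ge> 0"
  by (intro integral_nonneg cell_integrable continuous_intros CP_cont) auto

lemma integral_sq_nonneg: "CP g \<Longrightarrow> integral cell (\<lambda>p. (g p)\<^sup>2) \<ge> 0"
  by (intro integral_nonneg cell_integrable continuous_intros CP_cont) auto

lemma pow4_eq: "(x::real) ^ 4 = (x\<^sup>2)\<^sup>2"
  by (simp add: power2_eq_square eval_nat_numeral)

lemma integral_pow4_le:
  assumes g: "CP g"
  shows "integral cell (\<lambda>p. (g p) ^ 4) \<le> 2 * integral cell (\<lambda>p. ((g p)\<^sup>2 - 1)\<^sup>2) + 2 * tvol"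
proof -
  have "integral cell (\<lambda>p. (g p) ^ 4) \<le> integral cell (\<lambda>p. 2 * ((g p)\<^sup>2 - 1)\<^sup>2 + 2)"
  proof (rule integral_le)
    fix p
    have "y\<^sup>2 \<le> 2 * (y - 1)\<^sup>2 + 2" for y :: real using zero_le_power2[of "y - 2"] by (simp add: power2_eq_square algebra_simps)
    then show "(g p) ^ 4 \<le> 2 * ((g p)\<^sup>2 - 1)\<^sup>2 + 2" unfolding pow4_eq .
  qed (intro cell_integrable continuous_intros CP_cont g)+
  also have "\<dots> = integral cell (\<lambda>p. 2 * ((g p)\<^sup>2 - 1)\<^sup>2) + integral cell (\<lambda>p. 2)"
    by (rule integral_add) (intro cell_integrable continuous_intros CP_cont g)+
  finally show ?thesis by simp
qed

lemma potential_le: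
  assumes g: "CP g"
  shows "integral cell (\<lambda>p. ((g p)\<^sup>2 - 1)\<^sup>2) \<le> integral cell (\<lambda>p. (g p) ^ 4) + tvol"
proof -
  have "integral cell (\<lambda>p. ((g p)\<^sup>2 - 1)\<^sup>2) \<le> integral cell (\<lambda>p. (g p) ^ 4 + 1)"
  proof (rule integral_le)
    fix p
    show "((g p)\<^sup>2 - 1)\<^sup>2 \<le> (g p) ^ 4 + 1" unfolding pow4_eq by (simp add: power2_diff)
  qed (intro cell_integrable continuous_intros CP_cont g)+
  also have "\<dots> = integral cell (\<lambda>p. (g p) ^ 4) + integral cell (\<lambda>p. 1)"
    by (rule integral_add) (intro cell_integrable continuous_intros CP_cont g)+
  finally show ?thesis by simp
qed

text \<open>The gradient does not grow under truncation. The quartic part is estimated through the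
  discarded tail \<open>w\<close>: \<open>N^2 ||w||^2\<close> and \<open>||grad w||^2\<close> are at
  most \<open>2E / \<nu>\<close>, so Ladyzhenskaya's inequality gives
  \<open>36 E^2 / (N \<nu>)^2\<close> for the integral of \<open>w^4\<close>.\<close>

lemma PiN_energy_bound:
  assumes adm: "admissible_data s u0" and \<nu>: "\<nu> > 0" and N: "N \<ge> 1"
  defines "E \<equiv> energy \<nu> u0" and "\<kappa> \<equiv> max 1 (1 / (real N * \<nu>))"
  shows "energy \<nu> (PiN N u0) \<le> (17 * E + 72 * E\<^sup>2 + 5 * tvol) * \<kappa>\<^sup>2" "E \<ge> 0"
proof -
  have u: "CP u0" "fourier u0 0 = 0" "Ck 1 u0" using admissible_decay[OF adm] admissible_Ck_1[OF adm] by auto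
  have per: "periodic2 u0" using u(1) by (simp add: CP_def)
  define v where "v = PiN N u0"
  have v_eq: "v = tp (DN N) (fourier u0)" unfolding v_def by (rule PiN_eq[OF u(1)])
  have v: "v \<in> XN N" by (simp add: v_eq)
  have fv: "fourier v k = (if k \<in> DN N then fourier u0 k else 0)" for k
    unfolding v_eq by (rule fourier_tp_DN[OF u(1)])
  have vP: "CP v" "Ck 1 v" "periodic2 v" using v CP_XN Ck_XN periodic2_XN by blast+
  define w where "w = (\<lambda>p. u0 p + (-1) * v p)"
  have w: "CP w" "Ck 1 w" "periodic2 w"
    using CP_add[OF u(1) CP_cmult[OF vP(1), of "-1"]] Ck_add[OF u(3) Ck_cmult[OF vP(2), of "-1"]]
    by (auto simp: w_def CP_def)
  have fw: "fourier w k = (if k \<in> DN N then 0 else fourier u0 k)" for k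
    unfolding w_def fourier_add[OF u(1) CP_cmult[OF vP(1)]] fourier_cmult[OF vP(1)] by (simp add: fv)
  have gw: "gradsq w \<le> gradsq u0"
  proof -
    have "tvol * gradsq w \<le> tvol * gradsq u0"
      by (rule has_sum_mono[OF parseval_grad[OF w(3,2)] parseval_grad[OF per u(3)]]) (auto simp: fw)
    then show ?thesis by simp
  qed
  have gv: "gradsq v \<le> gradsq u0"
  proof -
    have "tvol * gradsq v \<le> tvol * gradsq u0"
      by (rule has_sum_mono[OF parseval_grad[OF vP(3,2)] parseval_grad[OF per u(3)]]) (auto simp: fv)
    then show ?thesis by simp
  qed
  have g0: "gradsq u0 \<ge> 0" "gradsq w \<ge> 0" using gradsq_nonneg per u w by blast+
  have Iw: "(real N)\<^sup>2 * integral cell (\<lambda>p. (w p)\<^sup>2) \<le> gradsq u0"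
  proof -
    have "(real N)\<^sup>2 * (tvol * integral cell (\<lambda>p. (w p)\<^sup>2)) \<le> tvol * gradsq w"
    proof (rule has_sum_mono[OF has_sum_cmult_right[OF parseval[OF w(1)]] parseval_grad[OF w(3,2)]])
      fix k
      show "(real N)\<^sup>2 * (cmod (fourier w k))\<^sup>2 \<le> ksq k * (cmod (fourier w k))\<^sup>2"
        by (cases "k \<in> DN N") (auto simp: fw DN_def intro!: mult_right_mono)
    qed
    then have "tvol * ((real N)\<^sup>2 * integral cell (\<lambda>p. (w p)\<^sup>2)) \<le> tvol * gradsq w" by (simp add: mult.left_commute)
    then show ?thesis using gw by simp
  qed
  have E_eq: "E = \<nu> / 2 * gradsq u0 + 1/4 * integral cell (\<lambda>p. ((u0 p)\<^sup>2 - 1)\<^sup>2)"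
    unfolding E_def by (rule energy_eq[OF per u(3)])
  have pot0: "integral cell (\<lambda>p. ((u0 p)\<^sup>2 - 1)\<^sup>2) \<ge> 0" by (rule potential_nonneg[OF u(1)])
  show E0: "E \<ge> 0" unfolding E_eq using \<nu> g0 pot0 by simp
  have gE: "gradsq u0 \<le> 2 * E / \<nu>" using \<nu> pot0 unfolding E_eq by (simp add: field_simps)
  have \<kappa>: "\<kappa> \<ge> 1" "1 / (real N * \<nu>) \<le> \<kappa>" by (auto simp: \<kappa>_def)
  have \<kappa>2: "1 \<le> \<kappa>\<^sup>2" using \<kappa> by simp
  have w4: "integral cell (\<lambda>p. (w p) ^ 4) \<le> 36 * E\<^sup>2 * \<kappa>\<^sup>2"
  proof -
    have N0: "(real N)\<^sup>2 > 0" using N by simp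
    have I0: "integral cell (\<lambda>p. (w p)\<^sup>2) \<ge> 0" by (rule integral_sq_nonneg[OF w(1)])
    have "integral cell (\<lambda>p. (w p) ^ 4) \<le> 9 * integral cell (\<lambda>p. (w p)\<^sup>2) * gradsq w"
      by (rule ladyzhenskaya[OF w(3,2)]) (simp add: fw u(2))
    also have "\<dots> \<le> 9 * (gradsq u0 / (real N)\<^sup>2) * gradsq u0"
      using Iw gw g0 N0 I0 by (intro mult_mono) (auto simp: pos_le_divide_eq mult.commute)
    also have "\<dots> \<le> 9 * (2 * E / \<nu> / (real N)\<^sup>2) * (2 * E / \<nu>)"
      using gE g0 N0 E0 \<nu> by (intro mult_mono divide_right_mono) auto
    also have "\<dots> = 36 * E\<^sup>2 * (1 / (real N * \<nu>))\<^sup>2" by (simp add: power2_eq_square field_simps)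
    also have "\<dots> \<le> 36 * E\<^sup>2 * \<kappa>\<^sup>2" using \<kappa> \<nu> by (intro mult_left_mono power_mono) auto
    finally show ?thesis .
  qed
  have u4: "integral cell (\<lambda>p. (u0 p) ^ 4) \<le> 8 * E + 2 * tvol"
  proof -
    have "\<nu> / 2 * gradsq u0 \<ge> 0" using g0 \<nu> by simp
    then show ?thesis using integral_pow4_le[OF u(1)] E_eq by linarith
  qed
  have v4: "integral cell (\<lambda>p. (v p) ^ 4) \<le> 8 * integral cell (\<lambda>p. (u0 p) ^ 4) + 8 * integral cell (\<lambda>p. (w p) ^ 4)"
  proof -
    have "integral cell (\<lambda>p. (v p) ^ 4) \<le> integral cell (\<lambda>p. 8 * (u0 p) ^ 4 + 8 * (w p) ^ 4)"
    proof (rule integral_le)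
      fix p
      have sq: "(a - b)\<^sup>2 \<le> 2 * a\<^sup>2 + 2 * b\<^sup>2" for a b :: real
        using zero_le_power2[of "a + b"] by (simp add: power2_eq_square algebra_simps)
      have "((a - b)\<^sup>2)\<^sup>2 \<le> 8 * (a\<^sup>2)\<^sup>2 + 8 * (b\<^sup>2)\<^sup>2" for a b :: real
      proof -
        have "((a - b)\<^sup>2)\<^sup>2 \<le> (2 * a\<^sup>2 + 2 * b\<^sup>2)\<^sup>2" using sq by (intro power_mono) auto
        also have "\<dots> \<le> 2 * (2 * a\<^sup>2)\<^sup>2 + 2 * (2 * b\<^sup>2)\<^sup>2" using sq[of "2 * a\<^sup>2" "- (2 * b\<^sup>2)"] by simp
        finally show ?thesis by (simp add: power_mult_distrib)
      qed
      from this[of "u0 p" "w p"] show "(v p) ^ 4 \<le> 8 * (u0 p) ^ 4 + 8 * (w p) ^ 4"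
        unfolding pow4_eq by (simp add: w_def)
    qed (intro cell_integrable continuous_intros CP_cont u vP w)+
    also have "\<dots> = integral cell (\<lambda>p. 8 * (u0 p) ^ 4) + integral cell (\<lambda>p. 8 * (w p) ^ 4)"
      by (rule integral_add) (intro cell_integrable continuous_intros CP_cont u w)+
    finally show ?thesis by simp
  qed
  have "energy \<nu> v = \<nu> / 2 * gradsq v + 1/4 * integral cell (\<lambda>p. ((v p)\<^sup>2 - 1)\<^sup>2)" by (rule energy_eq[OF vP(3,2)])
  also have "\<dots> \<le> E + 1/4 * (integral cell (\<lambda>p. (v p) ^ 4) + tvol)"
  proof -
    have "\<nu> / 2 * gradsq v \<le> \<nu> / 2 * gradsq u0" using gv \<nu> by simp
    moreover have "1/4 * integral cell (\<lambda>p. ((v p)\<^sup>2 - 1)\<^sup>2) \<le> 1/4 * (integral cell (\<lambda>p. (v p) ^ 4) + tvol)"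
      using potential_le[OF vP(1)] by simp
    ultimately show ?thesis unfolding E_eq
      by (rule order_trans[OF add_mono]) (use pot0 in simp)
  qed
  \<comment> \<open>A quarter of \<open>8 (8E + 2 tvol)\<close> is \<open>16 E + 4 tvol\<close>; it
    is joined by \<open>E\<close> and a quarter of \<open>tvol\<close>, the latter rounded up to
    give \<open>5 tvol\<close>.\<close>
  also have "\<dots> \<le> 17 * E + 2 * (36 * E\<^sup>2 * \<kappa>\<^sup>2) + 5 * tvol"
  proof -
    have ar: "e + 1/4 * (x + t) \<le> 17 * e + 2 * c + 5 * t"
      if "x \<le> 8 * a + 8 * b" "a \<le> 8 * e + 2 * t" "b \<le> c" "0 < t" for x a b c e t :: real
      using that by simp
    show ?thesis by (rule ar[OF v4 u4 w4 tvol_pos])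
  qed
  also have "\<dots> = 17 * E + 72 * E\<^sup>2 * \<kappa>\<^sup>2 + 5 * tvol" by simp
  also have "\<dots> \<le> 17 * E * \<kappa>\<^sup>2 + 72 * E\<^sup>2 * \<kappa>\<^sup>2 + 5 * tvol * \<kappa>\<^sup>2"
  proof -
    have "17 * E * 1 \<le> 17 * E * \<kappa>\<^sup>2" "5 * tvol * 1 \<le> 5 * tvol * \<kappa>\<^sup>2"
      using E0 by (intro mult_left_mono \<kappa>2; simp)+
    then show ?thesis by (intro add_mono order_refl) (simp_all only: mult_1_right)
  qed
  finally show "energy \<nu> (PiN N u0) \<le> (17 * E + 72 * E\<^sup>2 + 5 * tvol) * \<kappa>\<^sup>2"
    by (simp add: v_def algebra_simps)
qed

text \<open>After division by \<open>|k|^2\<close>, the time difference contributes the nonnegative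
  term \<open>|d|^2 / (\<tau> |k|^2)\<close> in each mode. It is dropped, and this is where
  \<open>\<tau>\<close> disappears. Polarization of the implicit linear term yields the difference
  of the gradients and the extra dissipation of \<open>d\<close>; zero mean settles
  \<open>k = 0\<close>.\<close>

lemma scheme_step_inequality:
  assumes a: "a \<in> XN N" and b: "b \<in> XN N" and \<tau>: "\<tau> > 0" and a0: "fourier a 0 = 0" and b0: "fourier b 0 = 0"
    and step: "\<And>k. k \<in> DN N \<Longrightarrow> (fourier b k - fourier a k) / of_real \<tau> =
      - of_real \<nu> * (of_real (ksq k))\<^sup>2 * fourier b k - of_real A * of_real (ksq k) * (fourier b k - fourier a k)
      - of_real (ksq k) * fourier (\<lambda>p. fCH (a p)) k"
  defines "d \<equiv> \<lambda>p. b p - a p"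
  shows "\<nu> / 2 * gradsq b - \<nu> / 2 * gradsq a + \<nu> / 2 * gradsq d + A * integral cell (\<lambda>p. (d p)\<^sup>2)
      + integral cell (\<lambda>p. fCH (a p) * d p) \<le> 0"
proof -
  have d: "d \<in> XN N" unfolding d_def by (rule XN_diff[OF b a])
  have fd: "fourier d k = fourier b k - fourier a k" for k unfolding d_def by (rule fourier_diff[OF CP_XN[OF b] CP_XN[OF a]])
  let ?\<phi> = "fourier (\<lambda>p. fCH (a p))"
  have key: "\<nu> / 2 * (ksq k * (cmod (fourier b k))\<^sup>2) - \<nu> / 2 * (ksq k * (cmod (fourier a k))\<^sup>2)
      + \<nu> / 2 * (ksq k * (cmod (fourier d k))\<^sup>2) + A * (cmod (fourier d k))\<^sup>2 + Re (?\<phi> k * cnj (fourier d k)) \<le> 0"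
    if k: "k \<in> DN N" for k
  proof (cases "k = 0")
    case True
    then show ?thesis by (simp add: fd a0 b0)
  next
    case False
    define q where "q = ksq k"
    have q: "q > 0" using ksq_ge_1[OF False] by (simp add: q_def)
    define z where "z = fourier d k"
    define w where "w = fourier b k"
    define f where "f = ?\<phi> k"
    have ak: "fourier a k = w - z" by (simp add: z_def w_def fd)
    have "z / of_real \<tau> = - of_real \<nu> * (of_real q)\<^sup>2 * w - of_real A * of_real q * z - of_real q * f"
      using step[OF k] by (simp add: z_def w_def f_def q_def fd)
    then have "z = of_real \<tau> * (- of_real \<nu> * (of_real q)\<^sup>2 * w - of_real A * of_real q * z - of_real q * f)"
      using \<tau> by (simp add: nonzero_divide_eq_eq mult.commute)
    then have "z = - (of_real (\<tau> * q) * (of_real (\<nu> * q) * w + of_real A * z + f))"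
      by (simp only: of_real_mult power2_eq_square) algebra
    then have "Re (z * cnj z) = Re (- (of_real (\<tau> * q) * (of_real (\<nu> * q) * w + of_real A * z + f)) * cnj z)"
      by (rule arg_cong)
    then have "(cmod z)\<^sup>2 = - (\<tau> * q * (\<nu> * q * Re (w * cnj z) + A * (cmod z)\<^sup>2 + Re (f * cnj z)))"
      unfolding cmod_power2 by (simp add: power2_eq_square algebra_simps)
    then have "\<tau> * q * (\<nu> * q * Re (w * cnj z) + A * (cmod z)\<^sup>2 + Re (f * cnj z)) \<le> 0"
      using zero_le_power2[of "cmod z"] by linarith
    then have *: "\<nu> * q * Re (w * cnj z) + A * (cmod z)\<^sup>2 + Re (f * cnj z) \<le> 0"
      using \<tau> q by (simp add: mult_le_0_iff)
    have "Re (w * cnj z) = 1/2 * (cmod w)\<^sup>2 - 1/2 * (cmod (w - z))\<^sup>2 + 1/2 * (cmod z)\<^sup>2"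
      unfolding cmod_power2 by (simp add: power2_eq_square algebra_simps)
    then have "\<nu> * q * Re (w * cnj z) = \<nu> / 2 * (q * (cmod w)\<^sup>2) - \<nu> / 2 * (q * (cmod (w - z))\<^sup>2) + \<nu> / 2 * (q * (cmod z)\<^sup>2)"
      by (simp only:) (simp add: algebra_simps)
    then show ?thesis using * unfolding ak z_def[symmetric] w_def[symmetric] f_def[symmetric] q_def[symmetric] by linarith
  qed
  have "(\<Sum>k\<in>DN N. \<nu> / 2 * (ksq k * (cmod (fourier b k))\<^sup>2) - \<nu> / 2 * (ksq k * (cmod (fourier a k))\<^sup>2)
      + \<nu> / 2 * (ksq k * (cmod (fourier d k))\<^sup>2) + A * (cmod (fourier d k))\<^sup>2 + Re (?\<phi> k * cnj (fourier d k))) \<le> 0"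
    by (rule sum_nonpos) (rule key)
  then have "\<nu> / 2 * (tvol * gradsq b) - \<nu> / 2 * (tvol * gradsq a) + \<nu> / 2 * (tvol * gradsq d)
      + A * (tvol * integral cell (\<lambda>p. (d p)\<^sup>2)) + tvol * integral cell (\<lambda>p. fCH (a p) * d p) \<le> 0"
    unfolding sum.distrib sum_subtractf sum_distrib_left[symmetric] parseval_grad_XN[OF a] parseval_grad_XN[OF b]
      parseval_grad_XN[OF d] parseval_XN_sq[OF d] parseval_XN[OF d CP_fCH[OF CP_XN[OF a]]] .
  then have "tvol * (\<nu> / 2 * gradsq b - \<nu> / 2 * gradsq a + \<nu> / 2 * gradsq d + A * integral cell (\<lambda>p. (d p)\<^sup>2)
      + integral cell (\<lambda>p. fCH (a p) * d p)) \<le> 0"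
    by (simp add: algebra_simps)
  then show ?thesis using tvol_pos by (simp only: mult_le_0_iff) (auto simp: not_le)
qed

text \<open>The Taylor expansion of the double well leaves
  \<open>3/2 x^2 y^2 + x y^3 + y^4 / 4 - y^2 / 2\<close>; the mixed term is split by Young's
  inequality and the negative square is discarded.\<close>

lemma potential_increment:
  assumes a: "CP a" and d: "CP d"
  shows "1/4 * integral cell (\<lambda>p. ((a p + d p)\<^sup>2 - 1)\<^sup>2) \<le> 1/4 * integral cell (\<lambda>p. ((a p)\<^sup>2 - 1)\<^sup>2)
     + integral cell (\<lambda>p. fCH (a p) * d p) + 2 * integral cell (\<lambda>p. (a p * d p)\<^sup>2) + 3/4 * integral cell (\<lambda>p. (d p) ^ 4)"
proof -
  have "1/4 * integral cell (\<lambda>p. ((a p + d p)\<^sup>2 - 1)\<^sup>2) = integral cell (\<lambda>p. 1/4 * ((a p + d p)\<^sup>2 - 1)\<^sup>2)" by simp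
  also have "\<dots> \<le> integral cell (\<lambda>p. ((1/4 * ((a p)\<^sup>2 - 1)\<^sup>2 + fCH (a p) * d p) + 2 * (a p * d p)\<^sup>2) + 3/4 * (d p) ^ 4)"
  proof (rule integral_le)
    fix p
    have "1/4 * ((x + y)\<^sup>2 - 1)\<^sup>2 \<le> ((1/4 * (x\<^sup>2 - 1)\<^sup>2 + fCH x * y) + 2 * (x * y)\<^sup>2) + 3/4 * y ^ 4" for x y :: real
    proof -
      have "(x\<^sup>2 - 1)\<^sup>2 + 4 * (fCH x * y) + 8 * (x * y)\<^sup>2 + 3 * y ^ 4 = ((x + y)\<^sup>2 - 1)\<^sup>2 + 2 * (y * (x - y))\<^sup>2 + 2 * y\<^sup>2"
        unfolding fCH_def by algebra
      then show ?thesis using zero_le_power2[of "y * (x - y)"] zero_le_power2[of y] by linarith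
    qed
    then show "1/4 * ((a p + d p)\<^sup>2 - 1)\<^sup>2 \<le> ((1/4 * ((a p)\<^sup>2 - 1)\<^sup>2 + fCH (a p) * d p) + 2 * (a p * d p)\<^sup>2) + 3/4 * (d p) ^ 4" .
  qed (intro cell_integrable continuous_intros CP_cont a d CP_fCH)+
  also have "\<dots> = ((integral cell (\<lambda>p. 1/4 * ((a p)\<^sup>2 - 1)\<^sup>2) + integral cell (\<lambda>p. fCH (a p) * d p)) + integral cell (\<lambda>p. 2 * (a p * d p)\<^sup>2)) + integral cell (\<lambda>p. 3/4 * (d p) ^ 4)"
  proof -
    have e1: "integral cell (\<lambda>p. 1/4 * ((a p)\<^sup>2 - 1)\<^sup>2 + fCH (a p) * d p) = integral cell (\<lambda>p. 1/4 * ((a p)\<^sup>2 - 1)\<^sup>2) + integral cell (\<lambda>p. fCH (a p) * d p)"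
      by (rule integral_add) (intro cell_integrable continuous_intros CP_cont a d CP_fCH)+
    have e2: "integral cell (\<lambda>p. (1/4 * ((a p)\<^sup>2 - 1)\<^sup>2 + fCH (a p) * d p) + 2 * (a p * d p)\<^sup>2)
        = integral cell (\<lambda>p. 1/4 * ((a p)\<^sup>2 - 1)\<^sup>2 + fCH (a p) * d p) + integral cell (\<lambda>p. 2 * (a p * d p)\<^sup>2)"
      by (rule integral_add) (intro cell_integrable continuous_intros CP_cont a d CP_fCH)+
    show ?thesis unfolding e1[symmetric] e2[symmetric]
      by (rule integral_add) (intro cell_integrable continuous_intros CP_cont a d CP_fCH)+
  qed
  finally show ?thesis by simp
qed

text \<open>Writing \<open>f(a) d = a^2 (a d) - a d\<close> brings in \<open>d\<close> only through
  the norm of \<open>a d\<close>, the quantity that also occurs in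
  \<open>potential_increment\<close>.\<close>

lemma fCH_test_bound:
  assumes a: "CP a" and d: "CP d"
  shows "- integral cell (\<lambda>p. fCH (a p) * d p) \<le> sqrt (integral cell (\<lambda>p. (a p) ^ 4)) * sqrt (integral cell (\<lambda>p. (a p * d p)\<^sup>2))
    + sqrt tvol * sqrt (integral cell (\<lambda>p. (a p * d p)\<^sup>2))"
proof -
  have "- integral cell (\<lambda>p. fCH (a p) * d p) = integral cell (\<lambda>p. - (fCH (a p) * d p))" by simp
  also have "(\<lambda>p. - (fCH (a p) * d p)) = (\<lambda>p. (a p)\<^sup>2 * (- (a p * d p)) + 1 * (a p * d p))"
    by (simp add: fun_eq_iff fCH_def power2_eq_square power3_eq_cube algebra_simps)
  also have "integral cell \<dots> = integral cell (\<lambda>p. (a p)\<^sup>2 * (- (a p * d p))) + integral cell (\<lambda>p. 1 * (a p * d p))"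
    by (rule integral_add) (intro cell_integrable continuous_intros CP_cont a d)+
  finally have 1: "- integral cell (\<lambda>p. fCH (a p) * d p) = integral cell (\<lambda>p. (a p)\<^sup>2 * (- (a p * d p))) + integral cell (\<lambda>p. 1 * (a p * d p))" .
  have 2: "integral cell (\<lambda>p. (a p)\<^sup>2 * (- (a p * d p))) \<le> sqrt (integral cell (\<lambda>p. ((a p)\<^sup>2)\<^sup>2)) * sqrt (integral cell (\<lambda>p. (- (a p * d p))\<^sup>2))"
    by (rule integral_cauchy_schwarz_sqrt[of "\<lambda>p. (a p)\<^sup>2" "\<lambda>p. - (a p * d p)"]) (intro continuous_intros CP_cont a d)+
  have 3: "integral cell (\<lambda>p. 1 * (a p * d p)) \<le> sqrt (integral cell (\<lambda>p. 1\<^sup>2)) * sqrt (integral cell (\<lambda>p. (a p * d p)\<^sup>2))"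
    by (rule integral_cauchy_schwarz_sqrt[of "\<lambda>p. 1" "\<lambda>p. a p * d p"]) (intro continuous_intros CP_cont a d)+
  show ?thesis
    using add_mono[OF 2 3] unfolding 1[symmetric]
    by (simp only: pow4_eq power2_minus one_power2 integral_cell_const real_scaleR_def mult_1_right)
qed

text \<open>The hypothesis \<open>int\<close> is supplied by the Ladyzhenskaya inequality with Young's inequality, or by
  Bernstein's inequality on \<open>XN N\<close>; \<open>\<kappa>\<close> will be \<open>max 1 (1 / (N \<nu>))\<close>.\<close>

lemma energy_step_algebra:
  fixes G \<kappa> \<epsilon> Y ga \<alpha> \<delta> m :: real
  assumes "\<kappa> \<ge> 1" "G \<ge> tvol" and Y0: "Y \<ge> 0" and e0: "\<epsilon> \<ge> 0"
    and ga: "ga \<le> G * \<kappa>\<^sup>2" and \<alpha>: "0 \<le> \<alpha>" "\<alpha> \<le> G * \<kappa>\<^sup>2" and \<delta>: "0 \<le> \<delta>"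
    and int: "\<kappa> * sqrt \<delta> \<le> 3 * \<epsilon> * Y"
    and m: "0 \<le> m" "m \<le> sqrt \<alpha> * sqrt \<delta>"
    and tst: "Y / 2 \<le> ga + sqrt \<alpha> * sqrt m + sqrt tvol * sqrt m"
    and small: "24 * (sqrt G * \<epsilon>) \<le> 1"
  shows "2 * m + 3/4 * \<delta> \<le> Y / 2"
proof -
  have G0: "G \<ge> 0" using assms(2) tvol_pos by linarith
  define g where "g = sqrt G"
  have g: "g \<ge> 0" "g * g = G" using G0 by (auto simp: g_def)
  have sa: "sqrt \<alpha> \<le> g * \<kappa>" using real_sqrt_le_mono[OF \<alpha>(2)] assms(1) by (simp add: real_sqrt_mult g_def)
  have ge: "g * \<epsilon> \<le> 1/24" using small by (simp add: g_def)
  have ge0: "0 \<le> g * \<epsilon>" using g e0 by simp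
  \<comment> \<open>Linear in \<open>Y\<close>, and the coefficient
    \<open>3 * (g * \<epsilon>)\<close> is at most \<open>1/8\<close>.\<close>
  have m1: "m \<le> 3 * (g * \<epsilon>) * Y"
  proof -
    have "m \<le> (g * \<kappa>) * sqrt \<delta>" using m(2) mult_right_mono[OF sa, of "sqrt \<delta>"] \<delta> by simp
    also have "\<dots> = g * (\<kappa> * sqrt \<delta>)" by simp
    also have "\<dots> \<le> g * (3 * \<epsilon> * Y)" using int g by (intro mult_left_mono)
    finally show ?thesis by (simp add: mult_ac)
  qed
  have m2: "m \<le> Y / 8" using m1 mult_right_mono[OF ge Y0] by simp
  have am: "x * sqrt m \<le> x\<^sup>2 / 2 + m / 2" for x
    using zero_le_power2[of "x - sqrt m"] m(1) by (simp add: power2_diff)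
  have "sqrt \<alpha> * sqrt m \<le> \<alpha> / 2 + m / 2" "sqrt tvol * sqrt m \<le> tvol / 2 + m / 2"
    using am[of "sqrt \<alpha>"] am[of "sqrt tvol"] \<alpha> by simp_all
  then have "Y / 2 \<le> G * \<kappa>\<^sup>2 + G * \<kappa>\<^sup>2 / 2 + tvol / 2 + Y / 8" using tst ga \<alpha>(2) m2 by linarith
  moreover have "tvol \<le> G * \<kappa>\<^sup>2" using assms(1,2) mult_left_mono[of 1 "\<kappa>\<^sup>2" G] G0 by simp
  \<comment> \<open>An a priori bound on the increment, from the tested scheme. It is needed because
    \<open>\<delta>\<close> is controlled only quadratically in \<open>Y\<close>: one factor
    \<open>Y\<close> is replaced by this bound, whose \<open>\<kappa>\<^sup>2\<close> cancels the
    one on the left.\<close>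
  ultimately have Y1: "Y \<le> 8 * (G * \<kappa>\<^sup>2)" using tvol_pos by linarith
  have "\<kappa>\<^sup>2 * \<delta> = (\<kappa> * sqrt \<delta>)\<^sup>2" using \<delta> by (simp add: power_mult_distrib)
  also have "\<dots> \<le> (3 * \<epsilon> * Y)\<^sup>2" using int assms(1) \<delta> by (intro power_mono) auto
  also have "\<dots> = 9 * \<epsilon>\<^sup>2 * Y * Y" by (simp add: power2_eq_square)
  also have "\<dots> \<le> 9 * \<epsilon>\<^sup>2 * Y * (8 * (G * \<kappa>\<^sup>2))" using Y1 Y0 by (intro mult_left_mono) auto
  also have "\<dots> = \<kappa>\<^sup>2 * (72 * (g * \<epsilon>)\<^sup>2 * Y)" by (simp add: power2_eq_square g(2)[symmetric])
  finally have "\<delta> \<le> 72 * (g * \<epsilon>)\<^sup>2 * Y" using assms(1) by simp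
  also have "\<dots> \<le> 72 * (1/24)\<^sup>2 * Y" using ge ge0 Y0 by (intro mult_right_mono mult_left_mono power_mono) auto
  finally have "\<delta> \<le> Y / 8" by (simp add: power2_eq_square)
  then show ?thesis using m2 Y0 by linarith
qed

lemma bernstein_grad:
  assumes "d \<in> XN N"
  shows "gradsq d \<le> (real N)\<^sup>2 * integral cell (\<lambda>p. (d p)\<^sup>2)"
proof -
  have "tvol * gradsq d = (\<Sum>k\<in>DN N. ksq k * (cmod (fourier d k))\<^sup>2)" by (rule parseval_grad_XN[OF assms, symmetric])
  also have "\<dots> \<le> (\<Sum>k\<in>DN N. (real N)\<^sup>2 * (cmod (fourier d k))\<^sup>2)"
    by (intro sum_mono mult_right_mono) (auto simp: DN_def)
  also have "\<dots> = tvol * ((real N)\<^sup>2 * integral cell (\<lambda>p. (d p)\<^sup>2))"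
    by (simp add: sum_distrib_left[symmetric] parseval_XN_sq[OF assms])
  finally show ?thesis by simp
qed

text \<open>Everything is compared with the dissipation \<open>Y\<close>, half of which must pay for
  the quartic increment terms. \<open>\<epsilon>\<close> is small because \<open>A \<nu>\<close> is
  large relative to \<open>G\<close>; 576 is the square of the 24 demanded by
  \<open>energy_step_algebra\<close>. The energy bound carries \<open>\<kappa>\<^sup>2\<close>, so
  the interpolation estimate has to gain a factor \<open>\<kappa>\<close>.\<close>

lemma energy_step:
  assumes a: "a \<in> XN N" and b: "b \<in> XN N" and \<tau>: "\<tau> > 0" and \<nu>: "\<nu> > 0" and A: "A > 0" and N: "N \<ge> 1"
    and a0: "fourier a 0 = 0" and b0: "fourier b 0 = 0"
    and step: "\<And>k. k \<in> DN N \<Longrightarrow> (fourier b k - fourier a k) / of_real \<tau> =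
      - of_real \<nu> * (of_real (ksq k))\<^sup>2 * fourier b k - of_real A * of_real (ksq k) * (fourier b k - fourier a k)
      - of_real (ksq k) * fourier (\<lambda>p. fCH (a p)) k"
    and en: "energy \<nu> a \<le> G1 * (max 1 (1 / (real N * \<nu>)))\<^sup>2"
    and G: "8 * G1 + 2 * tvol \<le> G" and G1: "G1 \<ge> 0" and A\<nu>: "576 * G \<le> A * \<nu>" "1 \<le> A * \<nu>"
  shows "energy \<nu> b \<le> energy \<nu> a"
proof -
  define \<kappa> where "\<kappa> = max 1 (1 / (real N * \<nu>))"
  define d where "d = (\<lambda>p. b p - a p)"
  define n where "n = integral cell (\<lambda>p. (d p)\<^sup>2)"
  define Y where "Y = A * n + \<nu> * gradsq d"
  define \<epsilon> where "\<epsilon> = 1 / sqrt (A * \<nu>)"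
  have d: "d \<in> XN N" unfolding d_def by (rule XN_diff[OF b a])
  note cp = CP_XN[OF a] CP_XN[OF b] CP_XN[OF d]
  have fd0: "fourier d 0 = 0" unfolding d_def fourier_diff[OF cp(2,1)] by (simp add: a0 b0)
  have lad: "integral cell (\<lambda>p. (d p) ^ 4) \<le> 9 * n * gradsq d"
    unfolding n_def by (rule ladyzhenskaya[OF periodic2_XN[OF d] Ck_XN[OF d] fd0])
  have D0: "gradsq d \<ge> 0" and ga0: "gradsq a \<ge> 0" by (intro gradsq_nonneg periodic2_XN[OF d] Ck_XN[OF d] periodic2_XN[OF a] Ck_XN[OF a])+
  have n0: "n \<ge> 0" unfolding n_def by (rule integral_sq_nonneg[OF cp(3)])
  have \<kappa>1: "\<kappa> \<ge> 1" by (simp add: \<kappa>_def)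
  have \<kappa>2: "\<kappa>\<^sup>2 \<ge> 1" using \<kappa>1 by simp
  have sA: "sqrt (A * \<nu>) \<ge> 1" using A\<nu>(2) by simp
  have Ea: "energy \<nu> a = \<nu> / 2 * gradsq a + 1/4 * integral cell (\<lambda>p. ((a p)\<^sup>2 - 1)\<^sup>2)"
    by (rule energy_eq[OF periodic2_XN[OF a] Ck_XN[OF a]])
  have Eb: "energy \<nu> b = \<nu> / 2 * gradsq b + 1/4 * integral cell (\<lambda>p. ((b p)\<^sup>2 - 1)\<^sup>2)"
    by (rule energy_eq[OF periodic2_XN[OF b] Ck_XN[OF b]])
  have pa0: "integral cell (\<lambda>p. ((a p)\<^sup>2 - 1)\<^sup>2) \<ge> 0" by (rule potential_nonneg[OF cp(1)])
  have va0: "\<nu> / 2 * gradsq a \<ge> 0" using \<nu> ga0 by simp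
  have GG: "G1 * \<kappa>\<^sup>2 \<le> G * \<kappa>\<^sup>2" 
  proof (rule mult_right_mono)
    show "G1 \<le> G" using G G1 tvol_pos by linarith
  qed simp
  have step': "\<nu> / 2 * gradsq b - \<nu> / 2 * gradsq a + \<nu> / 2 * gradsq d + A * n + integral cell (\<lambda>p. fCH (a p) * d p) \<le> 0"
    unfolding n_def d_def by (rule scheme_step_inequality[OF a b \<tau> a0 b0 step])
  have gb0: "\<nu> / 2 * gradsq b \<ge> 0" using \<nu> gradsq_nonneg[OF periodic2_XN[OF b] Ck_XN[OF b]] by simp
  \<comment> \<open>For \<open>N \<nu> \<ge> 1\<close> this is Young's inequality with
    \<open>\<kappa> = 1\<close>. Otherwise Bernstein's inequality costs a factor \<open>N\<close>,
    which \<open>\<kappa> = 1 / (N \<nu>)\<close> cancels, leaving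
    \<open>n / \<nu> = (A n) / (A \<nu>)\<close>; and \<open>A \<nu> \<ge> 1\<close> gives
    \<open>1 / (A \<nu>) \<le> \<epsilon>\<close>.\<close>
  have nd: "\<kappa> * (sqrt n * sqrt (gradsq d)) \<le> \<epsilon> * Y"
  proof (cases "1 / (real N * \<nu>) \<le> 1")
    case True
    then have "\<kappa> = 1" by (simp add: \<kappa>_def)
    have "2 * (sqrt (A * n) * sqrt (\<nu> * gradsq d)) \<le> A * n + \<nu> * gradsq d"
      using zero_le_power2[of "sqrt (A * n) - sqrt (\<nu> * gradsq d)"] A \<nu> n0 D0 by (simp add: power2_diff)
    then have "2 * (sqrt (A * \<nu>) * (sqrt n * sqrt (gradsq d))) \<le> Y" by (simp add: Y_def real_sqrt_mult mult_ac)
    moreover have "0 \<le> sqrt (A * \<nu>) * (sqrt n * sqrt (gradsq d))" using n0 D0 A \<nu> by simp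
    ultimately have "sqrt (A * \<nu>) * (sqrt n * sqrt (gradsq d)) \<le> Y" by linarith
    then show ?thesis using sA \<open>\<kappa> = 1\<close> by (simp add: \<epsilon>_def field_simps)
  next
    case False
    then have k: "\<kappa> = 1 / (real N * \<nu>)" by (simp add: \<kappa>_def)
    have "sqrt (gradsq d) \<le> real N * sqrt n"
      using real_sqrt_le_mono[OF bernstein_grad[OF d]] by (simp add: real_sqrt_mult n_def)
    then have "sqrt n * sqrt (gradsq d) \<le> sqrt n * (real N * sqrt n)" using n0 by (intro mult_left_mono) auto
    also have "\<dots> = real N * n" using n0 by simp
    finally have "\<kappa> * (sqrt n * sqrt (gradsq d)) \<le> \<kappa> * (real N * n)" using \<kappa>1 by (intro mult_left_mono) auto
    also have "\<dots> = n / \<nu>" using N \<nu> by (simp add: k)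
    also have "\<dots> = (1 / (sqrt (A * \<nu>) * sqrt (A * \<nu>))) * (A * n)" using A \<nu> by simp
    also have "\<dots> \<le> \<epsilon> * (A * n)"
    proof (rule mult_right_mono)
      show "1 / (sqrt (A * \<nu>) * sqrt (A * \<nu>)) \<le> \<epsilon>"
        unfolding \<epsilon>_def using sA by (intro divide_left_mono) (auto simp del: real_sqrt_mult_self intro!: mult_pos_pos)
    qed (use A n0 in simp)
    also have "\<dots> \<le> \<epsilon> * Y" unfolding Y_def using sA \<nu> D0 by (intro mult_left_mono) (auto simp: \<epsilon>_def)
    finally show ?thesis .
  qed
  have m_le: "integral cell (\<lambda>p. (a p * d p)\<^sup>2) \<le> sqrt (integral cell (\<lambda>p. (a p) ^ 4)) * sqrt (integral cell (\<lambda>p. (d p) ^ 4))"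
    unfolding pow4_eq power_mult_distrib
    by (rule integral_cauchy_schwarz_sqrt[of "\<lambda>p. (a p)\<^sup>2" "\<lambda>p. (d p)\<^sup>2"]) (intro continuous_intros CP_cont cp)+
  have "2 * integral cell (\<lambda>p. (a p * d p)\<^sup>2) + 3/4 * integral cell (\<lambda>p. (d p) ^ 4) \<le> Y / 2"
  proof (rule energy_step_algebra[of \<kappa> G Y \<epsilon> "\<nu> / 2 * gradsq a" "integral cell (\<lambda>p. (a p) ^ 4)"])
    show "tvol \<le> G" using G G1 tvol_pos by linarith
    show "0 \<le> Y" using A \<nu> n0 D0 by (simp add: Y_def)
    show "0 \<le> \<epsilon>" using sA by (simp add: \<epsilon>_def)
    show "\<nu> / 2 * gradsq a \<le> G * \<kappa>\<^sup>2" using en GG pa0 Ea unfolding \<kappa>_def[symmetric] by linarith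
    show "integral cell (\<lambda>p. (a p) ^ 4) \<le> G * \<kappa>\<^sup>2"
    proof -
      have "integral cell (\<lambda>p. (a p) ^ 4) \<le> 8 * energy \<nu> a + 2 * tvol"
        using integral_pow4_le[OF cp(1)] Ea va0 by linarith
      also have "\<dots> \<le> 8 * (G1 * \<kappa>\<^sup>2) + 2 * tvol * \<kappa>\<^sup>2"
      proof -
        have "2 * tvol * 1 \<le> 2 * tvol * \<kappa>\<^sup>2" by (intro mult_left_mono \<kappa>2) simp
        then show ?thesis using en unfolding \<kappa>_def[symmetric] by linarith
      qed
      also have "\<dots> = (8 * G1 + 2 * tvol) * \<kappa>\<^sup>2" by (simp add: algebra_simps)
      also have "\<dots> \<le> G * \<kappa>\<^sup>2" using G by (intro mult_right_mono) auto
      finally show ?thesis .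
    qed
    show "\<kappa> * sqrt (integral cell (\<lambda>p. (d p) ^ 4)) \<le> 3 * \<epsilon> * Y"
    proof -
      have "sqrt (integral cell (\<lambda>p. (d p) ^ 4)) \<le> sqrt (9 * n * gradsq d)" using lad by simp
      also have "\<dots> = 3 * (sqrt n * sqrt (gradsq d))" by (simp add: real_sqrt_mult)
      finally have "\<kappa> * sqrt (integral cell (\<lambda>p. (d p) ^ 4)) \<le> \<kappa> * (3 * (sqrt n * sqrt (gradsq d)))"
        using \<kappa>1 by (intro mult_left_mono) auto
      then show ?thesis using nd by simp
    qed
    show "Y / 2 \<le> \<nu> / 2 * gradsq a + sqrt (integral cell (\<lambda>p. (a p) ^ 4)) * sqrt (integral cell (\<lambda>p. (a p * d p)\<^sup>2))
       + sqrt tvol * sqrt (integral cell (\<lambda>p. (a p * d p)\<^sup>2))"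
    proof -
      have "Y / 2 \<le> \<nu> / 2 * gradsq d + A * n" using A n0 unfolding Y_def by (simp add: field_simps)
      then show ?thesis using step' gb0 fCH_test_bound[OF cp(1,3)] by linarith
    qed
    show "24 * (sqrt G * \<epsilon>) \<le> 1"
    proof -
      have "sqrt (576 * G) \<le> sqrt (A * \<nu>)" using A\<nu>(1) by simp
      moreover have "sqrt 576 = (24::real)" by (rule real_sqrt_unique) auto
      ultimately have "24 * sqrt G \<le> sqrt (A * \<nu>)" by (simp add: real_sqrt_mult)
      then show ?thesis using sA by (simp add: \<epsilon>_def field_simps)
    qed
  qed (use \<kappa>1 integral_pow4_nonneg[OF cp(1)] integral_pow4_nonneg[OF cp(3)] m_le integral_sq_nonneg[OF CP_mult[OF cp(1,3)]] in auto)
  moreover have "1/4 * integral cell (\<lambda>p. ((b p)\<^sup>2 - 1)\<^sup>2) \<le> 1/4 * integral cell (\<lambda>p. ((a p)\<^sup>2 - 1)\<^sup>2)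
     + integral cell (\<lambda>p. fCH (a p) * d p) + 2 * integral cell (\<lambda>p. (a p * d p)\<^sup>2) + 3/4 * integral cell (\<lambda>p. (d p) ^ 4)"
    using potential_increment[OF cp(1,3)] by (simp add: d_def)
  moreover have "Y / 2 \<le> \<nu> / 2 * gradsq d + A * n" using A n0 unfolding Y_def by (simp add: field_simps)
  ultimately show ?thesis unfolding Ea Eb using step' by linarith
qed

section \<open>The scheme in Fourier coefficients and the stability theorem\<close>

lemma scheme_fourier:
  assumes sch: "is_scheme \<nu> N \<tau> A u0 U" and u0: "CP u0"
  shows "U n \<in> XN N" "fourier (U 0) k = (if k \<in> DN N then fourier u0 k else 0)"
    "k \<in> DN N \<Longrightarrow> (fourier (U (Suc n)) k - fourier (U n) k) / of_real \<tau> =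
      - of_real \<nu> * (of_real (ksq k))\<^sup>2 * fourier (U (Suc n)) k
      - of_real A * of_real (ksq k) * (fourier (U (Suc n)) k - fourier (U n) k)
      - of_real (ksq k) * fourier (\<lambda>p. fCH (U n p)) k"
proof -
  show X: "U n \<in> XN N" for n using sch by (simp add: is_scheme_def)
  show "fourier (U 0) k = (if k \<in> DN N then fourier u0 k else 0)"
    using sch by (simp add: is_scheme_def PiN_eq[OF u0] fourier_tp_DN[OF u0])
  assume k: "k \<in> DN N"
  let ?a = "U n" and ?b = "U (Suc n)"
  let ?d = "\<lambda>q. ?b q - ?a q" and ?f = "PiN N (\<lambda>q. fCH (?a q))"
  have d: "?d \<in> XN N" by (rule XN_diff[OF X X])
  have cf: "CP (\<lambda>q. fCH (?a q))" by (rule CP_fCH[OF CP_XN[OF X]])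
  have f: "?f \<in> XN N" unfolding PiN_eq[OF cf] by simp
  have ll: "lap ?b \<in> XN N" "lap (lap ?b) \<in> XN N" "lap ?d \<in> XN N" "lap ?f \<in> XN N"
    by (intro lap_XN X d f)+
  note c = CP_XN[OF ll(2)] CP_XN[OF ll(3)] CP_XN[OF ll(4)]
  have eq: "(\<lambda>p. (1 / \<tau>) * (?b p - ?a p)) = (\<lambda>p. (- \<nu> * lap (lap ?b) p + A * lap ?d p) + lap ?f p)"
    using sch by (simp add: is_scheme_def fun_eq_iff)
  have "fourier (\<lambda>p. (1 / \<tau>) * (?b p - ?a p)) k = of_real (1 / \<tau>) * (fourier ?b k - fourier ?a k)"
    by (simp only: fourier_cmult[OF CP_XN[OF d]] fourier_diff[OF CP_XN[OF X] CP_XN[OF X]])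
  moreover have "fourier (\<lambda>p. (- \<nu> * lap (lap ?b) p + A * lap ?d p) + lap ?f p) k
      = (of_real (- \<nu>) * fourier (lap (lap ?b)) k + of_real A * fourier (lap ?d) k) + fourier (lap ?f) k"
    by (simp only: fourier_add[OF CP_add[OF CP_cmult[OF c(1)] CP_cmult[OF c(2)]] c(3)]
        fourier_add[OF CP_cmult[OF c(1)] CP_cmult[OF c(2)]] fourier_cmult[OF c(1)] fourier_cmult[OF c(2)])
  ultimately have "of_real (1 / \<tau>) * (fourier ?b k - fourier ?a k)
      = (of_real (- \<nu>) * fourier (lap (lap ?b)) k + of_real A * fourier (lap ?d) k) + fourier (lap ?f) k"
    using eq by simp
  moreover have "fourier (lap (lap ?b)) k = (of_real (ksq k))\<^sup>2 * fourier ?b k"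
    by (simp add: fourier_lap_XN[OF ll(1)] fourier_lap_XN[OF X] power2_eq_square)
  moreover have "fourier (lap ?d) k = - of_real (ksq k) * (fourier ?b k - fourier ?a k)"
    by (simp only: fourier_lap_XN[OF d] fourier_diff[OF CP_XN[OF X] CP_XN[OF X]])
  moreover have "fourier (lap ?f) k = - of_real (ksq k) * fourier (\<lambda>q. fCH (?a q)) k"
    unfolding fourier_lap_XN[OF f] unfolding PiN_eq[OF cf] fourier_tp_DN[OF cf] using k by simp
  ultimately show "(fourier ?b k - fourier ?a k) / of_real \<tau> =
      - of_real \<nu> * (of_real (ksq k))\<^sup>2 * fourier ?b k - of_real A * of_real (ksq k) * (fourier ?b k - fourier ?a k)
      - of_real (ksq k) * fourier (\<lambda>p. fCH (?a p)) k"
    by (simp add: divide_inverse algebra_simps)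
qed

lemma zero_in_DN [simp]: "0 \<in> DN N"
  by (simp add: DN_def)

lemma scheme_mean:
  assumes sch: "is_scheme \<nu> N \<tau> A u0 U" and u0: "CP u0" "fourier u0 0 = 0" and \<tau>: "\<tau> > 0"
  shows "fourier (U n) 0 = 0"
proof (induction n)
  case 0
  then show ?case using scheme_fourier(2)[OF sch u0(1), of 0] u0(2) by simp
next
  case (Suc n)
  then show ?case using scheme_fourier(3)[OF sch u0(1) zero_in_DN, of n] \<tau> by simp
qed

definition Gen :: "real \<Rightarrow> real" where
  "Gen E = 17 * E + 72 * E\<^sup>2 + 5 * tvol"

text \<open>\<open>2304 = 4 * 576\<close>: the factor 4 makes up for
  \<open>\<beta> / 4 \<le> A \<nu>\<close>, and the summand 4 ensures
  \<open>A \<nu> \<ge> 1\<close>. With the absolute value the lower bound 4 holds for every real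
  argument.\<close>

definition betac :: "real \<Rightarrow> real" where
  "betac E = 2304 * (8 * Gen \<bar>E\<bar> + 2 * tvol) + 4"

lemma Gen_nonneg: "E \<ge> 0 \<Longrightarrow> Gen E \<ge> 0"
  by (simp add: Gen_def)

lemma betac_ge: "betac E \<ge> 4"
  using Gen_nonneg[OF abs_ge_zero[of E]] unfolding betac_def by simp

text \<open>If \<open>\<nu> \<ge> 1/4\<close>, the summand 1 in the hypothesis contributes enough;
  otherwise \<open>ln \<nu> \<le> \<nu> - 1\<close> forces \<open>(ln \<nu>)^2 \<ge> 9/16\<close>,
  so the logarithmic summand does.\<close>

lemma stabilizer_bound:
  fixes \<beta> \<nu> A m :: real
  assumes \<nu>: "\<nu> > 0" and \<beta>: "\<beta> \<ge> 0" and A: "A \<ge> \<beta> * (m\<^sup>2 + \<bar>ln \<nu>\<bar>\<^sup>2 / \<nu> + 1)"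
  shows "\<beta> / 4 \<le> A * \<nu>" "\<beta> \<le> A"
proof -
  have "\<beta> * (m\<^sup>2 + \<bar>ln \<nu>\<bar>\<^sup>2 / \<nu> + 1) \<ge> \<beta> * 1"
    using \<nu> \<beta> by (intro mult_left_mono) auto
  then show "\<beta> \<le> A" using A by simp
  have "1/4 \<le> (ln \<nu>)\<^sup>2 + \<nu>"
  proof (cases "\<nu> \<ge> 1/4")
    case True
    then show ?thesis using zero_le_power2[of "ln \<nu>"] by linarith
  next
    case False
    have "ln \<nu> \<le> \<nu> - 1" using \<nu> by (rule ln_le_minus_one)
    then have "ln \<nu> \<le> - (3/4)" using False by linarith
    then have "(3/4)\<^sup>2 \<le> (- ln \<nu>)\<^sup>2" by (intro power_mono) auto
    then show ?thesis using \<nu> by (simp add: power2_eq_square)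
  qed
  also have "\<dots> \<le> (m\<^sup>2 + \<bar>ln \<nu>\<bar>\<^sup>2 / \<nu> + 1) * \<nu>" using \<nu> by (simp add: algebra_simps)
  finally have "\<beta> * (1/4) \<le> \<beta> * ((m\<^sup>2 + \<bar>ln \<nu>\<bar>\<^sup>2 / \<nu> + 1) * \<nu>)" using \<beta> by (rule mult_left_mono)
  also have "\<dots> \<le> A * \<nu>" using mult_right_mono[OF A, of \<nu>] \<nu> by simp
  finally show "\<beta> / 4 \<le> A * \<nu>" by simp
qed

text \<open>\<open>energy_step\<close> presupposes the energy bound at step \<open>n\<close>, and
  its conclusion hands the bound on to the next step; so the bound is proved by induction, and
  monotonicity follows from it.\<close>

theorem energy_stability:
  assumes \<nu>: "\<nu> > 0" and adm: "admissible_data s u0" and N: "N \<ge> 1" and \<tau>: "\<tau> > 0"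
    and \<beta>: "\<beta> \<ge> betac (energy \<nu> u0)"
    and A: "A \<ge> \<beta> * ((supnorm u0)\<^sup>2 + \<bar>ln \<nu>\<bar>\<^sup>2 / \<nu> + 1)"
    and sch: "is_scheme \<nu> N \<tau> A u0 U"
  shows "energy \<nu> (U (Suc n)) \<le> energy \<nu> (U n)"
    "energy \<nu> (U n) \<le> Gen (energy \<nu> u0) * (max 1 (1 / (real N * \<nu>)))\<^sup>2"
proof -
  let ?E = "energy \<nu> u0" and ?\<kappa> = "max 1 (1 / (real N * \<nu>))"
  note u0 = admissible_decay(1,2)[OF adm]
  have E0: "?E \<ge> 0" by (rule PiN_energy_bound(2)[OF adm \<nu> N])
  have \<beta>4: "\<beta> \<ge> 4" using \<beta> betac_ge[of ?E] by linarith
  have AA: "\<beta> / 4 \<le> A * \<nu>" "\<beta> \<le> A" using stabilizer_bound[OF \<nu> _ A] \<beta>4 by auto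
  have G: "576 * (8 * Gen ?E + 2 * tvol) \<le> A * \<nu>" "1 \<le> A * \<nu>" "A > 0"
    using AA \<beta> \<beta>4 E0 unfolding betac_def by auto
  have step: "energy \<nu> (U (Suc n)) \<le> energy \<nu> (U n)" if "energy \<nu> (U n) \<le> Gen ?E * ?\<kappa>\<^sup>2" for n
    by (rule energy_step[OF scheme_fourier(1)[OF sch u0(1)] scheme_fourier(1)[OF sch u0(1)] \<tau> \<nu> G(3) N
          scheme_mean[OF sch u0 \<tau>] scheme_mean[OF sch u0 \<tau>] scheme_fourier(3)[OF sch u0(1)] that order_refl Gen_nonneg[OF E0] G(1,2)])
  have bd: "energy \<nu> (U n) \<le> Gen ?E * ?\<kappa>\<^sup>2" for n
  proof (induction n)
    case 0
    have "U 0 = PiN N u0" using sch by (simp add: is_scheme_def)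
    then show ?case using PiN_energy_bound(1)[OF adm \<nu> N] by (simp add: Gen_def)
  next
    case (Suc n)
    then show ?case using step[OF Suc] by linarith
  qed
  show "energy \<nu> (U n) \<le> Gen (energy \<nu> u0) * (max 1 (1 / (real N * \<nu>)))\<^sup>2" by (rule bd)
  show "energy \<nu> (U (Suc n)) \<le> energy \<nu> (U n)" by (rule step[OF bd])
qed

subsection \<open>Fourier coefficients of the exact solution\<close>

lemma continuous_fourier:
  assumes c: "continuous_on (S \<times> UNIV) (\<lambda>(t, p). g t p)" and CP: "\<And>t. t \<in> S \<Longrightarrow> CP (g t)"
  shows "continuous_on S (\<lambda>t. fourier (g t) k)"
proof -
  have "continuous_on (S \<times> cbox (0,0) (2*pi,2*pi)) (\<lambda>(t, p). of_real (g t p) * ep (- k) p)"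
    using continuous_on_subset[OF c, of "S \<times> cbox (0,0) (2*pi,2*pi)"]
    unfolding case_prod_beta' by (intro continuous_intros) auto
  from integral_continuous_on_param[OF this]
  have "continuous_on S (\<lambda>t. integral cell (\<lambda>p. of_real (g t p) * ep (- k) p))" by (simp add: cell_def)
  then show ?thesis by (rule continuous_on_eq) (simp add: fourier_eq[OF CP])
qed

lemma continuous_integral_cell:
  fixes g :: "real \<Rightarrow> real \<times> real \<Rightarrow> real"
  assumes c: "continuous_on (S \<times> UNIV) (\<lambda>(t, p). g t p)"
  shows "continuous_on S (\<lambda>t. integral cell (g t))"
  unfolding cell_def
  by (rule integral_continuous_on_param) (rule continuous_on_subset[OF c], auto)

lemma fourier_has_vector_derivative:
  assumes c: "continuous_on ({0<..} \<times> UNIV) (\<lambda>(t, p). g' t p)"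
    and d: "\<And>t p. t > 0 \<Longrightarrow> ((\<lambda>r. g r p) has_real_derivative g' t p) (at t)"
    and CP: "\<And>t. t > 0 \<Longrightarrow> CP (g t)" and CP': "CP (g' t)" and t: "t > 0"
  shows "((\<lambda>t. fourier (g t) k) has_vector_derivative fourier (g' t) k) (at t)"
proof -
  have "((\<lambda>t. integral (cbox (0,0) (2*pi,2*pi)) (\<lambda>p. of_real (g t p) * ep (- k) p)) has_vector_derivative
      integral (cbox (0,0) (2*pi,2*pi)) (\<lambda>p. of_real (g' t p) * ep (- k) p)) (at t within {0<..})"
  proof (rule leibniz_rule_vector_derivative)
    fix r :: real and p assume "r \<in> {0<..}"
    then have "((\<lambda>r. g r p) has_real_derivative g' r p) (at r within {0<..})"
      using d[of r p] by (auto intro: has_field_derivative_at_within)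
    then have "((\<lambda>r. of_real (g r p) :: complex) has_vector_derivative of_real (g' r p)) (at r within {0<..})"
      by (intro has_vector_derivative_of_real) (simp add: has_real_derivative_iff_has_vector_derivative)
    then show "((\<lambda>r. of_real (g r p) * ep (- k) p) has_vector_derivative of_real (g' r p) * ep (- k) p) (at r within {0<..})"
      by (rule has_vector_derivative_mult_left)
  next
    fix r :: real assume "r \<in> {0<..}"
    then have "CP (g r)" using CP by simp
    then show "(\<lambda>p. of_real (g r p) * ep (- k) p) integrable_on cbox (0,0) (2*pi,2*pi)"
      unfolding cell_def[symmetric] by (intro cell_integrable continuous_intros CP_cont)
  next
    show "continuous_on ({0<..} \<times> cbox (0,0) (2*pi,2*pi)) (\<lambda>(t, p). of_real (g' t p) * ep (- k) p)"
      using continuous_on_subset[OF c, of "{0<..} \<times> cbox (0,0) (2*pi,2*pi)"]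
      unfolding case_prod_beta' by (intro continuous_intros) auto
  qed (use t in auto)
  then have "((\<lambda>t. integral cell (\<lambda>p. of_real (g t p) * ep (- k) p)) has_vector_derivative fourier (g' t) k) (at t within {0<..})"
    unfolding fourier_eq[OF CP'] cell_def .
  then have "((\<lambda>t. fourier (g t) k) has_vector_derivative fourier (g' t) k) (at t within {0<..})"
    by (rule has_vector_derivative_transform[rotated 2]) (use t CP in \<open>auto simp: fourier_eq\<close>)
  then show ?thesis using t by (simp add: at_within_open[of t "{0<..}"])
qed

lemma integral_cell_has_derivative:
  fixes g :: "real \<Rightarrow> real \<times> real \<Rightarrow> real"
  assumes c: "continuous_on ({0<..} \<times> UNIV) (\<lambda>(t, p). g' t p)"
    and d: "\<And>t p. t > 0 \<Longrightarrow> ((\<lambda>r. g r p) has_real_derivative g' t p) (at t)"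
    and CP: "\<And>t. t > 0 \<Longrightarrow> CP (g t)" and t: "t > 0"
  shows "((\<lambda>t. integral cell (g t)) has_real_derivative integral cell (g' t)) (at t)"
proof -
  have "((\<lambda>t. integral (cbox (0,0) (2*pi,2*pi)) (g t)) has_real_derivative
      integral (cbox (0,0) (2*pi,2*pi)) (g' t)) (at t within {0<..})"
  proof (rule leibniz_rule_field_derivative)
    fix r :: real and p assume "r \<in> {0<..}"
    then show "((\<lambda>r. g r p) has_real_derivative g' r p) (at r within {0<..})"
      using d[of r p] by (auto intro: has_field_derivative_at_within)
  next
    fix r :: real assume "r \<in> {0<..}"
    then have "CP (g r)" using CP by simp
    then show "g r integrable_on cbox (0,0) (2*pi,2*pi)"
      unfolding cell_def[symmetric] by (intro cell_integrable CP_cont)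
  next
    show "continuous_on ({0<..} \<times> cbox (0,0) (2*pi,2*pi)) (\<lambda>(t, p). g' t p)"
      by (rule continuous_on_subset[OF c]) auto
  qed (use t in auto)
  then show ?thesis using t by (simp add: at_within_open[of t "{0<..}"] cell_def)
qed

definition ut :: "real \<Rightarrow> (real \<Rightarrow> real \<times> real \<Rightarrow> real) \<Rightarrow> real \<Rightarrow> real \<times> real \<Rightarrow> real" where
  "ut \<nu> u t = lap (\<lambda>q. - \<nu> * lap (u t) q + fCH (u t q))"

text \<open>Nonnegativity of \<open>|\<nu> q x + y|^2 / \<nu>\<close>: half of the dissipation
  absorbs the forcing \<open>y\<close>, the other half remains available.\<close>

lemma mode_young:
  fixes x y :: complex
  assumes \<nu>: "\<nu> > 0"
  shows "2 * Re (cnj x * (- of_real \<nu> * (of_real q)\<^sup>2 * x - of_real q * y)) \<le> - (\<nu> * q\<^sup>2 * (cmod x)\<^sup>2) + (cmod y)\<^sup>2 / \<nu>"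
proof -
  have "Re (cnj x * (- of_real \<nu> * (of_real q)\<^sup>2 * x - of_real q * y)) = - (\<nu> * q\<^sup>2 * (cmod x)\<^sup>2) - q * Re (cnj x * y)"
    unfolding cmod_power2 by (simp add: power2_eq_square algebra_simps)
  moreover have "- (2 * (q * Re (cnj x * y))) \<le> \<nu> * q\<^sup>2 * (cmod x)\<^sup>2 + (cmod y)\<^sup>2 / \<nu>"
  proof -
    have "0 \<le> (cmod (of_real (\<nu> * q) * x + y))\<^sup>2 / \<nu>" using \<nu> by simp
    also have "(cmod (of_real (\<nu> * q) * x + y))\<^sup>2 = (\<nu> * q)\<^sup>2 * (cmod x)\<^sup>2 + 2 * \<nu> * q * Re (cnj x * y) + (cmod y)\<^sup>2"
      unfolding cmod_power2 by (simp add: power2_eq_square algebra_simps)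
    also have "\<dots> / \<nu> = \<nu> * q\<^sup>2 * (cmod x)\<^sup>2 + 2 * (q * Re (cnj x * y)) + (cmod y)\<^sup>2 / \<nu>"
      using \<nu> by (simp add: add_divide_distrib power2_eq_square)
    finally show ?thesis by linarith
  qed
  ultimately show ?thesis by linarith
qed

lemma cmod_power2_has_derivative:
  assumes "(f has_vector_derivative D) (at r)"
  shows "((\<lambda>r. (cmod (f r))\<^sup>2) has_real_derivative 2 * Re (cnj (f r) * D)) (at r)"
proof -
  have "((\<lambda>r. Re (f r)) has_real_derivative Re D) (at r)" "((\<lambda>r. Im (f r)) has_real_derivative Im D) (at r)"
    using bounded_linear.has_vector_derivative[OF bounded_linear_Re assms]
      bounded_linear.has_vector_derivative[OF bounded_linear_Im assms]
    by (simp_all add: has_real_derivative_iff_has_vector_derivative)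
  from DERIV_add[OF DERIV_power[OF this(1), of 2] DERIV_power[OF this(2), of 2]] show ?thesis
    unfolding cmod_power2 by (rule DERIV_cong) (simp add: algebra_simps)
qed

text \<open>The equation is available for positive times only; at time 0 there is just continuity.
  Statements that include \<open>t = 0\<close> are therefore derived for Fourier coefficients, which
  are continuous up to 0.\<close>

locale CH_solution =
  fixes \<nu> :: real and u0 :: "real \<times> real \<Rightarrow> real" and u :: "real \<Rightarrow> real \<times> real \<Rightarrow> real"
  assumes \<nu>: "\<nu> > 0" and u0_CP: "CP u0" and u0_mean: "fourier u0 0 = 0" and sol: "is_CH_solution \<nu> u0 u"
begin

abbreviation "c k t \<equiv> fourier (u t) k"
abbreviation "\<phi> k t \<equiv> fourier (\<lambda>p. fCH (u t p)) k"

text \<open>Right-hand side of the ordinary differential equation of the \<open>k\<close>-th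
  coefficient. The formula makes sense at \<open>t = 0\<close> and is continuous there, although
  \<open>u\<close> is not assumed differentiable in time at 0.\<close>

definition "pk k t = - of_real \<nu> * (of_real (ksq k))\<^sup>2 * c k t - of_real (ksq k) * \<phi> k t"

lemma u_0: "u 0 = u0" using sol by (simp add: is_CH_solution_def)

lemma u_cont: "continuous_on ({0..} \<times> UNIV) (\<lambda>(t, p). u t p)" using sol by (simp add: is_CH_solution_def)

lemma u_CP: "t \<ge> 0 \<Longrightarrow> CP (u t)"
proof -
  assume t: "t \<ge> 0"
  have "continuous_on UNIV (\<lambda>p. case (t, p) of (t, p) \<Rightarrow> u t p)"
    by (rule continuous_on_compose2[OF u_cont]) (use t in \<open>auto intro!: continuous_intros\<close>)
  then show ?thesis using sol t by (simp add: is_CH_solution_def CP_def)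
qed

lemma u_Ck: "t > 0 \<Longrightarrow> n \<le> 4 \<Longrightarrow> Ck n (u t)"
  using sol Ck_le[of n 4 "u t"] by (simp add: is_CH_solution_def)

lemma u_per: "t \<ge> 0 \<Longrightarrow> periodic2 (u t)" using sol by (simp add: is_CH_solution_def)

lemma ut_cont: "continuous_on ({0<..} \<times> UNIV) (\<lambda>(t, p). ut \<nu> u t p)"
  using sol by (simp add: is_CH_solution_def ut_def)

lemma ut_deriv: "t > 0 \<Longrightarrow> ((\<lambda>r. u r p) has_real_derivative ut \<nu> u t p) (at t)"
  using sol unfolding is_CH_solution_def ut_def by blast

lemma ut_fourier:
  assumes t: "t > 0"
  shows "CP (ut \<nu> u t)" "fourier (ut \<nu> u t) k = pk k t"
proof -
  have t0: "t \<ge> 0" using t by simp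
  have C4: "Ck (Suc (Suc 2)) (u t)" using u_Ck[OF t, of 4] by (simp add: eval_nat_numeral)
  have C2: "Ck 2 (u t)" by (rule u_Ck[OF t]) simp
  have l: "CP (lap (u t))" "fourier (lap (u t)) k = - of_real (ksq k) * c k t"
    using fourier_lap[OF u_per[OF t0] C2] by auto
  have f: "CP (\<lambda>q. fCH (u t q))" by (rule CP_fCH[OF u_CP[OF t0]])
  let ?m = "\<lambda>q. - \<nu> * lap (u t) q + fCH (u t q)"
  have m: "CP ?m" by (rule CP_add[OF CP_cmult[OF l(1)] f])
  have mC: "Ck 2 ?m" by (rule Ck_add[OF Ck_cmult[OF Ck_lap[OF C4]] Ck_fCH[OF C2]])
  have mp: "periodic2 ?m" using m by (simp add: CP_def)
  have fm: "fourier ?m k = of_real (- \<nu>) * fourier (lap (u t)) k + \<phi> k t"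
    by (simp only: fourier_add[OF CP_cmult[OF l(1)] f] fourier_cmult[OF l(1)])
  show "CP (ut \<nu> u t)" unfolding ut_def by (rule fourier_lap(1)[OF mp mC])
  show "fourier (ut \<nu> u t) k = pk k t"
    unfolding ut_def fourier_lap(2)[OF mp mC] fm l(2) pk_def by (simp add: power2_eq_square algebra_simps)
qed

lemma c_cont: "continuous_on {0..} (c k)"
  by (rule continuous_fourier[OF u_cont]) (simp add: u_CP)

lemma c_deriv: "t > 0 \<Longrightarrow> (c k has_vector_derivative pk k t) (at t)"
  using fourier_has_vector_derivative[OF ut_cont ut_deriv u_CP ut_fourier(1)] ut_fourier(2) by simp

lemma fCH_u_cont: "continuous_on ({0..} \<times> UNIV) (\<lambda>(t, p). fCH (u t p))"
  using u_cont unfolding case_prod_beta' fCH_def by (intro continuous_intros) auto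

lemma \<phi>_cont: "continuous_on {0..} (\<phi> k)"
  by (rule continuous_fourier[OF fCH_u_cont]) (simp add: u_CP CP_fCH)

lemma pk_cont: "continuous_on {0..} (pk k)"
  unfolding pk_def[abs_def] by (intro continuous_intros c_cont \<phi>_cont)

definition "gt t p = (3 * (u t p)\<^sup>2 - 1) * ut \<nu> u t p"

lemma gt_CP: "t > 0 \<Longrightarrow> CP (gt t)"
  unfolding gt_def[abs_def] by (intro CP_mult CP_diff CP_cmult CP_power CP_const u_CP ut_fourier(1)) auto

lemma fCH_u_deriv: "t > 0 \<Longrightarrow> ((\<lambda>r. fCH (u r p)) has_real_derivative gt t p) (at t)"
  unfolding fCH_def gt_def by (auto intro!: derivative_eq_intros ut_deriv simp: algebra_simps power2_eq_square)

lemma u_cont': "continuous_on ({0<..} \<times> UNIV) (\<lambda>x. u (fst x) (snd x))"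
  by (rule continuous_on_subset[OF u_cont[unfolded case_prod_beta']]) auto

lemma gt_cont: "continuous_on ({0<..} \<times> UNIV) (\<lambda>(t, p). gt t p)"
  using u_cont' ut_cont unfolding case_prod_beta' gt_def by (intro continuous_intros) auto

lemma \<phi>_deriv: "t > 0 \<Longrightarrow> (\<phi> k has_vector_derivative fourier (gt t) k) (at t)"
  by (rule fourier_has_vector_derivative[OF gt_cont fCH_u_deriv]) (auto simp: gt_CP CP_fCH u_CP)

lemma c_mean: assumes "t \<ge> 0" shows "c 0 t = 0"
proof -
  have "c 0 t = c 0 0"
  proof (rule has_derivative_zero_unique_strong_interval[of "{0,t}" 0 t "c 0"])
    show "continuous_on {0..t} (c 0)" by (rule continuous_on_subset[OF c_cont]) auto
    fix x assume x: "x \<in> {0..t} - {0, t}"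
    then have "(c 0 has_vector_derivative 0) (at x)" using c_deriv[of x 0] by (simp add: pk_def)
    then show "(c 0 has_derivative (\<lambda>h. 0)) (at x within {0..t})"
      unfolding has_vector_derivative_def by (auto intro: has_derivative_at_withinI)
  qed (use assms in auto)
  then show ?thesis by (simp add: u_0 u0_mean)
qed

text \<open>Duhamel's formula as a comparison of \<open>exp (l * r) * c k r\<close> with
  \<open>B / (\<nu> q) * exp (l * r)\<close>, whose derivative dominates. Since
  \<open>l = \<nu> q^2\<close> and the forcing carries one \<open>q\<close>, it is damped by
  \<open>1 / (\<nu> q)\<close>: two powers of \<open>|k|\<close> are gained.\<close>

lemma c_bound:
  assumes k: "k \<noteq> 0" and t: "t \<ge> 0" and B: "\<And>r. 0 < r \<Longrightarrow> r < t \<Longrightarrow> cmod (\<phi> k r) \<le> B" and B0: "B \<ge> 0"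
  shows "cmod (c k t) \<le> cmod (fourier u0 k) + B / (\<nu> * ksq k)"
proof (cases "t = 0")
  case True
  have "B / (\<nu> * ksq k) \<ge> 0" using B0 \<nu> by simp
  then show ?thesis using True by (simp add: u_0)
next
  case False
  define q where "q = ksq k"
  define l where "l = \<nu> * q\<^sup>2"
  have q: "q > 0" using ksq_ge_1[OF k] by (simp add: q_def)
  have l: "l > 0" using q \<nu> by (simp add: l_def)
  let ?f = "\<lambda>r. exp (l * r) *\<^sub>R c k r" and ?g = "\<lambda>r. B / (\<nu> * q) * exp (l * r)"
  have "norm (?f t - ?f 0) \<le> ?g t - ?g 0"
  proof (rule differentiable_bound_general)
    show "0 < t" using t False by simp
    show "continuous_on {0..t} ?f" by (intro continuous_intros continuous_on_subset[OF c_cont]) auto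
    show "continuous_on {0..t} ?g" by (intro continuous_intros)
    fix r assume r: "0 < r" "r < t"
    have "((\<lambda>r. exp (l * r)) has_real_derivative l * exp (l * r)) (at r)" by (auto intro!: derivative_eq_intros)
    from has_vector_derivative_scaleR[OF this c_deriv[OF r(1)]]
    show "(?f has_vector_derivative exp (l * r) *\<^sub>R pk k r + (l * exp (l * r)) *\<^sub>R c k r) (at r)" by simp
    show "(?g has_vector_derivative B * q * exp (l * r)) (at r)"
      unfolding has_real_derivative_iff_has_vector_derivative[symmetric]
      using q \<nu> by (auto intro!: derivative_eq_intros simp: l_def power2_eq_square)
    have "exp (l * r) *\<^sub>R pk k r + (l * exp (l * r)) *\<^sub>R c k r = - (of_real (exp (l * r) * q) * \<phi> k r)"
      unfolding pk_def q_def[symmetric] l_def by (simp add: scaleR_conv_of_real power2_eq_square algebra_simps exp_of_real)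
    then have "norm (exp (l * r) *\<^sub>R pk k r + (l * exp (l * r)) *\<^sub>R c k r) = exp (l * r) * q * cmod (\<phi> k r)"
      using q by (simp add: norm_mult)
    also have "\<dots> \<le> exp (l * r) * q * B" using q B[OF r] by (intro mult_left_mono) auto
    finally show "norm (exp (l * r) *\<^sub>R pk k r + (l * exp (l * r)) *\<^sub>R c k r) \<le> B * q * exp (l * r)" by (simp add: mult_ac)
  qed
  then have "norm (?f t - c k 0) \<le> B / (\<nu> * q) * exp (l * t) - B / (\<nu> * q)" by simp
  moreover have "norm (?f t) \<le> norm (?f t - c k 0) + norm (c k 0)" using norm_triangle_sub[of "?f t" "c k 0"] by simp
  moreover have "B / (\<nu> * q) \<ge> 0" using B0 \<nu> q by simp
  ultimately have "exp (l * t) * cmod (c k t) \<le> cmod (c k 0) + B / (\<nu> * q) * exp (l * t)" by simp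
  also have "\<dots> \<le> exp (l * t) * cmod (c k 0) + B / (\<nu> * q) * exp (l * t)"
    using l t mult_right_mono[of 1 "exp (l * t)" "cmod (c k 0)"] by simp
  finally have "exp (l * t) * cmod (c k t) \<le> exp (l * t) * (cmod (c k 0) + B / (\<nu> * q))" by (simp add: algebra_simps)
  then show ?thesis by (simp add: u_0 q_def)
qed

lemma mode_ineq:
  "2 * Re (cnj (c k r) * pk k r) \<le> - (\<nu> * (ksq k)\<^sup>2 * (cmod (c k r))\<^sup>2) + (cmod (\<phi> k r))\<^sup>2 / \<nu>"
  unfolding pk_def by (rule mode_young[OF \<nu>])

lemma cmod2_deriv:
  "r > 0 \<Longrightarrow> ((\<lambda>r. (cmod (c k r))\<^sup>2) has_real_derivative 2 * Re (cnj (c k r) * pk k r)) (at r)"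
  by (rule cmod_power2_has_derivative[OF c_deriv])

text \<open>Smoothing turns the weight \<open>|k|^2\<close> into the integrable singularity
  \<open>1 / sqrt (\<nu> (t - r))\<close>, so square integrability of \<open>f(u)\<close> suffices.
  The growth in \<open>T\<close> is harmless, since this bound only serves to justify the energy
  inequality.\<close>

lemma H1_bound_of_sup:
  assumes M: "\<And>r. 0 \<le> r \<Longrightarrow> r \<le> T \<Longrightarrow> integral cell (\<lambda>p. (fCH (u r p))\<^sup>2) \<le> M" and t: "0 \<le> t" "t \<le> T" and F: "finite F"
  shows "(\<Sum>k\<in>F. ksq k * (cmod (c k t))\<^sup>2) \<le> (\<Sum>k\<in>F. ksq k * (cmod (fourier u0 k))\<^sup>2) + 2 * (tvol * M / (\<nu> * sqrt \<nu>)) * sqrt T"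
proof -
  define K where "K = tvol * M / (\<nu> * sqrt \<nu>)"
  define l where "l k = \<nu> * (ksq k)\<^sup>2" for k
  have "0 \<le> integral cell (\<lambda>p. (fCH (u t p))\<^sup>2)" by (rule integral_sq_nonneg[OF CP_fCH[OF u_CP[OF t(1)]]])
  then have M0: "M \<ge> 0" using M[OF t] by linarith
  have K0: "K \<ge> 0" unfolding K_def using M0 \<nu> by simp
  \<comment> \<open>At \<open>r = t\<close> this is the sum to be bounded, at \<open>r = 0\<close> a
    bound by the data. The square root is designed so that its derivative
    \<open>- K / sqrt (t - r)\<close> absorbs the forcing.\<close>
  let ?h = "\<lambda>r. (\<Sum>k\<in>F. ksq k * (exp (- l k * (t - r)) * (cmod (c k r))\<^sup>2)) + 2 * K * sqrt (t - r)"
  have "?h t \<le> ?h 0"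
  proof (rule DERIV_nonpos_imp_decreasing_open[OF t(1)])
    show "continuous_on {0..t} ?h" by (intro continuous_intros continuous_on_subset[OF c_cont]) auto
    fix r assume r: "0 < r" "r < t"
    let ?D = "\<lambda>k. ksq k * (l k * exp (- l k * (t - r)) * (cmod (c k r))\<^sup>2 + 2 * Re (cnj (c k r) * pk k r) * exp (- l k * (t - r)))"
    have e: "((\<lambda>r. exp (- l k * (t - r))) has_real_derivative l k * exp (- l k * (t - r))) (at r)" for k
      by (auto intro!: derivative_eq_intros)
    have s: "((\<lambda>r. 2 * K * sqrt (t - r)) has_real_derivative - (K / sqrt (t - r))) (at r)"
      using r by (auto intro!: derivative_eq_intros simp: field_simps)
    have "(?h has_real_derivative (\<Sum>k\<in>F. ?D k) + - (K / sqrt (t - r))) (at r)"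
      by (intro DERIV_add DERIV_sum DERIV_cmult DERIV_mult e cmod2_deriv r(1) s)
    moreover have "(\<Sum>k\<in>F. ?D k) \<le> K / sqrt (t - r)"
    proof -
      have "?D k \<le> 1 / (\<nu> * sqrt \<nu> * sqrt (t - r)) * (cmod (\<phi> k r))\<^sup>2" for k
      proof -
        have "ksq k * exp (- l k * (t - r)) \<le> 1 / sqrt (\<nu> * (t - r))"
        proof -
          \<comment> \<open>This substitution reduces the smoothing estimate to
            \<open>x exp (-x^2) \<le> 1\<close>.\<close>
          define x where "x = ksq k * sqrt (\<nu> * (t - r))"
          have x2: "x\<^sup>2 = l k * (t - r)" using r \<nu> by (simp add: x_def l_def power_mult_distrib)
          have "x * exp (- (x\<^sup>2)) \<le> 1"
          proof -
            have "x \<le> 1 + x\<^sup>2" using zero_le_power2[of "x - 1/2"] by (simp add: power2_eq_square algebra_simps)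
            also have "\<dots> \<le> exp (x\<^sup>2)" by (rule exp_ge_add_one_self)
            finally show ?thesis by (simp add: exp_minus field_simps)
          qed
          then show ?thesis unfolding x2 unfolding x_def using r \<nu> by (simp add: pos_le_divide_eq mult_ac)
        qed
        then have w: "ksq k * exp (- l k * (t - r)) * ((cmod (\<phi> k r))\<^sup>2 / \<nu>) \<le> 1 / sqrt (\<nu> * (t - r)) * ((cmod (\<phi> k r))\<^sup>2 / \<nu>)"
          using \<nu> by (intro mult_right_mono) auto
        have "?D k = ksq k * exp (- l k * (t - r)) * (l k * (cmod (c k r))\<^sup>2 + 2 * Re (cnj (c k r) * pk k r))"
          by (simp add: algebra_simps)
        also have "\<dots> \<le> ksq k * exp (- l k * (t - r)) * ((cmod (\<phi> k r))\<^sup>2 / \<nu>)"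
          using mode_ineq[of r k] by (intro mult_left_mono) (auto simp: l_def)
        also note w
        finally show ?thesis by (simp add: real_sqrt_mult mult_ac)
      qed
      then have "(\<Sum>k\<in>F. ?D k) \<le> (\<Sum>k\<in>F. 1 / (\<nu> * sqrt \<nu> * sqrt (t - r)) * (cmod (\<phi> k r))\<^sup>2)" by (rule sum_mono)
      also have "\<dots> = 1 / (\<nu> * sqrt \<nu> * sqrt (t - r)) * (\<Sum>k\<in>F. (cmod (\<phi> k r))\<^sup>2)" by (simp add: sum_distrib_left)
      also have "\<dots> \<le> 1 / (\<nu> * sqrt \<nu> * sqrt (t - r)) * (tvol * M)"
      proof (rule mult_left_mono)
        have "(\<Sum>k\<in>F. (cmod (\<phi> k r))\<^sup>2) \<le> tvol * integral cell (\<lambda>p. (fCH (u r p))\<^sup>2)"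
          by (rule bessel[OF CP_fCH[OF u_CP] F]) (use r in simp)
        also have "\<dots> \<le> tvol * M" using M[of r] r t by (intro mult_left_mono) auto
        finally show "(\<Sum>k\<in>F. (cmod (\<phi> k r))\<^sup>2) \<le> tvol * M" .
      qed (use \<nu> r in simp)
      also have "\<dots> = K / sqrt (t - r)" by (simp add: K_def)
      finally show ?thesis .
    qed
    ultimately show "\<exists>y. (?h has_real_derivative y) (at r) \<and> y \<le> 0" by (intro exI conjI) auto
  qed
  then have "(\<Sum>k\<in>F. ksq k * (cmod (c k t))\<^sup>2) \<le> (\<Sum>k\<in>F. ksq k * (exp (- l k * t) * (cmod (c k 0))\<^sup>2)) + 2 * K * sqrt t" by simp
  also have "(\<Sum>k\<in>F. ksq k * (exp (- l k * t) * (cmod (c k 0))\<^sup>2)) \<le> (\<Sum>k\<in>F. ksq k * (1 * (cmod (c k 0))\<^sup>2))"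
    using \<nu> t by (intro sum_mono mult_left_mono mult_right_mono) (auto simp: l_def)
  also have "2 * K * sqrt t \<le> 2 * K * sqrt T" using t K0 by (intro mult_left_mono) auto
  finally show ?thesis by (simp add: K_def u_0)
qed

text \<open>The gradient of \<open>f(u)\<close> is \<open>(3u^2 - 1) grad u\<close>, integrable by
  Cauchy-Schwarz; this gives decay \<open>|k|^(-1)\<close> of \<open>\<phi>\<close>, and Duhamel
  adds \<open>|k|^(-2)\<close>. The total \<open>|k|^(-3)\<close> is \<open>kw (3/2)\<close>, just
  the threshold of the product estimate. \<open>9 B2 + tvol\<close> bounds the integral of
  \<open>(3u^2 - 1)^2\<close>, and \<open>B1 / tvol\<close> the squared gradient norm.\<close>

lemma decay_of_H1:
  assumes t: "t \<ge> 0" and B1: "\<And>r F. 0 < r \<Longrightarrow> r < t \<Longrightarrow> finite F \<Longrightarrow> (\<Sum>k\<in>F. ksq k * (cmod (c k r))\<^sup>2) \<le> B1"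
    and B2: "\<And>r. 0 < r \<Longrightarrow> r < t \<Longrightarrow> integral cell (\<lambda>p. (u r p) ^ 4) \<le> B2" and B0: "B1 \<ge> 0" "B2 \<ge> 0"
  shows "cmod (c k t) \<le> cmod (fourier u0 k) + (4 * sqrt (9 * B2 + tvol) * sqrt (B1 / tvol) / \<nu>) * kw (3/2) k"
proof (cases "k = 0")
  case True
  have "(4 * sqrt (9 * B2 + tvol) * sqrt (B1 / tvol) / \<nu>) * kw (3/2) k \<ge> 0" using \<nu> B0 by (intro mult_nonneg_nonneg divide_nonneg_pos) auto
  then show ?thesis using c_mean[OF t] True by simp
next
  case False
  define D where "D = sqrt (9 * B2 + tvol) * sqrt (B1 / tvol)"
  have D0: "D \<ge> 0" unfolding D_def using B0 by simp
  define q where "q = ksq k"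
  have q: "q \<ge> 1" using ksq_ge_1[OF False] by (simp add: q_def)
  have "cmod (\<phi> k r) \<le> sqrt 2 * D / sqrt q" if r: "0 < r" "r < t" for r
  proof -
    have r0: "r \<ge> 0" using r by simp
    have C1: "Ck 1 (u r)" by (rule u_Ck[OF r(1)]) simp
    note per = u_per[OF r0]
    have f: "Ck 1 (\<lambda>p. fCH (u r p))" "periodic2 (\<lambda>p. fCH (u r p))"
      using Ck_fCH[OF C1] CP_fCH[OF u_CP[OF r0]] by (auto simp: CP_def)
    have diff: "u r differentiable (at p)" for p using C1 by (intro Ck_differentiable[of 0]) simp
    have "tvol * gradsq (u r) \<le> B1"
      by (rule has_sum_le_finite_sums[OF parseval_grad[OF per C1]]) (rule B1[OF r])
    then have gs: "gradsq (u r) \<le> B1 / tvol" by (simp add: pos_le_divide_eq mult.commute)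
    have gs_eq: "gradsq (u r) = integral cell (\<lambda>p. (dx (u r) p)\<^sup>2) + integral cell (\<lambda>p. (dy (u r) p)\<^sup>2)"
      unfolding gradsq_def by (rule integral_add) (intro cell_integrable continuous_intros CP_cont CP_dx[OF per C1] CP_dy[OF per C1])+
    have dxy: "CP (dx (u r))" "CP (dy (u r))" by (rule CP_dx[OF per C1], rule CP_dy[OF per C1])
    have uC: "CP (u r)" by (rule u_CP[OF r0])
    have main: "cmod (fourier (\<lambda>p. (3 * (u r p)\<^sup>2 - 1) * h p) k) \<le> D" if h: "CP h" "integral cell (\<lambda>p. (h p)\<^sup>2) \<le> B1 / tvol" for h
    proof -
      have "cmod (fourier (\<lambda>p. (3 * (u r p)\<^sup>2 - 1) * h p) k) \<le> integral cell (\<lambda>p. \<bar>3 * (u r p)\<^sup>2 - 1\<bar> * \<bar>h p\<bar>)"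
      proof (rule norm_fourier_le)
        show "CP (\<lambda>p. (3 * (u r p)\<^sup>2 - 1) * h p)" by (intro CP_mult CP_diff CP_cmult CP_power CP_const uC h(1))
        then show "CP (\<lambda>p. \<bar>3 * (u r p)\<^sup>2 - 1\<bar> * \<bar>h p\<bar>)"
          unfolding CP_def abs_mult[symmetric] periodic2_def by (auto intro!: continuous_intros)
      qed (simp add: abs_mult)
      also have "\<dots> \<le> sqrt (integral cell (\<lambda>p. \<bar>3 * (u r p)\<^sup>2 - 1\<bar>\<^sup>2)) * sqrt (integral cell (\<lambda>p. \<bar>h p\<bar>\<^sup>2))"
        by (rule integral_cauchy_schwarz_sqrt[of "\<lambda>p. \<bar>3 * (u r p)\<^sup>2 - 1\<bar>" "\<lambda>p. \<bar>h p\<bar>"]) (intro continuous_intros CP_cont uC h(1))+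
      also have "\<dots> \<le> D" unfolding D_def
      proof (rule mult_mono)
        have "integral cell (\<lambda>p. \<bar>3 * (u r p)\<^sup>2 - 1\<bar>\<^sup>2) \<le> integral cell (\<lambda>p. 9 * (u r p) ^ 4 + 1)"
        proof (rule integral_le)
          fix p
          have "(3 * y - 1)\<^sup>2 \<le> 9 * y\<^sup>2 + 1" if "y \<ge> 0" for y :: real using that by (simp add: power2_eq_square algebra_simps)
          from this[of "(u r p)\<^sup>2"] show "\<bar>3 * (u r p)\<^sup>2 - 1\<bar>\<^sup>2 \<le> 9 * (u r p) ^ 4 + 1" unfolding pow4_eq power2_abs by (simp only: zero_le_power2)
        qed (intro cell_integrable continuous_intros CP_cont uC)+
        also have "\<dots> = integral cell (\<lambda>p. 9 * (u r p) ^ 4) + integral cell (\<lambda>p. 1)"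
          by (rule integral_add) (intro cell_integrable continuous_intros CP_cont uC)+
        also have "\<dots> = 9 * integral cell (\<lambda>p. (u r p) ^ 4) + tvol" by simp
        also have "\<dots> \<le> 9 * B2 + tvol" using B2[OF r] by simp
        finally show "sqrt (integral cell (\<lambda>p. \<bar>3 * (u r p)\<^sup>2 - 1\<bar>\<^sup>2)) \<le> sqrt (9 * B2 + tvol)" by simp
        show "sqrt (integral cell (\<lambda>p. \<bar>h p\<bar>\<^sup>2)) \<le> sqrt (B1 / tvol)" using h(2) by simp
        show "0 \<le> sqrt (9 * B2 + tvol)" using B0 by simp
        show "0 \<le> sqrt (integral cell (\<lambda>p. \<bar>h p\<bar>\<^sup>2))" using integral_sq_nonneg[OF h(1)] by simp
      qed
      finally show ?thesis .
    qed
    have ddx: "dx (\<lambda>p. fCH (u r p)) = (\<lambda>p. (3 * (u r p)\<^sup>2 - 1) * dx (u r) p)"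
    proof
      fix p show "dx (\<lambda>p. fCH (u r p)) p = (3 * (u r p)\<^sup>2 - 1) * dx (u r) p"
        by (rule dx_eqI, unfold fCH_def) (use has_dx[OF diff[of p]] in \<open>auto intro!: derivative_eq_intros simp: algebra_simps power2_eq_square\<close>)
    qed
    have ddy: "dy (\<lambda>p. fCH (u r p)) = (\<lambda>p. (3 * (u r p)\<^sup>2 - 1) * dy (u r) p)"
    proof
      fix p show "dy (\<lambda>p. fCH (u r p)) p = (3 * (u r p)\<^sup>2 - 1) * dy (u r) p"
        by (rule dy_eqI, unfold fCH_def) (use has_dy[OF diff[of p]] in \<open>auto intro!: derivative_eq_intros simp: algebra_simps power2_eq_square\<close>)
    qed
    have "cmod (fourier (dx (\<lambda>p. fCH (u r p))) k) \<le> D" unfolding ddx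
      by (rule main[OF dxy(1)]) (use gs gs_eq integral_sq_nonneg[OF dxy(2)] in linarith)
    then have x: "\<bar>real_of_int (fst k)\<bar> * cmod (\<phi> k r) \<le> D" unfolding fourier_dx[OF f(2,1)] by (simp add: norm_mult)
    have "cmod (fourier (dy (\<lambda>p. fCH (u r p))) k) \<le> D" unfolding ddy
      by (rule main[OF dxy(2)]) (use gs gs_eq integral_sq_nonneg[OF dxy(1)] in linarith)
    then have y: "\<bar>real_of_int (snd k)\<bar> * cmod (\<phi> k r) \<le> D" unfolding fourier_dy[OF f(2,1)] by (simp add: norm_mult)
    have "q * (cmod (\<phi> k r))\<^sup>2 = (\<bar>real_of_int (fst k)\<bar> * cmod (\<phi> k r))\<^sup>2 + (\<bar>real_of_int (snd k)\<bar> * cmod (\<phi> k r))\<^sup>2"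
      unfolding q_def ksq_def by (simp add: power_mult_distrib distrib_right)
    also have "\<dots> \<le> D\<^sup>2 + D\<^sup>2" using x y by (intro add_mono power_mono) auto
    finally have "sqrt (q * (cmod (\<phi> k r))\<^sup>2) \<le> sqrt (2 * D\<^sup>2)" by simp
    then have "sqrt q * cmod (\<phi> k r) \<le> sqrt 2 * D" using D0 by (simp add: real_sqrt_mult)
    then show ?thesis using q by (simp add: pos_le_divide_eq mult.commute)
  qed
  from c_bound[OF False t this] D0 q
  have c1: "cmod (c k t) \<le> cmod (fourier u0 k) + sqrt 2 * D / sqrt q / (\<nu> * q)" by (simp add: q_def)
  \<comment> \<open>For \<open>q \<ge> 1\<close>, \<open>(1 + q) powr (3/2)\<close> is at most
    \<open>2 sqrt 2 q sqrt q\<close>; with the \<open>sqrt 2\<close> from combining the two partial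
    derivatives this makes 4.\<close>
  have "sqrt 2 * D / sqrt q / (\<nu> * q) \<le> 4 * D / \<nu> * kw (3/2) k"
  proof -
    have "(1 + q) powr (3/2) \<le> (2 * q) powr (3/2)" using q by (intro powr_mono2) auto
    also have "\<dots> = (2 * q) * sqrt (2 * q)"
    proof -
      have "(2 * q) powr (3/2) = (2 * q) powr (1 + 1/2)" by simp
      also have "\<dots> = (2 * q) powr 1 * (2 * q) powr (1/2)" by (rule powr_add)
      finally show ?thesis using q by (simp add: powr_half_sqrt)
    qed
    also have "\<dots> = 2 * sqrt 2 * (q * sqrt q)" by (simp only: real_sqrt_mult mult_ac)
    finally have le: "(1 + q) powr (3/2) \<le> 2 * sqrt 2 * (q * sqrt q)" .
    have "1 / (q * sqrt q) \<le> 2 * sqrt 2 / (1 + q) powr (3/2)"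
    proof -
      have "q * sqrt q > 0" "(1 + q) powr (3/2) > 0" using q by auto
      then have "(1 + q) powr (3/2) / (q * sqrt q) \<le> 2 * sqrt 2" using le by (simp only: pos_divide_le_eq)
      then show ?thesis using \<open>(1 + q) powr (3/2) > 0\<close> by (simp add: pos_le_divide_eq)
    qed
    also have "\<dots> = 2 * sqrt 2 * kw (3/2) k" unfolding kw_def q_def[symmetric] by (simp only: powr_minus divide_inverse)
    finally have le2: "sqrt 2 * (D / \<nu>) * (1 / (q * sqrt q)) \<le> sqrt 2 * (D / \<nu>) * (2 * sqrt 2 * kw (3/2) k)"
      using D0 \<nu> by (intro mult_left_mono) auto
    have "sqrt 2 * D / sqrt q / (\<nu> * q) = sqrt 2 * (D / \<nu>) * (1 / (q * sqrt q))" by simp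
    moreover have "sqrt 2 * (D / \<nu>) * (2 * sqrt 2 * kw (3/2) k) = (sqrt 2 * sqrt 2) * (2 * (D / \<nu>) * kw (3/2) k)" by (simp only: mult_ac)
    moreover have "\<dots> = 4 * D / \<nu> * kw (3/2) k" by simp
    ultimately show ?thesis using le2 by linarith
  qed
  then have "cmod (c k t) \<le> cmod (fourier u0 k) + 4 * D / \<nu> * kw (3/2) k" using c1 by linarith
  then show ?thesis unfolding D_def by (simp only: mult.assoc)
qed

text \<open>The cubic nonlinearity preserves decay \<open>kw q\<close>, and Duhamel gains one more
  unit of \<open>q\<close>; \<open>1 / |k|^2 \<le> 2 / (1 + |k|^2)\<close> accounts for the 2. The
  data enter through their own coefficient instead of a decay bound, so that their weighted square
  summability is not lost.\<close>

lemma decay_step: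
  assumes q: "q \<ge> 3/2" and t: "t \<ge> 0" and C: "\<And>r k. 0 < r \<Longrightarrow> r < t \<Longrightarrow> cmod (c k r) \<le> C * kw q k" and C0: "C \<ge> 0"
  shows "cmod (c k t) \<le> cmod (fourier u0 k) + (2 * ((convK q)\<^sup>2 * C ^ 3 + C) / \<nu>) * kw (q + 1) k"
proof (cases "k = 0")
  case True
  have "(2 * ((convK q)\<^sup>2 * C ^ 3 + C) / \<nu>) * kw (q + 1) k \<ge> 0" using \<nu> C0 by (intro mult_nonneg_nonneg divide_nonneg_pos) auto
  then show ?thesis using c_mean[OF t] True by simp
next
  case False
  define K where "K = (convK q)\<^sup>2 * C ^ 3 + C"
  have K0: "K \<ge> 0" unfolding K_def using C0 by simp
  have "cmod (\<phi> k r) \<le> K * kw q k" if r: "0 < r" "r < t" for r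
    unfolding K_def by (rule fourier_fCH_bound[OF q u_CP C[OF r]]) (use r in simp)
  from c_bound[OF False t this] K0
  have "cmod (c k t) \<le> cmod (fourier u0 k) + K * kw q k / (\<nu> * ksq k)" by simp
  also have "K * kw q k / (\<nu> * ksq k) \<le> 2 * K / \<nu> * kw (q + 1) k"
  proof -
    have "1 / ksq k \<le> 2 / (1 + ksq k)" using ksq_ge_1[OF False] by (simp add: field_simps)
    also have "\<dots> = 2 * kw 1 k" unfolding kw_def using one_plus_ksq_pos[of k] by (simp add: powr_minus divide_inverse)
    finally have "K * kw q k / \<nu> * (1 / ksq k) \<le> K * kw q k / \<nu> * (2 * kw 1 k)"
      using K0 \<nu> by (intro mult_left_mono) auto
    then show ?thesis by (simp add: kw_add mult_ac)
  qed
  finally show ?thesis by (simp add: K_def)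
qed

end

section \<open>Energy inequality and time derivative of the exact solution\<close>

lemma ksq_kw: "ksq k * kw 1 k \<le> 1"
proof -
  have "ksq k * kw 1 k = ksq k / (1 + ksq k)" unfolding kw_def using one_plus_ksq_pos[of k] by (simp add: powr_minus divide_inverse)
  also have "\<dots> \<le> 1" using one_plus_ksq_pos[of k] by (simp only: pos_divide_le_eq) simp
  finally show ?thesis .
qed

lemma ksq_kw_step: "ksq k * kw (q + 1) k \<le> kw q k"
proof -
  have "kw q k * (ksq k * kw 1 k) \<le> kw q k * 1" by (intro mult_left_mono ksq_kw) simp
  then show ?thesis by (simp add: kw_add mult_ac)
qed

lemma ksq_kw_2: "(ksq k)\<^sup>2 * kw (q + 2) k \<le> kw q k"
proof -
  have "ksq k * (ksq k * kw (q + 1 + 1) k) \<le> ksq k * kw (q + 1) k" by (intro mult_left_mono ksq_kw_step) simp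
  moreover have "q + 2 = q + 1 + 1" by simp
  ultimately show ?thesis using ksq_kw_step[of k q] by (simp only: power2_eq_square mult.assoc)
qed

lemma kw_0 [simp]: "kw 0 k = 1"
  using one_plus_ksq_pos[of k] by (simp add: kw_def less_imp_neq[symmetric])

context CH_solution
begin

text \<open>Purely qualitative, from compactness and periodicity: \<open>M\<close> depends on the
  solution and on \<open>T\<close>. It starts the first pass of
  \<open>uniform_decay\<close>.\<close>

lemma sup_bounded: "\<exists>M\<ge>0. \<forall>t p. 0 \<le> t \<longrightarrow> t \<le> T \<longrightarrow> \<bar>u t p\<bar> \<le> M"
proof -
  have "compact ({0..T} \<times> cell)" by (intro compact_Times) auto
  moreover have "continuous_on ({0..T} \<times> cell) (\<lambda>(t, p). u t p)"
    by (rule continuous_on_subset[OF u_cont]) auto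
  ultimately have "bounded ((\<lambda>(t, p). u t p) ` ({0..T} \<times> cell))"
    by (intro compact_imp_bounded compact_continuous_image)
  then obtain M where M: "\<And>x. x \<in> (\<lambda>(t, p). u t p) ` ({0..T} \<times> cell) \<Longrightarrow> norm x \<le> M" unfolding bounded_iff by blast
  have "\<bar>u t p\<bar> \<le> max M 0" if "0 \<le> t" "t \<le> T" for t p
  proof -
    obtain q where q: "q \<in> cell" "\<And>g. periodic2 g \<Longrightarrow> g q = g p" using periodic2_reduce[of p] by blast
    have "u t q = u t p" by (rule q(2)[OF u_per[OF that(1)]])
    moreover have "u t q \<in> (\<lambda>(t, p). u t p) ` ({0..T} \<times> cell)" using that q(1) by (intro image_eqI[of _ _ "(t, q)"]) auto
    ultimately show ?thesis using M[of "u t q"] by simp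
  qed
  then show ?thesis by (intro exI[of _ "max M 0"]) auto
qed

lemma energy_density_deriv:
  "t > 0 \<Longrightarrow> ((\<lambda>r. ((u r p)\<^sup>2 - 1)\<^sup>2) has_real_derivative 4 * (fCH (u t p) * ut \<nu> u t p)) (at t)"
  by (rule DERIV_cong, rule DERIV_power[OF DERIV_diff[OF DERIV_power[OF ut_deriv] DERIV_const]], simp)
     (simp add: fCH_def power2_eq_square power3_eq_cube algebra_simps)

text \<open>The gradient is truncated to finitely many modes, which avoids differentiating an
  infinite sum in time. The potential is differentiated exactly; the resulting pairing of
  \<open>f(u)\<close> with the time derivative exceeds its part over the retained modes by at most
  \<open>\<epsilon>\<close>, because \<open>kw 2\<close> decay makes the coefficients of
  \<open>f(u)\<close> summable and those of the time derivative bounded.\<close>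

lemma energy_bound:
  assumes Ck: "Ck 1 u0" and C: "\<And>t k. 0 \<le> t \<Longrightarrow> t \<le> T \<Longrightarrow> cmod (c k t) \<le> C * kw 2 k" and C0: "C \<ge> 0"
    and t: "0 \<le> t" "t \<le> T" and F0: "finite F0"
  shows "\<nu> / 2 * (\<Sum>k\<in>F0. ksq k * (cmod (c k t))\<^sup>2) + tvol / 4 * integral cell (\<lambda>p. ((u t p)\<^sup>2 - 1)\<^sup>2) \<le> tvol * energy \<nu> u0"
proof -
  define Kf where "Kf = (convK 2)\<^sup>2 * C ^ 3 + C"
  define P where "P = \<nu> * C + Kf"
  have Kf0: "Kf \<ge> 0" unfolding Kf_def using C0 by simp
  have P0: "P \<ge> 0" unfolding P_def using Kf0 C0 \<nu> by simp
  have f_le: "cmod (\<phi> k r) \<le> Kf * kw 2 k" if "0 \<le> r" "r \<le> T" for r k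
    unfolding Kf_def by (rule fourier_fCH_bound[OF _ u_CP[OF that(1)] C[OF that]]) simp
  have p_le: "cmod (pk k r) \<le> P" if "0 \<le> r" "r \<le> T" for r k
  proof -
    have "cmod (pk k r) \<le> \<nu> * (ksq k)\<^sup>2 * cmod (c k r) + ksq k * cmod (\<phi> k r)"
      unfolding pk_def by (rule order_trans[OF norm_triangle_ineq4]) (use \<nu> in \<open>simp add: norm_mult norm_power\<close>)
    also have "\<dots> \<le> \<nu> * (ksq k)\<^sup>2 * (C * kw 2 k) + ksq k * (Kf * kw 2 k)"
      using \<nu> C[OF that, of k] f_le[OF that, of k] by (intro add_mono mult_left_mono) auto
    also have "\<dots> = \<nu> * C * ((ksq k)\<^sup>2 * kw (0 + 2) k) + Kf * (ksq k * kw (1 + 1) k)" by simp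
    also have "\<dots> \<le> \<nu> * C * 1 + Kf * 1"
    proof (rule add_mono)
      show "\<nu> * C * ((ksq k)\<^sup>2 * kw (0 + 2) k) \<le> \<nu> * C * 1"
        using \<nu> C0 ksq_kw_2[of k 0] by (intro mult_left_mono) auto
      have "kw 1 k \<le> kw 0 k" by (rule kw_mono) simp
      then show "Kf * (ksq k * kw (1 + 1) k) \<le> Kf * 1"
        using Kf0 ksq_kw_step[of k 1] by (intro mult_left_mono) auto
    qed
    finally show ?thesis by (simp add: P_def)
  qed
  have main: "\<nu> / 2 * (\<Sum>k\<in>F0. ksq k * (cmod (c k t))\<^sup>2) + tvol / 4 * integral cell (\<lambda>p. ((u t p)\<^sup>2 - 1)\<^sup>2) \<le> tvol * energy \<nu> u0 + \<epsilon> * t"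
    if \<epsilon>: "\<epsilon> > 0" for \<epsilon>
  proof -
    have sm: "(\<lambda>k. Kf * P * kw 2 k) summable_on UNIV" by (intro summable_on_cmult_right kw_summable) simp
    have "\<exists>H. finite H \<and> (\<forall>F. finite F \<longrightarrow> F \<inter> H = {} \<longrightarrow> (\<Sum>k\<in>F. Kf * P * kw 2 k) < \<epsilon>)"
      by (rule abs_le_summable_tail[OF sm _ \<epsilon>]) (use Kf0 P0 in simp)
    then obtain H where H: "finite H" "\<And>F. finite F \<Longrightarrow> F \<inter> H = {} \<Longrightarrow> (\<Sum>k\<in>F. Kf * P * kw 2 k) < \<epsilon>" by blast
    \<comment> \<open>The modes of \<open>F0\<close> are the ones to be bounded; those of
      \<open>H\<close> make the neglected tail of the pairing smaller than
      \<open>\<epsilon>\<close>.\<close>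
    define F where "F = F0 \<union> H"
    have F: "finite F" using F0 H by (simp add: F_def)
    let ?G = "\<lambda>r. \<nu> / 2 * (\<Sum>k\<in>F. ksq k * (cmod (c k r))\<^sup>2) + tvol / 4 * integral cell (\<lambda>p. ((u r p)\<^sup>2 - 1)\<^sup>2)"
    have "?G t - \<epsilon> * t \<le> ?G 0 - \<epsilon> * 0"
    proof (rule DERIV_nonpos_imp_decreasing_open[OF t(1)])
      have "continuous_on {0..} (\<lambda>r. integral cell (\<lambda>p. ((u r p)\<^sup>2 - 1)\<^sup>2))"
        by (rule continuous_integral_cell) (use u_cont in \<open>unfold case_prod_beta', intro continuous_intros\<close>)
      then show "continuous_on {0..t} (\<lambda>r. ?G r - \<epsilon> * r)"
        by (intro continuous_intros continuous_on_subset[OF c_cont] continuous_on_subset[of "{0..}" _ "{0..t}"]) auto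
      fix r assume r: "0 < r" "r < t"
      have r0: "0 \<le> r" "r \<le> T" using r t by auto
      have "((\<lambda>r. integral cell (\<lambda>p. ((u r p)\<^sup>2 - 1)\<^sup>2)) has_real_derivative integral cell (\<lambda>p. 4 * (fCH (u r p) * ut \<nu> u r p))) (at r)"
      proof (rule integral_cell_has_derivative[OF _ energy_density_deriv _ r(1)])
        show "continuous_on ({0<..} \<times> UNIV) (\<lambda>(t, p). 4 * (fCH (u t p) * ut \<nu> u t p))"
          using u_cont' ut_cont unfolding case_prod_beta' fCH_def by (intro continuous_intros) auto
        fix t :: real assume "t > 0"
        then show "CP (\<lambda>p. ((u t p)\<^sup>2 - 1)\<^sup>2)" by (intro CP_power CP_diff CP_const u_CP) simp
      qed
      then have dI: "((\<lambda>r. integral cell (\<lambda>p. ((u r p)\<^sup>2 - 1)\<^sup>2)) has_real_derivative 4 * integral cell (\<lambda>p. fCH (u r p) * ut \<nu> u r p)) (at r)" by simp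
      have "((\<lambda>r. ?G r - \<epsilon> * r) has_real_derivative
         \<nu> / 2 * (\<Sum>k\<in>F. ksq k * (2 * Re (cnj (c k r) * pk k r))) + tvol / 4 * (4 * integral cell (\<lambda>p. fCH (u r p) * ut \<nu> u r p)) - \<epsilon> * 1) (at r)"
        by (intro DERIV_diff DERIV_add DERIV_cmult DERIV_sum cmod2_deriv r(1) dI DERIV_ident)
      moreover have "\<nu> / 2 * (\<Sum>k\<in>F. ksq k * (2 * Re (cnj (c k r) * pk k r))) + tvol / 4 * (4 * integral cell (\<lambda>p. fCH (u r p) * ut \<nu> u r p)) - \<epsilon> * 1 \<le> 0"
      proof -
        let ?R = "\<lambda>k. Re (\<phi> k r * cnj (pk k r))"
        have hs: "(?R has_sum (tvol * integral cell (\<lambda>p. fCH (u r p) * ut \<nu> u r p))) UNIV"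
          using parseval_inner[OF CP_fCH[OF u_CP[OF r0(1)]] ut_fourier(1)[OF r(1)]] unfolding ut_fourier(2)[OF r(1)] .
        have "tvol * integral cell (\<lambda>p. fCH (u r p) * ut \<nu> u r p) \<le> sum ?R F + \<epsilon>"
        proof (rule tendsto_upperbound[OF hs[unfolded has_sum_def]])
          show "\<forall>\<^sub>F X in finite_subsets_at_top UNIV. sum ?R X \<le> sum ?R F + \<epsilon>"
            unfolding eventually_finite_subsets_at_top
          proof (rule exI[of _ F], intro conjI allI impI)
            fix X assume X: "finite X \<and> F \<subseteq> X \<and> X \<subseteq> UNIV"
            have "sum ?R X = sum ?R F + sum ?R (X - F)" using X sum.subset_diff[of F X ?R] by (simp add: add.commute)
            also have "sum ?R (X - F) \<le> (\<Sum>k\<in>X - F. Kf * P * kw 2 k)"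
            proof (rule sum_mono)
              fix k
              have "?R k \<le> cmod (\<phi> k r * cnj (pk k r))" by (rule complex_Re_le_cmod)
              also have "\<dots> = cmod (\<phi> k r) * cmod (pk k r)" by (simp add: norm_mult)
              also have "\<dots> \<le> (Kf * kw 2 k) * P" using f_le[OF r0] p_le[OF r0] Kf0 by (intro mult_mono) auto
              finally show "?R k \<le> Kf * P * kw 2 k" by (simp add: mult_ac)
            qed
            also have "\<dots> \<le> \<epsilon>" by (rule less_imp_le, rule H(2)) (use X in \<open>auto simp: F_def\<close>)
            finally show "sum ?R X \<le> sum ?R F + \<epsilon>" by simp
          qed (use F in auto)
        qed simp
        moreover have "\<nu> / 2 * (\<Sum>k\<in>F. ksq k * (2 * Re (cnj (c k r) * pk k r))) + sum ?R F \<le> 0"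
        proof -
          have "\<nu> / 2 * (ksq k * (2 * Re (cnj (c k r) * pk k r))) + ?R k \<le> 0" for k
          proof -
            define q where "q = ksq k"
            \<comment> \<open>The coefficient of the chemical potential
              \<open>-\<nu> \<Delta>u + f(u)\<close>. Testing with it produces minus a square in
              each mode.\<close>
            define z where "z = of_real (\<nu> * q) * c k r + \<phi> k r"
            have pz: "pk k r = - (of_real q * z)" unfolding pk_def z_def q_def by (simp add: power2_eq_square algebra_simps)
            have "\<nu> / 2 * (q * (2 * Re (cnj (c k r) * pk k r))) + Re (\<phi> k r * cnj (pk k r)) = Re (z * cnj (pk k r))"
              unfolding z_def by (simp add: algebra_simps)
            also have "\<dots> = - (q * (cmod z)\<^sup>2)" unfolding pz cmod_power2 by (simp add: power2_eq_square algebra_simps)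
            also have "\<dots> \<le> 0" by (simp add: q_def)
            finally show ?thesis by (simp only: q_def)
          qed
          then have "(\<Sum>k\<in>F. \<nu> / 2 * (ksq k * (2 * Re (cnj (c k r) * pk k r))) + ?R k) \<le> 0" by (intro sum_nonpos)
          then show ?thesis by (simp only: sum.distrib sum_distrib_left)
        qed
        ultimately show ?thesis by simp
      qed
      ultimately show "\<exists>y. ((\<lambda>r. ?G r - \<epsilon> * r) has_real_derivative y) (at r) \<and> y \<le> 0" by blast
    qed
    moreover have "?G 0 \<le> tvol * energy \<nu> u0"
    proof -
      have per: "periodic2 u0" using u0_CP by (simp add: CP_def)
      have "(\<Sum>k\<in>F. ksq k * (cmod (fourier u0 k))\<^sup>2) \<le> tvol * gradsq u0"
        by (rule finite_sum_le_has_sum[OF parseval_grad[OF per Ck] F]) auto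
      then have "\<nu> / 2 * (\<Sum>k\<in>F. ksq k * (cmod (fourier u0 k))\<^sup>2) \<le> \<nu> / 2 * (tvol * gradsq u0)" using \<nu> by (intro mult_left_mono) auto
      then show ?thesis unfolding energy_eq[OF per Ck] u_0 by (simp add: algebra_simps)
    qed
    moreover have "\<nu> / 2 * (\<Sum>k\<in>F0. ksq k * (cmod (c k t))\<^sup>2) \<le> \<nu> / 2 * (\<Sum>k\<in>F. ksq k * (cmod (c k t))\<^sup>2)"
      using \<nu> F by (intro mult_left_mono sum_mono2) (auto simp: F_def)
    ultimately show ?thesis by simp
  qed
  show ?thesis
  proof (rule field_le_epsilon)
    fix e :: real assume "e > 0"
    have "e / (t + 1) * t \<le> e" using t \<open>e > 0\<close> by (simp add: field_simps)
    moreover have "e / (t + 1) > 0" using t \<open>e > 0\<close> by simp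
    ultimately show "\<nu> / 2 * (\<Sum>k\<in>F0. ksq k * (cmod (c k t))\<^sup>2) + tvol / 4 * integral cell (\<lambda>p. ((u t p)\<^sup>2 - 1)\<^sup>2) \<le> tvol * energy \<nu> u0 + e"
      using main[of "e / (t + 1)"] by linarith
  qed
qed

lemma pk_deriv:
  assumes "t > 0"
  shows "(pk k has_vector_derivative - of_real \<nu> * (of_real (ksq k))\<^sup>2 * pk k t - of_real (ksq k) * fourier (gt t) k) (at t)"
proof -
  have "((\<lambda>t. - of_real \<nu> * (of_real (ksq k))\<^sup>2 * c k t - of_real (ksq k) * \<phi> k t) has_vector_derivative
     - of_real \<nu> * (of_real (ksq k))\<^sup>2 * pk k t - of_real (ksq k) * fourier (gt t) k) (at t)"
    by (intro has_vector_derivative_diff has_vector_derivative_mult_right c_deriv \<phi>_deriv assms)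
  then show ?thesis by (simp only: pk_def[abs_def])
qed

text \<open>Energy estimate for the equation differentiated in time: the mode equation of
  \<open>pk\<close> is tested with \<open>pk\<close>, and the forcing is the time derivative times
  \<open>3u^2 - 1\<close>, which is bounded by \<open>3 M^2 + 1\<close>. It controls the time
  integral of the squared Laplacian of the time derivative, as required by the consistency error of
  the implicit linear term.\<close>

lemma pk_integral_bound:
  assumes M: "\<And>t p. t \<ge> 0 \<Longrightarrow> \<bar>u t p\<bar> \<le> M" and Sd: "\<And>t F. t \<ge> 0 \<Longrightarrow> finite F \<Longrightarrow> (\<Sum>k\<in>F. (cmod (pk k t))\<^sup>2) \<le> Sd"
    and T: "T \<ge> 0" and F: "finite F"
  shows "\<nu> * integral {0..T} (\<lambda>t. \<Sum>k\<in>F. (ksq k)\<^sup>2 * (cmod (pk k t))\<^sup>2) \<le> Sd + T * ((3 * M\<^sup>2 + 1)\<^sup>2 * Sd / \<nu>)"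
proof -
  define K where "K = (3 * M\<^sup>2 + 1)\<^sup>2 * Sd / \<nu>"
  let ?g = "\<lambda>t. \<Sum>k\<in>F. (ksq k)\<^sup>2 * (cmod (pk k t))\<^sup>2" and ?y = "\<lambda>t. \<Sum>k\<in>F. (cmod (pk k t))\<^sup>2"
  have cg: "continuous_on {0..T} ?g" and cy: "continuous_on {0..T} ?y"
    by (intro continuous_intros continuous_on_subset[OF pk_cont]; simp)+
  let ?h = "\<lambda>t. ?y t + \<nu> * integral {0..t} ?g - K * t"
  have "?h T \<le> ?h 0"
  proof (rule DERIV_nonpos_imp_decreasing_open[OF T])
    show "continuous_on {0..T} ?h"
      by (intro continuous_intros cy indefinite_integral_continuous_1 integrable_continuous_interval cg)
    fix r assume r: "0 < r" "r < T"
    let ?D = "\<lambda>k. - of_real \<nu> * (of_real (ksq k))\<^sup>2 * pk k r - of_real (ksq k) * fourier (gt r) k"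
    have "((\<lambda>t. integral {0..t} ?g) has_real_derivative ?g r) (at r within {0..T})"
      using integral_has_real_derivative[OF cg, of r] r by simp
    then have di: "((\<lambda>t. integral {0..t} ?g) has_real_derivative ?g r) (at r)"
      using r by (simp add: at_within_Icc_at)
    have "(?h has_real_derivative (\<Sum>k\<in>F. 2 * Re (cnj (pk k r) * ?D k)) + \<nu> * ?g r - K * 1) (at r)"
      by (intro DERIV_diff DERIV_add DERIV_cmult DERIV_sum cmod_power2_has_derivative pk_deriv r(1) di DERIV_ident)
    moreover have "(\<Sum>k\<in>F. 2 * Re (cnj (pk k r) * ?D k)) + \<nu> * ?g r - K * 1 \<le> 0"
    proof -
      have r0: "r \<ge> 0" using r by simp
      have "(\<Sum>k\<in>F. 2 * Re (cnj (pk k r) * ?D k)) \<le> (\<Sum>k\<in>F. - (\<nu> * (ksq k)\<^sup>2 * (cmod (pk k r))\<^sup>2) + (cmod (fourier (gt r) k))\<^sup>2 / \<nu>)"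
        by (intro sum_mono mode_young \<nu>)
      also have "\<dots> = - (\<nu> * ?g r) + (\<Sum>k\<in>F. (cmod (fourier (gt r) k))\<^sup>2) / \<nu>"
        by (simp add: sum.distrib sum_negf sum_subtractf sum_distrib_left sum_divide_distrib mult.assoc)
      also have "(\<Sum>k\<in>F. (cmod (fourier (gt r) k))\<^sup>2) \<le> (3 * M\<^sup>2 + 1)\<^sup>2 * Sd"
      proof -
        have "(\<Sum>k\<in>F. (cmod (fourier (gt r) k))\<^sup>2) \<le> tvol * integral cell (\<lambda>p. (gt r p)\<^sup>2)" by (rule bessel[OF gt_CP[OF r(1)] F])
        also have "integral cell (\<lambda>p. (gt r p)\<^sup>2) \<le> integral cell (\<lambda>p. (3 * M\<^sup>2 + 1)\<^sup>2 * (ut \<nu> u r p)\<^sup>2)"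
        proof (rule integral_le)
          fix p
          have "(u r p)\<^sup>2 \<le> M\<^sup>2" using power_mono[OF M[OF r0, of p], of 2] by simp
          then have "\<bar>3 * (u r p)\<^sup>2 - 1\<bar> \<le> 3 * M\<^sup>2 + 1" using zero_le_power2[of "u r p"] by (simp add: abs_le_iff)
          then have "\<bar>3 * (u r p)\<^sup>2 - 1\<bar>\<^sup>2 \<le> (3 * M\<^sup>2 + 1)\<^sup>2" by (intro power_mono) auto
          then show "(gt r p)\<^sup>2 \<le> (3 * M\<^sup>2 + 1)\<^sup>2 * (ut \<nu> u r p)\<^sup>2"
            unfolding gt_def power_mult_distrib by (intro mult_right_mono) auto
        qed (intro cell_integrable continuous_intros CP_cont gt_CP r(1) ut_fourier(1))+
        also have "\<dots> = (3 * M\<^sup>2 + 1)\<^sup>2 * integral cell (\<lambda>p. (ut \<nu> u r p)\<^sup>2)" by simp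
        finally have "(\<Sum>k\<in>F. (cmod (fourier (gt r) k))\<^sup>2) \<le> (3 * M\<^sup>2 + 1)\<^sup>2 * (tvol * integral cell (\<lambda>p. (ut \<nu> u r p)\<^sup>2))"
          by (simp add: mult_ac)
        moreover have "tvol * integral cell (\<lambda>p. (ut \<nu> u r p)\<^sup>2) \<le> Sd"
          using parseval[OF ut_fourier(1)[OF r(1)]] unfolding ut_fourier(2)[OF r(1)]
          by (rule has_sum_le_finite_sums) (rule Sd[OF r0])
        ultimately show ?thesis using mult_left_mono[of "tvol * integral cell (\<lambda>p. (ut \<nu> u r p)\<^sup>2)" Sd "(3 * M\<^sup>2 + 1)\<^sup>2"] zero_le_power2[of "3 * M\<^sup>2 + 1"] by linarith
      qed
      finally show ?thesis using \<nu> by (simp add: K_def divide_right_mono)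
    qed
    ultimately show "\<exists>y. (?h has_real_derivative y) (at r) \<and> y \<le> 0" by blast
  qed
  moreover have "?y 0 \<le> Sd" by (rule Sd[OF order_refl F])
  moreover have "?y T \<ge> 0" by (intro sum_nonneg) simp
  ultimately show ?thesis unfolding K_def by (simp add: mult.commute)
qed

end

section \<open>Bootstrap of the decay, uniform in time\<close>

text \<open>Each round gains one unit of decay until the exponent \<open>s/2\<close> of the data is
  reached. The constant is fixed before \<open>u\<close> and \<open>T\<close>, so the bounds are
  uniform over all solutions and time intervals.\<close>

lemma decay_iterate:
  assumes \<nu>: "\<nu> > 0" and s: "s \<ge> 4" and C0: "\<And>k. cmod (fourier u0 k) \<le> C0 * kw (s/2) k" "C0 \<ge> 0" and Cb: "Cb \<ge> 0"
  shows "\<exists>C\<ge>0. \<forall>u T. CH_solution \<nu> u0 u \<longrightarrow> (\<forall>t k. 0 \<le> t \<longrightarrow> t \<le> T \<longrightarrow> cmod (fourier (u t) k) \<le> Cb * kw (3/2) k)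
      \<longrightarrow> (\<forall>t k. 0 \<le> t \<longrightarrow> t \<le> T \<longrightarrow> cmod (fourier (u t) k) \<le> C * kw (min (3/2 + real n) (s/2)) k)"
proof (induction n)
  case 0
  show ?case using s Cb by (intro exI[of _ Cb]) (simp add: min_def)
next
  case (Suc n)
  let ?q = "min (3/2 + real n) (s/2)"
  obtain C where C: "C \<ge> 0" and IH: "\<And>u T t k. CH_solution \<nu> u0 u \<Longrightarrow> (\<forall>t k. 0 \<le> t \<longrightarrow> t \<le> T \<longrightarrow> cmod (fourier (u t) k) \<le> Cb * kw (3/2) k)
      \<Longrightarrow> 0 \<le> t \<Longrightarrow> t \<le> T \<Longrightarrow> cmod (fourier (u t) k) \<le> C * kw ?q k"
    using Suc by blast
  define K where "K = 2 * ((convK ?q)\<^sup>2 * C ^ 3 + C) / \<nu>"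
  have K: "K \<ge> 0" unfolding K_def using \<nu> C by simp
  have q: "?q \<ge> 3/2" using s by simp
  have "cmod (fourier (u t) k) \<le> (C0 + K) * kw (min (3/2 + real (Suc n)) (s/2)) k"
    if sol: "CH_solution \<nu> u0 u" and b: "\<forall>t k. 0 \<le> t \<longrightarrow> t \<le> T \<longrightarrow> cmod (fourier (u t) k) \<le> Cb * kw (3/2) k" and t: "0 \<le> t" "t \<le> T" for u T t k
  proof -
    have "cmod (fourier (u t) k) \<le> cmod (fourier u0 k) + K * kw (?q + 1) k"
      unfolding K_def by (rule CH_solution.decay_step[OF sol q t(1) _ C]) (rule IH[OF sol b], use t in auto)
    also have "\<dots> \<le> C0 * kw (min (3/2 + real (Suc n)) (s/2)) k + K * kw (min (3/2 + real (Suc n)) (s/2)) k"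
    proof (rule add_mono)
      show "cmod (fourier u0 k) \<le> C0 * kw (min (3/2 + real (Suc n)) (s/2)) k"
        by (rule order_trans[OF C0(1)]) (intro mult_left_mono kw_mono C0(2) min.cobounded2)
      show "K * kw (?q + 1) k \<le> K * kw (min (3/2 + real (Suc n)) (s/2)) k"
        by (intro mult_left_mono kw_mono K) (simp add: min_def)
    qed
    finally show ?thesis by (simp add: distrib_right)
  qed
  then show ?case using C0 K by (intro exI[of _ "C0 + K"]) auto
qed

text \<open>One further round beyond \<open>s/2\<close>, with the data kept apart: the correction
  decays like \<open>kw (s/2 + 1)\<close>, so its squares remain summable against
  \<open>|k|^(2s)\<close>, which the bound by \<open>kw (s/2)\<close> alone would not give.\<close>

lemma decay_full:
  assumes \<nu>: "\<nu> > 0" and s: "s \<ge> 4" and C0: "\<And>k. cmod (fourier u0 k) \<le> C0 * kw (s/2) k" "C0 \<ge> 0" and Cb: "Cb \<ge> 0"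
  shows "\<exists>C\<ge>0. \<forall>u T. CH_solution \<nu> u0 u \<longrightarrow> (\<forall>t k. 0 \<le> t \<longrightarrow> t \<le> T \<longrightarrow> cmod (fourier (u t) k) \<le> Cb * kw (3/2) k)
      \<longrightarrow> (\<forall>t k. 0 \<le> t \<longrightarrow> t \<le> T \<longrightarrow> cmod (fourier (u t) k) \<le> C * kw (s/2) k
            \<and> cmod (fourier (u t) k) \<le> cmod (fourier u0 k) + C * kw (s/2 + 1) k)"
proof -
  obtain n :: nat where n: "s/2 \<le> real n" using real_arch_simple by blast
  have m: "min (3/2 + real n) (s/2) = s/2" using n by simp
  obtain C where C: "C \<ge> 0" and D: "\<And>u T t k. CH_solution \<nu> u0 u \<Longrightarrow> (\<forall>t k. 0 \<le> t \<longrightarrow> t \<le> T \<longrightarrow> cmod (fourier (u t) k) \<le> Cb * kw (3/2) k)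
      \<Longrightarrow> 0 \<le> t \<Longrightarrow> t \<le> T \<Longrightarrow> cmod (fourier (u t) k) \<le> C * kw (s/2) k"
    using decay_iterate[OF \<nu> s C0 Cb, of n] unfolding m by blast
  define K where "K = 2 * ((convK (s/2))\<^sup>2 * C ^ 3 + C) / \<nu>"
  have K: "K \<ge> 0" unfolding K_def using \<nu> C by simp
  have q: "s/2 \<ge> 3/2" using s by simp
  have "cmod (fourier (u t) k) \<le> (C + K) * kw (s/2) k \<and> cmod (fourier (u t) k) \<le> cmod (fourier u0 k) + (C + K) * kw (s/2 + 1) k"
    if sol: "CH_solution \<nu> u0 u" and b: "\<forall>t k. 0 \<le> t \<longrightarrow> t \<le> T \<longrightarrow> cmod (fourier (u t) k) \<le> Cb * kw (3/2) k" and t: "0 \<le> t" "t \<le> T" for u T t k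
  proof
    have "C * kw (s/2) k \<le> (C + K) * kw (s/2) k" using K by (intro mult_right_mono) auto
    then show "cmod (fourier (u t) k) \<le> (C + K) * kw (s/2) k" using D[OF sol b t, of k] by linarith
    have "cmod (fourier (u t) k) \<le> cmod (fourier u0 k) + K * kw (s/2 + 1) k"
      unfolding K_def by (rule CH_solution.decay_step[OF sol q t(1) _ C]) (rule D[OF sol b], use t in auto)
    moreover have "K * kw (s/2 + 1) k \<le> (C + K) * kw (s/2 + 1) k" using C by (intro mult_right_mono) auto
    ultimately show "cmod (fourier (u t) k) \<le> cmod (fourier u0 k) + (C + K) * kw (s/2 + 1) k" by linarith
  qed
  then show ?thesis using C K by (intro exI[of _ "C + K"]) auto
qed

text \<open>Two passes. The first uses the sup of \<open>u\<close> up to time \<open>t\<close>, with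
  constants that may depend on \<open>t\<close> and \<open>u\<close>, and bootstraps to
  \<open>kw 2\<close> so that \<open>energy_bound\<close> applies. The second feeds the energy into
  \<open>decay_of_H1\<close>, whose constants then depend on the data and \<open>\<nu>\<close>
  only.\<close>

theorem uniform_decay:
  assumes \<nu>: "\<nu> > 0" and adm: "admissible_data s u0"
  shows "\<exists>Cb\<ge>0. \<forall>u. CH_solution \<nu> u0 u \<longrightarrow> (\<forall>t\<ge>0. \<forall>k. cmod (fourier (u t) k) \<le> Cb * kw (3/2) k)"
proof -
  have s: "s \<ge> 4" using adm by (simp add: admissible_data_def)
  note u0 = admissible_decay(1,2)[OF adm] admissible_Ck_1[OF adm]
  have per: "periodic2 u0" using u0(1) by (simp add: CP_def)
  obtain C0 where C0: "C0 > 0" "\<And>k. cmod (fourier u0 k) \<le> C0 * kw (s/2) k" using admissible_decay(3)[OF adm] by blast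
  have C0': "cmod (fourier u0 k) \<le> C0 * kw (3/2) k" for k
    by (rule order_trans[OF C0(2)]) (use C0(1) s in \<open>intro mult_left_mono kw_mono, auto\<close>)
  let ?E = "energy \<nu> u0"
  have E0: "?E \<ge> 0" by (rule PiN_energy_bound(2)[OF adm \<nu>, of 1]) simp
  define B1 where "B1 = 2 * tvol * ?E / \<nu>"
  define B2 where "B2 = 8 * ?E + 2 * tvol"
  have B: "B1 \<ge> 0" "B2 \<ge> 0" using E0 \<nu> by (auto simp: B1_def B2_def)
  let ?K = "\<lambda>B1 B2. 4 * sqrt (9 * B2 + tvol) * sqrt (B1 / tvol) / \<nu>"
  have K0: "?K B1 B2 \<ge> 0" if "B1 \<ge> 0" "B2 \<ge> 0" for B1 B2 using that \<nu> by (intro divide_nonneg_pos mult_nonneg_nonneg) auto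
  have "cmod (fourier (u t) k) \<le> (C0 + ?K B1 B2) * kw (3/2) k" if chs: "CH_solution \<nu> u0 u" and t: "t \<ge> 0" for u t k
  proof -
    interpret CH_solution \<nu> u0 u by (rule chs)
    obtain M where M: "M \<ge> 0" "\<And>r p. 0 \<le> r \<Longrightarrow> r \<le> t \<Longrightarrow> \<bar>u r p\<bar> \<le> M" using sup_bounded[of t] by blast
    have If: "integral cell (\<lambda>p. (fCH (u r p))\<^sup>2) \<le> tvol * (M ^ 3 + M)\<^sup>2" if r: "0 \<le> r" "r \<le> t" for r
    proof -
      have "integral cell (\<lambda>p. (fCH (u r p))\<^sup>2) \<le> integral cell (\<lambda>p. (M ^ 3 + M)\<^sup>2)"
      proof (rule integral_le)
        fix p
        have "\<bar>fCH (u r p)\<bar> \<le> \<bar>u r p\<bar> ^ 3 + \<bar>u r p\<bar>"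
          unfolding fCH_def using abs_triangle_ineq4[of "u r p ^ 3" "u r p"] by (simp add: power_abs)
        also have "\<dots> \<le> M ^ 3 + M" using M(2)[OF r, of p] by (intro add_mono power_mono) auto
        finally have "\<bar>fCH (u r p)\<bar>\<^sup>2 \<le> (M ^ 3 + M)\<^sup>2" by (intro power_mono) auto
        then show "(fCH (u r p))\<^sup>2 \<le> (M ^ 3 + M)\<^sup>2" by simp
      qed (intro cell_integrable continuous_intros CP_cont CP_fCH u_CP r(1))+
      then show ?thesis by simp
    qed
    have I4: "integral cell (\<lambda>p. (u r p) ^ 4) \<le> tvol * M ^ 4" if r: "0 \<le> r" "r \<le> t" for r
    proof -
      have "integral cell (\<lambda>p. (u r p) ^ 4) \<le> integral cell (\<lambda>p. M ^ 4)"
      proof (rule integral_le)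
        fix p
        have "\<bar>u r p\<bar> ^ 4 \<le> M ^ 4" using M(2)[OF r, of p] by (intro power_mono) auto
        then show "(u r p) ^ 4 \<le> M ^ 4" by simp
      qed (intro cell_integrable continuous_intros CP_cont u_CP r(1))+
      then show ?thesis by simp
    qed
    define B1' where "B1' = tvol * gradsq u0 + 2 * (tvol * (tvol * (M ^ 3 + M)\<^sup>2) / (\<nu> * sqrt \<nu>)) * sqrt t"
    have H1: "(\<Sum>k\<in>F. ksq k * (cmod (c k r))\<^sup>2) \<le> B1'" if r: "0 \<le> r" "r \<le> t" and F: "finite F" for r F
    proof -
      have "(\<Sum>k\<in>F. ksq k * (cmod (fourier u0 k))\<^sup>2) \<le> tvol * gradsq u0"
        by (rule finite_sum_le_has_sum[OF parseval_grad[OF per u0(3)] F]) auto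
      then show ?thesis using H1_bound_of_sup[OF If r F] unfolding B1'_def by linarith
    qed
    have B': "B1' \<ge> 0" "tvol * M ^ 4 \<ge> 0" using H1[OF order_refl t, of "{}"] M by auto
    define Cb' where "Cb' = C0 + ?K B1' (tvol * M ^ 4)"
    have Cb': "Cb' \<ge> 0" unfolding Cb'_def using C0(1) K0[OF B'] by linarith
    have d1: "cmod (c k r) \<le> Cb' * kw (3/2) k" if r: "0 \<le> r" "r \<le> t" for r k
    proof -
      have "cmod (c k r) \<le> cmod (fourier u0 k) + ?K B1' (tvol * M ^ 4) * kw (3/2) k"
        by (rule decay_of_H1[OF r(1) _ _ B']) (use r in \<open>auto intro!: H1 I4\<close>)
      then show ?thesis using C0'[of k] unfolding Cb'_def distrib_right by linarith
    qed
    from decay_full[OF \<nu> s C0(2) less_imp_le[OF C0(1)] Cb'] obtain C where C1: "C \<ge> 0"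
      and C2: "\<forall>u T. CH_solution \<nu> u0 u \<longrightarrow> (\<forall>t k. 0 \<le> t \<longrightarrow> t \<le> T \<longrightarrow> cmod (fourier (u t) k) \<le> Cb' * kw (3/2) k)
      \<longrightarrow> (\<forall>t k. 0 \<le> t \<longrightarrow> t \<le> T \<longrightarrow> cmod (fourier (u t) k) \<le> C * kw (s/2) k
            \<and> cmod (fourier (u t) k) \<le> cmod (fourier u0 k) + C * kw (s/2 + 1) k)" by auto
    have C: "C \<ge> 0" "\<And>r k. 0 \<le> r \<Longrightarrow> r \<le> t \<Longrightarrow> cmod (c k r) \<le> C * kw (s/2) k"
      using C1 C2[rule_format, OF chs d1] by simp_all
    have d2: "cmod (c k r) \<le> C * kw 2 k" if "0 \<le> r" "r \<le> t" for r k
      by (rule order_trans[OF C(2)[OF that]]) (use C(1) s in \<open>intro mult_left_mono kw_mono, auto\<close>)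
    have en: "\<nu> / 2 * (\<Sum>k\<in>F. ksq k * (cmod (c k r))\<^sup>2) + tvol / 4 * integral cell (\<lambda>p. ((u r p)\<^sup>2 - 1)\<^sup>2) \<le> tvol * ?E"
      if "0 \<le> r" "r \<le> t" "finite F" for r F
      by (rule energy_bound[OF u0(3) d2 C(1) that])
    \<comment> \<open>The same estimate as for \<open>d1\<close>, now with the constants supplied by
      the energy; no bound taken from the particular solution remains in them.\<close>
    have "cmod (c k t) \<le> cmod (fourier u0 k) + ?K B1 B2 * kw (3/2) k"
    proof (rule decay_of_H1[OF t _ _ B])
      fix r F assume r: "0 < r" "r < t" and F: "finite (F :: (int \<times> int) set)"
      have "integral cell (\<lambda>p. ((u r p)\<^sup>2 - 1)\<^sup>2) \<ge> 0" by (rule potential_nonneg[OF u_CP]) (use r in simp)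
      then have "tvol / 4 * integral cell (\<lambda>p. ((u r p)\<^sup>2 - 1)\<^sup>2) \<ge> 0" by simp
      then have "\<nu> / 2 * (\<Sum>k\<in>F. ksq k * (cmod (c k r))\<^sup>2) \<le> tvol * ?E" using en[of r F] r F by linarith
      then show "(\<Sum>k\<in>F. ksq k * (cmod (c k r))\<^sup>2) \<le> B1" unfolding B1_def using \<nu> by (simp add: field_simps)
    next
      fix r assume r: "0 < r" "r < t"
      have "tvol * (1/4 * integral cell (\<lambda>p. ((u r p)\<^sup>2 - 1)\<^sup>2)) \<le> tvol * ?E" using en[of r "{}"] r by simp
      then have "1/4 * integral cell (\<lambda>p. ((u r p)\<^sup>2 - 1)\<^sup>2) \<le> ?E" by (simp only: mult_le_cancel_left_pos tvol_pos)
      then show "integral cell (\<lambda>p. (u r p) ^ 4) \<le> B2" unfolding B2_def using integral_pow4_le[OF u_CP, of r] r by simp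
    qed
    then show ?thesis using C0'[of k] unfolding distrib_right by linarith
  qed
  moreover have "C0 + ?K B1 B2 \<ge> 0" using C0(1) K0[OF B] by linarith
  ultimately show ?thesis by blast
qed

subsection \<open>The error recurrence\<close>

text \<open>Modes in a finite set \<open>H\<close> are estimated by Cauchy-Schwarz with its
  cardinality, the others by Cauchy-Schwarz with the weight \<open>1 + |k|^2\<close>, whose inverse
  squares sum to less than \<open>\<eta> / 4\<close> off \<open>H\<close>. It is stated for
  arbitrary coefficients and finite sets, so that \<open>C\<close> depends on \<open>\<eta>\<close>
  only and not on \<open>N\<close>.\<close>

lemma agmon_type:
  assumes "\<eta> > 0"
  shows "\<exists>C\<ge>0. \<forall>F (z :: int \<times> int \<Rightarrow> complex). finite F \<longrightarrow>
     (\<Sum>k\<in>F. cmod (z k))\<^sup>2 \<le> \<eta> * (\<Sum>k\<in>F. (ksq k)\<^sup>2 * (cmod (z k))\<^sup>2) + C * (\<Sum>k\<in>F. (cmod (z k))\<^sup>2)"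
proof -
  \<comment> \<open>The 4 is a factor 2 from splitting into low and high modes and a factor 2 from
    \<open>(1 + q)^2 \<le> 2 + 2 q^2\<close>.\<close>
  define e where "e = \<eta> / 4"
  have e: "e > 0" using assms by (simp add: e_def)
  have "\<exists>H. finite H \<and> (\<forall>F. finite F \<longrightarrow> F \<inter> H = {} \<longrightarrow> sum (kw 2) F < e)"
    by (rule abs_le_summable_tail[OF kw_summable _ e]) auto
  then obtain H where H: "finite H" "\<And>F. finite F \<Longrightarrow> F \<inter> H = {} \<Longrightarrow> sum (kw 2) F < e" by blast
  have "(\<Sum>k\<in>F. cmod (z k))\<^sup>2 \<le> \<eta> * (\<Sum>k\<in>F. (ksq k)\<^sup>2 * (cmod (z k))\<^sup>2) + (2 * real (card H) + \<eta>) * (\<Sum>k\<in>F. (cmod (z k))\<^sup>2)"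
    if F: "finite F" for F and z :: "int \<times> int \<Rightarrow> complex"
  proof -
    let ?S = "\<Sum>k\<in>F. (cmod (z k))\<^sup>2" and ?P = "\<Sum>k\<in>F. (ksq k)\<^sup>2 * (cmod (z k))\<^sup>2"
    let ?a = "\<Sum>k\<in>F \<inter> H. cmod (z k)" and ?b = "\<Sum>k\<in>F - H. cmod (z k)"
    have S0: "?S \<ge> 0" and P0: "?P \<ge> 0" by (intro sum_nonneg; simp)+
    have split: "(\<Sum>k\<in>F. cmod (z k)) = ?a + ?b" using F by (subst sum.Int_Diff[of _ _ H]) auto
    have a: "?a\<^sup>2 \<le> real (card H) * ?S"
    proof -
      have "?a\<^sup>2 = (\<Sum>k\<in>F \<inter> H. 1 * cmod (z k))\<^sup>2" by simp
      also have "\<dots> \<le> (\<Sum>k\<in>F \<inter> H. 1\<^sup>2) * (\<Sum>k\<in>F \<inter> H. (cmod (z k))\<^sup>2)" by (rule Cauchy_Schwarz_ineq_sum)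
      also have "\<dots> \<le> real (card H) * ?S"
      proof (rule mult_mono)
        show "(\<Sum>k\<in>F \<inter> H. 1\<^sup>2) \<le> real (card H)" using H(1) by (simp add: card_mono)
        show "(\<Sum>k\<in>F \<inter> H. (cmod (z k))\<^sup>2) \<le> ?S" using F by (intro sum_mono2) auto
      qed (auto intro: sum_nonneg)
      finally show ?thesis .
    qed
    have b: "?b\<^sup>2 \<le> e * (2 * ?S + 2 * ?P)"
    proof -
      have kw1: "kw 1 k * ((1 + ksq k) * cmod (z k)) = cmod (z k)" for k
      proof -
        have "1 + ksq k \<noteq> 0" using one_plus_ksq_pos[of k] by linarith
        then have i: "inverse (1 + ksq k) * (1 + ksq k) = 1" by (rule left_inverse)
        have "(1 + ksq k) powr (- 1) = inverse (1 + ksq k)" using one_plus_ksq_pos[of k] by (simp add: powr_minus)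
        then show ?thesis unfolding kw_def by (simp only: mult.assoc[symmetric] i mult_1_left)
      qed
      have "?b\<^sup>2 = (\<Sum>k\<in>F - H. kw 1 k * ((1 + ksq k) * cmod (z k)))\<^sup>2" unfolding kw1 ..
      also have "\<dots> \<le> (\<Sum>k\<in>F - H. (kw 1 k)\<^sup>2) * (\<Sum>k\<in>F - H. ((1 + ksq k) * cmod (z k))\<^sup>2)" by (rule Cauchy_Schwarz_ineq_sum)
      also have "\<dots> \<le> e * (2 * ?S + 2 * ?P)"
      proof (rule mult_mono)
        have "(kw 1 k)\<^sup>2 = kw 2 k" for k using kw_add[of 1 1 k] by (simp add: power2_eq_square)
        then show "(\<Sum>k\<in>F - H. (kw 1 k)\<^sup>2) \<le> e" using H(2)[OF finite_Diff[OF F], of H] by (simp add: Diff_Int_distrib2 less_imp_le inf.commute)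
        have "(\<Sum>k\<in>F - H. ((1 + ksq k) * cmod (z k))\<^sup>2) \<le> (\<Sum>k\<in>F. ((1 + ksq k) * cmod (z k))\<^sup>2)" using F by (intro sum_mono2) auto
        also have "\<dots> \<le> (\<Sum>k\<in>F. 2 * (cmod (z k))\<^sup>2 + 2 * ((ksq k)\<^sup>2 * (cmod (z k))\<^sup>2))"
        proof (rule sum_mono)
          fix k
          have "(1 + ksq k)\<^sup>2 \<le> 2 + 2 * (ksq k)\<^sup>2" using zero_le_power2[of "1 - ksq k"] by (simp add: power2_eq_square algebra_simps)
          then have "(1 + ksq k)\<^sup>2 * (cmod (z k))\<^sup>2 \<le> (2 + 2 * (ksq k)\<^sup>2) * (cmod (z k))\<^sup>2" by (rule mult_right_mono) simp
          then show "((1 + ksq k) * cmod (z k))\<^sup>2 \<le> 2 * (cmod (z k))\<^sup>2 + 2 * ((ksq k)\<^sup>2 * (cmod (z k))\<^sup>2)"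
            unfolding power_mult_distrib by (simp only: distrib_right mult.assoc)
        qed
        also have "\<dots> = 2 * ?S + 2 * ?P" by (simp add: sum.distrib sum_distrib_left)
        finally show "(\<Sum>k\<in>F - H. ((1 + ksq k) * cmod (z k))\<^sup>2) \<le> 2 * ?S + 2 * ?P" .
      qed (use e in \<open>auto intro: sum_nonneg\<close>)
      finally show ?thesis .
    qed
    have "(?a + ?b)\<^sup>2 \<le> 2 * ?a\<^sup>2 + 2 * ?b\<^sup>2"
      using zero_le_power2[of "?a - ?b"] by (simp add: power2_eq_square algebra_simps)
    also have "\<dots> \<le> 2 * (real (card H) * ?S) + 2 * (e * (2 * ?S + 2 * ?P))" using a b by linarith
    also have "\<dots> = \<eta> * ?P + (2 * real (card H) + \<eta>) * ?S" by (simp add: e_def algebra_simps)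
    finally show ?thesis unfolding split .
  qed
  then show ?thesis using assms by (intro exI[of _ "2 * real (card H) + \<eta>"]) auto
qed

text \<open>Nonnegativity of the variance of \<open>h\<close> about its mean
  \<open>m\<close>.\<close>

lemma integral_interval_sq_le:
  fixes h :: "real \<Rightarrow> real"
  assumes ab: "a \<le> b" and h: "continuous_on {a..b} h"
  shows "(integral {a..b} h)\<^sup>2 \<le> (b - a) * integral {a..b} (\<lambda>x. (h x)\<^sup>2)"
proof (cases "a = b")
  case False
  define m where "m = integral {a..b} h / (b - a)"
  let ?I = "integral {a..b} h" and ?J = "integral {a..b} (\<lambda>x. (h x)\<^sup>2)"
  have i: "g integrable_on {a..b}" if "continuous_on {a..b} g" for g :: "real \<Rightarrow> real"
    using that by (rule integrable_continuous_interval)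
  have "0 \<le> integral {a..b} (\<lambda>x. (h x - m)\<^sup>2)" by (intro integral_nonneg i continuous_intros h) auto
  also have "(\<lambda>x. (h x - m)\<^sup>2) = (\<lambda>x. ((h x)\<^sup>2 - 2 * m * h x) + m\<^sup>2)" by (simp add: fun_eq_iff power2_eq_square algebra_simps)
  also have "integral {a..b} \<dots> = integral {a..b} (\<lambda>x. (h x)\<^sup>2 - 2 * m * h x) + integral {a..b} (\<lambda>x. m\<^sup>2)"
    by (rule integral_add) (intro i continuous_intros h)+
  also have "integral {a..b} (\<lambda>x. (h x)\<^sup>2 - 2 * m * h x) = ?J - integral {a..b} (\<lambda>x. 2 * m * h x)"
    by (rule integral_diff) (intro i continuous_intros h)+
  finally have "0 \<le> ?J - 2 * m * ?I + (b - a) * m\<^sup>2" using ab by simp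
  moreover have "?I = m * (b - a)" using False by (simp add: m_def)
  ultimately have "m\<^sup>2 * (b - a) \<le> ?J" by (simp add: power2_eq_square algebra_simps)
  then have "(b - a) * (m\<^sup>2 * (b - a)) \<le> (b - a) * ?J" using ab by (intro mult_left_mono) auto
  then show ?thesis using \<open>?I = m * (b - a)\<close> by (simp add: power2_eq_square mult_ac)
qed simp

lemma norm_integral_interval_sq_le:
  fixes f :: "real \<Rightarrow> complex"
  assumes ab: "a \<le> b" and f: "continuous_on {a..b} f"
  shows "(cmod (integral {a..b} f))\<^sup>2 \<le> (b - a) * integral {a..b} (\<lambda>x. (cmod (f x))\<^sup>2)"
proof -
  have "cmod (integral {a..b} f) \<le> integral {a..b} (\<lambda>x. cmod (f x))"
    by (rule integral_norm_bound_integral) (intro integrable_continuous_interval continuous_intros f, intro integrable_continuous_interval continuous_intros f, simp)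
  then have "(cmod (integral {a..b} f))\<^sup>2 \<le> (integral {a..b} (\<lambda>x. cmod (f x)))\<^sup>2" by (intro power_mono) auto
  also have "\<dots> \<le> (b - a) * integral {a..b} (\<lambda>x. (cmod (f x))\<^sup>2)" by (intro integral_interval_sq_le ab continuous_intros f)
  finally show ?thesis .
qed

lemma fCH_diff: "fCH x - fCH y = (x - y) * (x\<^sup>2 + x * y + y\<^sup>2 - 1)"
  unfolding fCH_def by (simp add: power2_eq_square power3_eq_cube algebra_simps)

lemma fCH_lipschitz:
  assumes "\<bar>x\<bar> \<le> M" "\<bar>y\<bar> \<le> M"
  shows "(fCH x - fCH y)\<^sup>2 \<le> (3 * M\<^sup>2 + 1)\<^sup>2 * (x - y)\<^sup>2"
proof -
  have M: "M \<ge> 0" using assms by linarith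
  have "x\<^sup>2 \<le> M\<^sup>2" "y\<^sup>2 \<le> M\<^sup>2" "\<bar>x * y\<bar> \<le> M\<^sup>2"
    using power_mono[OF assms(1), of 2] power_mono[OF assms(2), of 2] mult_mono[OF assms] M
    by (auto simp: abs_mult power2_eq_square)
  then have "\<bar>x\<^sup>2 + x * y + y\<^sup>2 - 1\<bar> \<le> 3 * M\<^sup>2 + 1" using zero_le_power2[of x] zero_le_power2[of y] by linarith
  then have "\<bar>x\<^sup>2 + x * y + y\<^sup>2 - 1\<bar>\<^sup>2 \<le> (3 * M\<^sup>2 + 1)\<^sup>2" by (intro power_mono) auto
  then have "(x - y)\<^sup>2 * (x\<^sup>2 + x * y + y\<^sup>2 - 1)\<^sup>2 \<le> (x - y)\<^sup>2 * (3 * M\<^sup>2 + 1)\<^sup>2" by (intro mult_left_mono) auto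
  then show ?thesis unfolding fCH_diff power_mult_distrib by (simp add: mult.commute)
qed

text \<open>Unrolling with \<open>1 + l \<le> exp l\<close>; every source is simply multiplied by
  the full exponential. In the application \<open>l\<close> is proportional to
  \<open>\<tau>\<close>, whatever its size.\<close>

lemma discrete_gronwall:
  fixes Z b :: "nat \<Rightarrow> real"
  assumes step: "\<And>n. Z (Suc n) \<le> (1 + l) * Z n + b n" and Z0: "Z 0 \<le> 0" and l: "l \<ge> 0" and b: "\<And>n. b n \<ge> 0"
  shows "Z m \<le> exp (real m * l) * (\<Sum>n<m. b n)"
proof (induction m)
  case 0
  then show ?case using Z0 by simp
next
  case (Suc m)
  let ?B = "\<Sum>n<m. b n"
  have B0: "?B \<ge> 0" by (intro sum_nonneg b)
  have e1: "1 + l \<le> exp l" by (rule exp_ge_add_one_self)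
  have ee: "exp l * exp (real m * l) = exp (real (Suc m) * l)" by (simp add: exp_add[symmetric] algebra_simps)
  have "Z (Suc m) \<le> (1 + l) * Z m + b m" by (rule step)
  also have "\<dots> \<le> (1 + l) * (exp (real m * l) * ?B) + b m" using Suc l by (intro add_mono mult_left_mono) auto
  also have "\<dots> \<le> exp l * (exp (real m * l) * ?B) + b m" using e1 B0 by (intro add_mono mult_right_mono) auto
  also have "\<dots> \<le> exp (real (Suc m) * l) * ?B + exp (real (Suc m) * l) * b m"
  proof -
    have "1 * b m \<le> exp (real (Suc m) * l) * b m" using b l by (intro mult_right_mono) auto
    then show ?thesis using ee by (simp only: mult.assoc[symmetric])
  qed
  finally show ?case by (simp add: distrib_left)
qed

lemma sum_squares_le: "(a + b)\<^sup>2 \<le> 2 * a\<^sup>2 + 2 * b\<^sup>2" for a b :: real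
  using zero_le_power2[of "a - b"] by (simp add: power2_eq_square algebra_simps)

text \<open>Bounds the integral of \<open>(v^2 + v U + U^2 - 1)^2\<close> when
  \<open>|v| \<le> M\<close> and the integral of \<open>U^4\<close> is at most \<open>L\<close>; 7
  rounds up \<open>3 * 9/4\<close>. It is defined outside the locale because the exponent of the
  final estimate is built from it before a solution or a scheme is given.\<close>

definition K4c :: "real \<Rightarrow> real \<Rightarrow> real" where
  "K4c M L = 7 * M ^ 4 * tvol + 7 * L + 3 * tvol"

lemma K4c_pos: "M \<ge> 0 \<Longrightarrow> L \<ge> 0 \<Longrightarrow> K4c M L > 0"
  unfolding K4c_def by (intro add_nonneg_pos add_nonneg_nonneg mult_nonneg_nonneg) auto

text \<open>Collects what regularity and stability deliver; \<open>x\<close> stands for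
  \<open>N^(-s)\<close>. The bounds \<open>M0\<close>, \<open>L4\<close>, \<open>Ks\<close> and
  \<open>Sd\<close> will be supplied independently of \<open>N\<close>, \<open>\<tau>\<close> and
  \<open>A\<close>, which keeps the final constants free of them.\<close>

locale CH_error = CH_solution +
  fixes N :: nat and \<tau> A M0 L4 Ks Sd x :: real and U :: "nat \<Rightarrow> real \<times> real \<Rightarrow> real"
  assumes \<tau>: "\<tau> > 0" and A: "A \<ge> 1"
    and M0: "M0 \<ge> 0" and L4_0: "L4 \<ge> 0" and Ks0: "Ks \<ge> 0"
    and sup: "\<And>t p. t \<ge> 0 \<Longrightarrow> \<bar>u t p\<bar> \<le> M0"
    and supv: "\<And>t p. t \<ge> 0 \<Longrightarrow> \<bar>tp (DN N) (fourier (u t)) p\<bar> \<le> M0"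
    and tail: "\<And>t. t \<ge> 0 \<Longrightarrow> integral cell (\<lambda>p. (u t p - tp (DN N) (fourier (u t)) p)\<^sup>2) \<le> Ks * x\<^sup>2"
    and Sd: "\<And>t F. t \<ge> 0 \<Longrightarrow> finite F \<Longrightarrow> (\<Sum>k\<in>F. (cmod (pk k t))\<^sup>2) \<le> Sd"
    and UX: "\<And>n. U n \<in> XN N"
    and U0: "\<And>k. k \<in> DN N \<Longrightarrow> fourier (U 0) k = fourier u0 k"
    and Ustep: "\<And>n k. k \<in> DN N \<Longrightarrow> (fourier (U (Suc n)) k - fourier (U n) k) / of_real \<tau> =
      - of_real \<nu> * (of_real (ksq k))\<^sup>2 * fourier (U (Suc n)) k
      - of_real A * of_real (ksq k) * (fourier (U (Suc n)) k - fourier (U n) k)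
      - of_real (ksq k) * fourier (\<lambda>p. fCH (U n p)) k"
    and L4: "\<And>n. integral cell (\<lambda>p. (U n p) ^ 4) \<le> L4"
begin

definition "tn n = real n * \<tau>"
definition "v n = tp (DN N) (fourier (u (tn n)))"
definition "er n k = c k (tn n) - fourier (U n) k"
definition "gk n k = \<phi> k (tn n) - fourier (\<lambda>p. fCH (U n p)) k"
text \<open>Integrated deviation of the right-hand side from its implicit-explicit evaluation, the
  linear term at the new time and the nonlinear one at the old time, divided by
  \<open>-|k|^2\<close>. Extracting this factor lets the dissipation absorb the consistency error
  \<open>rk\<close> in the same way as the nonlinear error \<open>gk\<close>.\<close>

definition "Jk n k = integral {tn n..tn (Suc n)} (\<lambda>t. of_real (\<nu> * ksq k) * (c k t - c k (tn (Suc n))) + (\<phi> k t - \<phi> k (tn n)))"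
definition "rk n k = Jk n k / of_real \<tau> - of_real A * (c k (tn (Suc n)) - c k (tn n))"
definition "Sn n = (\<Sum>k\<in>DN N. (cmod (er n k))\<^sup>2)"
definition "Pn n = (\<Sum>k\<in>DN N. (ksq k)\<^sup>2 * (cmod (er n k))\<^sup>2)"
text \<open>The propagated quantity. \<open>A \<tau> |k|^2\<close> comes from the stabilisation;
  \<open>\<tau> \<nu> |k|^4\<close> is the dissipation of the last step, stored to absorb the part
  of the next nonlinear error that is measured by \<open>Pn\<close>.\<close>

definition "Zn n = (\<Sum>k\<in>DN N. (1 + A * \<tau> * ksq k + \<tau> * \<nu> * (ksq k)\<^sup>2) * (cmod (er n k))\<^sup>2)"
definition "In n = integral {tn n..tn (Suc n)} (\<lambda>t. \<Sum>k\<in>DN N. (ksq k)\<^sup>2 * (cmod (pk k t))\<^sup>2)"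

lemma tn_nonneg [simp]: "tn n \<ge> 0" using \<tau> by (simp add: tn_def)
lemma tn_Suc: "tn (Suc n) = tn n + \<tau>" by (simp add: tn_def algebra_simps)
lemma tn_le: "tn n \<le> tn (Suc n)" using \<tau> by (simp add: tn_Suc)
lemma Sd0: "Sd \<ge> 0" using Sd[of 0 "{}"] by simp

lemma cont_c: "0 \<le> a \<Longrightarrow> continuous_on {a..b} (c k)" by (rule continuous_on_subset[OF c_cont]) auto
lemma cont_\<phi>: "0 \<le> a \<Longrightarrow> continuous_on {a..b} (\<phi> k)" by (rule continuous_on_subset[OF \<phi>_cont]) auto
lemma cont_pk: "0 \<le> a \<Longrightarrow> continuous_on {a..b} (pk k)" by (rule continuous_on_subset[OF pk_cont]) auto

lemma c_FTC:
  assumes "0 \<le> a" "a \<le> b"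
  shows "c k b - c k a = integral {a..b} (pk k)"
proof -
  have "(pk k has_integral (c k b - c k a)) {a..b}"
    by (rule fundamental_theorem_of_calculus_interior[OF assms(2) cont_c[OF assms(1)]]) (use assms c_deriv in auto)
  then show ?thesis by (simp add: integral_unique)
qed

lemma c_increment:
  assumes "0 \<le> a" "a \<le> b"
  shows "(cmod (c k b - c k a))\<^sup>2 \<le> (b - a) * integral {a..b} (\<lambda>t. (cmod (pk k t))\<^sup>2)"
  unfolding c_FTC[OF assms] by (rule norm_integral_interval_sq_le[OF assms(2) cont_pk[OF assms(1)]])

lemma c_increment_sum:
  assumes "0 \<le> a" "a \<le> b" "finite F"
  shows "(\<Sum>k\<in>F. (cmod (c k b - c k a))\<^sup>2) \<le> (b - a)\<^sup>2 * Sd"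
proof -
  have "(\<Sum>k\<in>F. (cmod (c k b - c k a))\<^sup>2) \<le> (\<Sum>k\<in>F. (b - a) * integral {a..b} (\<lambda>t. (cmod (pk k t))\<^sup>2))"
    by (intro sum_mono c_increment assms)
  also have "\<dots> = (b - a) * integral {a..b} (\<lambda>t. \<Sum>k\<in>F. (cmod (pk k t))\<^sup>2)"
    by (subst integral_sum[OF assms(3)]) (intro integrable_continuous_interval continuous_intros cont_pk assms(1), simp add: sum_distrib_left)
  also have "\<dots> \<le> (b - a) * integral {a..b} (\<lambda>t. Sd)"
    using assms by (intro mult_left_mono integral_le integrable_continuous_interval continuous_intros cont_pk Sd) auto
  also have "\<dots> = (b - a)\<^sup>2 * Sd" using assms by (simp add: power2_eq_square)
  finally show ?thesis .
qed

text \<open>On \<open>DN N\<close> the projection in the scheme leaves coefficients unchanged, so no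
  projection error appears here; it enters through the estimate of \<open>gk\<close> and the final
  triangle inequality.\<close>

lemma error_recurrence:
  assumes k: "k \<in> DN N"
  shows "er (Suc n) k - er n k = of_real \<tau> * (- of_real \<nu> * (of_real (ksq k))\<^sup>2 * er (Suc n) k
     - of_real A * of_real (ksq k) * (er (Suc n) k - er n k) - of_real (ksq k) * gk n k - of_real (ksq k) * rk n k)"
proof -
  define q where "q = (of_real (ksq k) :: complex)"
  define vv where "vv = (of_real \<nu> :: complex)"
  define T where "T = (of_real \<tau> :: complex)"
  have T0: "T \<noteq> 0" using \<tau> by (simp add: T_def)
  let ?c' = "c k (tn (Suc n))" and ?c = "c k (tn n)" and ?p = "\<phi> k (tn n)"
  have ii: "f integrable_on {tn n..tn (Suc n)}" if "continuous_on {tn n..tn (Suc n)} f" for f :: "real \<Rightarrow> complex"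
    using that by (rule integrable_continuous_interval)
  note cc = cont_c[OF tn_nonneg] cont_\<phi>[OF tn_nonneg]
  have "integral {tn n..tn (Suc n)} (pk k) = integral {tn n..tn (Suc n)} (\<lambda>t. - q * (of_real (\<nu> * ksq k) * (c k t - ?c') + (\<phi> k t - ?p)) + - q * (vv * q * ?c' + ?p))"
    by (rule arg_cong[where f = "integral _"]) (simp add: fun_eq_iff pk_def q_def vv_def power2_eq_square algebra_simps)
  also have "\<dots> = integral {tn n..tn (Suc n)} (\<lambda>t. - q * (of_real (\<nu> * ksq k) * (c k t - ?c') + (\<phi> k t - ?p))) + integral {tn n..tn (Suc n)} (\<lambda>t. - q * (vv * q * ?c' + ?p))"
    by (rule integral_add) (intro ii continuous_intros cc)+
  also have "integral {tn n..tn (Suc n)} (\<lambda>t. - q * (of_real (\<nu> * ksq k) * (c k t - ?c') + (\<phi> k t - ?p))) = - q * Jk n k"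
    unfolding Jk_def by (rule integral_mult_right)
  also have "integral {tn n..tn (Suc n)} (\<lambda>t. - q * (vv * q * ?c' + ?p)) = T * (- q * (vv * q * ?c' + ?p))"
    using tn_le by (simp add: tn_Suc T_def scaleR_conv_of_real)
  finally have c1: "?c' - ?c = - q * Jk n k + T * (- q * (vv * q * ?c' + ?p))"
    using c_FTC[OF tn_nonneg tn_le] by simp
  have J: "Jk n k = T * (rk n k + of_real A * (?c' - ?c))" using T0 by (simp add: rk_def T_def)
  have U1: "fourier (U (Suc n)) k - fourier (U n) k = T * (- vv * q\<^sup>2 * fourier (U (Suc n)) k
      - of_real A * q * (fourier (U (Suc n)) k - fourier (U n) k) - q * fourier (\<lambda>p. fCH (U n p)) k)"
    using Ustep[OF k, of n] T0 by (simp add: T_def q_def vv_def nonzero_divide_eq_eq mult.commute)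
  show ?thesis unfolding q_def[symmetric] vv_def[symmetric] T_def[symmetric] er_def gk_def
    using c1 U1 unfolding J by algebra
qed

text \<open>Testing with the new error: the polarized time difference appears with the factor
  \<open>1 + A \<tau> |k|^2\<close>, since the stabilisation acts on the same difference. The square
  of the difference is dropped.\<close>

lemma Zn_mode:
  assumes k: "k \<in> DN N"
  shows "(1 + A * \<tau> * ksq k + \<tau> * \<nu> * (ksq k)\<^sup>2) * (cmod (er (Suc n) k))\<^sup>2
     \<le> (1 + A * \<tau> * ksq k) * (cmod (er n k))\<^sup>2 + 2 * \<tau> / \<nu> * ((cmod (gk n k))\<^sup>2 + (cmod (rk n k))\<^sup>2)"
proof -
  define q where "q = ksq k"
  define E' where "E' = er (Suc n) k"
  define E where "E = er n k"
  define h where "h = gk n k + rk n k"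
  have q: "q \<ge> 0" by (simp add: q_def)
  have rec: "E' - E = of_real \<tau> * (- of_real \<nu> * (of_real q)\<^sup>2 * E' - of_real A * of_real q * (E' - E) - of_real q * h)"
    unfolding E'_def E_def q_def h_def using error_recurrence[OF k, of n] by (simp add: algebra_simps)
  have pol: "2 * Re (cnj E' * (E' - E)) = (cmod E')\<^sup>2 - (cmod E)\<^sup>2 + (cmod (E' - E))\<^sup>2"
    unfolding cmod_power2 by (simp add: power2_eq_square algebra_simps)
  have "2 * Re (cnj E' * (E' - E)) = \<tau> * (2 * Re (cnj E' * (- of_real \<nu> * (of_real q)\<^sup>2 * E' - of_real q * h)))
      - \<tau> * A * q * (2 * Re (cnj E' * (E' - E)))"
  proof -
    have "cnj E' * (E' - E) = of_real \<tau> * (cnj E' * (- of_real \<nu> * (of_real q)\<^sup>2 * E' - of_real q * h)) - of_real (\<tau> * A * q) * (cnj E' * (E' - E))"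
      using rec by (simp only: of_real_mult) algebra
    then have "Re (cnj E' * (E' - E)) = Re (of_real \<tau> * (cnj E' * (- of_real \<nu> * (of_real q)\<^sup>2 * E' - of_real q * h)) - of_real (\<tau> * A * q) * (cnj E' * (E' - E)))"
      by (rule arg_cong)
    moreover have R: "Re (of_real a * z) = a * Re z" for a z by simp
    ultimately have "Re (cnj E' * (E' - E)) = \<tau> * Re (cnj E' * (- of_real \<nu> * (of_real q)\<^sup>2 * E' - of_real q * h)) - \<tau> * A * q * Re (cnj E' * (E' - E))"
      by (simp only: minus_complex.sel R)
    then show ?thesis by algebra
  qed
  moreover have "\<tau> * (2 * Re (cnj E' * (- of_real \<nu> * (of_real q)\<^sup>2 * E' - of_real q * h))) \<le> \<tau> * (- (\<nu> * q\<^sup>2 * (cmod E')\<^sup>2) + (cmod h)\<^sup>2 / \<nu>)"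
    using \<tau> by (intro mult_left_mono mode_young[OF \<nu>]) simp
  ultimately have "2 * Re (cnj E' * (E' - E)) + \<tau> * A * q * (2 * Re (cnj E' * (E' - E))) \<le> \<tau> * (- (\<nu> * q\<^sup>2 * (cmod E')\<^sup>2) + (cmod h)\<^sup>2 / \<nu>)"
    by linarith
  then have m: "(1 + A * \<tau> * q) * ((cmod E')\<^sup>2 - (cmod E)\<^sup>2 + (cmod (E' - E))\<^sup>2) + \<tau> * \<nu> * q\<^sup>2 * (cmod E')\<^sup>2 \<le> \<tau> / \<nu> * (cmod h)\<^sup>2"
    unfolding pol by (simp add: algebra_simps)
  have "0 \<le> (1 + A * \<tau> * q) * (cmod (E' - E))\<^sup>2" using A \<tau> q by simp
  then have m2: "(1 + A * \<tau> * q + \<tau> * \<nu> * q\<^sup>2) * (cmod E')\<^sup>2 \<le> (1 + A * \<tau> * q) * (cmod E)\<^sup>2 + \<tau> / \<nu> * (cmod h)\<^sup>2"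
    using m by (simp add: algebra_simps)
  have "(cmod h)\<^sup>2 \<le> (cmod (gk n k) + cmod (rk n k))\<^sup>2" unfolding h_def by (intro power_mono norm_triangle_ineq) simp
  also have "\<dots> \<le> 2 * ((cmod (gk n k))\<^sup>2 + (cmod (rk n k))\<^sup>2)"
    using zero_le_power2[of "cmod (gk n k) - cmod (rk n k)"] by (simp add: power2_eq_square algebra_simps)
  finally have "\<tau> / \<nu> * (cmod h)\<^sup>2 \<le> \<tau> / \<nu> * (2 * ((cmod (gk n k))\<^sup>2 + (cmod (rk n k))\<^sup>2))"
    using \<tau> \<nu> by (intro mult_left_mono) auto
  moreover have "\<tau> / \<nu> * (2 * ((cmod (gk n k))\<^sup>2 + (cmod (rk n k))\<^sup>2)) = 2 * \<tau> / \<nu> * ((cmod (gk n k))\<^sup>2 + (cmod (rk n k))\<^sup>2)" by simp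
  ultimately have "\<tau> / \<nu> * (cmod h)\<^sup>2 \<le> 2 * \<tau> / \<nu> * ((cmod (gk n k))\<^sup>2 + (cmod (rk n k))\<^sup>2)" by (simp only:)
  from order_trans[OF m2 add_left_mono[OF this]] show ?thesis unfolding E'_def E_def q_def .
qed

abbreviation "K4 \<equiv> K4c M0 L4"

lemma err_fourier: "(\<lambda>p. v n p - U n p) \<in> XN N" "k \<in> DN N \<Longrightarrow> fourier (\<lambda>p. v n p - U n p) k = er n k"
proof -
  have vX: "v n \<in> XN N" by (simp add: v_def)
  show "(\<lambda>p. v n p - U n p) \<in> XN N" by (rule XN_diff[OF vX UX])
  assume "k \<in> DN N"
  then show "fourier (\<lambda>p. v n p - U n p) k = er n k"
    unfolding fourier_diff[OF CP_XN[OF vX] CP_XN[OF UX]] unfolding v_def er_def by (simp add: fourier_tp_DN u_CP)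
qed

lemma err_L2: "Sn n = tvol * integral cell (\<lambda>p. (v n p - U n p)\<^sup>2)"
  unfolding parseval_XN_sq[OF err_fourier(1), symmetric] Sn_def by (intro sum.cong refl) (simp add: err_fourier(2))

lemma err_sup: "\<bar>v n p - U n p\<bar> \<le> (\<Sum>k\<in>DN N. cmod (er n k)) / tvol"
proof -
  have "v n p - U n p = tp (DN N) (fourier (\<lambda>p. v n p - U n p)) p"
    by (rule fun_cong[OF XN_repr[OF err_fourier(1)[of n]], of p])
  then have "\<bar>v n p - U n p\<bar> \<le> (\<Sum>k\<in>DN N. cmod (fourier (\<lambda>p. v n p - U n p) k)) / tvol" by (simp only: norm_tp_le)
  then show ?thesis by (simp add: err_fourier(2))
qed

text \<open>With \<open>v\<close> the truncation of \<open>u\<close>, the difference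
  \<open>f(u) - f(v)\<close> is handled by a Lipschitz bound and costs the projection tail, while
  \<open>f(v) - f(U)\<close> is the error times \<open>v^2 + vU + U^2 - 1\<close>. Taking the error
  in sup norm leaves a square integral controlled by the quartic bound on \<open>U\<close>.\<close>

lemma gk_bound:
  "(\<Sum>k\<in>DN N. (cmod (gk n k))\<^sup>2) \<le> 2 * tvol * (3 * M0\<^sup>2 + 1)\<^sup>2 * Ks * x\<^sup>2 + 2 * K4 / tvol * (\<Sum>k\<in>DN N. cmod (er n k))\<^sup>2"
proof -
  note uC = u_CP[OF tn_nonneg[of n]] and UC = CP_XN[OF UX[of n]]
  have vC: "CP (v n)" by (simp add: v_def)
  define m where "m = (\<Sum>k\<in>DN N. cmod (er n k)) / tvol"
  have gk: "gk n k = fourier (\<lambda>p. fCH (u (tn n) p) - fCH (U n p)) k" for k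
    unfolding gk_def by (rule fourier_diff[OF CP_fCH[OF uC] CP_fCH[OF UC], symmetric])
  have "(\<Sum>k\<in>DN N. (cmod (gk n k))\<^sup>2) \<le> tvol * integral cell (\<lambda>p. (fCH (u (tn n) p) - fCH (U n p))\<^sup>2)"
    unfolding gk by (rule bessel[OF CP_diff[OF CP_fCH[OF uC] CP_fCH[OF UC]] finite_DN])
  also have "\<dots> \<le> tvol * (2 * (3 * M0\<^sup>2 + 1)\<^sup>2 * (Ks * x\<^sup>2) + 2 * m\<^sup>2 * K4)"
  proof (rule mult_left_mono)
    have "integral cell (\<lambda>p. (fCH (u (tn n) p) - fCH (U n p))\<^sup>2)
       \<le> integral cell (\<lambda>p. 2 * (3 * M0\<^sup>2 + 1)\<^sup>2 * (u (tn n) p - v n p)\<^sup>2 + 2 * m\<^sup>2 * (7 * (U n p) ^ 4 + (7 * M0 ^ 4 + 3)))"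
    proof (rule integral_le)
      fix p
      let ?u = "u (tn n) p" and ?v = "v n p" and ?U = "U n p"
      have vb: "\<bar>?v\<bar> \<le> M0" unfolding v_def by (rule supv) simp
      have 1: "(fCH ?u - fCH ?v)\<^sup>2 \<le> (3 * M0\<^sup>2 + 1)\<^sup>2 * (?u - ?v)\<^sup>2" by (rule fCH_lipschitz[OF sup vb]) simp
      have 2: "(fCH ?v - fCH ?U)\<^sup>2 \<le> m\<^sup>2 * (7 * ?U ^ 4 + (7 * M0 ^ 4 + 3))"
      proof -
        have "(?v\<^sup>2 + ?v * ?U + ?U\<^sup>2 - 1)\<^sup>2 \<le> 7 * ?U ^ 4 + (7 * M0 ^ 4 + 3)"
        proof -
          define a where "a = ?v\<^sup>2"
          define b where "b = ?U\<^sup>2"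
          define d where "d = ?v * ?U"
          have ab: "0 \<le> a" "0 \<le> b" by (auto simp: a_def b_def)
          have d: "\<bar>d\<bar> \<le> a / 2 + b / 2"
            unfolding a_def b_def d_def using zero_le_power2[of "?v - ?U"] zero_le_power2[of "?v + ?U"]
            by (simp add: abs_le_iff power2_eq_square algebra_simps)
          have "\<bar>a + d + b - 1\<bar> \<le> 3/2 * a + 3/2 * b + 1" using d ab by (simp add: abs_le_iff)
          then have "\<bar>a + d + b - 1\<bar>\<^sup>2 \<le> (3/2 * a + 3/2 * b + 1)\<^sup>2" by (intro power_mono) auto
          also have "\<dots> \<le> 3 * ((3/2 * a)\<^sup>2 + (3/2 * b)\<^sup>2 + 1)"
            using zero_le_power2[of "3/2 * a - 3/2 * b"] zero_le_power2[of "3/2 * a - 1"] zero_le_power2[of "3/2 * b - 1"]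
            by (simp add: power2_eq_square algebra_simps)
          also have "\<dots> \<le> 7 * b\<^sup>2 + (7 * a\<^sup>2 + 3)"
          proof -
            have "(3/2 * a)\<^sup>2 = 9/4 * a\<^sup>2" "(3/2 * b)\<^sup>2 = 9/4 * b\<^sup>2" by (simp_all add: power_mult_distrib power_divide)
            then have "3 * ((3/2 * a)\<^sup>2 + (3/2 * b)\<^sup>2 + 1) = 27/4 * a\<^sup>2 + 27/4 * b\<^sup>2 + 3" by (simp only:) simp
            then show ?thesis using zero_le_power2[of a] zero_le_power2[of b] by linarith
          qed
          finally have "(a + d + b - 1)\<^sup>2 \<le> 7 * b\<^sup>2 + (7 * a\<^sup>2 + 3)" by simp
          moreover have "a\<^sup>2 \<le> M0 ^ 4"
          proof -
            have "a \<le> M0\<^sup>2" unfolding a_def using power_mono[OF vb, of 2] by simp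
            then have "a\<^sup>2 \<le> (M0\<^sup>2)\<^sup>2" using ab by (intro power_mono)
            then show ?thesis by (simp only: pow4_eq)
          qed
          ultimately show ?thesis unfolding pow4_eq[of ?U] a_def[symmetric] b_def[symmetric] d_def[symmetric] by linarith
        qed
        moreover have "(?v - ?U)\<^sup>2 \<le> m\<^sup>2" using power_mono[OF err_sup[of n p], of 2] by (simp add: m_def)
        ultimately show ?thesis unfolding fCH_diff power_mult_distrib by (intro mult_mono) auto
      qed
      have "(fCH ?u - fCH ?U)\<^sup>2 \<le> 2 * (fCH ?u - fCH ?v)\<^sup>2 + 2 * (fCH ?v - fCH ?U)\<^sup>2"
        using zero_le_power2[of "(fCH ?u - fCH ?v) - (fCH ?v - fCH ?U)"] by (simp add: power2_eq_square algebra_simps)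
      also have "\<dots> \<le> 2 * ((3 * M0\<^sup>2 + 1)\<^sup>2 * (?u - ?v)\<^sup>2) + 2 * (m\<^sup>2 * (7 * ?U ^ 4 + (7 * M0 ^ 4 + 3)))"
        using 1 2 by (intro add_mono mult_left_mono) auto
      finally show "(fCH ?u - fCH ?U)\<^sup>2 \<le> 2 * (3 * M0\<^sup>2 + 1)\<^sup>2 * (?u - ?v)\<^sup>2 + 2 * m\<^sup>2 * (7 * ?U ^ 4 + (7 * M0 ^ 4 + 3))" by (simp only: mult.assoc)
    qed (intro cell_integrable continuous_intros CP_cont CP_fCH uC UC vC)+
    also have "\<dots> = integral cell (\<lambda>p. 2 * (3 * M0\<^sup>2 + 1)\<^sup>2 * (u (tn n) p - v n p)\<^sup>2) + integral cell (\<lambda>p. 2 * m\<^sup>2 * (7 * (U n p) ^ 4 + (7 * M0 ^ 4 + 3)))"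
      by (rule integral_add) (intro cell_integrable continuous_intros CP_cont uC UC vC)+
    also have "integral cell (\<lambda>p. 2 * (3 * M0\<^sup>2 + 1)\<^sup>2 * (u (tn n) p - v n p)\<^sup>2) = 2 * (3 * M0\<^sup>2 + 1)\<^sup>2 * integral cell (\<lambda>p. (u (tn n) p - v n p)\<^sup>2)"
      by (rule integral_mult_right)
    also have "integral cell (\<lambda>p. 2 * m\<^sup>2 * (7 * (U n p) ^ 4 + (7 * M0 ^ 4 + 3))) = 2 * m\<^sup>2 * integral cell (\<lambda>p. 7 * (U n p) ^ 4 + (7 * M0 ^ 4 + 3))"
      by (rule integral_mult_right)
    also have "integral cell (\<lambda>p. 7 * (U n p) ^ 4 + (7 * M0 ^ 4 + 3)) = integral cell (\<lambda>p. 7 * (U n p) ^ 4) + integral cell (\<lambda>p. 7 * M0 ^ 4 + 3)"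
      by (rule integral_add) (intro cell_integrable continuous_intros CP_cont UC)+
    finally have fin: "integral cell (\<lambda>p. (fCH (u (tn n) p) - fCH (U n p))\<^sup>2)
      \<le> 2 * (3 * M0\<^sup>2 + 1)\<^sup>2 * integral cell (\<lambda>p. (u (tn n) p - v n p)\<^sup>2) + 2 * m\<^sup>2 * (integral cell (\<lambda>p. 7 * (U n p) ^ 4) + integral cell (\<lambda>p. 7 * M0 ^ 4 + 3))" .
    have "integral cell (\<lambda>p. (u (tn n) p - v n p)\<^sup>2) \<le> Ks * x\<^sup>2" unfolding v_def by (rule tail) simp
    then have f1: "2 * (3 * M0\<^sup>2 + 1)\<^sup>2 * integral cell (\<lambda>p. (u (tn n) p - v n p)\<^sup>2) \<le> 2 * (3 * M0\<^sup>2 + 1)\<^sup>2 * (Ks * x\<^sup>2)" by (intro mult_left_mono) auto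
    have "integral cell (\<lambda>p. 7 * (U n p) ^ 4) + integral cell (\<lambda>p. 7 * M0 ^ 4 + 3) \<le> K4"
      using L4[of n] by (simp add: K4c_def algebra_simps)
    then have f2: "2 * m\<^sup>2 * (integral cell (\<lambda>p. 7 * (U n p) ^ 4) + integral cell (\<lambda>p. 7 * M0 ^ 4 + 3)) \<le> 2 * m\<^sup>2 * K4" by (intro mult_left_mono) auto
    show "integral cell (\<lambda>p. (fCH (u (tn n) p) - fCH (U n p))\<^sup>2) \<le> 2 * (3 * M0\<^sup>2 + 1)\<^sup>2 * (Ks * x\<^sup>2) + 2 * m\<^sup>2 * K4"
      using fin add_mono[OF f1 f2] by linarith
  qed simp
  also have "\<dots> = 2 * tvol * (3 * M0\<^sup>2 + 1)\<^sup>2 * Ks * x\<^sup>2 + 2 * K4 / tvol * (\<Sum>k\<in>DN N. cmod (er n k))\<^sup>2"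
    unfolding m_def power_divide by (simp add: power2_eq_square algebra_simps)
  finally show ?thesis .
qed

lemma \<phi>_increment_sum:
  assumes "0 \<le> a" "a \<le> b" "finite F"
  shows "(\<Sum>k\<in>F. (cmod (\<phi> k b - \<phi> k a))\<^sup>2) \<le> (3 * M0\<^sup>2 + 1)\<^sup>2 * ((b - a)\<^sup>2 * Sd)"
proof -
  have b0: "b \<ge> 0" using assms by simp
  note ca = u_CP[OF assms(1)] and cb = u_CP[OF b0]
  have "(\<Sum>k\<in>F. (cmod (\<phi> k b - \<phi> k a))\<^sup>2) = (\<Sum>k\<in>F. (cmod (fourier (\<lambda>p. fCH (u b p) - fCH (u a p)) k))\<^sup>2)"
    by (simp only: fourier_diff[OF CP_fCH[OF cb] CP_fCH[OF ca]])
  also have "\<dots> \<le> tvol * integral cell (\<lambda>p. (fCH (u b p) - fCH (u a p))\<^sup>2)"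
    by (rule bessel[OF CP_diff[OF CP_fCH[OF cb] CP_fCH[OF ca]] assms(3)])
  also have "\<dots> \<le> tvol * integral cell (\<lambda>p. (3 * M0\<^sup>2 + 1)\<^sup>2 * (u b p - u a p)\<^sup>2)"
    by (intro mult_left_mono integral_le cell_integrable continuous_intros CP_cont CP_fCH ca cb fCH_lipschitz sup b0 assms(1)) simp
  also have "\<dots> = (3 * M0\<^sup>2 + 1)\<^sup>2 * (tvol * integral cell (\<lambda>p. (u b p - u a p)\<^sup>2))" by (simp add: mult_ac)
  also have "\<dots> \<le> (3 * M0\<^sup>2 + 1)\<^sup>2 * ((b - a)\<^sup>2 * Sd)"
  proof (rule mult_left_mono)
    have hs: "((\<lambda>k. (cmod (c k b - c k a))\<^sup>2) has_sum (tvol * integral cell (\<lambda>p. (u b p - u a p)\<^sup>2))) UNIV"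
      using parseval[OF CP_diff[OF cb ca]] unfolding fourier_diff[OF cb ca] .
    show "tvol * integral cell (\<lambda>p. (u b p - u a p)\<^sup>2) \<le> (b - a)\<^sup>2 * Sd"
      by (rule has_sum_le_finite_sums[OF hs]) (rule c_increment_sum[OF assms(1,2)])
  qed simp
  finally show ?thesis .
qed

text \<open>The linear part is \<open>\<nu> |k|^2\<close> times an increment of \<open>c\<close>,
  bounded through the integral of \<open>|pk|^2\<close> over the step; this produces
  \<open>In\<close>. A single power of \<open>\<tau>\<close> in front of it suffices, since
  \<open>In\<close> is itself an integral over the step. The other parts use increments of
  \<open>f(u)\<close> and of \<open>u\<close>, both of order \<open>\<tau>\<close> in the
  mean.\<close>

lemma rk_bound:
  "(\<Sum>k\<in>DN N. (cmod (rk n k))\<^sup>2) \<le> 4 * \<nu>\<^sup>2 * \<tau> * In n + (4 * (3 * M0\<^sup>2 + 1)\<^sup>2 + 2 * A\<^sup>2) * (\<tau>\<^sup>2 * Sd)"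
proof -
  let ?I = "{tn n..tn (Suc n)}"
  let ?W = "\<lambda>k. integral ?I (\<lambda>t. (cmod (pk k t))\<^sup>2)"
  note cc = cont_c[OF tn_nonneg] cont_\<phi>[OF tn_nonneg] cont_pk[OF tn_nonneg]
  have ii: "f integrable_on ?I" if "continuous_on ?I f" for f :: "real \<Rightarrow> real"
    using that by (rule integrable_continuous_interval)
  have J: "(cmod (Jk n k / of_real \<tau>))\<^sup>2 \<le> 2 * \<nu>\<^sup>2 * \<tau> * ((ksq k)\<^sup>2 * ?W k) + 2 / \<tau> * integral ?I (\<lambda>t. (cmod (\<phi> k t - \<phi> k (tn n)))\<^sup>2)" for k
  proof -
    let ?f = "\<lambda>t. of_real (\<nu> * ksq k) * (c k t - c k (tn (Suc n))) + (\<phi> k t - \<phi> k (tn n))"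
    have "(cmod (Jk n k))\<^sup>2 \<le> (tn (Suc n) - tn n) * integral ?I (\<lambda>t. (cmod (?f t))\<^sup>2)"
      unfolding Jk_def by (rule norm_integral_interval_sq_le[OF tn_le]) (intro continuous_intros cc)
    also have "\<dots> = \<tau> * integral ?I (\<lambda>t. (cmod (?f t))\<^sup>2)" by (simp add: tn_Suc)
    also have "\<dots> \<le> \<tau> * integral ?I (\<lambda>t. 2 * \<nu>\<^sup>2 * (ksq k)\<^sup>2 * (\<tau> * ?W k) + 2 * (cmod (\<phi> k t - \<phi> k (tn n)))\<^sup>2)"
    proof (intro mult_left_mono integral_le ii continuous_intros cc)
      fix t assume t: "t \<in> ?I"
      have t0: "0 \<le> t" "t \<le> tn (Suc n)" using t order_trans[OF tn_nonneg[of n], of t] by auto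
      have "(cmod (c k (tn (Suc n)) - c k t))\<^sup>2 \<le> (tn (Suc n) - t) * integral {t..tn (Suc n)} (\<lambda>t. (cmod (pk k t))\<^sup>2)"
        by (rule c_increment[OF t0])
      also have "\<dots> \<le> \<tau> * ?W k"
      proof (rule mult_mono)
        show "tn (Suc n) - t \<le> \<tau>" using t by (simp add: tn_Suc)
        show "integral {t..tn (Suc n)} (\<lambda>t. (cmod (pk k t))\<^sup>2) \<le> ?W k"
          using t t0 by (intro integral_subset_le integrable_continuous_interval continuous_intros cont_pk cc) auto
        show "0 \<le> integral {t..tn (Suc n)} (\<lambda>t. (cmod (pk k t))\<^sup>2)"
          using t0 by (intro integral_nonneg integrable_continuous_interval continuous_intros cont_pk) auto
      qed (use \<tau> in auto)
      finally have ci: "(cmod (c k t - c k (tn (Suc n))))\<^sup>2 \<le> \<tau> * ?W k" by (simp only: norm_minus_commute)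
      have "(cmod (?f t))\<^sup>2 \<le> (cmod (of_real (\<nu> * ksq k) * (c k t - c k (tn (Suc n)))) + cmod (\<phi> k t - \<phi> k (tn n)))\<^sup>2"
        by (intro power_mono norm_triangle_ineq) simp
      also have "\<dots> \<le> 2 * (cmod (of_real (\<nu> * ksq k) * (c k t - c k (tn (Suc n)))))\<^sup>2 + 2 * (cmod (\<phi> k t - \<phi> k (tn n)))\<^sup>2"
        by (rule sum_squares_le)
      also have "(cmod (of_real (\<nu> * ksq k) * (c k t - c k (tn (Suc n)))))\<^sup>2 = (\<nu> * ksq k)\<^sup>2 * (cmod (c k t - c k (tn (Suc n))))\<^sup>2"
        by (simp only: norm_mult norm_of_real power_mult_distrib power2_abs)
      also have "2 * ((\<nu> * ksq k)\<^sup>2 * (cmod (c k t - c k (tn (Suc n))))\<^sup>2) \<le> 2 * ((\<nu> * ksq k)\<^sup>2 * (\<tau> * ?W k))"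
        using ci by (intro mult_left_mono) auto
      finally show "(cmod (?f t))\<^sup>2 \<le> 2 * \<nu>\<^sup>2 * (ksq k)\<^sup>2 * (\<tau> * ?W k) + 2 * (cmod (\<phi> k t - \<phi> k (tn n)))\<^sup>2"
        by (simp add: power_mult_distrib mult.assoc)
    qed (use \<tau> in simp)
    also have "integral ?I (\<lambda>t. 2 * \<nu>\<^sup>2 * (ksq k)\<^sup>2 * (\<tau> * ?W k) + 2 * (cmod (\<phi> k t - \<phi> k (tn n)))\<^sup>2)
       = integral ?I (\<lambda>t. 2 * \<nu>\<^sup>2 * (ksq k)\<^sup>2 * (\<tau> * ?W k)) + integral ?I (\<lambda>t. 2 * (cmod (\<phi> k t - \<phi> k (tn n)))\<^sup>2)"
      by (rule integral_add) (intro ii continuous_intros cc)+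
    also have "\<dots> = \<tau> * (2 * \<nu>\<^sup>2 * (ksq k)\<^sup>2 * (\<tau> * ?W k)) + 2 * integral ?I (\<lambda>t. (cmod (\<phi> k t - \<phi> k (tn n)))\<^sup>2)"
      using tn_le by (simp add: tn_Suc)
    finally have "(cmod (Jk n k))\<^sup>2 \<le> \<tau> * (\<tau> * (2 * \<nu>\<^sup>2 * (ksq k)\<^sup>2 * (\<tau> * ?W k)) + 2 * integral ?I (\<lambda>t. (cmod (\<phi> k t - \<phi> k (tn n)))\<^sup>2))" .
    then have "(cmod (Jk n k))\<^sup>2 / \<tau>\<^sup>2 \<le> \<tau> * (\<tau> * (2 * \<nu>\<^sup>2 * (ksq k)\<^sup>2 * (\<tau> * ?W k)) + 2 * integral ?I (\<lambda>t. (cmod (\<phi> k t - \<phi> k (tn n)))\<^sup>2)) / \<tau>\<^sup>2"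
      by (rule divide_right_mono) simp
    also have "\<dots> = 2 * \<nu>\<^sup>2 * \<tau> * ((ksq k)\<^sup>2 * ?W k) + 2 / \<tau> * integral ?I (\<lambda>t. (cmod (\<phi> k t - \<phi> k (tn n)))\<^sup>2)"
      using \<tau> by (simp add: power2_eq_square field_simps)
    finally show ?thesis using \<tau> by (simp add: norm_divide power_divide)
  qed
  have "(\<Sum>k\<in>DN N. (cmod (rk n k))\<^sup>2) \<le> (\<Sum>k\<in>DN N. 2 * (2 * \<nu>\<^sup>2 * \<tau> * ((ksq k)\<^sup>2 * ?W k) + 2 / \<tau> * integral ?I (\<lambda>t. (cmod (\<phi> k t - \<phi> k (tn n)))\<^sup>2))
      + 2 * A\<^sup>2 * (cmod (c k (tn (Suc n)) - c k (tn n)))\<^sup>2)"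
  proof (rule sum_mono)
    fix k
    have "(cmod (rk n k))\<^sup>2 \<le> (cmod (Jk n k / of_real \<tau>) + cmod (of_real A * (c k (tn (Suc n)) - c k (tn n))))\<^sup>2"
      unfolding rk_def by (intro power_mono norm_triangle_ineq4) simp
    also have "\<dots> \<le> 2 * (cmod (Jk n k / of_real \<tau>))\<^sup>2 + 2 * (cmod (of_real A * (c k (tn (Suc n)) - c k (tn n))))\<^sup>2" by (rule sum_squares_le)
    also have "(cmod (of_real A * (c k (tn (Suc n)) - c k (tn n))))\<^sup>2 = A\<^sup>2 * (cmod (c k (tn (Suc n)) - c k (tn n)))\<^sup>2"
      by (simp only: norm_mult norm_of_real power_mult_distrib power2_abs)
    finally show "(cmod (rk n k))\<^sup>2 \<le> 2 * (2 * \<nu>\<^sup>2 * \<tau> * ((ksq k)\<^sup>2 * ?W k) + 2 / \<tau> * integral ?I (\<lambda>t. (cmod (\<phi> k t - \<phi> k (tn n)))\<^sup>2))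
      + 2 * A\<^sup>2 * (cmod (c k (tn (Suc n)) - c k (tn n)))\<^sup>2" using J[of k] by (simp add: mult.assoc)
  qed
  also have "\<dots> = 4 * \<nu>\<^sup>2 * \<tau> * (\<Sum>k\<in>DN N. (ksq k)\<^sup>2 * ?W k) + 4 / \<tau> * (\<Sum>k\<in>DN N. integral ?I (\<lambda>t. (cmod (\<phi> k t - \<phi> k (tn n)))\<^sup>2))
      + 2 * A\<^sup>2 * (\<Sum>k\<in>DN N. (cmod (c k (tn (Suc n)) - c k (tn n)))\<^sup>2)"
    by (simp add: sum.distrib sum_distrib_left algebra_simps)
  also have "(\<Sum>k\<in>DN N. (ksq k)\<^sup>2 * ?W k) = In n"
    unfolding In_def by (subst integral_sum[OF finite_DN]) (intro ii continuous_intros cc, simp)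
  also have "(\<Sum>k\<in>DN N. integral ?I (\<lambda>t. (cmod (\<phi> k t - \<phi> k (tn n)))\<^sup>2)) = integral ?I (\<lambda>t. \<Sum>k\<in>DN N. (cmod (\<phi> k t - \<phi> k (tn n)))\<^sup>2)"
    by (subst integral_sum[OF finite_DN]) (intro ii continuous_intros cc, simp)
  finally have fin: "(\<Sum>k\<in>DN N. (cmod (rk n k))\<^sup>2) \<le> 4 * \<nu>\<^sup>2 * \<tau> * In n + 4 / \<tau> * integral ?I (\<lambda>t. \<Sum>k\<in>DN N. (cmod (\<phi> k t - \<phi> k (tn n)))\<^sup>2)
      + 2 * A\<^sup>2 * (\<Sum>k\<in>DN N. (cmod (c k (tn (Suc n)) - c k (tn n)))\<^sup>2)" .
  have "integral ?I (\<lambda>t. \<Sum>k\<in>DN N. (cmod (\<phi> k t - \<phi> k (tn n)))\<^sup>2) \<le> integral ?I (\<lambda>t. (3 * M0\<^sup>2 + 1)\<^sup>2 * (\<tau>\<^sup>2 * Sd))"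
  proof (intro integral_le ii continuous_intros cc)
    fix t assume t: "t \<in> ?I"
    have "(\<Sum>k\<in>DN N. (cmod (\<phi> k t - \<phi> k (tn n)))\<^sup>2) \<le> (3 * M0\<^sup>2 + 1)\<^sup>2 * ((t - tn n)\<^sup>2 * Sd)"
      by (rule \<phi>_increment_sum) (use t in auto)
    also have "\<dots> \<le> (3 * M0\<^sup>2 + 1)\<^sup>2 * (\<tau>\<^sup>2 * Sd)"
      using t Sd0 by (intro mult_left_mono mult_right_mono power_mono) (auto simp: tn_Suc)
    finally show "(\<Sum>k\<in>DN N. (cmod (\<phi> k t - \<phi> k (tn n)))\<^sup>2) \<le> (3 * M0\<^sup>2 + 1)\<^sup>2 * (\<tau>\<^sup>2 * Sd)" .
  qed
  also have "\<dots> = \<tau> * ((3 * M0\<^sup>2 + 1)\<^sup>2 * (\<tau>\<^sup>2 * Sd))" using tn_le by (simp add: tn_Suc)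
  finally have "4 / \<tau> * integral ?I (\<lambda>t. \<Sum>k\<in>DN N. (cmod (\<phi> k t - \<phi> k (tn n)))\<^sup>2) \<le> 4 / \<tau> * (\<tau> * ((3 * M0\<^sup>2 + 1)\<^sup>2 * (\<tau>\<^sup>2 * Sd)))"
    using \<tau> by (intro mult_left_mono) auto
  then have f2: "4 / \<tau> * integral ?I (\<lambda>t. \<Sum>k\<in>DN N. (cmod (\<phi> k t - \<phi> k (tn n)))\<^sup>2) \<le> 4 * (3 * M0\<^sup>2 + 1)\<^sup>2 * (\<tau>\<^sup>2 * Sd)"
    using \<tau> by simp
  have "(\<Sum>k\<in>DN N. (cmod (c k (tn (Suc n)) - c k (tn n)))\<^sup>2) \<le> \<tau>\<^sup>2 * Sd"
    using c_increment_sum[OF tn_nonneg tn_le finite_DN, of n N] by (simp add: tn_Suc)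
  then have f3: "2 * A\<^sup>2 * (\<Sum>k\<in>DN N. (cmod (c k (tn (Suc n)) - c k (tn n)))\<^sup>2) \<le> 2 * A\<^sup>2 * (\<tau>\<^sup>2 * Sd)" by (intro mult_left_mono) auto
  show ?thesis using fin f2 f3 unfolding distrib_right by linarith
qed

lemma In_sum: "(\<Sum>n<m. In n) = integral {0..tn m} (\<lambda>t. \<Sum>k\<in>DN N. (ksq k)\<^sup>2 * (cmod (pk k t))\<^sup>2)"
proof (induction m)
  case 0
  then show ?case by (simp add: tn_def)
next
  case (Suc m)
  let ?g = "\<lambda>t. \<Sum>k\<in>DN N. (ksq k)\<^sup>2 * (cmod (pk k t))\<^sup>2"
  have "?g integrable_on {0..tn (Suc m)}" by (intro integrable_continuous_interval continuous_intros cont_pk) simp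
  then have "integral {0..tn m} ?g + integral {tn m..tn (Suc m)} ?g = integral {0..tn (Suc m)} ?g"
    by (intro Henstock_Kurzweil_Integration.integral_combine tn_le tn_nonneg)
  then show ?case using Suc by (simp add: In_def)
qed

lemma Sn_le_Zn: "Sn n \<le> Zn n"
  unfolding Sn_def Zn_def
proof (rule sum_mono)
  fix k
  have "0 \<le> A * \<tau> * ksq k + \<tau> * \<nu> * (ksq k)\<^sup>2" using A \<tau> \<nu> by simp
  then have "1 * (cmod (er n k))\<^sup>2 \<le> (1 + A * \<tau> * ksq k + \<tau> * \<nu> * (ksq k)\<^sup>2) * (cmod (er n k))\<^sup>2" by (intro mult_right_mono) auto
  then show "(cmod (er n k))\<^sup>2 \<le> (1 + A * \<tau> * ksq k + \<tau> * \<nu> * (ksq k)\<^sup>2) * (cmod (er n k))\<^sup>2" by simp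
qed

definition "aK = 2 * tvol * (3 * M0\<^sup>2 + 1)\<^sup>2 * Ks"
definition "bn n = 2 * \<tau> / \<nu> * (aK * x\<^sup>2 + (4 * \<nu>\<^sup>2 * \<tau> * In n + (4 * (3 * M0\<^sup>2 + 1)\<^sup>2 + 2 * A\<^sup>2) * (\<tau>\<^sup>2 * Sd)))"

lemma aK0: "aK \<ge> 0" unfolding aK_def using Ks0 by simp

lemma In0: "In n \<ge> 0"
  unfolding In_def by (intro integral_nonneg integrable_continuous_interval continuous_intros cont_pk sum_nonneg) auto

lemma bn0: "bn n \<ge> 0"
  unfolding bn_def using \<tau> \<nu> aK0 In0[of n] Sd0 by (intro mult_nonneg_nonneg add_nonneg_nonneg) auto

text \<open>The coefficient in the Agmon-type inequality is chosen so that, after multiplication by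
  \<open>2 K4 / tvol\<close> and \<open>2 \<tau> / \<nu>\<close>, the \<open>Pn\<close> term becomes
  exactly \<open>\<tau> \<nu> Pn\<close>, the dissipation contained in \<open>Zn n\<close>. Only a
  multiple of \<open>Sn n\<close> is left for Gronwall.\<close>

lemma Zn_step:
  assumes ag: "\<And>F (z :: int \<times> int \<Rightarrow> complex). finite F \<Longrightarrow>
     (\<Sum>k\<in>F. cmod (z k))\<^sup>2 \<le> (\<nu>\<^sup>2 * tvol / (4 * K4)) * (\<Sum>k\<in>F. (ksq k)\<^sup>2 * (cmod (z k))\<^sup>2) + Ce * (\<Sum>k\<in>F. (cmod (z k))\<^sup>2)"
    and Ce: "Ce \<ge> 0"
  shows "Zn (Suc n) \<le> (1 + \<tau> * (4 * K4 * Ce / (\<nu> * tvol))) * Zn n + bn n"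
proof -
  have K40: "K4 > 0" by (rule K4c_pos[OF M0 L4_0])
  let ?L = "4 * K4 * Ce / (\<nu> * tvol)" and ?r = "\<Sum>k\<in>DN N. (cmod (rk n k))\<^sup>2" and ?g = "\<Sum>k\<in>DN N. (cmod (gk n k))\<^sup>2"
  let ?S0 = "\<Sum>k\<in>DN N. (1 + A * \<tau> * ksq k) * (cmod (er n k))\<^sup>2"
  have Z: "Zn n = ?S0 + \<tau> * \<nu> * Pn n"
    unfolding Zn_def Pn_def sum_distrib_left by (simp only: distrib_right sum.distrib mult.assoc)
  have "Zn (Suc n) \<le> (\<Sum>k\<in>DN N. (1 + A * \<tau> * ksq k) * (cmod (er n k))\<^sup>2 + 2 * \<tau> / \<nu> * ((cmod (gk n k))\<^sup>2 + (cmod (rk n k))\<^sup>2))"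
    unfolding Zn_def by (intro sum_mono Zn_mode)
  also have "\<dots> = ?S0 + 2 * \<tau> / \<nu> * (?g + ?r)" by (simp only: sum.distrib sum_distrib_left[symmetric])
  finally have 1: "Zn (Suc n) \<le> ?S0 + 2 * \<tau> / \<nu> * (?g + ?r)" .
  have g: "?g \<le> aK * x\<^sup>2 + (\<nu>\<^sup>2 / 2 * Pn n + 2 * K4 * Ce / tvol * Sn n)"
  proof -
    have "(\<Sum>k\<in>DN N. cmod (er n k))\<^sup>2 \<le> (\<nu>\<^sup>2 * tvol / (4 * K4)) * Pn n + Ce * Sn n"
      unfolding Pn_def Sn_def by (rule ag[OF finite_DN])
    then have "2 * K4 / tvol * (\<Sum>k\<in>DN N. cmod (er n k))\<^sup>2 \<le> 2 * K4 / tvol * ((\<nu>\<^sup>2 * tvol / (4 * K4)) * Pn n + Ce * Sn n)"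
      using K40 by (intro mult_left_mono) auto
    also have "\<dots> = \<nu>\<^sup>2 / 2 * Pn n + 2 * K4 * Ce / tvol * Sn n" using K40 by (simp add: field_simps)
    finally show ?thesis using gk_bound[of n] unfolding aK_def by linarith
  qed
  let ?R = "4 * \<nu>\<^sup>2 * \<tau> * In n + (4 * (3 * M0\<^sup>2 + 1)\<^sup>2 + 2 * A\<^sup>2) * (\<tau>\<^sup>2 * Sd)"
  have "2 * \<tau> / \<nu> * (?g + ?r) \<le> 2 * \<tau> / \<nu> * ((aK * x\<^sup>2 + (\<nu>\<^sup>2 / 2 * Pn n + 2 * K4 * Ce / tvol * Sn n)) + ?R)"
    using \<tau> \<nu> by (intro mult_left_mono add_mono g rk_bound) auto
  also have "\<dots> = bn n + \<tau> * \<nu> * Pn n + \<tau> * ?L * Sn n"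
    unfolding bn_def using \<nu> by (simp add: field_simps power2_eq_square)
  finally have 2: "2 * \<tau> / \<nu> * (?g + ?r) \<le> bn n + \<tau> * \<nu> * Pn n + \<tau> * ?L * Sn n" .
  have 3: "\<tau> * ?L * Sn n \<le> \<tau> * ?L * Zn n" using \<tau> \<nu> K40 Ce Sn_le_Zn[of n] by (intro mult_left_mono) auto
  have "Zn (Suc n) \<le> Zn n + \<tau> * ?L * Zn n + bn n" using 1 2 3 Z by linarith
  then show ?thesis by (simp only: distrib_right mult_1_left)
qed

lemma Zn_0: "Zn 0 = 0"
  unfolding Zn_def by (intro sum.neutral ballI) (simp add: er_def tn_def u_0 U0)

definition "CR = 2 / \<nu> * (aK + 4 * \<nu> * Sd + 8 * (3 * M0\<^sup>2 + 1)\<^sup>2 * Sd + 2 * Sd)"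

lemma CR0: "CR \<ge> 0" unfolding CR_def using \<nu> aK0 Sd0 by (intro mult_nonneg_nonneg add_nonneg_nonneg) auto

text \<open>Each source carries a factor \<open>\<tau>\<close> or an integral over one step, so
  \<open>m\<close> steps contribute at most a factor \<open>1 + T\<close>. \<open>A\<^sup>2\<close>
  comes from the stabilisation part of \<open>rk\<close> and, as \<open>A \<ge> 1\<close>, also
  majorises the coefficients without \<open>A\<close>.\<close>

lemma bn_sum: "(\<Sum>n<m. bn n) \<le> A\<^sup>2 * (1 + tn m) * CR * (x\<^sup>2 + \<tau>\<^sup>2)"
proof -
  define D where "D = (3 * M0\<^sup>2 + 1)\<^sup>2"
  define T where "T = tn m"
  define I where "I = (\<Sum>n<m. In n)"
  have D0: "D \<ge> 0" by (simp add: D_def)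
  have T0: "T \<ge> 0" by (simp add: T_def)
  have A2: "A\<^sup>2 \<ge> 1" using A by simp
  have "(\<Sum>n<m. bn n) = 2 * \<tau> / \<nu> * (\<Sum>n<m. aK * x\<^sup>2 + (4 * \<nu>\<^sup>2 * \<tau> * In n + (4 * D + 2 * A\<^sup>2) * (\<tau>\<^sup>2 * Sd)))"
    unfolding bn_def sum_distrib_left D_def ..
  also have "\<dots> = 2 * \<tau> / \<nu> * (real m * (aK * x\<^sup>2) + (4 * \<nu>\<^sup>2 * \<tau> * I + real m * ((4 * D + 2 * A\<^sup>2) * (\<tau>\<^sup>2 * Sd))))"
    unfolding I_def by (simp add: sum.distrib sum_distrib_left)
  also have "\<dots> = 2 / \<nu> * (T * (aK * x\<^sup>2) + (4 * \<nu> * \<tau>\<^sup>2 * (\<nu> * I) + T * ((4 * D + 2 * A\<^sup>2) * (\<tau>\<^sup>2 * Sd))))"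
    unfolding T_def tn_def by (simp add: algebra_simps power2_eq_square)
  also have "\<dots> \<le> 2 / \<nu> * (T * (aK * x\<^sup>2) + (4 * \<nu> * \<tau>\<^sup>2 * (Sd + T * (D * Sd / \<nu>)) + T * ((4 * D + 2 * A\<^sup>2) * (\<tau>\<^sup>2 * Sd))))"
  proof -
    have "\<nu> * I \<le> Sd + T * (D * Sd / \<nu>)"
      unfolding I_def In_sum D_def T_def by (rule pk_integral_bound[OF sup Sd tn_nonneg finite_DN])
    then have "4 * \<nu> * \<tau>\<^sup>2 * (\<nu> * I) \<le> 4 * \<nu> * \<tau>\<^sup>2 * (Sd + T * (D * Sd / \<nu>))" using \<nu> by (intro mult_left_mono) auto
    from mult_left_mono[OF add_left_mono[OF add_right_mono[OF this]], of "2 / \<nu>"] show ?thesis using \<nu> by simp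
  qed
  also have "4 * \<nu> * \<tau>\<^sup>2 * (Sd + T * (D * Sd / \<nu>)) = \<tau>\<^sup>2 * (4 * \<nu> * Sd) + T * (4 * D * (\<tau>\<^sup>2 * Sd))"
    using \<nu> by (simp add: algebra_simps)
  also have "2 / \<nu> * (T * (aK * x\<^sup>2) + ((\<tau>\<^sup>2 * (4 * \<nu> * Sd) + T * (4 * D * (\<tau>\<^sup>2 * Sd))) + T * ((4 * D + 2 * A\<^sup>2) * (\<tau>\<^sup>2 * Sd))))
     \<le> 2 / \<nu> * (A\<^sup>2 * (1 + T) * (aK + 4 * \<nu> * Sd + 8 * D * Sd + 2 * Sd) * (x\<^sup>2 + \<tau>\<^sup>2))"
  proof (rule mult_left_mono)
    define w where "w = A\<^sup>2 * (1 + T)"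
    have w1: "T \<le> w" "1 \<le> w" "T * A\<^sup>2 \<le> w"
    proof -
      have "1 * (1 + T) \<le> w" unfolding w_def using A2 T0 by (intro mult_right_mono) auto
      then show "T \<le> w" "1 \<le> w" using T0 by auto
      have "A\<^sup>2 * T \<le> A\<^sup>2 * (1 + T)" by (intro mult_left_mono) auto
      then show "T * A\<^sup>2 \<le> w" unfolding w_def by (simp only: mult.commute)
    qed
    have "T * (aK * x\<^sup>2) + ((\<tau>\<^sup>2 * (4 * \<nu> * Sd) + T * (4 * D * (\<tau>\<^sup>2 * Sd))) + T * ((4 * D + 2 * A\<^sup>2) * (\<tau>\<^sup>2 * Sd)))
       = T * (aK * x\<^sup>2) + 1 * (\<tau>\<^sup>2 * (4 * \<nu> * Sd)) + T * (8 * D * (\<tau>\<^sup>2 * Sd)) + T * A\<^sup>2 * (2 * (\<tau>\<^sup>2 * Sd))"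
      by (simp add: algebra_simps)
    also have "\<dots> \<le> w * (aK * x\<^sup>2) + w * (\<tau>\<^sup>2 * (4 * \<nu> * Sd)) + w * (8 * D * (\<tau>\<^sup>2 * Sd)) + w * (2 * (\<tau>\<^sup>2 * Sd))"
      using w1 aK0 Sd0 D0 \<nu> by (intro add_mono mult_right_mono) auto
    also have "\<dots> = w * (aK * x\<^sup>2 + (4 * \<nu> * Sd + 8 * D * Sd + 2 * Sd) * \<tau>\<^sup>2)" by (simp add: algebra_simps)
    also have "\<dots> \<le> w * ((aK + 4 * \<nu> * Sd + 8 * D * Sd + 2 * Sd) * (x\<^sup>2 + \<tau>\<^sup>2))"
    proof (rule mult_left_mono)
      define y where "y = 4 * \<nu> * Sd + 8 * D * Sd + 2 * Sd"
      have y0: "y \<ge> 0" unfolding y_def using \<nu> Sd0 D0 by simp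
      have "0 \<le> aK * \<tau>\<^sup>2 + y * x\<^sup>2" using aK0 y0 by simp
      then have "aK * x\<^sup>2 + y * \<tau>\<^sup>2 \<le> (aK + y) * (x\<^sup>2 + \<tau>\<^sup>2)" by (simp add: algebra_simps)
      then show "aK * x\<^sup>2 + (4 * \<nu> * Sd + 8 * D * Sd + 2 * Sd) * \<tau>\<^sup>2 \<le> (aK + 4 * \<nu> * Sd + 8 * D * Sd + 2 * Sd) * (x\<^sup>2 + \<tau>\<^sup>2)"
        unfolding y_def by (simp only: add.assoc)
    qed (use w1 in simp)
    finally show "T * (aK * x\<^sup>2) + ((\<tau>\<^sup>2 * (4 * \<nu> * Sd) + T * (4 * D * (\<tau>\<^sup>2 * Sd))) + T * ((4 * D + 2 * A\<^sup>2) * (\<tau>\<^sup>2 * Sd)))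
       \<le> A\<^sup>2 * (1 + T) * (aK + 4 * \<nu> * Sd + 8 * D * Sd + 2 * Sd) * (x\<^sup>2 + \<tau>\<^sup>2)" unfolding w_def by (simp only: mult.assoc)
  qed (use \<nu> in simp)
  also have "\<dots> = A\<^sup>2 * (1 + tn m) * CR * (x\<^sup>2 + \<tau>\<^sup>2)" unfolding CR_def D_def T_def by (simp only: mult_ac)
  finally show ?thesis .
qed

definition "CF = 2 * Ks + 2 * CR / tvol"

lemma CF0: "CF \<ge> 0" unfolding CF_def using Ks0 CR0 by simp

theorem error_bound:
  assumes ag: "\<And>F (z :: int \<times> int \<Rightarrow> complex). finite F \<Longrightarrow>
     (\<Sum>k\<in>F. cmod (z k))\<^sup>2 \<le> (\<nu>\<^sup>2 * tvol / (4 * K4)) * (\<Sum>k\<in>F. (ksq k)\<^sup>2 * (cmod (z k))\<^sup>2) + Ce * (\<Sum>k\<in>F. (cmod (z k))\<^sup>2)"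
    and Ce: "Ce \<ge> 0" and x: "x \<ge> 0"
  shows "L2norm (\<lambda>p. u (real m * \<tau>) p - U m p) \<le> A * exp ((4 * K4 * Ce / (\<nu> * tvol) / 2 + 1) * (real m * \<tau>)) * sqrt CF * (x + \<tau>)"
proof -
  define L where "L = 4 * K4 * Ce / (\<nu> * tvol)"
  define T where "T = real m * \<tau>"
  have Tm: "T = tn m" by (simp add: T_def tn_def)
  have T0: "T \<ge> 0" by (simp add: Tm)
  have L0: "L \<ge> 0" unfolding L_def using K4c_pos[OF M0 L4_0] Ce \<nu> by simp
  note uC = u_CP[OF tn_nonneg[of m]] and UC = CP_XN[OF UX[of m]]
  have vC: "CP (v m)" by (simp add: v_def)
  have eL: "exp (L * T) \<ge> 1" using L0 T0 by simp
  have A2: "A\<^sup>2 \<ge> 1" using A by simp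
  have "Zn m \<le> exp (real m * (\<tau> * L)) * (\<Sum>n<m. bn n)"
  proof (rule discrete_gronwall)
    show "Zn (Suc n) \<le> (1 + \<tau> * L) * Zn n + bn n" for n
      unfolding L_def by (rule Zn_step[OF _ Ce]) (rule ag)
  qed (use Zn_0 bn0 L0 \<tau> in auto)
  also have "\<dots> \<le> exp (real m * (\<tau> * L)) * (A\<^sup>2 * (1 + T) * CR * (x\<^sup>2 + \<tau>\<^sup>2))"
    unfolding Tm by (intro mult_left_mono bn_sum) simp
  also have "real m * (\<tau> * L) = L * T" by (simp add: T_def)
  finally have Zm: "Zn m \<le> exp (L * T) * (A\<^sup>2 * (1 + T) * CR * (x\<^sup>2 + \<tau>\<^sup>2))" .
  define w where "w = exp (L * T) * (A\<^sup>2 * (1 + T))"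
  have w1: "w \<ge> 1"
  proof -
    have "1 * (1 + T) \<le> A\<^sup>2 * (1 + T)" using A2 T0 by (intro mult_right_mono) auto
    then have "1 \<le> A\<^sup>2 * (1 + T)" by (rule order_trans[rotated]) (use T0 in simp)
    then have "1 * 1 \<le> exp (L * T) * (A\<^sup>2 * (1 + T))" using eL by (intro mult_mono) auto
    then show ?thesis by (simp add: w_def)
  qed
  let ?I = "integral cell (\<lambda>p. (u (tn m) p - U m p)\<^sup>2)"
  have "?I \<le> integral cell (\<lambda>p. 2 * (u (tn m) p - v m p)\<^sup>2 + 2 * (v m p - U m p)\<^sup>2)"
  proof (rule integral_le)
    fix p show "(u (tn m) p - U m p)\<^sup>2 \<le> 2 * (u (tn m) p - v m p)\<^sup>2 + 2 * (v m p - U m p)\<^sup>2"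
      using sum_squares_le[of "u (tn m) p - v m p" "v m p - U m p"] by simp
  qed (intro cell_integrable continuous_intros CP_cont uC UC vC)+
  also have "\<dots> = integral cell (\<lambda>p. 2 * (u (tn m) p - v m p)\<^sup>2) + integral cell (\<lambda>p. 2 * (v m p - U m p)\<^sup>2)"
    by (rule integral_add) (intro cell_integrable continuous_intros CP_cont uC UC vC)+
  also have "\<dots> = 2 * integral cell (\<lambda>p. (u (tn m) p - v m p)\<^sup>2) + 2 * integral cell (\<lambda>p. (v m p - U m p)\<^sup>2)" by simp
  also have "integral cell (\<lambda>p. (v m p - U m p)\<^sup>2) = Sn m / tvol" by (simp add: err_L2)
  also have "2 * integral cell (\<lambda>p. (u (tn m) p - v m p)\<^sup>2) + 2 * (Sn m / tvol) \<le> 2 * (Ks * x\<^sup>2) + 2 * ((w * (CR * (x\<^sup>2 + \<tau>\<^sup>2))) / tvol)"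
  proof (intro add_mono mult_left_mono divide_right_mono)
    show "integral cell (\<lambda>p. (u (tn m) p - v m p)\<^sup>2) \<le> Ks * x\<^sup>2" unfolding v_def by (rule tail) simp
    show "Sn m \<le> w * (CR * (x\<^sup>2 + \<tau>\<^sup>2))" using order_trans[OF Sn_le_Zn Zm] unfolding w_def by (simp only: mult.assoc)
  qed auto
  also have "\<dots> \<le> 2 * (w * (Ks * (x\<^sup>2 + \<tau>\<^sup>2))) + 2 * ((w * (CR * (x\<^sup>2 + \<tau>\<^sup>2))) / tvol)"
  proof (intro add_mono mult_left_mono order_refl)
    have "1 * (Ks * x\<^sup>2) \<le> w * (Ks * (x\<^sup>2 + \<tau>\<^sup>2))" using w1 Ks0 by (intro mult_mono mult_left_mono) auto
    then show "Ks * x\<^sup>2 \<le> w * (Ks * (x\<^sup>2 + \<tau>\<^sup>2))" by simp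
  qed auto
  also have "\<dots> = w * CF * (x\<^sup>2 + \<tau>\<^sup>2)" unfolding CF_def by (simp add: field_simps)
  also have "\<dots> \<le> w * CF * (x + \<tau>)\<^sup>2"
    using x \<tau> w1 CF0 by (intro mult_left_mono) (auto simp: power2_sum)
  finally have I: "?I \<le> w * CF * (x + \<tau>)\<^sup>2" .
  have "L2norm (\<lambda>p. u (real m * \<tau>) p - U m p) = sqrt ?I"
    unfolding L2norm_def T_def[symmetric] Tm by (subst LINT_cell) (intro continuous_intros CP_cont uC UC, simp)
  also have "\<dots> \<le> sqrt (w * CF * (x + \<tau>)\<^sup>2)" using I by simp
  also have "\<dots> = sqrt w * sqrt CF * (x + \<tau>)" using x \<tau> by (simp add: real_sqrt_mult)
  \<comment> \<open>The square root halves the Gronwall exponent and turns \<open>A\<^sup>2\<close>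
    into \<open>A\<close>; the factor \<open>1 + T\<close>, bounded by \<open>exp (2 * T)\<close>,
    accounts for the \<open>+ 1\<close> in the exponent.\<close>
  also have "\<dots> \<le> A * exp ((L / 2 + 1) * T) * sqrt CF * (x + \<tau>)"
  proof (intro mult_right_mono)
    have "1 + T \<le> exp T" by (rule exp_ge_add_one_self)
    also have "\<dots> \<le> exp (2 * T)" using T0 by simp
    finally have "w \<le> exp (L * T) * (A\<^sup>2 * exp (2 * T))" unfolding w_def by (intro mult_left_mono) auto
    also have "\<dots> = (A * exp ((L / 2 + 1) * T))\<^sup>2"
      by (simp add: power_mult_distrib power2_eq_square exp_add[symmetric] algebra_simps)
    finally have "sqrt w \<le> \<bar>A * exp ((L / 2 + 1) * T)\<bar>" by (metis real_sqrt_abs real_sqrt_le_mono)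
    then show "sqrt w \<le> A * exp ((L / 2 + 1) * T)" using A by (simp add: abs_mult)
  qed (use x \<tau> CF0 in auto)
  finally show ?thesis by (simp only: L_def T_def)
qed

end

section \<open>Constants uniform over all solutions, and the final estimate\<close>

lemma ksq_powr_kw: "s \<ge> 0 \<Longrightarrow> ksq k powr s * kw s k \<le> 1"
proof -
  assume s: "s \<ge> 0"
  have "ksq k powr s \<le> (1 + ksq k) powr s" using s by (intro powr_mono2) auto
  then have "ksq k powr s * kw s k \<le> (1 + ksq k) powr s * kw s k" by (intro mult_right_mono) auto
  also have "\<dots> = 1"
  proof -
    have "1 + ksq k \<noteq> 0" using one_plus_ksq_pos[of k] by linarith
    then show ?thesis unfolding kw_def by (simp flip: powr_add)
  qed
  finally show ?thesis .
qed

lemma power2_le_of_le_add: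
  assumes "(a :: real) \<ge> 0" "a \<le> b + d"
  shows "a\<^sup>2 \<le> 2 * b\<^sup>2 + 2 * d\<^sup>2"
  using power_mono[OF assms(2) assms(1), of 2] sum_squares_le[of b d] by linarith

lemma kw_sq: "(kw q k)\<^sup>2 = kw (2 * q) k"
  using kw_add[of q q k] by (simp add: power2_eq_square)

text \<open>Against the weight \<open>|k|^(2s)\<close>, the coefficients of the solution are split
  into those of the data, square summable by assumption, and a correction whose square decays like
  \<open>kw (s + 2)\<close>. The bound on \<open>pk\<close> asks that \<open>|k|^4\<close> times the
  coefficients be square summable, which is what \<open>s \<ge> 4\<close> provides.\<close>

lemma solution_regularity:
  assumes \<nu>: "\<nu> > 0" and adm: "admissible_data s u0" and Cb: "Cb \<ge> 0"
    and dec: "\<And>u t k. CH_solution \<nu> u0 u \<Longrightarrow> t \<ge> 0 \<Longrightarrow> cmod (fourier (u t) k) \<le> Cb * kw (3/2) k"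
  shows "\<exists>Ks\<ge>0. \<exists>Sd. \<forall>u. CH_solution \<nu> u0 u \<longrightarrow>
     (\<forall>t\<ge>0. \<forall>N\<ge>1. integral cell (\<lambda>p. (u t p - tp (DN N) (fourier (u t)) p)\<^sup>2) \<le> Ks * (real N powr (- s))\<^sup>2) \<and>
     (\<forall>t\<ge>0. \<forall>F. finite F \<longrightarrow> (\<Sum>k\<in>F. (cmod (CH_solution.pk \<nu> u k t))\<^sup>2) \<le> Sd)"
proof -
  have s: "s \<ge> 4" using adm by (simp add: admissible_data_def)
  obtain C0 where C0: "C0 > 0" "\<And>k. cmod (fourier u0 k) \<le> C0 * kw (s/2) k" using admissible_decay(3)[OF adm] by blast
  from decay_full[OF \<nu> s C0(2) less_imp_le[OF C0(1)] Cb] obtain C where C: "C \<ge> 0"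
    and C2: "\<forall>u T. CH_solution \<nu> u0 u \<longrightarrow> (\<forall>t k. 0 \<le> t \<longrightarrow> t \<le> T \<longrightarrow> cmod (fourier (u t) k) \<le> Cb * kw (3/2) k)
      \<longrightarrow> (\<forall>t k. 0 \<le> t \<longrightarrow> t \<le> T \<longrightarrow> cmod (fourier (u t) k) \<le> C * kw (s/2) k
            \<and> cmod (fourier (u t) k) \<le> cmod (fourier u0 k) + C * kw (s/2 + 1) k)" by auto
  have D: "cmod (fourier (u t) k) \<le> C * kw (s/2) k" "cmod (fourier (u t) k) \<le> cmod (fourier u0 k) + C * kw (s/2 + 1) k"
    if "CH_solution \<nu> u0 u" "t \<ge> 0" for u t k
    using C2[rule_format, of u t t k] dec[OF that(1)] that by simp_all
  let ?h = "\<lambda>k. ksq k powr s * (cmod (fourier u0 k))\<^sup>2"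
  have hs: "?h summable_on UNIV" by (rule admissible_decay(4)[OF adm])
  have hF: "sum ?h F \<le> infsum ?h UNIV" if "finite F" for F by (rule finite_sum_le_infsum[OF hs that]) auto
  define H where "H = infsum ?h UNIV"
  have H0: "H \<ge> 0" unfolding H_def by (rule infsum_nonneg) simp
  define W where "W = infsum (kw 2) UNIV"
  have W0: "W \<ge> 0" unfolding W_def by (rule infsum_kw_nonneg)
  have WF: "sum (kw 2) F \<le> W" if "finite F" for F unfolding W_def by (rule kw_sum_le[OF _ that]) simp
  define K1 where "K1 = 2 * H + 2 * C\<^sup>2 * W"
  have K10: "K1 \<ge> 0" unfolding K1_def using H0 W0 by simp
  define Kf where "Kf = (convK 2)\<^sup>2 * C ^ 3 + C"
  define Sd where "Sd = 2 * (\<nu>\<^sup>2 * K1) + 2 * (Kf\<^sup>2 * W)"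
  have Hs: "(\<Sum>k\<in>F. ksq k powr s * (cmod (fourier (u t) k))\<^sup>2) \<le> K1"
    if "CH_solution \<nu> u0 u" "t \<ge> 0" "finite F" for u t F
  proof -
    have "(\<Sum>k\<in>F. ksq k powr s * (cmod (fourier (u t) k))\<^sup>2) \<le> (\<Sum>k\<in>F. 2 * ?h k + 2 * C\<^sup>2 * kw 2 k)"
    proof (rule sum_mono)
      fix k
      have "(cmod (fourier (u t) k))\<^sup>2 \<le> 2 * (cmod (fourier u0 k))\<^sup>2 + 2 * (C * kw (s/2 + 1) k)\<^sup>2"
        by (rule power2_le_of_le_add[OF norm_ge_zero D(2)[OF that(1,2)]])
      also have "(C * kw (s/2 + 1) k)\<^sup>2 = C\<^sup>2 * (kw s k * kw 2 k)"
        by (simp add: power_mult_distrib kw_sq kw_add[symmetric] distrib_left)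
      finally have "ksq k powr s * (cmod (fourier (u t) k))\<^sup>2 \<le> ksq k powr s * (2 * (cmod (fourier u0 k))\<^sup>2 + 2 * (C\<^sup>2 * (kw s k * kw 2 k)))"
        by (rule mult_left_mono) simp
      also have "\<dots> = 2 * ?h k + 2 * C\<^sup>2 * kw 2 k * (ksq k powr s * kw s k)" by (simp add: algebra_simps)
      also have "\<dots> \<le> 2 * ?h k + 2 * C\<^sup>2 * kw 2 k * 1"
        using s by (intro add_left_mono mult_left_mono ksq_powr_kw) auto
      finally show "ksq k powr s * (cmod (fourier (u t) k))\<^sup>2 \<le> 2 * ?h k + 2 * C\<^sup>2 * kw 2 k" by simp
    qed
    also have "\<dots> = 2 * sum ?h F + 2 * C\<^sup>2 * sum (kw 2) F" by (simp add: sum.distrib sum_distrib_left mult.assoc)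
    also have "\<dots> \<le> 2 * H + 2 * C\<^sup>2 * W" unfolding H_def using hF[OF that(3)] WF[OF that(3)] by (intro add_mono mult_left_mono) auto
    finally show ?thesis by (simp add: K1_def)
  qed
  have tail: "integral cell (\<lambda>p. (u t p - tp (DN N) (fourier (u t)) p)\<^sup>2) \<le> K1 / tvol * (real N powr (- s))\<^sup>2"
    if sol: "CH_solution \<nu> u0 u" and t: "t \<ge> 0" and N: "N \<ge> 1" for u t N
  proof -
    have uC: "CP (u t)" by (rule CH_solution.u_CP[OF sol t])
    have fw: "fourier (\<lambda>p. u t p - tp (DN N) (fourier (u t)) p) k = (if k \<in> DN N then 0 else fourier (u t) k)" for k
      by (simp add: fourier_diff[OF uC CP_tp] fourier_tp_DN[OF uC])
    have "tvol * integral cell (\<lambda>p. (u t p - tp (DN N) (fourier (u t)) p)\<^sup>2) \<le> (real N powr (- s))\<^sup>2 * K1"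
    proof (rule has_sum_le_finite_sums[OF parseval[OF CP_diff[OF uC CP_tp]]])
      fix F :: "(int \<times> int) set" assume F: "finite F"
      have "(\<Sum>k\<in>F. (cmod (fourier (\<lambda>p. u t p - tp (DN N) (fourier (u t)) p) k))\<^sup>2)
          \<le> (\<Sum>k\<in>F. (real N powr (- s))\<^sup>2 * (ksq k powr s * (cmod (fourier (u t) k))\<^sup>2))"
      proof (rule sum_mono)
        fix k
        show "(cmod (fourier (\<lambda>p. u t p - tp (DN N) (fourier (u t)) p) k))\<^sup>2 \<le> (real N powr (- s))\<^sup>2 * (ksq k powr s * (cmod (fourier (u t) k))\<^sup>2)"
        proof (cases "k \<in> DN N")
          case True
          then show ?thesis by (simp add: fw)
        next
          case False
          then have "(real N)\<^sup>2 \<le> ksq k" by (simp add: DN_def)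
          then have "((real N)\<^sup>2) powr s \<le> ksq k powr s" using s by (intro powr_mono2) auto
          moreover have "((real N)\<^sup>2) powr s = (real N powr s)\<^sup>2"
            using N by (simp add: power2_eq_square powr_mult)
          ultimately have le: "(real N powr s)\<^sup>2 \<le> ksq k powr s" by simp
          have "(real N powr (- s))\<^sup>2 * (real N powr s)\<^sup>2 = 1"
            using N by (simp add: power_mult_distrib[symmetric] powr_add[symmetric])
          then have "1 \<le> (real N powr (- s))\<^sup>2 * ksq k powr s" using mult_left_mono[OF le, of "(real N powr (- s))\<^sup>2"] by simp
          then have "1 * (cmod (fourier (u t) k))\<^sup>2 \<le> (real N powr (- s))\<^sup>2 * ksq k powr s * (cmod (fourier (u t) k))\<^sup>2" by (intro mult_right_mono) auto
          then show ?thesis using False by (simp add: fw mult.assoc)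
        qed
      qed
      also have "\<dots> = (real N powr (- s))\<^sup>2 * (\<Sum>k\<in>F. ksq k powr s * (cmod (fourier (u t) k))\<^sup>2)" by (simp add: sum_distrib_left)
      also have "\<dots> \<le> (real N powr (- s))\<^sup>2 * K1" by (intro mult_left_mono Hs[OF sol t F]) simp
      finally show "(\<Sum>k\<in>F. (cmod (fourier (\<lambda>p. u t p - tp (DN N) (fourier (u t)) p) k))\<^sup>2) \<le> (real N powr (- s))\<^sup>2 * K1" .
    qed
    then show ?thesis by (simp add: field_simps)
  qed
  have pk: "(\<Sum>k\<in>F. (cmod (CH_solution.pk \<nu> u k t))\<^sup>2) \<le> Sd"
    if sol: "CH_solution \<nu> u0 u" and t: "t \<ge> 0" and F: "finite F" for u t F
  proof -
    have uC: "CP (u t)" by (rule CH_solution.u_CP[OF sol t])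
    have c2: "cmod (fourier (u t) k) \<le> C * kw 2 k" for k
      by (rule order_trans[OF D(1)[OF sol t]]) (use C s in \<open>intro mult_left_mono kw_mono, auto\<close>)
    have f2: "cmod (fourier (\<lambda>p. fCH (u t p)) k) \<le> Kf * kw 2 k" for k
      unfolding Kf_def by (rule fourier_fCH_bound[OF _ uC c2]) simp
    have "(\<Sum>k\<in>F. (cmod (CH_solution.pk \<nu> u k t))\<^sup>2)
       \<le> (\<Sum>k\<in>F. 2 * (\<nu>\<^sup>2 * (ksq k powr s * (cmod (fourier (u t) k))\<^sup>2)) + 2 * (Kf\<^sup>2 * kw 2 k))"
    proof (rule sum_mono)
      fix k
      have "cmod (CH_solution.pk \<nu> u k t) \<le> \<nu> * (ksq k)\<^sup>2 * cmod (fourier (u t) k) + ksq k * cmod (fourier (\<lambda>p. fCH (u t p)) k)"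
        unfolding CH_solution.pk_def[OF sol] by (rule order_trans[OF norm_triangle_ineq4]) (use \<nu> in \<open>simp add: norm_mult norm_power\<close>)
      from power2_le_of_le_add[OF norm_ge_zero this]
      have "(cmod (CH_solution.pk \<nu> u k t))\<^sup>2 \<le> 2 * (\<nu> * (ksq k)\<^sup>2 * cmod (fourier (u t) k))\<^sup>2 + 2 * (ksq k * cmod (fourier (\<lambda>p. fCH (u t p)) k))\<^sup>2" .
      also have "(\<nu> * (ksq k)\<^sup>2 * cmod (fourier (u t) k))\<^sup>2 \<le> \<nu>\<^sup>2 * (ksq k powr s * (cmod (fourier (u t) k))\<^sup>2)"
      proof -
        have "((ksq k)\<^sup>2)\<^sup>2 \<le> ksq k powr s"
        proof (cases "k = 0")
          case False
          have "((ksq k)\<^sup>2)\<^sup>2 = ksq k powr 4" using ksq_ge_1[OF False] by (simp add: powr_numeral flip: power_mult)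
          also have "\<dots> \<le> ksq k powr s" using s ksq_ge_1[OF False] by (intro powr_mono) auto
          finally show ?thesis .
        qed simp
        then have "\<nu>\<^sup>2 * (((ksq k)\<^sup>2)\<^sup>2 * (cmod (fourier (u t) k))\<^sup>2) \<le> \<nu>\<^sup>2 * (ksq k powr s * (cmod (fourier (u t) k))\<^sup>2)"
          by (intro mult_left_mono mult_right_mono) auto
        then show ?thesis by (simp only: power_mult_distrib mult.assoc)
      qed
      also have "(ksq k * cmod (fourier (\<lambda>p. fCH (u t p)) k))\<^sup>2 \<le> Kf\<^sup>2 * kw 2 k"
      proof -
        have "(ksq k * cmod (fourier (\<lambda>p. fCH (u t p)) k))\<^sup>2 \<le> (ksq k * (Kf * kw 2 k))\<^sup>2"
          using f2[of k] by (intro power_mono mult_left_mono) auto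
        also have "\<dots> = Kf\<^sup>2 * ((ksq k)\<^sup>2 * kw (2 + 2) k)" by (simp add: power_mult_distrib kw_sq)
        also have "\<dots> \<le> Kf\<^sup>2 * kw 2 k" by (intro mult_left_mono ksq_kw_2) simp
        finally show ?thesis .
      qed
      finally show "(cmod (CH_solution.pk \<nu> u k t))\<^sup>2 \<le> 2 * (\<nu>\<^sup>2 * (ksq k powr s * (cmod (fourier (u t) k))\<^sup>2)) + 2 * (Kf\<^sup>2 * kw 2 k)" by simp
    qed
    also have "\<dots> = 2 * (\<nu>\<^sup>2 * (\<Sum>k\<in>F. ksq k powr s * (cmod (fourier (u t) k))\<^sup>2)) + 2 * (Kf\<^sup>2 * sum (kw 2) F)"
      by (simp add: sum.distrib sum_distrib_left)
    also have "\<dots> \<le> Sd" unfolding Sd_def using Hs[OF sol t F] WF[OF F] by (intro add_mono mult_left_mono) auto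
    finally show ?thesis .
  qed
  have "K1 / tvol \<ge> 0" using K10 by simp
  then show ?thesis using tail pk by blast
qed

text \<open>The order of quantifiers is the point: \<open>c1\<close> is built from
  \<open>Cb\<close>, the stability bound and the Agmon constant, all fixed before \<open>s\<close>,
  with \<open>s0\<close> witnessing that the data are admissible for some exponent. The actual
  \<open>s\<close> enters afterwards, through \<open>Ks\<close> and \<open>Sd\<close>.\<close>

theorem error_estimate:
  assumes \<nu>: "\<nu> > 0" and ex: "admissible_data s0 u0"
  shows "\<exists>c1>0. \<forall>s. \<exists>c2>0. \<forall>u N \<tau> A \<beta> U m.
     admissible_data s u0 \<and> is_CH_solution \<nu> u0 u \<and> N \<ge> 2 \<and> \<tau> > 0 \<and> \<beta> \<ge> betac (energy \<nu> u0) \<and>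
     A \<ge> \<beta> * ((supnorm u0)\<^sup>2 + \<bar>ln \<nu>\<bar>\<^sup>2 / \<nu> + 1) \<and> is_scheme \<nu> N \<tau> A u0 U \<and> m \<ge> 1 \<longrightarrow>
     L2norm (\<lambda>p. u (real m * \<tau>) p - U m p) \<le> A * exp (c1 * (real m * \<tau>)) * c2 * (real N powr (- s) + \<tau>)"
proof -
  obtain Cb where Cb: "Cb \<ge> 0" and dec: "\<And>u t k. CH_solution \<nu> u0 u \<Longrightarrow> t \<ge> 0 \<Longrightarrow> cmod (fourier (u t) k) \<le> Cb * kw (3/2) k"
    using uniform_decay[OF \<nu> ex] by blast
  note u0 = admissible_decay(1,2)[OF ex]
  define M0 where "M0 = Cb * infsum (kw (3/2)) UNIV / tvol"
  define E where "E = energy \<nu> u0"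
  \<comment> \<open>The factor \<open>max 1 (1 / (N \<nu>))\<close> of the stability theorem is
    replaced by its value at \<open>N = 1\<close>, so that \<open>L4\<close> is free of
    \<open>N\<close>.\<close>
  define L4 where "L4 = 8 * (Gen E * (max 1 (1 / \<nu>))\<^sup>2) + 2 * tvol"
  have E0: "E \<ge> 0" unfolding E_def by (rule PiN_energy_bound(2)[OF ex \<nu>, of 1]) simp
  have M0: "M0 \<ge> 0" unfolding M0_def using Cb infsum_kw_nonneg by (intro divide_nonneg_pos mult_nonneg_nonneg) auto
  have L4: "L4 \<ge> 0" unfolding L4_def using Gen_nonneg[OF E0] by simp
  have K4: "K4c M0 L4 > 0" by (rule K4c_pos[OF M0 L4])
  have "\<nu>\<^sup>2 * tvol / (4 * K4c M0 L4) > 0" using \<nu> K4 by simp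
  from agmon_type[OF this] obtain Ce where Ce: "Ce \<ge> 0" and ag: "\<And>F (z :: int \<times> int \<Rightarrow> complex). finite F \<Longrightarrow>
     (\<Sum>k\<in>F. cmod (z k))\<^sup>2 \<le> (\<nu>\<^sup>2 * tvol / (4 * K4c M0 L4)) * (\<Sum>k\<in>F. (ksq k)\<^sup>2 * (cmod (z k))\<^sup>2) + Ce * (\<Sum>k\<in>F. (cmod (z k))\<^sup>2)" by blast
  define c1 where "c1 = 4 * K4c M0 L4 * Ce / (\<nu> * tvol) / 2 + 1"
  have c1: "c1 > 0" unfolding c1_def using K4 Ce \<nu> by (intro add_nonneg_pos divide_nonneg_pos) auto
  have sumF: "(\<Sum>k\<in>F. cmod (fourier (u t) k)) \<le> Cb * infsum (kw (3/2)) UNIV" if "CH_solution \<nu> u0 u" "t \<ge> 0" "finite F" for u t F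
  proof -
    have "(\<Sum>k\<in>F. cmod (fourier (u t) k)) \<le> (\<Sum>k\<in>F. Cb * kw (3/2) k)" by (intro sum_mono dec that)
    also have "\<dots> = Cb * sum (kw (3/2)) F" by (simp add: sum_distrib_left)
    also have "\<dots> \<le> Cb * infsum (kw (3/2)) UNIV" using Cb kw_sum_le[OF _ that(3)] by (intro mult_left_mono) auto
    finally show ?thesis .
  qed
  have "\<exists>c2>0. \<forall>u N \<tau> A \<beta> U m.
     admissible_data s u0 \<and> is_CH_solution \<nu> u0 u \<and> N \<ge> 2 \<and> \<tau> > 0 \<and> \<beta> \<ge> betac (energy \<nu> u0) \<and>
     A \<ge> \<beta> * ((supnorm u0)\<^sup>2 + \<bar>ln \<nu>\<bar>\<^sup>2 / \<nu> + 1) \<and> is_scheme \<nu> N \<tau> A u0 U \<and> m \<ge> 1 \<longrightarrow>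
     L2norm (\<lambda>p. u (real m * \<tau>) p - U m p) \<le> A * exp (c1 * (real m * \<tau>)) * c2 * (real N powr (- s) + \<tau>)" for s
  proof (cases "admissible_data s u0")
    \<comment> \<open>For inadmissible \<open>s\<close> the claim is vacuous, and any positive
      constant will do.\<close>
    case False
    then show ?thesis by (intro exI[of _ 1]) simp
  next
    case True
    have "\<exists>Ks\<ge>0. \<exists>Sd. \<forall>u. CH_solution \<nu> u0 u \<longrightarrow>
     (\<forall>t\<ge>0. \<forall>N\<ge>1. integral cell (\<lambda>p. (u t p - tp (DN N) (fourier (u t)) p)\<^sup>2) \<le> Ks * (real N powr (- s))\<^sup>2) \<and>
     (\<forall>t\<ge>0. \<forall>F. finite F \<longrightarrow> (\<Sum>k\<in>F. (cmod (CH_solution.pk \<nu> u k t))\<^sup>2) \<le> Sd)"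
      by (rule solution_regularity[OF \<nu> True Cb]) (rule dec)
    then obtain Ks Sd where Ks: "Ks \<ge> 0" and KS: "\<forall>u. CH_solution \<nu> u0 u \<longrightarrow>
     (\<forall>t\<ge>0. \<forall>N\<ge>1. integral cell (\<lambda>p. (u t p - tp (DN N) (fourier (u t)) p)\<^sup>2) \<le> Ks * (real N powr (- s))\<^sup>2) \<and>
     (\<forall>t\<ge>0. \<forall>F. finite F \<longrightarrow> (\<Sum>k\<in>F. (cmod (CH_solution.pk \<nu> u k t))\<^sup>2) \<le> Sd)" by (elim exE conjE)
    note tail = KS[rule_format, THEN conjunct1, rule_format] and Sd = KS[rule_format, THEN conjunct2, rule_format]
    \<comment> \<open>Outside the locale \<open>CF\<close> is a function of \<open>\<nu>\<close>,
      \<open>M0\<close>, \<open>Ks\<close> and \<open>Sd\<close> alone, so it can be fixed before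
      \<open>u\<close>, \<open>N\<close>, \<open>\<tau>\<close> and \<open>A\<close>.\<close>
    have main: "L2norm (\<lambda>p. u (real m * \<tau>) p - U m p) \<le> A * exp (c1 * (real m * \<tau>)) * sqrt (CH_error.CF \<nu> M0 Ks Sd) * (real N powr (- s) + \<tau>)"
        "A \<ge> 1" "CH_error.CF \<nu> M0 Ks Sd \<ge> 0"
      if sol: "is_CH_solution \<nu> u0 u" and N: "N \<ge> 2" and \<tau>: "\<tau> > 0" and \<beta>: "\<beta> \<ge> betac (energy \<nu> u0)"
        and A: "A \<ge> \<beta> * ((supnorm u0)\<^sup>2 + \<bar>ln \<nu>\<bar>\<^sup>2 / \<nu> + 1)" and sch: "is_scheme \<nu> N \<tau> A u0 U" for u N \<tau> A \<beta> U m
    proof -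
      have chs: "CH_solution \<nu> u0 u" by unfold_locales (use \<nu> u0 sol in auto)
      have N1: "N \<ge> 1" using N by simp
      have \<beta>4: "\<beta> \<ge> 4" using \<beta> betac_ge[of "energy \<nu> u0"] by linarith
      show A1: "A \<ge> 1" using stabilizer_bound(2)[OF \<nu> _ A] \<beta>4 by linarith
      have sup: "\<bar>u t p\<bar> \<le> M0" if t: "t \<ge> 0" for t p
        unfolding M0_def by (rule fourier_bound_sup[OF CH_solution.u_CP[OF chs t] fourier_summable_of_decay[OF _ dec[OF chs t]] sumF[OF chs t]]) simp
      have supv: "\<bar>tp (DN N) (fourier (u t)) p\<bar> \<le> M0" if t: "t \<ge> 0" for t p
        unfolding M0_def by (rule order_trans[OF norm_tp_le]) (intro divide_right_mono sumF[OF chs t]; simp)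
      have U4: "integral cell (\<lambda>p. (U n p) ^ 4) \<le> L4" for n
      proof -
        have UX: "U n \<in> XN N" by (rule scheme_fourier(1)[OF sch u0(1)])
        have "energy \<nu> (U n) \<le> Gen E * (max 1 (1 / (real N * \<nu>)))\<^sup>2"
          unfolding E_def by (rule energy_stability(2)[OF \<nu> True N1 \<tau> \<beta> A sch])
        also have "\<dots> \<le> Gen E * (max 1 (1 / \<nu>))\<^sup>2"
        proof (intro mult_left_mono power_mono)
          have "1 / (real N * \<nu>) \<le> 1 / \<nu>" using N1 \<nu> by (intro divide_left_mono) auto
          then show "max 1 (1 / (real N * \<nu>)) \<le> max 1 (1 / \<nu>)" by (simp add: max_def)
        qed (use Gen_nonneg[OF E0] in auto)
        finally have en: "energy \<nu> (U n) \<le> Gen E * (max 1 (1 / \<nu>))\<^sup>2" .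
        have "\<nu> / 2 * gradsq (U n) \<ge> 0" using \<nu> gradsq_nonneg[OF periodic2_XN[OF UX] Ck_XN[OF UX]] by simp
        then have "1/4 * integral cell (\<lambda>p. ((U n p)\<^sup>2 - 1)\<^sup>2) \<le> energy \<nu> (U n)"
          unfolding energy_eq[OF periodic2_XN[OF UX] Ck_XN[OF UX]] by simp
        then have "integral cell (\<lambda>p. ((U n p)\<^sup>2 - 1)\<^sup>2) \<le> 4 * (Gen E * (max 1 (1 / \<nu>))\<^sup>2)" using en by simp
        then show ?thesis using integral_pow4_le[OF CP_XN[OF UX]] unfolding L4_def by linarith
      qed
      interpret CH_error \<nu> u0 u N \<tau> A M0 L4 Ks Sd "real N powr (- s)" U
      proof (unfold_locales)
        show "0 < \<tau>" "1 \<le> A" "0 \<le> M0" "0 \<le> L4" "0 \<le> Ks" by (fact \<tau> A1 M0 L4 Ks)+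
        show "\<And>t p. t \<ge> 0 \<Longrightarrow> \<bar>u t p\<bar> \<le> M0" by (rule sup)
        show "\<And>t p. t \<ge> 0 \<Longrightarrow> \<bar>tp (DN N) (fourier (u t)) p\<bar> \<le> M0" by (rule supv)
        show "\<And>t. t \<ge> 0 \<Longrightarrow> integral cell (\<lambda>p. (u t p - tp (DN N) (fourier (u t)) p)\<^sup>2) \<le> Ks * (real N powr (- s))\<^sup>2" by (rule tail[OF chs _ N1])
        show "\<And>t F. t \<ge> 0 \<Longrightarrow> finite F \<Longrightarrow> (\<Sum>k\<in>F. (cmod (CH_solution.pk \<nu> u k t))\<^sup>2) \<le> Sd" by (rule Sd[OF chs])
        show "\<And>n. U n \<in> XN N" by (rule scheme_fourier(1)[OF sch u0(1)])
        show "\<And>k. k \<in> DN N \<Longrightarrow> fourier (U 0) k = fourier u0 k" by (simp add: scheme_fourier(2)[OF sch u0(1)])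
        show "\<And>n. integral cell (\<lambda>p. (U n p) ^ 4) \<le> L4" by (rule U4)
      qed (use \<nu> u0 sol scheme_fourier(3)[OF sch u0(1)] in auto)
      show "L2norm (\<lambda>p. u (real m * \<tau>) p - U m p) \<le> A * exp (c1 * (real m * \<tau>)) * sqrt (CH_error.CF \<nu> M0 Ks Sd) * (real N powr (- s) + \<tau>)"
        unfolding c1_def by (rule error_bound[OF _ Ce]) (rule ag, assumption, simp)
      show "CH_error.CF \<nu> M0 Ks Sd \<ge> 0" by (rule CF0)
    qed
    show ?thesis
    \<comment> \<open>The summand 1 makes the constant strictly positive, as \<open>CF\<close> is
      only known to be nonnegative.\<close>
    proof (intro exI[of _ "\<bar>sqrt (CH_error.CF \<nu> M0 Ks Sd)\<bar> + 1"] conjI allI impI)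
      fix u N \<tau> A \<beta> U m
      assume h: "admissible_data s u0 \<and> is_CH_solution \<nu> u0 u \<and> N \<ge> 2 \<and> \<tau> > 0 \<and> \<beta> \<ge> betac (energy \<nu> u0) \<and>
         A \<ge> \<beta> * ((supnorm u0)\<^sup>2 + \<bar>ln \<nu>\<bar>\<^sup>2 / \<nu> + 1) \<and> is_scheme \<nu> N \<tau> A u0 U \<and> m \<ge> (1::nat)"
      then have "L2norm (\<lambda>p. u (real m * \<tau>) p - U m p) \<le> A * exp (c1 * (real m * \<tau>)) * sqrt (CH_error.CF \<nu> M0 Ks Sd) * (real N powr (- s) + \<tau>)"
        and "A \<ge> 1" using main(1,2)[of u N \<tau> \<beta> A U] by auto
      moreover have "A * exp (c1 * (real m * \<tau>)) * sqrt (CH_error.CF \<nu> M0 Ks Sd) * (real N powr (- s) + \<tau>)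
         \<le> A * exp (c1 * (real m * \<tau>)) * (\<bar>sqrt (CH_error.CF \<nu> M0 Ks Sd)\<bar> + 1) * (real N powr (- s) + \<tau>)"
        using \<open>A \<ge> 1\<close> h by (intro mult_right_mono mult_left_mono) auto
      ultimately show "L2norm (\<lambda>p. u (real m * \<tau>) p - U m p) \<le> A * exp (c1 * (real m * \<tau>)) * (\<bar>sqrt (CH_error.CF \<nu> M0 Ks Sd)\<bar> + 1) * (real N powr (- s) + \<tau>)"
        by linarith
    qed simp
  qed
  note est = this
  show ?thesis by (rule exI[of _ c1], rule conjI, rule c1, rule allI, rule est)
qed

theorem theorem1p3:
  "\<exists>(\<beta>c :: real \<Rightarrow> real)
     (C1 :: (real \<times> real \<Rightarrow> real) \<Rightarrow> real \<Rightarrow> real)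
     (C2 :: (real \<times> real \<Rightarrow> real) \<Rightarrow> real \<Rightarrow> real \<Rightarrow> real).
     (\<forall>u0 \<nu> s. C1 u0 \<nu> > 0 \<and> C2 u0 \<nu> s > 0) \<and>
     (\<forall>\<nu> s u0 N \<tau> A \<beta> U.
        \<nu> > 0 \<and> admissible_data s u0 \<and> N \<ge> 2 \<and> \<tau> > 0 \<and>
        \<beta> \<ge> \<beta>c (energy \<nu> u0) \<and>
        A \<ge> \<beta> * ((supnorm u0)\<^sup>2 + \<bar>ln \<nu>\<bar>\<^sup>2 / \<nu> + 1) \<and>
        is_scheme \<nu> N \<tau> A u0 U
        \<longrightarrow> (\<forall>n. energy \<nu> (U (Suc n)) \<le> energy \<nu> (U n))) \<and>
     (\<forall>\<nu> s u0 u N \<tau> A \<beta> U m.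
        \<nu> > 0 \<and> admissible_data s u0 \<and> is_CH_solution \<nu> u0 u \<and>
        N \<ge> 2 \<and> \<tau> > 0 \<and>
        \<beta> \<ge> \<beta>c (energy \<nu> u0) \<and>
        A \<ge> \<beta> * ((supnorm u0)\<^sup>2 + \<bar>ln \<nu>\<bar>\<^sup>2 / \<nu> + 1) \<and>
        is_scheme \<nu> N \<tau> A u0 U \<and> m \<ge> 1
        \<longrightarrow> L2norm (\<lambda>p. u (real m * \<tau>) p - U m p)
              \<le> A * exp (C1 u0 \<nu> * (real m * \<tau>)) * C2 u0 \<nu> s
                  * (real N powr (- s) + \<tau>))"
proof -
  let ?P = "\<lambda>u0 \<nu> c1 s c2. \<forall>u N \<tau> A \<beta> U m.
     \<nu> > 0 \<and> admissible_data s u0 \<and> is_CH_solution \<nu> u0 u \<and> N \<ge> 2 \<and> \<tau> > 0 \<and> \<beta> \<ge> betac (energy \<nu> u0) \<and>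
     A \<ge> \<beta> * ((supnorm u0)\<^sup>2 + \<bar>ln \<nu>\<bar>\<^sup>2 / \<nu> + 1) \<and> is_scheme \<nu> N \<tau> A u0 U \<and> m \<ge> (1::nat) \<longrightarrow>
     L2norm (\<lambda>p. u (real m * \<tau>) p - U m p) \<le> A * exp (c1 * (real m * \<tau>)) * c2 * (real N powr (- s) + \<tau>)"
  have "\<exists>c1. c1 > 0 \<and> (\<forall>s. \<exists>c2. c2 > 0 \<and> ?P u0 \<nu> c1 s c2)" for u0 \<nu>
  proof (cases "\<nu> > 0 \<and> (\<exists>s. admissible_data s u0)")
    case True
    then obtain s0 where "admissible_data s0 u0" "\<nu> > 0" by blast
    from error_estimate[OF this(2,1)] obtain c1 where "c1 > 0" and c1: "\<And>s. \<exists>c2>0. \<forall>u N \<tau> A \<beta> U m.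
     admissible_data s u0 \<and> is_CH_solution \<nu> u0 u \<and> N \<ge> 2 \<and> \<tau> > 0 \<and> \<beta> \<ge> betac (energy \<nu> u0) \<and>
     A \<ge> \<beta> * ((supnorm u0)\<^sup>2 + \<bar>ln \<nu>\<bar>\<^sup>2 / \<nu> + 1) \<and> is_scheme \<nu> N \<tau> A u0 U \<and> m \<ge> 1 \<longrightarrow>
     L2norm (\<lambda>p. u (real m * \<tau>) p - U m p) \<le> A * exp (c1 * (real m * \<tau>)) * c2 * (real N powr (- s) + \<tau>)"
      by (elim exE conjE) simp
    then show ?thesis using \<open>\<nu> > 0\<close> by - (rule exI[of _ c1], simp)
  next
    case False
    \<comment> \<open>Here \<open>?P\<close> is vacuous and 1 is an arbitrary positive witness; the
      case arises because \<open>C1\<close> and \<open>C2\<close> are total functions with positive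
      values.\<close>
    then show ?thesis by (intro exI[of _ 1] conjI allI exI[of _ 1]) auto
  qed
  note ex1 = this
  \<comment> \<open>\<open>s\<close> is quantified inside the chosen property, so \<open>C1\<close>
    depends on \<open>u0\<close> and \<open>\<nu>\<close> only; \<open>C2\<close> is chosen
    afterwards for each \<open>s\<close>.\<close>
  define C1 where "C1 u0 \<nu> = (SOME c1. c1 > 0 \<and> (\<forall>s. \<exists>c2. c2 > 0 \<and> ?P u0 \<nu> c1 s c2))" for u0 \<nu>
  have C1: "C1 u0 \<nu> > 0 \<and> (\<forall>s. \<exists>c2. c2 > 0 \<and> ?P u0 \<nu> (C1 u0 \<nu>) s c2)" for u0 \<nu>
    unfolding C1_def by (rule someI_ex[OF ex1])
  define C2 where "C2 u0 \<nu> s = (SOME c2. c2 > 0 \<and> ?P u0 \<nu> (C1 u0 \<nu>) s c2)" for u0 \<nu> s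
  have C2: "C2 u0 \<nu> s > 0 \<and> ?P u0 \<nu> (C1 u0 \<nu>) s (C2 u0 \<nu> s)" for u0 \<nu> s
    unfolding C2_def by (rule someI_ex[OF C1[THEN conjunct2, THEN spec]])
  show ?thesis
  proof (intro exI[of _ betac] exI[of _ C1] exI[of _ C2] conjI allI impI)
    fix \<nu> s u0 N \<tau> A \<beta> U n
    assume "\<nu> > 0 \<and> admissible_data s u0 \<and> (N::nat) \<ge> 2 \<and> \<tau> > 0 \<and> \<beta> \<ge> betac (energy \<nu> u0) \<and>
        A \<ge> \<beta> * ((supnorm u0)\<^sup>2 + \<bar>ln \<nu>\<bar>\<^sup>2 / \<nu> + 1) \<and> is_scheme \<nu> N \<tau> A u0 U"
    then show "energy \<nu> (U (Suc n)) \<le> energy \<nu> (U n)" by (intro energy_stability(1)[of \<nu> s u0 N \<tau> \<beta> A]) auto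
  next
    fix \<nu> s u0 u N \<tau> A \<beta> U m
    assume "\<nu> > 0 \<and> admissible_data s u0 \<and> is_CH_solution \<nu> u0 u \<and> (N::nat) \<ge> 2 \<and> \<tau> > 0 \<and> \<beta> \<ge> betac (energy \<nu> u0) \<and>
        A \<ge> \<beta> * ((supnorm u0)\<^sup>2 + \<bar>ln \<nu>\<bar>\<^sup>2 / \<nu> + 1) \<and> is_scheme \<nu> N \<tau> A u0 U \<and> (m::nat) \<ge> 1"
    then show "L2norm (\<lambda>p. u (real m * \<tau>) p - U m p) \<le> A * exp (C1 u0 \<nu> * (real m * \<tau>)) * C2 u0 \<nu> s * (real N powr (- s) + \<tau>)"
      by (rule C2[THEN conjunct2, rule_format])
  qed (use C1 C2 in \<open>simp_all only: simp_thms\<close>)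
qed

end
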